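(* Let $K\subset\mathbb{R}^2$ be open, bounded and simply connected with $C^2$-regular boundary, let $\rho=\sup_{y\in K}\operatorname{dist}(y,\partial K)$ be its in-radius, with coordinates chosen so that $B(0,\rho)\subseteq K$, and let $M=\mathbb{R}^2\setminus K$. Let $\sigma\in L^\infty(\partial M)$ be real-valued with $\sigma_0:=\operatorname{ess\,inf}_{\partial M}\sigma>0$. Then for all $u\in H^1(M)$ $$\int_M|\nabla u|^2\,dx+\int_{\partial M}\sigma|u|^2\,dS\ \ge\ \frac14\int_M\frac{|u(x)|^2}{|x|^2\left(\log\frac{|x|}{\rho}+\frac{1}{2\rho\sigma_0}\right)^2}\,dx.$$ Moreover, the constant $\frac14$ on the right-hand side cannot be replaced by any constant $C>\frac14$: for any $C>\frac14$ the inequality $$\int_M|\nabla u|^2\,dx+\int_{\partial M}\sigma|u|^2\,dS\ \ge\ C\int_M\frac{|u(x)|^2}{|x|^2\left(\log\frac{|x|}{\rho}+\frac{1}{2\rho\sigma_0}\right)^2}\,dx\qquad\text{for all } u\in H^1(M)$$ fails.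
   Context: $B(x,r)$ is the ball of radius $r$ centered at $x$; $dS$ is the surface (arc length) measure on $\partial M$, and $u$ on $\partial M$ is understood in the sense of traces. *)

theory Defs
  imports "HOL-Analysis.Analysis"
begin

section \<open>Plane sets with twice continuously differentiable boundary\<close>

definition C2_real :: "(real \<Rightarrow> real) \<Rightarrow> bool" where
  "C2_real g \<longleftrightarrow> (\<exists>g' g''. (\<forall>t. (g has_real_derivative g' t) (at t)) \<and>
      (\<forall>t. (g' has_real_derivative g'' t) (at t)) \<and> continuous_on UNIV g'')"

text \<open>After a change of Cartesian coordinates (an orthogonal map \<open>T\<close>), the set is near each of its
  boundary points the part of the plane lying strictly above the graph of a \<open>C\<^sup>2\<close> function.\<close>

definition C2_boundary :: "(real^2) set \<Rightarrow> bool" where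
  "C2_boundary U \<longleftrightarrow> (\<forall>p \<in> frontier U. \<exists>r>0. \<exists>(T :: real^2 \<Rightarrow> real^2) g. orthogonal_transformation T \<and> C2_real g \<and>
      U \<inter> ball p r = {x \<in> ball p r. T x $ 2 > g (T x $ 1)})"

definition inradius :: "(real^2) set \<Rightarrow> real" where
  "inradius U = (SUP y\<in>U. infdist y (frontier U))"


section \<open>Arc length measure\<close>

text \<open>Arc length on a curve \<open>S\<close> is the one-dimensional Hausdorff measure, on the Borel subsets
  of \<open>S\<close>. The bound on the sets \<open>C i\<close> must be demanded separately because \<^const>\<open>diameter\<close> has
  no useful value on unbounded sets.\<close>

definition hausdorff1_pre :: "real \<Rightarrow> 'a::metric_space set \<Rightarrow> ennreal" where
  "hausdorff1_pre \<delta> A =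
     (INF C \<in> {C :: nat \<Rightarrow> 'a set. A \<subseteq> (\<Union>i. C i) \<and> (\<forall>i. bounded (C i) \<and> diameter (C i) \<le> \<delta>)}.
        \<Sum>i. ennreal (diameter (C i)))"

definition hausdorff1 :: "'a::metric_space measure" where
  "hausdorff1 = measure_of UNIV (sets borel) (\<lambda>A. SUP \<delta>\<in>{0<..}. hausdorff1_pre \<delta> A)"

definition arclength :: "'a::metric_space set \<Rightarrow> 'a measure" where
  "arclength S = restrict_space hausdorff1 S"


section \<open>Essentially bounded and square integrable functions\<close>

definition Linfty :: "'a measure \<Rightarrow> ('a \<Rightarrow> real) \<Rightarrow> bool" where
  "Linfty N f \<longleftrightarrow> f \<in> borel_measurable N \<and> (\<exists>B. AE x in N. \<bar>f x\<bar> \<le> B)"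

definition ess_inf :: "'a measure \<Rightarrow> ('a \<Rightarrow> real) \<Rightarrow> real" where
  "ess_inf N f = Sup {a. AE x in N. a \<le> f x}"

definition L2 :: "'a measure \<Rightarrow> ('a \<Rightarrow> 'b::real_normed_vector) \<Rightarrow> bool" where
  "L2 N f \<longleftrightarrow> f \<in> borel_measurable N \<and> integrable N (\<lambda>x. (norm (f x))\<^sup>2)"


section \<open>The Sobolev space of order one\<close>

definition partial :: "2 \<Rightarrow> (real^2 \<Rightarrow> 'b::real_normed_vector) \<Rightarrow> real^2 \<Rightarrow> 'b" where
  "partial i f x = frechet_derivative f (at x) (axis i 1)"

definition grad :: "(real^2 \<Rightarrow> complex) \<Rightarrow> real^2 \<Rightarrow> complex^2" where
  "grad f x = (\<chi> i. partial i f x)"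

text \<open>\<open>C1c \<Omega>\<close>: continuously differentiable functions on the plane with compact support in \<open>\<Omega>\<close>.\<close>

definition C1c :: "(real^2) set \<Rightarrow> (real^2 \<Rightarrow> 'b::real_normed_vector) set" where
  "C1c \<Omega> = {f. f differentiable_on UNIV \<and> (\<forall>i. continuous_on UNIV (partial i f)) \<and>
      compact (closure {x. f x \<noteq> 0}) \<and> closure {x. f x \<noteq> 0} \<subseteq> \<Omega>}"

text \<open>Weak derivatives are tested against \<open>C\<^sup>1\<close> functions of compact support, as in Gilbarg and
  Trudinger; by mollification, smooth test functions give the same notion.\<close>

definition weak_gradient :: "(real^2) set \<Rightarrow> (real^2 \<Rightarrow> complex) \<Rightarrow> (real^2 \<Rightarrow> complex^2) \<Rightarrow> bool" where
  "weak_gradient \<Omega> u G \<longleftrightarrow> L2 (lebesgue_on \<Omega>) G \<and>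
     (\<forall>i. \<forall>\<phi> \<in> C1c \<Omega>. (LINT x:\<Omega>|lebesgue. partial i \<phi> x *\<^sub>R u x)
                     = - (LINT x:\<Omega>|lebesgue. \<phi> x *\<^sub>R (G x $ i)))"

definition H1 :: "(real^2) set \<Rightarrow> (real^2 \<Rightarrow> complex) set" where
  "H1 \<Omega> = {u. L2 (lebesgue_on \<Omega>) u \<and> (\<exists>G. weak_gradient \<Omega> u G)}"

text \<open>The weak gradient is determined up to null sets of \<open>\<Omega>\<close>.\<close>

definition wgrad :: "(real^2) set \<Rightarrow> (real^2 \<Rightarrow> complex) \<Rightarrow> real^2 \<Rightarrow> complex^2" where
  "wgrad \<Omega> u = (SOME G. weak_gradient \<Omega> u G)"


section \<open>Boundary traces\<close>

text \<open>The trace operator is the continuous extension, from \<open>H\<^sup>1(\<Omega>)\<close> to the square integrable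
  functions on \<open>\<partial>\<Omega>\<close>, of the restriction map \<open>\<phi> \<mapsto> \<phi>|\<partial>\<Omega>\<close> for \<open>\<phi>\<close> in \<open>C1c UNIV\<close>.\<close>

definition is_trace :: "(real^2) set \<Rightarrow> (real^2 \<Rightarrow> complex) \<Rightarrow> (real^2 \<Rightarrow> complex) \<Rightarrow> bool" where
  "is_trace \<Omega> u g \<longleftrightarrow> L2 (arclength (frontier \<Omega>)) g \<and>
     (\<exists>\<phi> :: nat \<Rightarrow> real^2 \<Rightarrow> complex. (\<forall>n. \<phi> n \<in> C1c UNIV) \<and>
        (\<lambda>n. LINT x:\<Omega>|lebesgue. (norm (\<phi> n x - u x))\<^sup>2) \<longlonglongrightarrow> 0 \<and>
        (\<lambda>n. LINT x:\<Omega>|lebesgue. (norm (grad (\<phi> n) x - wgrad \<Omega> u x))\<^sup>2) \<longlonglongrightarrow> 0 \<and>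
        (\<lambda>n. LINT x|arclength (frontier \<Omega>). (norm (\<phi> n x - g x))\<^sup>2) \<longlonglongrightarrow> 0)"

definition trace_on_boundary :: "(real^2) set \<Rightarrow> (real^2 \<Rightarrow> complex) \<Rightarrow> real^2 \<Rightarrow> complex" where
  "trace_on_boundary \<Omega> u = (SOME g. is_trace \<Omega> u g)"

end

theory Submission
  imports Defs
begin

text \<open>With \<open>f = ln (\<bar>x\<bar> / \<rho>) + c\<close> and \<open>c = 1 / (2 \<rho> \<sigma>0)\<close>, the function \<open>sqrt f\<close> is a positive ground state
  of the Hardy operator outside the disc \<open>ball 0 \<rho>\<close>. Its logarithmic gradient \<open>F = x / (2 \<bar>x\<bar>\<^sup>2 f)\<close> satisfies
  \<open>- div F - \<bar>F\<bar>\<^sup>2 = 1 / (4 \<bar>x\<bar>\<^sup>2 f\<^sup>2)\<close>, and \<open>\<bar>F\<bar> \<le> \<sigma>0\<close> for \<open>\<bar>x\<bar> \<ge> \<rho>\<close>. Integrating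
  \<open>\<bar>grad \<phi> - \<phi> F\<bar>\<^sup>2 \<ge> 0\<close> and applying the divergence theorem therefore gives the inequality for functions \<open>\<phi>\<close> that are
  continuously differentiable up to the boundary; these are dense in the Sobolev space, and the trace inequality
  carries the boundary term over to the limit. The constant cannot be improved because, in the variable \<open>ln f\<close>,
  the quotient of the two sides at \<open>sqrt f \<cdot> \<psi>\<close> becomes that of \<open>\<psi>'\<^sup>2 + \<psi>\<^sup>2 / 4\<close> and \<open>\<psi>\<^sup>2\<close>, for
  \<open>\<psi>\<close> of compact support in a half-line.\<close>

section \<open>The one-dimensional Hausdorff measure\<close>

text \<open>The obstacle is that arc length is a Hausdorff measure, of which only crude facts are
  proved: it is a Borel measure, a connected set has at least the measure of the distance between
  any two of its points, and a Lipschitz image of an interval has at most the Lipschitz constant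
  times the length of the interval. So neither an area formula nor a normal vector appears. The
  divergence theorem is the inequality
  \<open>\<integral> div X \<le> \<integral> \<bar>X\<bar> dS\<close>, which follows from the lower
  bound by chords and is enough, because the flux through the boundary is estimated by the length of
  the field anyway. The upper bound yields the trace inequality. The value of \<open>c\<close> comes
  from the boundary: \<open>\<bar>F\<bar> = 1 / (2 \<bar>x\<bar> f)\<close> is largest where
  \<open>\<bar>x\<bar> = \<rho>\<close> and \<open>f = c\<close>, and
  \<open>1 / (2 \<rho> c)\<close> has to be \<open>\<sigma>0\<close>. Weak gradient and trace are
  picked by a choice operator. The inequality uses only their defining properties; sharpness also
  needs that the weak gradient is unique up to null sets, in order to compute with concrete test
  functions. These are supported away from the boundary, so that their boundary term drops
  out.\<close>

definition hausdorff1_outer :: "'a::metric_space set \<Rightarrow> ennreal" where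
  "hausdorff1_outer A = (SUP \<delta>\<in>{0<..}. hausdorff1_pre \<delta> A)"

lemma hausdorff1_pre_le:
  assumes "A \<subseteq> (\<Union>i. C i)" "\<And>i. bounded (C i)" "\<And>i. diameter (C i) \<le> \<delta>"
  shows "hausdorff1_pre \<delta> A \<le> (\<Sum>i. ennreal (diameter (C i)))"
  unfolding hausdorff1_pre_def using assms by (intro INF_lower) auto

lemma hausdorff1_pre_mono: "A \<subseteq> B \<Longrightarrow> hausdorff1_pre \<delta> A \<le> hausdorff1_pre \<delta> B"
  unfolding hausdorff1_pre_def by (intro INF_superset_mono) auto

lemma hausdorff1_pre_antimono: "\<delta> \<le> \<delta>' \<Longrightarrow> hausdorff1_pre \<delta>' A \<le> hausdorff1_pre \<delta> A"
  unfolding hausdorff1_pre_def by (intro INF_superset_mono) (auto intro: order_trans)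

text \<open>The sequence of covering sets is completed by empty sets, whose diameter 0 costs nothing
  and respects the bound because \<open>0 \<le> \<delta>\<close>.\<close>

lemma hausdorff1_pre_finite_cover:
  assumes "finite I" "A \<subseteq> (\<Union>i\<in>I. C i)" "\<And>i. i \<in> I \<Longrightarrow> bounded (C i)"
    "\<And>i. i \<in> I \<Longrightarrow> diameter (C i) \<le> \<delta>" "0 \<le> \<delta>"
  shows "hausdorff1_pre \<delta> A \<le> (\<Sum>i\<in>I. ennreal (diameter (C i)))"
proof -
  obtain h where h: "bij_betw h {..<card I} I"
    using assms(1) ex_bij_betw_nat_finite[of I] by (auto simp: atLeast0LessThan)
  define D where "D n = (if n < card I then C (h n) else {})" for n
  have hI: "h n \<in> I" if "n < card I" for n
    using h that by (auto dest: bij_betw_apply)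
  have cov: "A \<subseteq> (\<Union>n. D n)"
  proof
    fix x assume "x \<in> A"
    then obtain i where i: "i \<in> I" "x \<in> C i"
      using assms(2) by blast
    then obtain n where "n < card I" "h n = i"
      using h unfolding bij_betw_def by (metis imageE lessThan_iff)
    then have "x \<in> D n" using i by (simp add: D_def)
    then show "x \<in> (\<Union>n. D n)" by blast
  qed
  have "hausdorff1_pre \<delta> A \<le> (\<Sum>n. ennreal (diameter (D n)))"
    by (rule hausdorff1_pre_le[OF cov]) (auto simp: D_def hI assms)
  also have "\<dots> = (\<Sum>n<card I. ennreal (diameter (D n)))"
    by (rule suminf_finite) (auto simp: D_def)
  also have "\<dots> = (\<Sum>n<card I. ennreal (diameter (C (h n))))"
    by (simp add: D_def)
  also have "\<dots> = (\<Sum>i\<in>I. ennreal (diameter (C i)))"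
    by (rule sum.reindex_bij_betw[OF h])
  finally show ?thesis .
qed

text \<open>Covers of the \<open>A i\<close> that are optimal up to \<open>e / 2 ^ (i + 1)\<close>
  are listed along the pairing of the natural numbers. The errors sum to \<open>e\<close>, and the
  bound on the diameters survives because the single sets are unchanged.\<close>

lemma hausdorff1_pre_UN: "hausdorff1_pre \<delta> (\<Union>i::nat. A i) \<le> (\<Sum>i. hausdorff1_pre \<delta> (A i))"
proof (rule ennreal_le_epsilon)
  fix e :: real assume e: "0 < e" and fin: "(\<Sum>i. hausdorff1_pre \<delta> (A i)) < top"
  have fin1: "hausdorff1_pre \<delta> (A i) \<noteq> \<infinity>" for i
    using ennreal_suminf_lessD[OF fin, of i] by auto
  have "\<exists>C. (A i \<subseteq> (\<Union>j::nat. C j) \<and> (\<forall>j. bounded (C j) \<and> diameter (C j) \<le> \<delta>)) \<and>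
      (\<Sum>j. ennreal (diameter (C j))) \<le> hausdorff1_pre \<delta> (A i) + e * (1/2) ^ Suc i" for i
    using INF_approx_ennreal[of "e * (1/2) ^ Suc i", OF _ hausdorff1_pre_def[of \<delta> "A i"] fin1] e
    by (auto simp: Bex_def intro: less_imp_le)
  then obtain C where C: "\<And>i. A i \<subseteq> (\<Union>j::nat. C i j)" "\<And>i j. bounded (C i j)"
      "\<And>i j. diameter (C i j) \<le> \<delta>"
      "\<And>i. (\<Sum>j. ennreal (diameter (C i j))) \<le> hausdorff1_pre \<delta> (A i) + e * (1/2) ^ Suc i"
    by metis
  define D where "D = case_prod C \<circ> prod_decode"
  have "(\<Union>i. A i) \<subseteq> (\<Union>n. D n)"
    using C(1) by (auto simp add: D_def subset_eq) (metis prod.case prod_encode_inverse)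
  then have "hausdorff1_pre \<delta> (\<Union>i. A i) \<le> (\<Sum>n. ennreal (diameter (D n)))"
    by (rule hausdorff1_pre_le) (auto simp: D_def C split: prod.split)
  also have "\<dots> = (\<Sum>i. \<Sum>j. ennreal (diameter (C i j)))"
    using suminf_ennreal_2dimen[where f="\<lambda>(i,j). ennreal (diameter (C i j))"]
    by (auto simp: D_def split_def)
  also have "\<dots> \<le> (\<Sum>i. hausdorff1_pre \<delta> (A i) + ennreal (e * (1/2) ^ Suc i))"
    by (intro suminf_le C) auto
  also have "\<dots> = (\<Sum>i. hausdorff1_pre \<delta> (A i)) + (\<Sum>i. ennreal e * ennreal ((1/2) ^ Suc i))"
    using e by (subst suminf_add[symmetric])
      (auto simp del: ennreal_suminf_cmult simp add: ennreal_mult[symmetric])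
  also have "\<dots> = (\<Sum>i. hausdorff1_pre \<delta> (A i)) + e"
    unfolding ennreal_suminf_cmult
    by (subst suminf_ennreal_eq[OF zero_le_power power_half_series]) auto
  finally show "hausdorff1_pre \<delta> (\<Union>i. A i) \<le> (\<Sum>i. hausdorff1_pre \<delta> (A i)) + e" .
qed

lemma hausdorff1_outer_mono: "A \<subseteq> B \<Longrightarrow> hausdorff1_outer A \<le> hausdorff1_outer B"
  unfolding hausdorff1_outer_def by (intro SUP_mono') (rule hausdorff1_pre_mono)

lemma hausdorff1_outer_UN: "hausdorff1_outer (\<Union>i::nat. A i) \<le> (\<Sum>i. hausdorff1_outer (A i))"
  unfolding hausdorff1_outer_def
proof (rule SUP_least)
  fix \<delta> :: real assume "\<delta> \<in> {0<..}"
  then show "hausdorff1_pre \<delta> (\<Union>i. A i) \<le> (\<Sum>i. SUP \<delta>\<in>{0<..}. hausdorff1_pre \<delta> (A i))"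
    by (intro order_trans[OF hausdorff1_pre_UN] suminf_le SUP_upper) auto
qed

lemma hausdorff1_outer_empty [simp]: "hausdorff1_outer {} = 0"
proof -
  have "hausdorff1_pre \<delta> {} \<le> 0" if "0 < \<delta>" for \<delta>
    using hausdorff1_pre_finite_cover[of "{}" "{}" _ \<delta>] that by auto
  then show ?thesis
    unfolding hausdorff1_outer_def by (intro antisym SUP_least) auto
qed

lemma hausdorff1_outer_space: "outer_measure_space (Pow UNIV) hausdorff1_outer"
  unfolding outer_measure_space_def positive_def increasing_def countably_subadditive_def
  by (auto intro: hausdorff1_outer_mono hausdorff1_outer_UN)

lemma hausdorff1_outer_Un: "hausdorff1_outer (A \<union> B) \<le> hausdorff1_outer A + hausdorff1_outer B"
proof -
  define C where "C i = (if i = 0 then A else if i = 1 then B else {})" for i :: nat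
  have "(\<Union>i. C i) = A \<union> B"
    by (auto simp: C_def split: if_splits)
  moreover have "(\<Sum>i. hausdorff1_outer (C i)) = (\<Sum>i\<in>{0,1}. hausdorff1_outer (C i))"
    by (rule suminf_finite) (auto simp: C_def)
  ultimately show ?thesis
    using hausdorff1_outer_UN[of C] by (simp add: C_def)
qed

text \<open>At a scale below \<open>d\<close> no covering set meets both \<open>A\<close> and
  \<open>B\<close>, so every cover of the union splits into a cover of \<open>A\<close> and one of
  \<open>B\<close>.\<close>

lemma hausdorff1_outer_separated:
  assumes d: "0 < d" and sep: "\<And>x y. x \<in> A \<Longrightarrow> y \<in> B \<Longrightarrow> d \<le> dist x y"
  shows "hausdorff1_outer A + hausdorff1_outer B \<le> hausdorff1_outer (A \<union> B)"
proof -
  have pre: "hausdorff1_pre \<delta> A + hausdorff1_pre \<delta> B \<le> hausdorff1_pre \<delta> (A \<union> B)" if "0 < \<delta>" "\<delta> < d" for \<delta>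
    unfolding hausdorff1_pre_def[of \<delta> "A \<union> B"]
  proof (rule INF_greatest, clarify)
    fix C :: "nat \<Rightarrow> 'a set"
    assume cov: "A \<union> B \<subseteq> (\<Union>i. C i)" and C: "\<forall>i. bounded (C i) \<and> diameter (C i) \<le> \<delta>"
    define C1 where "C1 i = (if C i \<inter> A = {} then {} else C i)" for i
    define C2 where "C2 i = (if C i \<inter> A = {} then C i else {})" for i
    have "A \<subseteq> (\<Union>i. C1 i)"
      using cov by (fastforce simp: C1_def split: if_splits)
    moreover have "B \<subseteq> (\<Union>i. C2 i)"
    proof
      fix y assume y: "y \<in> B"
      then obtain i where i: "y \<in> C i" using cov by blast
      have "C i \<inter> A = {}"
      proof (rule ccontr)
        assume "C i \<inter> A \<noteq> {}"
        then obtain x where x: "x \<in> C i" "x \<in> A" by blast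
        have "d \<le> dist x y" by (rule sep[OF x(2) y])
        also have "dist x y \<le> diameter (C i)"
          using C i x by (intro diameter_bounded_bound) auto
        also have "\<dots> \<le> \<delta>" using C by auto
        finally show False using that by simp
      qed
      then show "y \<in> (\<Union>i. C2 i)" using i by (auto simp: C2_def)
    qed
    ultimately have "hausdorff1_pre \<delta> A + hausdorff1_pre \<delta> B \<le>
        (\<Sum>i. ennreal (diameter (C1 i))) + (\<Sum>i. ennreal (diameter (C2 i)))"
      using C that by (intro add_mono hausdorff1_pre_le) (auto simp: C1_def C2_def)
    also have "\<dots> = (\<Sum>i. ennreal (diameter (C1 i)) + ennreal (diameter (C2 i)))"
      by (rule suminf_add) auto
    also have "\<dots> = (\<Sum>i. ennreal (diameter (C i)))"
      by (intro suminf_cong) (auto simp: C1_def C2_def)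
    finally show "hausdorff1_pre \<delta> A + hausdorff1_pre \<delta> B \<le> (\<Sum>i. ennreal (diameter (C i)))" .
  qed
  \<comment> \<open>Scales from \<open>d\<close> on do not matter for the supremum, since the
    pre-measure grows as the scale shrinks.\<close>
  have eq: "hausdorff1_outer X = (SUP \<delta>\<in>{0<..<d}. hausdorff1_pre \<delta> X)" for X :: "'a set"
    unfolding hausdorff1_outer_def
  proof (rule antisym)
    show "(SUP \<delta>\<in>{0<..}. hausdorff1_pre \<delta> X) \<le> (SUP \<delta>\<in>{0<..<d}. hausdorff1_pre \<delta> X)"
    proof (rule SUP_least)
      fix \<delta> :: real assume "\<delta> \<in> {0<..}"
      then have "hausdorff1_pre \<delta> X \<le> hausdorff1_pre (min \<delta> (d/2)) X" "min \<delta> (d/2) \<in> {0<..<d}"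
        using d by (auto intro: hausdorff1_pre_antimono)
      then show "hausdorff1_pre \<delta> X \<le> (SUP \<delta>\<in>{0<..<d}. hausdorff1_pre \<delta> X)"
        by (meson SUP_upper2)
    qed
  qed (intro SUP_subset_mono, auto)
  \<comment> \<open>The two suprema run over independent scales; both are replaced by the smaller
    one.\<close>
  have "hausdorff1_pre \<delta> A + hausdorff1_pre \<epsilon> B \<le> hausdorff1_outer (A \<union> B)"
    if "\<delta> \<in> {0<..<d}" "\<epsilon> \<in> {0<..<d}" for \<delta> \<epsilon>
  proof -
    have "hausdorff1_pre \<delta> A + hausdorff1_pre \<epsilon> B
        \<le> hausdorff1_pre (min \<delta> \<epsilon>) A + hausdorff1_pre (min \<delta> \<epsilon>) B"
      by (intro add_mono hausdorff1_pre_antimono) auto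
    also have "\<dots> \<le> hausdorff1_pre (min \<delta> \<epsilon>) (A \<union> B)"
      using that by (intro pre) auto
    also have "\<dots> \<le> hausdorff1_outer (A \<union> B)"
      unfolding hausdorff1_outer_def using that by (intro SUP_upper) auto
    finally show ?thesis .
  qed
  then show ?thesis
    unfolding eq[of A] eq[of B] using d
    by (auto simp: ennreal_SUP_add_left[symmetric] ennreal_SUP_add_right intro!: SUP_least)
qed

text \<open>Caratheodory's criterion: the layers \<open>R k\<close> of \<open>A\<close> around the closed set \<open>C\<close> with indices of
  equal parity are separated, so their outer measures sum to at most \<open>2 \<mu>(A)\<close>; the part of \<open>A - C\<close>
  close to \<open>C\<close> is therefore negligible.\<close>

lemma hausdorff1_outer_closed_split:
  fixes A C :: "'a::metric_space set"
  assumes C: "closed C" "C \<noteq> {}"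
  shows "hausdorff1_outer (A \<inter> C) + hausdorff1_outer (A - C) \<le> hausdorff1_outer A"
proof (cases "hausdorff1_outer A = top")
  case fin: False
  define d where "d x = infdist x C" for x
  define R where "R k = {x \<in> A. 1 / (real k + 2) \<le> d x \<and> d x < 1 / (real k + 1)}" for k :: nat
  have lip: "d x - d y \<le> dist x y" for x y
    using infdist_triangle[of x C y] by (simp add: d_def)
  have sumR: "(\<Sum>k<N. hausdorff1_outer (R (2 * k + p))) \<le> hausdorff1_outer (\<Union>k<N. R (2 * k + p))" for N p
  proof (induction N)
    case (Suc N)
    have "(\<Sum>k<Suc N. hausdorff1_outer (R (2 * k + p)))
        \<le> hausdorff1_outer (\<Union>k<N. R (2 * k + p)) + hausdorff1_outer (R (2 * N + p))"
      using Suc by (simp add: add_mono)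
    also have "\<dots> \<le> hausdorff1_outer ((\<Union>k<N. R (2 * k + p)) \<union> R (2 * N + p))"
    proof (cases "N = 0")
      case False
      show ?thesis
      proof (rule hausdorff1_outer_separated)
        \<comment> \<open>The gap is the thickness of the layer with index
          \<open>2 * N + p - 1\<close>, which has the other parity. The case \<open>N = 0\<close> is
          separate: there is no earlier layer, and the first denominator may be 0.\<close>
        show "0 < 1 / (real (2 * N + p)) - 1 / (real (2 * N + p) + 1)"
          using False by (simp add: divide_strict_left_mono)
        fix x y assume "x \<in> (\<Union>k<N. R (2 * k + p))" and y: "y \<in> R (2 * N + p)"
        then obtain k where k: "k < N" "x \<in> R (2 * k + p)" by blast
        have "1 / real (2 * N + p) \<le> 1 / (real (2 * k + p) + 2)"
        proof (rule frac_le)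
          show "real (2 * k + p) + 2 \<le> real (2 * N + p)" using k(1) by linarith
        qed simp_all
        also have "\<dots> \<le> d x" using k by (auto simp: R_def)
        finally show "1 / (real (2 * N + p)) - 1 / (real (2 * N + p) + 1) \<le> dist x y"
          using y lip[of x y] by (auto simp: R_def)
      qed
    qed auto
    also have "(\<Union>k<N. R (2 * k + p)) \<union> R (2 * N + p) = (\<Union>k<Suc N. R (2 * k + p))"
      by (auto simp: less_Suc_eq)
    finally show ?case .
  qed auto
  have sumR': "(\<Sum>k<N. hausdorff1_outer (R (2 * k + p))) \<le> hausdorff1_outer A" for N p
    by (rule order_trans[OF sumR hausdorff1_outer_mono]) (auto simp: R_def)
  have split: "(\<Sum>k<2*N. f k) = (\<Sum>k<N. f (2 * k + 0)) + (\<Sum>k<N. f (2 * k + 1))" for f :: "nat \<Rightarrow> ennreal" and N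
    by (induction N) (auto simp: ac_simps)
  have "(\<Sum>k. hausdorff1_outer (R k)) \<le> hausdorff1_outer A + hausdorff1_outer A"
  proof (rule suminf_le_const)
    fix N
    have "(\<Sum>k<N. hausdorff1_outer (R k)) \<le> (\<Sum>k<2*N. hausdorff1_outer (R k))"
      by (intro sum_mono2) auto
    also have "\<dots> \<le> hausdorff1_outer A + hausdorff1_outer A"
      unfolding split by (intro add_mono sumR')
    finally show "(\<Sum>k<N. hausdorff1_outer (R k)) \<le> hausdorff1_outer A + hausdorff1_outer A" .
  qed auto
  then have sfin: "(\<Sum>k. hausdorff1_outer (R k)) \<noteq> top"
    using fin by (metis ennreal_add_eq_top top_unique)
  define r where "r k = enn2real (hausdorff1_outer (R k))" for k
  have r: "hausdorff1_outer (R k) = ennreal (r k)" "0 \<le> r k" for k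
    using ennreal_suminf_lessD[of "\<lambda>k. hausdorff1_outer (R k)" top k] sfin
    by (auto simp: r_def less_top)
  have sr: "summable r"
    using sfin r by (intro summable_suminf_not_top) auto
  show ?thesis
  proof (rule ennreal_le_epsilon)
    fix e :: real assume e: "0 < e"
    obtain N where N: "norm (\<Sum>i. r (i + N)) < e"
      using suminf_exist_split[OF e sr] by blast
    define A' where "A' = {x \<in> A. 1 / (real N + 1) \<le> d x}"
    have sub: "A - C \<subseteq> A' \<union> (\<Union>k. R (k + N))"
    proof
      fix x assume x: "x \<in> A - C"
      then have dx: "d x > 0"
        using C by (simp add: d_def infdist_pos_not_in_closed)
      show "x \<in> A' \<union> (\<Union>k. R (k + N))"
      proof (cases "1 / (real N + 1) \<le> d x")
        case True
        then show ?thesis using x by (auto simp: A'_def)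
      next
        case False
        obtain m where m: "1 / real (Suc m) < d x"
          using nat_approx_posE[OF dx] by blast
        define P where "P m \<longleftrightarrow> 1 / (real m + 1) \<le> d x" for m :: nat
        have Pm: "P m" using m by (simp add: P_def add.commute)
        \<comment> \<open>The least \<open>m\<close> with \<open>1 / (m + 1) \<le> d x\<close>
          exceeds \<open>N\<close>, and its predecessor is the index of the layer that contains
          \<open>x\<close>.\<close>
        define k where "k = (LEAST m. P m)"
        have Pk: "P k" unfolding k_def using Pm by (rule LeastI[of P m])
        have "N < k"
        proof (rule ccontr)
          assume "\<not> N < k"
          then have "1 / (real N + 1) \<le> 1 / (real k + 1)" by (intro frac_le) auto
          then show False using Pk False by (auto simp: P_def)
        qed
        then obtain j where j: "k = Suc (j + N)"
          by (metis add.commute add_Suc less_iff_Suc_add)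
        have "\<not> P (j + N)"
          using not_less_Least[of "j + N" P] j by (auto simp: k_def)
        then have "x \<in> R (j + N)"
          using Pk x j by (auto simp: P_def R_def add.commute)
        then show ?thesis by blast
      qed
    qed
    have "hausdorff1_outer (A - C) \<le> hausdorff1_outer A' + hausdorff1_outer (\<Union>k. R (k + N))"
      by (rule order_trans[OF hausdorff1_outer_mono[OF sub] hausdorff1_outer_Un])
    also have "hausdorff1_outer (\<Union>k. R (k + N)) \<le> (\<Sum>k. ennreal (r (k + N)))"
      using hausdorff1_outer_UN[of "\<lambda>k. R (k + N)"] by (simp add: r)
    also have "\<dots> = ennreal (\<Sum>k. r (k + N))"
      by (intro suminf_ennreal2) (auto simp: r sr summable_ignore_initial_segment)
    also have "\<dots> \<le> ennreal e" using N by (intro ennreal_leI) auto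
    finally have 1: "hausdorff1_outer (A - C) \<le> hausdorff1_outer A' + ennreal e"
      by (simp add: add_left_mono)
    have "hausdorff1_outer (A \<inter> C) + hausdorff1_outer A' \<le> hausdorff1_outer (A \<inter> C \<union> A')"
    proof (rule hausdorff1_outer_separated)
      show "0 < 1 / (real N + 1)" by simp
      fix x y assume "x \<in> A \<inter> C" "y \<in> A'"
      then show "1 / (real N + 1) \<le> dist x y"
        using lip[of y x] by (auto simp: A'_def d_def dist_commute)
    qed
    also have "\<dots> \<le> hausdorff1_outer A"
      by (rule hausdorff1_outer_mono) (auto simp: A'_def)
    finally have "hausdorff1_outer (A \<inter> C) + hausdorff1_outer A' \<le> hausdorff1_outer A" .
    then have "hausdorff1_outer (A \<inter> C) + (hausdorff1_outer A' + ennreal e) \<le> hausdorff1_outer A + ennreal e"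
      by (simp add: add.assoc[symmetric] add_right_mono)
    with 1 show "hausdorff1_outer (A \<inter> C) + hausdorff1_outer (A - C) \<le> hausdorff1_outer A + ennreal e"
      by (meson add_left_mono order_trans)
  qed
qed simp

text \<open>The splitting along closed sets is Caratheodory's criterion for them. The sets that
  satisfy the criterion form a sigma-algebra on which the outer measure is countably additive, and
  it contains the closed sets, hence the Borel sets.\<close>

lemma measure_space_hausdorff1:
  "measure_space UNIV (sets (borel :: 'a::metric_space measure)) hausdorff1_outer"
proof -
  interpret P: sigma_algebra "UNIV :: 'a set" "Pow UNIV" by (rule sigma_algebra_Pow)
  let ?L = "lambda_system (UNIV :: 'a set) (Pow UNIV) hausdorff1_outer"
  have ms: "measure_space UNIV ?L hausdorff1_outer"
    by (rule P.caratheodory_lemma[OF hausdorff1_outer_space])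
  then have sa: "sigma_algebra UNIV ?L" by (simp add: measure_space_def)
  have closed: "C \<in> ?L" if C: "closed C" for C :: "'a set"
    unfolding P.lambda_system_eq
  proof (clarsimp)
    fix A :: "'a set"
    show "hausdorff1_outer (A \<inter> C) + hausdorff1_outer (A - C) = hausdorff1_outer A"
    proof (cases "C = {}")
      case False
      have "hausdorff1_outer A \<le> hausdorff1_outer (A \<inter> C) + hausdorff1_outer (A - C)"
        using hausdorff1_outer_Un[of "A \<inter> C" "A - C"] by (simp add: Int_Diff_Un)
      with hausdorff1_outer_closed_split[OF C False] show ?thesis
        by (intro antisym)
    qed simp
  qed
  have "sigma_sets UNIV (Collect closed) \<subseteq> ?L"
    by (rule sigma_algebra.sigma_sets_subset[OF sa]) (use closed in auto)
  moreover have "sets (borel :: 'a measure) = sigma_sets UNIV (Collect closed)"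
    by (subst borel_eq_closed) (simp add: sets_measure_of_conv)
  ultimately have "sets (borel :: 'a measure) \<subseteq> ?L" by simp
  moreover have "sigma_algebra (UNIV :: 'a set) (sets borel)"
    using sets.sigma_algebra_axioms[of "borel :: 'a measure"] by (simp only: space_borel)
  ultimately show ?thesis
    using measure_down[OF ms] by blast
qed

lemma sets_hausdorff1 [simp, measurable_cong]: "sets hausdorff1 = sets borel"
  unfolding hausdorff1_def by (simp add: sets_measure_of_conv sets.sigma_sets_eq[of borel, simplified])

lemma space_hausdorff1 [simp]: "space hausdorff1 = UNIV"
  unfolding hausdorff1_def by (simp add: space_measure_of_conv)

text \<open>\<open>measure_of\<close> yields the zero measure unless its set function is a measure
  on the given sigma-algebra. This is where the definition of \<open>hausdorff1\<close> is seen to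
  have the intended value.\<close>

lemma emeasure_hausdorff1:
  assumes "A \<in> sets borel" shows "emeasure hausdorff1 A = hausdorff1_outer A"
proof -
  have "hausdorff1 = measure_of UNIV (sets (borel :: 'a measure)) hausdorff1_outer"
    unfolding hausdorff1_def hausdorff1_outer_def ..
  then show ?thesis
    using assms measure_space_hausdorff1[where 'a='a]
    unfolding measure_space_def by (metis emeasure_measure_of_sigma)
qed

text \<open>The function \<open>dist x\<close> does not increase distances. It maps the connected
  set onto a set containing the interval from 0 to \<open>dist x y\<close>, and each covering set
  into an interval as long as its diameter; countable subadditivity of Lebesgue measure on the line
  compares the two. Any fixed positive scale would do in place of 1.\<close>

lemma hausdorff1_outer_connected:
  fixes A :: "'a::metric_space set"
  assumes A: "connected A" "x \<in> A" "y \<in> A"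
  shows "ennreal (dist x y) \<le> hausdorff1_outer A"
proof -
  have "ennreal (dist x y) \<le> hausdorff1_pre 1 A"
    unfolding hausdorff1_pre_def
  proof (rule INF_greatest, clarify)
    fix C :: "nat \<Rightarrow> 'a set"
    assume cov: "A \<subseteq> (\<Union>i. C i)" and C: "\<forall>i. bounded (C i) \<and> diameter (C i) \<le> 1"
    have ex: "\<exists>l. dist x ` C i \<subseteq> {l..l + diameter (C i)}" for i
    proof (cases "C i = {}")
      case False
      define l where "l = (INF z\<in>C i. dist x z)"
      have bdd: "bdd_below (dist x ` C i)" by (auto intro: bdd_belowI[of _ 0])
      have "l \<le> dist x z \<and> dist x z \<le> l + diameter (C i)" if z: "z \<in> C i" for z
      proof
        show "l \<le> dist x z" unfolding l_def by (intro cINF_lower bdd z)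
        have "dist x z - diameter (C i) \<le> l"
          unfolding l_def
        proof (rule cINF_greatest[OF False])
          fix w assume "w \<in> C i"
          then have "dist w z \<le> diameter (C i)" using C z by (intro diameter_bounded_bound) auto
          then show "dist x z - diameter (C i) \<le> dist x w"
            using dist_triangle[of x z w] by simp
        qed
        then show "dist x z \<le> l + diameter (C i)" by simp
      qed
      then show ?thesis by (intro exI[of _ l]) auto
    qed auto
    then obtain l where l: "\<And>i. dist x ` C i \<subseteq> {l i..l i + diameter (C i)}" by metis
    have "connected (dist x ` A)"
      by (intro connected_continuous_image A continuous_intros)
    moreover have "0 \<in> dist x ` A" "dist x y \<in> dist x ` A"
      using A by (force, auto)
    ultimately have "{0..dist x y} \<subseteq> dist x ` A"
      by (rule connected_contains_Icc)
    also have "\<dots> \<subseteq> (\<Union>i. {l i..l i + diameter (C i)})"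
      using cov l by fastforce
    finally have "emeasure lborel {0..dist x y} \<le> emeasure lborel (\<Union>i. {l i..l i + diameter (C i)})"
      by (intro emeasure_mono) auto
    also have "\<dots> \<le> (\<Sum>i. emeasure lborel {l i..l i + diameter (C i)})"
      by (intro emeasure_subadditive_countably) auto
    also have "\<dots> = (\<Sum>i. ennreal (diameter (C i)))"
      using C by (intro suminf_cong) (auto simp: diameter_ge_0)
    finally show "ennreal (dist x y) \<le> (\<Sum>i. ennreal (diameter (C i)))" by simp
  qed
  also have "\<dots> \<le> hausdorff1_outer A"
    unfolding hausdorff1_outer_def by (intro SUP_upper) auto
  finally show ?thesis .
qed

lemma diameter_le_metric:
  assumes "0 \<le> \<delta>" "\<And>x y. x \<in> S \<Longrightarrow> y \<in> S \<Longrightarrow> dist x y \<le> \<delta>"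
  shows "diameter S \<le> \<delta>"
  using assms by (auto simp: diameter_def intro!: cSUP_least)

text \<open>Cutting the parameter interval into \<open>n\<close> equal pieces gives sets of diameter
  at most \<open>L (b - a) / n\<close>. Their sum is bounded by \<open>L (b - a)\<close> for every
  \<open>n\<close>, so \<open>n\<close> can be adapted to the scale.\<close>

lemma hausdorff1_outer_lipschitz_arc:
  fixes \<gamma> :: "real \<Rightarrow> 'a::metric_space"
  assumes ab: "a < b" and L: "0 \<le> L"
    and lip: "\<And>s t. s \<in> {a..<b} \<Longrightarrow> t \<in> {a..<b} \<Longrightarrow> dist (\<gamma> s) (\<gamma> t) \<le> L * \<bar>s - t\<bar>"
  shows "hausdorff1_outer (\<gamma> ` {a..<b}) \<le> ennreal (L * (b - a))"
  unfolding hausdorff1_outer_def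
proof (rule SUP_least)
  fix \<delta> :: real assume "\<delta> \<in> {0<..}"
  then have \<delta>: "0 < \<delta>" by simp
  obtain n :: nat where n: "L * (b - a) / \<delta> < real n" using reals_Archimedean2 by blast
  have "0 \<le> L * (b - a) / \<delta>" using L ab \<delta> by simp
  with n have n0: "0 < real n" by linarith
  define h where "h = (b - a) / n"
  have h0: "0 < h" using ab n0 by (simp add: h_def)
  have Lh: "L * h \<le> \<delta>" using n n0 \<delta> by (simp add: h_def field_simps)
  define I where "I i = {a..<b} \<inter> {a + real i * h..a + real (Suc i) * h}" for i
  have dist: "dist p q \<le> L * h" if "p \<in> \<gamma> ` I i" "q \<in> \<gamma> ` I i" for p q i
  proof -
    obtain s t where st: "s \<in> I i" "p = \<gamma> s" "t \<in> I i" "q = \<gamma> t" using \<open>p \<in> _\<close> \<open>q \<in> _\<close> by blast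
    have "\<bar>s - t\<bar> \<le> h" using st by (auto simp: I_def algebra_simps abs_le_iff)
    then have "L * \<bar>s - t\<bar> \<le> L * h" using L by (rule mult_left_mono)
    moreover have "dist p q \<le> L * \<bar>s - t\<bar>" using st lip by (auto simp: I_def)
    ultimately show ?thesis by linarith
  qed
  have diam: "diameter (\<gamma> ` I i) \<le> L * h" for i
    using L h0 dist by (intro diameter_le_metric) auto
  have "\<gamma> ` {a..<b} \<subseteq> (\<Union>i\<in>{..<n}. \<gamma> ` I i)"
  proof clarify
    fix t assume t: "t \<in> {a..<b}"
    define i where "i = nat \<lfloor>(t - a) / h\<rfloor>"
    have "0 \<le> (t - a) / h" using t h0 by simp
    then have i: "real i \<le> (t - a) / h" "(t - a) / h < real i + 1"
      unfolding i_def by linarith+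
    have "(t - a) / h < real n" using t n0 ab by (simp add: h_def field_simps)
    then have "i < n" using i by linarith
    moreover have "t \<in> I i" using i h0 t by (auto simp: I_def field_simps)
    ultimately show "\<gamma> t \<in> (\<Union>i\<in>{..<n}. \<gamma> ` I i)" by blast
  qed
  from _ this have "hausdorff1_pre \<delta> (\<gamma> ` {a..<b}) \<le> (\<Sum>i<n. ennreal (diameter (\<gamma> ` I i)))"
  proof (rule hausdorff1_pre_finite_cover)
    show "bounded (\<gamma> ` I i)" for i
      using dist unfolding bounded_two_points by meson
    show "diameter (\<gamma> ` I i) \<le> \<delta>" for i
      using diam[of i] Lh by linarith
  qed (use \<delta> in auto)
  also have "\<dots> \<le> (\<Sum>i<n. ennreal (L * h))"
    by (intro sum_mono ennreal_leI diam)
  also have "\<dots> = ennreal (L * (b - a))"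
  proof -
    have "real n * (L * h) = L * (b - a)" using n0 by (simp add: h_def)
    moreover have "(\<Sum>i<n. ennreal (L * h)) = ennreal (real n * (L * h))"
      using L h0 by (simp add: ennreal_of_nat_eq_real_of_nat ennreal_mult[symmetric])
    ultimately show ?thesis by (simp only:)
  qed
  finally show "hausdorff1_pre \<delta> (\<gamma> ` {a..<b}) \<le> ennreal (L * (b - a))" .
qed

section \<open>Continuously differentiable functions on the plane\<close>

text \<open>The regularity half of \<open>C1c\<close>, separated from the support condition so that
  coefficient functions without compact support obey the same calculus.\<close>

definition C1 :: "(real^2 \<Rightarrow> 'b::real_normed_vector) \<Rightarrow> bool" where
  "C1 f \<longleftrightarrow> f differentiable_on UNIV \<and> (\<forall>i. continuous_on UNIV (partial i f))"

text \<open>For \<open>C1\<close> functions this is the derivative at \<open>x\<close> in direction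
  \<open>h\<close>. Written through the partial derivatives, it is visibly continuous in
  \<open>x\<close> and \<open>h\<close> jointly.\<close>

definition dirder :: "(real^2 \<Rightarrow> 'b::real_normed_vector) \<Rightarrow> real^2 \<Rightarrow> real^2 \<Rightarrow> 'b" where
  "dirder f x h = (\<Sum>i\<in>UNIV. h $ i *\<^sub>R partial i f x)"

lemma partialI: "(f has_derivative f') (at x) \<Longrightarrow> partial i f x = f' (axis i 1)"
  unfolding partial_def by (metis frechet_derivative_at)

lemma dirder_axis [simp]: "dirder f x (axis i 1) = partial i f x"
proof -
  have "dirder f x (axis i 1) = (\<Sum>j\<in>{i}. (axis i 1 :: real^2) $ j *\<^sub>R partial j f x)"
    unfolding dirder_def by (rule sum.mono_neutral_right) (auto simp: axis_def)
  then show ?thesis by (simp add: axis_def)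
qed

lemma dirder_2: "dirder f x h = h $ 1 *\<^sub>R partial 1 f x + h $ 2 *\<^sub>R partial 2 f x"
  by (simp add: dirder_def sum_2)

lemma linear_eq_dirder:
  assumes "(f has_derivative f') (at x)" shows "f' = dirder f x"
proof
  fix h :: "real^2"
  interpret bounded_linear f' using assms by (rule has_derivative_bounded_linear)
  have "f' h = f' (\<Sum>i\<in>UNIV. h $ i *\<^sub>R axis i 1)"
    by (simp add: basis_expansion flip: scalar_mult_eq_scaleR)
  then show "f' h = dirder f x h"
    by (simp add: sum scaleR dirder_def partialI[OF assms])
qed

lemma C1_derivative: "C1 f \<Longrightarrow> (f has_derivative dirder f x) (at x)"
  unfolding C1_def differentiable_on_def differentiable_def
  by (metis UNIV_I linear_eq_dirder)

lemma C1_partial_continuous: "C1 f \<Longrightarrow> continuous_on S (partial i f)"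
  unfolding C1_def by (meson continuous_on_subset subset_UNIV)

lemma C1_continuous: "C1 f \<Longrightarrow> continuous_on S f"
  by (meson C1_derivative has_derivative_continuous_on has_derivative_at_withinI)

lemma C1I:
  assumes "\<And>x. (f has_derivative f' x) (at x)" "\<And>i. continuous_on UNIV (\<lambda>x. f' x (axis i 1))"
  shows "C1 f"
proof -
  have "partial i f = (\<lambda>x. f' x (axis i 1))" for i
    using partialI[OF assms(1)] by auto
  then show ?thesis
    using assms unfolding C1_def differentiable_on_def differentiable_def
    by (auto intro: has_derivative_at_withinI)
qed

lemma dirder_continuous:
  "C1 f \<Longrightarrow> continuous_on S g \<Longrightarrow> continuous_on S h \<Longrightarrow> continuous_on S (\<lambda>x. dirder f (g x) (h x))"
  unfolding dirder_def
  by (intro continuous_intros continuous_on_compose2[OF C1_partial_continuous[of f UNIV]]) auto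

lemma has_vector_derivative_along:
  assumes "C1 f" "(g has_vector_derivative v) (at t within S)"
  shows "((\<lambda>s. f (g s)) has_vector_derivative dirder f (g t) v) (at t within S)"
proof -
  interpret D: bounded_linear "dirder f (g t)"
    using C1_derivative[OF assms(1)] by (rule has_derivative_bounded_linear)
  show ?thesis
    using has_derivative_compose[OF assms(2)[unfolded has_vector_derivative_def] C1_derivative[OF assms(1)]]
    by (simp add: has_vector_derivative_def D.scaleR)
qed

text \<open>One product rule for scaling, multiplication and inner product, which are the instances
  named further down.\<close>

lemma C1_bilinear:
  fixes f :: "real^2 \<Rightarrow> 'b::real_normed_vector" and g :: "real^2 \<Rightarrow> 'c::real_normed_vector"
  assumes p: "bounded_bilinear p" and f: "C1 f" and g: "C1 g"
  shows "C1 (\<lambda>x. p (f x) (g x))"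
    "partial i (\<lambda>x. p (f x) (g x)) x = p (f x) (partial i g x) + p (partial i f x) (g x)"
proof -
  have D: "((\<lambda>x. p (f x) (g x)) has_derivative (\<lambda>h. p (f x) (dirder g x h) + p (dirder f x h) (g x))) (at x)" for x
    by (rule bounded_bilinear.FDERIV[OF p C1_derivative[OF f] C1_derivative[OF g]])
  show "C1 (\<lambda>x. p (f x) (g x))"
    by (rule C1I[OF D])
      (auto intro!: continuous_intros bounded_bilinear.continuous_on[OF p] C1_continuous[OF f] C1_continuous[OF g] C1_partial_continuous[OF f] C1_partial_continuous[OF g])
  show "partial i (\<lambda>x. p (f x) (g x)) x = p (f x) (partial i g x) + p (partial i f x) (g x)"
    using partialI[OF D] by simp
qed

lemma C1_bounded_linear:
  assumes L: "bounded_linear L" and f: "C1 f"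
  shows "C1 (\<lambda>x. L (f x))" "partial i (\<lambda>x. L (f x)) x = L (partial i f x)"
proof -
  have D: "((\<lambda>x. L (f x)) has_derivative (\<lambda>h. L (dirder f x h))) (at x)" for x
    by (rule bounded_linear.has_derivative[OF L C1_derivative[OF f]])
  show "C1 (\<lambda>x. L (f x))"
    by (rule C1I[OF D]) (auto intro!: bounded_linear.continuous_on[OF L] C1_partial_continuous[OF f])
  show "partial i (\<lambda>x. L (f x)) x = L (partial i f x)"
    using partialI[OF D] by simp
qed

lemma C1_compose_real:
  assumes f: "C1 f" and g: "\<And>t. (g has_real_derivative g' t) (at t)" and g': "continuous_on UNIV g'"
  shows "C1 (\<lambda>x. g (f x))" "partial i (\<lambda>x. g (f x)) x = g' (f x) * partial i f x"
proof -
  have D: "((\<lambda>x. g (f x)) has_derivative (\<lambda>h. g' (f x) * dirder f x h)) (at x)" for x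
    using has_derivative_compose[OF C1_derivative[OF f, of x] g[unfolded has_field_derivative_def]]
    by simp
  show "C1 (\<lambda>x. g (f x))"
    by (rule C1I[OF D])
      (auto intro!: continuous_intros continuous_on_compose2[OF g'] C1_continuous[OF f] C1_partial_continuous[OF f])
  show "partial i (\<lambda>x. g (f x)) x = g' (f x) * partial i f x"
    using partialI[OF D] by simp
qed

lemma C1_const: "C1 (\<lambda>x. c)" "partial i (\<lambda>x. c) x = 0"
proof -
  have D: "((\<lambda>x. c) has_derivative (\<lambda>h. 0)) (at x)" for x :: "real^2" by simp
  show "C1 (\<lambda>x. c)" by (rule C1I[OF D]) simp
  show "partial i (\<lambda>x. c) x = 0" using partialI[OF D] by simp
qed

lemma C1_ident: "C1 (\<lambda>x. x)" "partial i (\<lambda>x. x) x = axis i 1"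
proof -
  have D: "((\<lambda>x. x) has_derivative (\<lambda>h. h)) (at x)" for x :: "real^2" by simp
  show "C1 (\<lambda>x. x)" by (rule C1I[OF D]) simp
  show "partial i (\<lambda>x. x) x = axis i 1" using partialI[OF D] by simp
qed

lemma C1_add:
  assumes f: "C1 f" and g: "C1 g"
  shows "C1 (\<lambda>x. f x + g x)" "partial i (\<lambda>x. f x + g x) x = partial i f x + partial i g x"
proof -
  have D: "((\<lambda>x. f x + g x) has_derivative (\<lambda>h. dirder f x h + dirder g x h)) (at x)" for x
    by (rule has_derivative_add[OF C1_derivative[OF f] C1_derivative[OF g]])
  show "C1 (\<lambda>x. f x + g x)"
    by (rule C1I[OF D]) (auto intro!: continuous_intros C1_partial_continuous[OF f] C1_partial_continuous[OF g])
  show "partial i (\<lambda>x. f x + g x) x = partial i f x + partial i g x"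
    using partialI[OF D] by simp
qed

lemma C1_diff:
  assumes f: "C1 f" and g: "C1 g"
  shows "C1 (\<lambda>x. f x - g x)" "partial i (\<lambda>x. f x - g x) x = partial i f x - partial i g x"
proof -
  have D: "((\<lambda>x. f x - g x) has_derivative (\<lambda>h. dirder f x h - dirder g x h)) (at x)" for x
    by (rule has_derivative_diff[OF C1_derivative[OF f] C1_derivative[OF g]])
  show "C1 (\<lambda>x. f x - g x)"
    by (rule C1I[OF D]) (auto intro!: continuous_intros C1_partial_continuous[OF f] C1_partial_continuous[OF g])
  show "partial i (\<lambda>x. f x - g x) x = partial i f x - partial i g x"
    using partialI[OF D] by simp
qed

lemma C1_sum:
  assumes "finite I" "\<And>k. k \<in> I \<Longrightarrow> C1 (f k)"
  shows "C1 (\<lambda>x. \<Sum>k\<in>I. f k x) \<and> (\<forall>i x. partial i (\<lambda>x. \<Sum>k\<in>I. f k x) x = (\<Sum>k\<in>I. partial i (f k) x))"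
  using assms
proof (induction rule: finite_induct)
  case empty
  then show ?case by (simp add: C1_const)
next
  case (insert k I)
  then show ?case by (simp add: C1_add)
qed

lemmas C1_scaleR = C1_bilinear[OF bounded_bilinear_scaleR]
lemmas C1_mult = C1_bilinear[OF bounded_bilinear_mult]
lemmas C1_inner = C1_bilinear[OF bounded_bilinear_inner]

lemma C1_translate:
  assumes "C1 f" shows "C1 (\<lambda>y. f (y - x))" "partial i (\<lambda>y. f (y - x)) y = partial i f (y - x)"
proof -
  have D: "((\<lambda>y. f (y - x)) has_derivative dirder f (y - x)) (at y)" for y
  proof -
    have "((\<lambda>y. y - x) has_derivative (\<lambda>h. h)) (at y)" by (auto intro!: derivative_eq_intros)
    from has_derivative_compose[OF this C1_derivative[OF assms]] show ?thesis .
  qed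
  show "C1 (\<lambda>y. f (y - x))" by (rule C1I[OF D]) (intro dirder_continuous assms continuous_intros)
  show "partial i (\<lambda>y. f (y - x)) y = partial i f (y - x)" using partialI[OF D] by simp
qed

lemma partial_cong_open:
  assumes "open U" "x \<in> U" "\<And>y. y \<in> U \<Longrightarrow> f y = g y"
  shows "partial i f x = partial i g x"
proof -
  have "(f has_derivative f') (at x) \<longleftrightarrow> (g has_derivative f') (at x)" for f'
    using has_derivative_transform_within_open[OF _ assms(1,2), of f f' UNIV g]
      has_derivative_transform_within_open[OF _ assms(1,2), of g f' UNIV f] assms(3) by auto
  then show ?thesis unfolding partial_def frechet_derivative_def by simp
qed

text \<open>Serves to glue: a function extended by zero across a boundary near which it vanishes
  agrees locally with the original function or with 0.\<close>

lemma C1_local: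
  assumes "\<And>x. \<exists>U g. open U \<and> x \<in> U \<and> C1 g \<and> (\<forall>y\<in>U. f y = g y)"
  shows "C1 f"
proof -
  have 1: "\<exists>U g. open U \<and> x \<in> U \<and> C1 g \<and> (\<forall>y\<in>U. f y = g y) \<and> (\<forall>y\<in>U. \<forall>i. partial i f y = partial i g y)" for x
    using assms[of x] by (metis partial_cong_open)
  show ?thesis unfolding C1_def
  proof (intro conjI allI)
    show "f differentiable_on UNIV"
      unfolding differentiable_on_def
    proof
      fix x
      obtain U g where U: "open U" "x \<in> U" "C1 g" "\<forall>y\<in>U. f y = g y" using 1[of x] by blast
      have "(f has_derivative dirder g x) (at x)"
        by (rule has_derivative_transform_within_open[OF C1_derivative[OF U(3)] U(1,2)]) (use U in auto)
      then show "f differentiable (at x)" unfolding differentiable_def by blast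
    qed
    fix i
    show "continuous_on UNIV (partial i f)"
      unfolding continuous_on_eq_continuous_at[OF open_UNIV]
    proof
      fix x
      obtain U g where U: "open U" "x \<in> U" "C1 g" "\<forall>y\<in>U. \<forall>i. partial i f y = partial i g y" using 1[of x] by blast
      have "isCont (partial i g) x"
        using C1_partial_continuous[OF U(3), of UNIV i] by (simp add: continuous_on_eq_continuous_at)
      moreover have "\<forall>\<^sub>F y in nhds x. partial i f y = partial i g y"
        using U eventually_nhds by blast
      ultimately show "isCont (partial i f) x" using isCont_cong by blast
    qed
  qed
qed

section \<open>Functions of compact support\<close>

lemma C1c_iff: "f \<in> C1c \<Omega> \<longleftrightarrow> C1 f \<and> (\<exists>S. compact S \<and> S \<subseteq> \<Omega> \<and> (\<forall>x. x \<notin> S \<longrightarrow> f x = 0))"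
proof
  assume "f \<in> C1c \<Omega>"
  then show "C1 f \<and> (\<exists>S. compact S \<and> S \<subseteq> \<Omega> \<and> (\<forall>x. x \<notin> S \<longrightarrow> f x = 0))"
    using closure_subset[of "{x. f x \<noteq> 0}"] unfolding C1c_def C1_def by blast
next
  assume "C1 f \<and> (\<exists>S. compact S \<and> S \<subseteq> \<Omega> \<and> (\<forall>x. x \<notin> S \<longrightarrow> f x = 0))"
  then obtain S where S: "C1 f" "compact S" "S \<subseteq> \<Omega>" "\<And>x. x \<notin> S \<Longrightarrow> f x = 0" by blast
  have "closure {x. f x \<noteq> 0} \<subseteq> S"
    by (rule closure_minimal) (use S compact_imp_closed in auto)
  then show "f \<in> C1c \<Omega>"
    using S bounded_subset[of S] unfolding C1c_def C1_def
    by (auto simp: compact_eq_bounded_closed)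
qed

lemma C1c_C1: "f \<in> C1c \<Omega> \<Longrightarrow> C1 f"
  by (simp add: C1c_iff)

lemma C1c_mono: "f \<in> C1c \<Omega> \<Longrightarrow> \<Omega> \<subseteq> \<Omega>' \<Longrightarrow> f \<in> C1c \<Omega>'"
  by (auto simp: C1c_iff)

lemma C1cE:
  assumes "f \<in> C1c \<Omega>"
  obtains S where "compact S" "S \<subseteq> \<Omega>" "\<And>x. x \<notin> S \<Longrightarrow> f x = 0" "\<And>i x. x \<notin> S \<Longrightarrow> partial i f x = 0"
proof -
  obtain S where S: "C1 f" "compact S" "S \<subseteq> \<Omega>" "\<And>x. x \<notin> S \<Longrightarrow> f x = 0"
    using assms unfolding C1c_iff by blast
  have "partial i f x = 0" if "x \<notin> S" for i x
  proof -
    have "partial i f x = partial i (\<lambda>_. 0) x"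
      by (rule partial_cong_open[of "- S"]) (use S that compact_imp_closed in auto)
    then show ?thesis by (simp add: C1_const)
  qed
  with S show ?thesis using that by blast
qed

lemma C1c_scaleR_left: "f \<in> C1c \<Omega> \<Longrightarrow> C1 g \<Longrightarrow> (\<lambda>x. g x *\<^sub>R f x) \<in> C1c \<Omega>"
  unfolding C1c_iff by (auto intro!: C1_scaleR)

lemma C1c_scaleR_right: "f \<in> C1c \<Omega> \<Longrightarrow> C1 g \<Longrightarrow> (\<lambda>x. f x *\<^sub>R g x) \<in> C1c \<Omega>"
  unfolding C1c_iff by (auto intro!: C1_scaleR)

lemma C1c_add:
  assumes "f \<in> C1c \<Omega>" "g \<in> C1c \<Omega>" shows "(\<lambda>x. f x + g x) \<in> C1c \<Omega>"
proof -
  obtain S T where "compact S" "S \<subseteq> \<Omega>" "\<And>x. x \<notin> S \<Longrightarrow> f x = 0" "compact T" "T \<subseteq> \<Omega>" "\<And>x. x \<notin> T \<Longrightarrow> g x = 0"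
    using assms unfolding C1c_iff by metis
  then show ?thesis
    using assms unfolding C1c_iff by (auto intro!: C1_add exI[of _ "S \<union> T"])
qed

lemma C1c_bounded_linear: "f \<in> C1c \<Omega> \<Longrightarrow> bounded_linear L \<Longrightarrow> (\<lambda>x. L (f x)) \<in> C1c \<Omega>"
  using linear_0[OF bounded_linear.linear, of L] unfolding C1c_iff by (metis C1_bounded_linear(1))

lemma C1c_diff:
  assumes "f \<in> C1c \<Omega>" "g \<in> C1c \<Omega>" shows "(\<lambda>x. f x - g x) \<in> C1c \<Omega>"
  using C1c_add[OF assms(1) C1c_bounded_linear[OF assms(2) bounded_linear_minus[OF bounded_linear_ident]]] by simp

lemma C1c_sum: "finite I \<Longrightarrow> (\<And>k. k \<in> I \<Longrightarrow> f k \<in> C1c \<Omega>) \<Longrightarrow> (\<lambda>x. \<Sum>k\<in>I. f k x) \<in> C1c \<Omega>"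
proof (induction rule: finite_induct)
  case empty
  then show ?case by (auto simp: C1c_iff C1_const)
qed (auto intro: C1c_add)

lemma integrable_continuous_compact_support:
  fixes f :: "'a::euclidean_space \<Rightarrow> 'b::euclidean_space"
  assumes f: "continuous_on UNIV f" and S: "bounded S" "\<And>x. x \<notin> S \<Longrightarrow> f x = 0"
  shows "integrable lborel f"
proof -
  have "integrable lborel (\<lambda>x. indicator (closure S) x *\<^sub>R f x)"
    by (rule borel_integrable_compact) (use S continuous_on_subset[OF f] in auto)
  moreover have "(\<lambda>x. indicator (closure S) x *\<^sub>R f x) = f"
    using S closure_subset[of S] by (auto simp: indicator_def fun_eq_iff)
  ultimately show ?thesis by simp
qed

lemma C1c_integrable:
  fixes f :: "real^2 \<Rightarrow> 'b::euclidean_space"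
  assumes "f \<in> C1c \<Omega>"
  shows "integrable lborel f" "integrable lborel (partial i f)"
proof -
  obtain S where S: "compact S" "\<And>x. x \<notin> S \<Longrightarrow> f x = 0" "\<And>i x. x \<notin> S \<Longrightarrow> partial i f x = 0"
    using C1cE[OF assms] by metis
  show "integrable lborel f" "integrable lborel (partial i f)"
    using S C1_continuous[OF C1c_C1[OF assms]] C1_partial_continuous[OF C1c_C1[OF assms]]
    by (auto intro!: integrable_continuous_compact_support[of _ S] compact_imp_bounded)
qed

section \<open>Lebesgue measure and Fubini's theorem in orthonormal coordinates\<close>

lemma orthogonal_transformation_distr_lborel:
  fixes T :: "real^2 \<Rightarrow> real^2"
  assumes T: "orthogonal_transformation T"
  shows "distr lborel borel T = lborel"
proof (rule lborel_eqI[symmetric])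
  have lin: "linear T" using T by (rule orthogonal_transformation_linear)
  then have [measurable]: "T \<in> borel_measurable borel"
    by (intro borel_measurable_continuous_onI linear_continuous_on linear_conv_bounded_linear[THEN iffD1])
  obtain T' where T': "orthogonal_transformation T'" "\<And>x. T (T' x) = x" "\<And>x. T' (T x) = x"
    using T by (metis bij_inv_eq_iff orthogonal_transformation_bij orthogonal_transformation_inv)
  fix l u :: "real^2" assume lu: "\<And>b. b \<in> Basis \<Longrightarrow> l \<bullet> b \<le> u \<bullet> b"
  have vim: "T -` box l u = T' ` box l u"
    using T'(2,3) by (auto simp: image_iff) metis+
  have m1: "T' ` box l u \<in> sets borel"
    using measurable_sets[OF \<open>T \<in> borel_measurable borel\<close>, of "box l u"] vim by simp
  have "emeasure (distr lborel borel T) (box l u) = emeasure lborel (T' ` box l u)"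
    using vim by (simp add: emeasure_distr)
  also have "\<dots> = emeasure lebesgue (T' ` box l u)"
    using m1 by simp
  also have "\<dots> = ennreal (measure lebesgue (T' ` box l u))"
    using measurable_orthogonal_image[OF T'(1), of "box l u"] by (intro emeasure_eq_measure2) auto
  also have "\<dots> = ennreal (measure lebesgue (box l u))"
    using measure_orthogonal_image[OF T'(1), of "box l u"] by auto
  also have "\<dots> = emeasure lebesgue (box l u)"
    by (intro emeasure_eq_measure2[symmetric]) auto
  also have "\<dots> = (\<Prod>b\<in>Basis. (u - l) \<bullet> b)"
    using lu by simp
  finally show "emeasure (distr lborel borel T) (box l u) = (\<Prod>b\<in>Basis. (u - l) \<bullet> b)" .
qed simp

text \<open>Both measures give a box the product of its side lengths, which determines Lebesgue
  measure. With \<open>real \<times> real\<close> in place of \<open>real^2\<close>, the product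
  measure theorems become available.\<close>

lemma distr_lborel_standard_coords:
  "distr lborel borel (\<lambda>z. fst z *\<^sub>R axis 1 1 + snd z *\<^sub>R axis 2 1) = (lborel :: (real^2) measure)"
proof (rule lborel_eqI[symmetric])
  let ?S = "\<lambda>z::real \<times> real. fst z *\<^sub>R axis 1 1 + snd z *\<^sub>R axis 2 1 :: real^2"
  have [measurable]: "?S \<in> borel_measurable borel"
    by (intro borel_measurable_continuous_onI continuous_intros)
  have comp: "?S z $ 1 = fst z" "?S z $ 2 = snd z" for z by (auto simp: axis_def)
  then have comp': "x * axis 1 1 $ (2::2) = 0" "y * axis 2 1 $ (1::2) = 0" for x y :: real by (auto simp: axis_def)
  fix l u :: "real^2" assume lu: "\<And>b. b \<in> Basis \<Longrightarrow> l \<bullet> b \<le> u \<bullet> b"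
  have lu': "l $ i \<le> u $ i" for i using lu[of "axis i 1"] by (simp add: axis_in_Basis_iff inner_axis)
  have "?S -` box l u = box (l$1) (u$1) \<times> box (l$2) (u$2)"
    by (auto simp: mem_box_cart forall_2 comp')
  then have "emeasure (distr lborel borel ?S) (box l u) = emeasure lborel (box (l$1) (u$1) \<times> box (l$2) (u$2))"
    by (simp add: emeasure_distr)
  also have "\<dots> = ennreal ((u$1 - l$1) * (u$2 - l$2))"
    using lu' by (simp add: lborel_prod[symmetric] lborel.emeasure_pair_measure_Times ennreal_mult)
  also have "(u$1 - l$1) * (u$2 - l$2) = (\<Prod>b\<in>Basis. (u - l) \<bullet> b)"
  proof -
    have "(\<Prod>b\<in>(\<lambda>i. axis i 1) ` UNIV. (u - l) \<bullet> b) = (\<Prod>i\<in>UNIV. (u - l) \<bullet> axis i (1::real))"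
      by (rule prod.reindex_cong[where l="\<lambda>i. axis i 1"]) (auto simp: inj_on_def axis_eq_axis)
    moreover have "(Basis :: (real^2) set) = (\<lambda>i. axis i 1) ` UNIV"
      by (auto simp: Basis_vec_def)
    ultimately show ?thesis by (simp add: inner_axis UNIV_2)
  qed
  finally show "emeasure (distr lborel borel ?S) (box l u) = (\<Prod>b\<in>Basis. (u - l) \<bullet> b)" .
qed simp

definition frame :: "real^2 \<Rightarrow> real^2 \<Rightarrow> bool" where
  "frame a b \<longleftrightarrow> norm a = 1 \<and> norm b = 1 \<and> a \<bullet> b = 0"

lemma frame_inner:
  assumes "frame a b"
  shows "a \<bullet> a = 1" "b \<bullet> b = 1" "a \<bullet> b = 0" "b \<bullet> a = 0"
  using assms by (auto simp: frame_def norm_eq_1 inner_commute)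

lemma frame_transformation:
  assumes "frame a b"
  shows "orthogonal_transformation (\<lambda>x::real^2. x $ 1 *\<^sub>R a + x $ 2 *\<^sub>R b)"
proof -
  note ab = frame_inner[OF assms]
  have "linear (\<lambda>x::real^2. x $ 1 *\<^sub>R a + x $ 2 *\<^sub>R b)"
    by (rule linearI) (auto simp: algebra_simps)
  moreover have "(v $ 1 *\<^sub>R a + v $ 2 *\<^sub>R b) \<bullet> (w $ 1 *\<^sub>R a + w $ 2 *\<^sub>R b) = v \<bullet> w" for v w :: "real^2"
    by (simp add: inner_simps ab) (simp add: inner_vec_def sum_2)
  ultimately show ?thesis
    unfolding orthogonal_transformation_def by blast
qed

lemma frame_expansion:
  assumes "frame a b" shows "x = (x \<bullet> a) *\<^sub>R a + (x \<bullet> b) *\<^sub>R b"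
proof -
  note T = frame_transformation[OF assms]
  obtain y :: "real^2" where y: "x = y $ 1 *\<^sub>R a + y $ 2 *\<^sub>R b"
    using surjD[OF orthogonal_transformation_surj[OF T], of x] by blast
  note ab = frame_inner[OF assms]
  have "x \<bullet> a = y $ 1" "x \<bullet> b = y $ 2"
    unfolding y by (simp_all add: inner_simps ab)
  with y show ?thesis by metis
qed

text \<open>The identification of the plane with \<open>real \<times> real\<close> is followed by
  the orthogonal map that takes the standard basis to \<open>a\<close>, \<open>b\<close>; both
  preserve Lebesgue measure.\<close>

lemma distr_lborel_frame:
  assumes "frame a b"
  shows "distr lborel borel (\<lambda>z. fst z *\<^sub>R a + snd z *\<^sub>R b) = (lborel :: (real^2) measure)"
proof -
  let ?T = "\<lambda>x::real^2. x $ 1 *\<^sub>R a + x $ 2 *\<^sub>R b"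
  let ?S = "\<lambda>z::real \<times> real. fst z *\<^sub>R axis 1 1 + snd z *\<^sub>R axis 2 1 :: real^2"
  have [measurable]: "?S \<in> borel_measurable borel" "?T \<in> borel_measurable borel"
    by (intro borel_measurable_continuous_onI continuous_intros)+
  have "distr (distr lborel borel ?S) borel ?T = distr lborel borel (?T \<circ> ?S)"
    by (rule distr_distr) auto
  also have "?T \<circ> ?S = (\<lambda>z. fst z *\<^sub>R a + snd z *\<^sub>R b)"
    by (auto simp: axis_def)
  finally show ?thesis
    by (simp add: distr_lborel_standard_coords orthogonal_transformation_distr_lborel frame_transformation[OF assms])
qed

lemma integral_frame:
  fixes f :: "real^2 \<Rightarrow> 'b::{banach, second_countable_topology}"
  assumes "frame a b" and [measurable]: "f \<in> borel_measurable borel"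
  shows "(\<integral>x. f x \<partial>lborel) = (\<integral>z. f (fst z *\<^sub>R a + snd z *\<^sub>R b) \<partial>lborel)"
    "integrable lborel f \<longleftrightarrow> integrable lborel (\<lambda>z. f (fst z *\<^sub>R a + snd z *\<^sub>R b))"
proof -
  have [measurable]: "(\<lambda>z::real \<times> real. fst z *\<^sub>R a + snd z *\<^sub>R b) \<in> borel_measurable borel"
    by (intro borel_measurable_continuous_onI continuous_intros)
  show "(\<integral>x. f x \<partial>lborel) = (\<integral>z. f (fst z *\<^sub>R a + snd z *\<^sub>R b) \<partial>lborel)"
    by (subst distr_lborel_frame[OF assms(1), symmetric], subst integral_distr) auto
  show "integrable lborel f \<longleftrightarrow> integrable lborel (\<lambda>z. f (fst z *\<^sub>R a + snd z *\<^sub>R b))"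
    by (subst distr_lborel_frame[OF assms(1), symmetric], subst integrable_distr_eq) auto
qed

lemma integral_derivative_compact_support:
  fixes F :: "real \<Rightarrow> 'b::euclidean_space"
  assumes "\<And>t. (F has_vector_derivative f t) (at t)" "continuous_on UNIV f"
    "\<And>t. \<bar>t\<bar> \<ge> R \<Longrightarrow> F t = 0" "\<And>t. \<bar>t\<bar> > R \<Longrightarrow> f t = 0"
  shows "(\<integral>t. f t \<partial>lborel) = 0"
proof -
  have "(\<integral>t. f t \<partial>lborel) = (\<integral>t. indicator {-\<bar>R\<bar>..\<bar>R\<bar>} t *\<^sub>R f t \<partial>lborel)"
    by (intro Bochner_Integration.integral_cong) (auto simp: indicator_def assms(4))
  also have "\<dots> = F \<bar>R\<bar> - F (-\<bar>R\<bar>)"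
    by (rule integral_FTC_atLeastAtMost)
      (use assms in \<open>auto intro: has_vector_derivative_at_within continuous_on_subset\<close>)
  finally show ?thesis by (simp add: assms)
qed

text \<open>Fubini in the frame: along every line parallel to \<open>a\<close> the integrand is the
  derivative of a function of compact support.\<close>

lemma integral_dirder_zero:
  fixes f :: "real^2 \<Rightarrow> 'b::euclidean_space"
  assumes f: "f \<in> C1c UNIV" and ab: "frame a b"
  shows "(\<integral>x. dirder f x a \<partial>lborel) = 0"
proof -
  obtain S where S: "compact S" "\<And>x. x \<notin> S \<Longrightarrow> f x = 0" "\<And>i x. x \<notin> S \<Longrightarrow> partial i f x = 0"
    using C1cE[OF f] by metis
  obtain R where R: "\<And>x. x \<in> S \<Longrightarrow> norm x < R"
    using compact_imp_bounded[OF S(1)] bounded_pos_less by blast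
  note C = C1c_C1[OF f]
  have cont: "continuous_on UNIV (\<lambda>x. dirder f x a)"
    by (intro dirder_continuous C continuous_intros)
  have int: "integrable lborel (\<lambda>x. dirder f x a)"
    by (rule integrable_continuous_compact_support[OF cont, of S])
      (use S compact_imp_bounded in \<open>auto simp: dirder_def\<close>)
  have m: "(\<lambda>x. dirder f x a) \<in> borel_measurable borel"
    using cont by (rule borel_measurable_continuous_onI)
  let ?P = "\<lambda>z. fst z *\<^sub>R a + snd z *\<^sub>R b"
  have ip: "integrable (lborel \<Otimes>\<^sub>M lborel) (\<lambda>(t, s). dirder f (t *\<^sub>R a + s *\<^sub>R b) a)"
    using int unfolding integral_frame(2)[OF ab m] by (simp add: lborel_prod split_def)
  have "(\<integral>x. dirder f x a \<partial>lborel) = (\<integral>(t, s). dirder f (t *\<^sub>R a + s *\<^sub>R b) a \<partial>(lborel \<Otimes>\<^sub>M lborel))"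
    using integral_frame(1)[OF ab m] by (simp add: lborel_prod split_def)
  also have "\<dots> = (\<integral>s. (\<integral>t. dirder f (t *\<^sub>R a + s *\<^sub>R b) a \<partial>lborel) \<partial>lborel)"
    using lborel_pair.integral_snd[OF ip] by simp
  also have "(\<lambda>s. (\<integral>t. dirder f (t *\<^sub>R a + s *\<^sub>R b) a \<partial>lborel)) = (\<lambda>s. 0)"
  proof
    fix s
    have far: "t *\<^sub>R a + s *\<^sub>R b \<notin> S" if "\<bar>t\<bar> \<ge> R" for t
    proof
      assume "t *\<^sub>R a + s *\<^sub>R b \<in> S"
      then have 1: "norm (t *\<^sub>R a + s *\<^sub>R b) < R" by (rule R)
      have "(t *\<^sub>R a + s *\<^sub>R b) \<bullet> a = t"
        using frame_inner[OF ab] by (simp add: inner_simps)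
      then have "\<bar>t\<bar> \<le> norm (t *\<^sub>R a + s *\<^sub>R b)"
        using Cauchy_Schwarz_ineq2[of "t *\<^sub>R a + s *\<^sub>R b" a] ab by (simp add: frame_def)
      with 1 that show False by simp
    qed
    show "(\<integral>t. dirder f (t *\<^sub>R a + s *\<^sub>R b) a \<partial>lborel) = 0"
    proof (rule integral_derivative_compact_support)
      fix t
      have "((\<lambda>t. t *\<^sub>R a + s *\<^sub>R b) has_vector_derivative a) (at t)"
        by (auto intro!: derivative_eq_intros)
      then show "((\<lambda>t. f (t *\<^sub>R a + s *\<^sub>R b)) has_vector_derivative dirder f (t *\<^sub>R a + s *\<^sub>R b) a) (at t)"
        by (rule has_vector_derivative_along[OF C])
      show "continuous_on UNIV (\<lambda>t. dirder f (t *\<^sub>R a + s *\<^sub>R b) a)"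
        by (intro dirder_continuous C continuous_intros)
      show "\<bar>t\<bar> \<ge> R \<Longrightarrow> f (t *\<^sub>R a + s *\<^sub>R b) = 0" using far S by auto
      show "\<bar>t\<bar> > R \<Longrightarrow> dirder f (t *\<^sub>R a + s *\<^sub>R b) a = 0" using far S by (simp add: dirder_def)
    qed
  qed
  finally show ?thesis by simp
qed

lemma exists_frame:
  obtains b where "frame (axis i 1) b"
proof -
  have "\<exists>j::2. j \<noteq> i"
    by (metis exhaust_2 zero_neq_one one_neq_zero num1_eq1 card_2_iff' UNIV_I ex_card)
  then obtain j where "j \<noteq> i" by blast
  then have "frame (axis i 1) (axis j 1)" by (auto simp: frame_def inner_axis_axis)
  then show ?thesis by (rule that)
qed

lemma integral_partial_zero:
  fixes f :: "real^2 \<Rightarrow> 'b::euclidean_space"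
  assumes "f \<in> C1c UNIV"
  shows "(\<integral>x. partial i f x \<partial>lborel) = 0"
proof -
  obtain b where "frame (axis i 1) b" by (rule exists_frame)
  from integral_dirder_zero[OF assms this] show ?thesis by simp
qed

section \<open>Partitions of unity\<close>

text \<open>At 0 the difference quotient of the truncated power is dominated by that of the power
  itself, which tends to 0 because the exponent is at least 2. The bump functions and the test
  function for sharpness are built from such powers.\<close>

lemma has_real_derivative_pos_part_power:
  "((\<lambda>s. (max 0 s) ^ Suc (Suc n)) has_real_derivative real (Suc (Suc n)) * (max 0 t) ^ Suc n) (at t)"
proof -
  consider "t > 0" | "t < 0" | "t = 0" by linarith
  then show ?thesis
  proof cases
    case 1
    have "((\<lambda>s. s ^ Suc (Suc n)) has_real_derivative real (Suc (Suc n)) * t ^ Suc n) (at t)"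
      using DERIV_pow[of "Suc (Suc n)" t] by simp
    then have "((\<lambda>s. (max 0 s) ^ Suc (Suc n)) has_real_derivative real (Suc (Suc n)) * t ^ Suc n) (at t)"
      by (rule has_field_derivative_transform_within_open[of _ _ _ "{0<..}"]) (use 1 in auto)
    then show ?thesis using 1 by simp
  next
    case 2
    have "((\<lambda>s. 0) has_real_derivative 0) (at t)" by simp
    then have "((\<lambda>s. (max 0 s) ^ Suc (Suc n)) has_real_derivative 0) (at t)"
      by (rule has_field_derivative_transform_within_open[of _ _ _ "{..<0}"]) (use 2 in auto)
    then show ?thesis using 2 by simp
  next
    case 3
    have "((\<lambda>s. s ^ Suc (Suc n)) has_real_derivative real (Suc (Suc n)) * 0 ^ Suc n) (at 0)"
      using DERIV_pow[of "Suc (Suc n)" 0] by simp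
    then have lim: "((\<lambda>h::real. h ^ Suc (Suc n) / h) \<longlongrightarrow> 0) (at 0)"
      by (simp add: has_field_derivative_iff)
    have "norm ((max 0 h) ^ Suc (Suc n) / h) \<le> \<bar>h ^ Suc (Suc n) / h\<bar>" for h :: real
      by (cases "0 \<le> h") (simp_all add: max_def)
    then have "((\<lambda>h::real. (max 0 h) ^ Suc (Suc n) / h) \<longlongrightarrow> 0) (at 0)"
      by (intro Lim_null_comparison[OF _ tendsto_rabs_zero[OF lim]] always_eventually allI)
    then show ?thesis using 3 by (simp add: has_field_derivative_iff)
  qed
qed

lemma has_real_derivative_pos_part_square:
  "((\<lambda>s. (max 0 s)\<^sup>2) has_real_derivative 2 * max 0 t) (at t)"
  using has_real_derivative_pos_part_power[of 0 t] by (simp add: numeral_2_eq_2)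

lemma C1_pos_part_square: "C1 f \<Longrightarrow> C1 (\<lambda>x. (max 0 (f x :: real))\<^sup>2)"
  by (rule C1_compose_real(1)[where g="\<lambda>s. (max 0 s)\<^sup>2" and g'="\<lambda>t. 2 * max 0 t"])
    (auto intro!: continuous_intros has_real_derivative_pos_part_square)

text \<open>As only \<open>C1\<close> regularity is asked for, squares of positive parts of
  polynomials suffice. On the ball of half the radius
  \<open>r\<^sup>2 - \<bar>x - p\<bar>\<^sup>2\<close> is at least \<open>3/4 r\<^sup>2\<close>, and
  the factor \<open>16 / (9 r^4)\<close> is the inverse square of that, so
  \<open>\<beta> \<ge> 1\<close> there. The second truncation flattens everything above 1 to the
  value 1.\<close>

lemma exists_bump:
  fixes p :: "real^2"
  assumes r: "0 < r"
  obtains \<eta> :: "real^2 \<Rightarrow> real" where "\<eta> \<in> C1c UNIV" "\<And>x. 0 \<le> \<eta> x" "\<And>x. \<eta> x \<le> 1"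
    "\<And>x. x \<in> ball p (r/2) \<Longrightarrow> \<eta> x = 1" "\<And>x. x \<notin> ball p r \<Longrightarrow> \<eta> x = 0"
proof -
  define \<beta> where "\<beta> x = 16 / (9 * r^4) * (max 0 (r\<^sup>2 - (x - p) \<bullet> (x - p)))\<^sup>2" for x
  define \<eta> where "\<eta> x = 1 - (max 0 (1 - \<beta> x))\<^sup>2" for x
  have C\<beta>: "C1 \<beta>"
    unfolding \<beta>_def by (intro C1_mult(1) C1_pos_part_square C1_diff(1) C1_inner(1) C1_const C1_ident)
  have C\<eta>: "C1 \<eta>"
    unfolding \<eta>_def by (intro C1_pos_part_square C1_diff(1) C1_const C\<beta>)
  have \<beta>0: "0 \<le> \<beta> x" for x using r by (simp add: \<beta>_def)
  have "0 \<le> max 0 (1 - \<beta> x)" "max 0 (1 - \<beta> x) \<le> 1" for x using \<beta>0[of x] by auto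
  then have sq: "(max 0 (1 - \<beta> x))\<^sup>2 \<le> 1" for x by (meson power_le_one)
  have one: "\<eta> x = 1" if "x \<in> ball p (r/2)" for x
  proof -
    have "norm (x - p) < r / 2" using that by (simp add: dist_norm norm_minus_commute)
    then have "(norm (x - p))\<^sup>2 \<le> (r / 2)\<^sup>2" by (intro power_mono) auto
    then have *: "3/4 * r\<^sup>2 \<le> r\<^sup>2 - (x - p) \<bullet> (x - p)"
      by (simp add: dot_square_norm power_divide)
    then have "(3/4 * r\<^sup>2)\<^sup>2 \<le> (max 0 (r\<^sup>2 - (x - p) \<bullet> (x - p)))\<^sup>2"
      by (intro power_mono order_trans[OF * max.cobounded2]) auto
    then have "16 / (9 * r^4) * (3/4 * r\<^sup>2)\<^sup>2 \<le> \<beta> x"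
      unfolding \<beta>_def using r by (intro mult_left_mono) auto
    moreover have "16 / (9 * r^4) * (3/4 * r\<^sup>2)\<^sup>2 = 1"
      using r by (simp add: power_mult_distrib power_divide)
    ultimately show ?thesis by (simp add: \<eta>_def)
  qed
  have zero: "\<eta> x = 0" if "x \<notin> ball p r" for x
  proof -
    have "r \<le> norm (x - p)" using that by (simp add: dist_norm norm_minus_commute)
    then have "r\<^sup>2 \<le> (norm (x - p))\<^sup>2" using r by (intro power_mono) auto
    then have "\<beta> x = 0" by (simp add: \<beta>_def dot_square_norm)
    then show ?thesis by (simp add: \<eta>_def)
  qed
  have "\<eta> \<in> C1c UNIV"
    unfolding C1c_iff using C\<eta> zero by (auto intro!: exI[of _ "cball p r"])
  then show ?thesis
    using that[of \<eta>] one zero sq by (auto simp: \<eta>_def)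
qed

text \<open>Induction over the balls: to a family with sum \<open>S\<close> the function
  \<open>\<eta> (1 - S)\<close> is added, where \<open>\<eta>\<close> is a bump on the new ball.
  Then 1 minus the new sum is \<open>(1 - \<eta>) (1 - S)\<close>, which is nonnegative and vanishes
  where either \<open>\<eta>\<close> or \<open>S\<close> is 1.\<close>

lemma partition_of_unity:
  fixes I :: "(real^2) set"
  assumes "finite I" "\<And>p. p \<in> I \<Longrightarrow> 0 < r p"
  obtains \<theta> :: "real^2 \<Rightarrow> real^2 \<Rightarrow> real" where
    "\<And>p. p \<in> I \<Longrightarrow> \<theta> p \<in> C1c UNIV" "\<And>p x. p \<in> I \<Longrightarrow> 0 \<le> \<theta> p x"
    "\<And>p x. p \<in> I \<Longrightarrow> x \<notin> ball p (r p) \<Longrightarrow> \<theta> p x = 0"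
    "\<And>x. (\<Sum>p\<in>I. \<theta> p x) \<le> 1"
    "\<And>x. x \<in> (\<Union>p\<in>I. ball p (r p / 2)) \<Longrightarrow> (\<Sum>p\<in>I. \<theta> p x) = 1"
proof -
  have "(\<forall>p\<in>I. 0 < r p) \<longrightarrow> (\<exists>\<theta> :: real^2 \<Rightarrow> real^2 \<Rightarrow> real. (\<forall>p\<in>I. \<theta> p \<in> C1c UNIV \<and> (\<forall>x. 0 \<le> \<theta> p x) \<and> (\<forall>x. x \<notin> ball p (r p) \<longrightarrow> \<theta> p x = 0)) \<and>
    (\<forall>x. (\<Sum>p\<in>I. \<theta> p x) \<le> 1) \<and> (\<forall>x\<in>(\<Union>p\<in>I. ball p (r p / 2)). (\<Sum>p\<in>I. \<theta> p x) = 1))"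
    using assms(1)
  proof (induction rule: finite_induct)
    case (insert q I)
    show ?case
    proof
    assume rp: "\<forall>p\<in>insert q I. 0 < r p"
    then have "\<forall>p\<in>I. 0 < r p" by blast
    from mp[OF insert.IH this] obtain \<theta> :: "real^2 \<Rightarrow> real^2 \<Rightarrow> real" where
      \<theta>0: "\<forall>p\<in>I. \<theta> p \<in> C1c UNIV \<and> (\<forall>x. 0 \<le> \<theta> p x) \<and> (\<forall>x. x \<notin> ball p (r p) \<longrightarrow> \<theta> p x = 0)"
      "\<forall>x. (\<Sum>p\<in>I. \<theta> p x) \<le> 1" "\<forall>x\<in>(\<Union>p\<in>I. ball p (r p / 2)). (\<Sum>p\<in>I. \<theta> p x) = 1"
      by (elim exE conjE) (rule that)
    have \<theta>: "\<And>p. p \<in> I \<Longrightarrow> \<theta> p \<in> C1c UNIV" "\<And>p x. p \<in> I \<Longrightarrow> 0 \<le> \<theta> p x"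
        "\<And>p x. p \<in> I \<Longrightarrow> x \<notin> ball p (r p) \<Longrightarrow> \<theta> p x = 0"
        "\<And>x. (\<Sum>p\<in>I. \<theta> p x) \<le> 1"
        "\<And>x. x \<in> (\<Union>p\<in>I. ball p (r p / 2)) \<Longrightarrow> (\<Sum>p\<in>I. \<theta> p x) = 1"
      using \<theta>0 by blast+
    obtain \<eta> :: "real^2 \<Rightarrow> real" where \<eta>: "\<eta> \<in> C1c UNIV" "\<And>x. 0 \<le> \<eta> x" "\<And>x. \<eta> x \<le> 1"
        "\<And>x. x \<in> ball q (r q / 2) \<Longrightarrow> \<eta> x = 1" "\<And>x. x \<notin> ball q (r q) \<Longrightarrow> \<eta> x = 0"
      using exists_bump[of "r q" q] rp by blast
    define S where "S x = (\<Sum>p\<in>I. \<theta> p x)" for x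
    have CS: "C1 S"
      unfolding S_def using C1_sum[OF insert.hyps(1), of \<theta>] \<theta>(1) C1c_C1 by blast
    define \<psi> where "\<psi> x = \<eta> x * (1 - S x)" for x
    have \<psi>: "\<psi> \<in> C1c UNIV"
      unfolding \<psi>_def using C1c_scaleR_right[OF \<eta>(1) C1_diff(1)[OF C1_const(1)[of 1] CS]] by simp
    define \<theta>' where "\<theta>' p = (if p = q then \<psi> else \<theta> p)" for p
    have tot: "(\<Sum>p\<in>insert q I. \<theta>' p x) = \<psi> x + S x" for x
    proof -
      have "(\<Sum>p\<in>I. \<theta>' p x) = S x"
        unfolding S_def by (rule sum.cong) (use insert.hyps in \<open>auto simp: \<theta>'_def\<close>)
      then show ?thesis using insert.hyps by (simp add: \<theta>'_def)
    qed
    have S1: "S x \<le> 1" for x using \<theta>(4) by (simp add: S_def)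
    have "\<psi> x \<le> 1 - S x" for x
      unfolding \<psi>_def using \<eta>(3)[of x] S1[of x] by (simp add: mult_left_le_one_le \<eta>(2))
    then have le: "\<psi> x + S x \<le> 1" for x by (simp add: algebra_simps)
    have one: "\<psi> x + S x = 1" if "x \<in> (\<Union>p\<in>insert q I. ball p (r p / 2))" for x
      using that \<theta>(5)[of x, folded S_def] \<eta>(4)[of x]
      by (cases "x \<in> ball q (r q / 2)") (auto simp: \<psi>_def)
    have "\<forall>p\<in>insert q I. \<theta>' p \<in> C1c UNIV \<and> (\<forall>x. 0 \<le> \<theta>' p x) \<and> (\<forall>x. x \<notin> ball p (r p) \<longrightarrow> \<theta>' p x = 0)"
    proof
      fix p assume "p \<in> insert q I"
      then show "\<theta>' p \<in> C1c UNIV \<and> (\<forall>x. 0 \<le> \<theta>' p x) \<and> (\<forall>x. x \<notin> ball p (r p) \<longrightarrow> \<theta>' p x = 0)"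
        using \<psi> \<theta>(1,2,3)[of p] \<eta>(2,5) S1
        by (cases "p = q") (simp_all add: \<theta>'_def \<psi>_def)
    qed
    moreover have "\<forall>x. (\<Sum>p\<in>insert q I. \<theta>' p x) \<le> 1"
      using le by (simp only: tot) simp
    moreover have "\<forall>x\<in>(\<Union>p\<in>insert q I. ball p (r p / 2)). (\<Sum>p\<in>insert q I. \<theta>' p x) = 1"
      using one by (simp only: tot) blast
    ultimately show "\<exists>\<theta> :: real^2 \<Rightarrow> real^2 \<Rightarrow> real. (\<forall>p\<in>insert q I. \<theta> p \<in> C1c UNIV \<and> (\<forall>x. 0 \<le> \<theta> p x) \<and> (\<forall>x. x \<notin> ball p (r p) \<longrightarrow> \<theta> p x = 0)) \<and>
      (\<forall>x. (\<Sum>p\<in>insert q I. \<theta> p x) \<le> 1) \<and> (\<forall>x\<in>(\<Union>p\<in>insert q I. ball p (r p / 2)). (\<Sum>p\<in>insert q I. \<theta> p x) = 1)"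
      by blast
    qed
  qed simp
  with assms(2) obtain \<theta> :: "real^2 \<Rightarrow> real^2 \<Rightarrow> real" where
    \<theta>: "\<forall>p\<in>I. \<theta> p \<in> C1c UNIV \<and> (\<forall>x. 0 \<le> \<theta> p x) \<and> (\<forall>x. x \<notin> ball p (r p) \<longrightarrow> \<theta> p x = 0)"
      "\<forall>x. (\<Sum>p\<in>I. \<theta> p x) \<le> 1" "\<forall>x\<in>(\<Union>p\<in>I. ball p (r p / 2)). (\<Sum>p\<in>I. \<theta> p x) = 1"
    by blast
  show ?thesis
    by (rule that[of \<theta>]) (use \<theta> in blast)+
qed

section \<open>Square integrable functions\<close>

lemma L2_I:
  assumes "f \<in> borel_measurable M" "integrable M g" "\<And>x. (norm (f x))\<^sup>2 \<le> g x"
  shows "L2 M f"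
  unfolding L2_def
  by (intro conjI assms(1) Bochner_Integration.integrable_bound[OF assms(2)])
    (use assms in \<open>auto intro: order_trans[OF _ abs_ge_self]\<close>)

lemma norm_add_square_le: "(norm (x + y))\<^sup>2 \<le> 2 * (norm x)\<^sup>2 + 2 * (norm (y :: 'a::real_normed_vector))\<^sup>2"
proof -
  have "(norm (x + y))\<^sup>2 \<le> (norm x + norm y)\<^sup>2"
    by (intro power_mono norm_triangle_ineq) auto
  also have "\<dots> \<le> 2 * (norm x)\<^sup>2 + 2 * (norm y)\<^sup>2"
    using sum_squares_bound[of "norm x" "norm y"] by (simp add: power2_sum)
  finally show ?thesis .
qed

lemma norm_diff_square_le: "(norm (x - y))\<^sup>2 \<le> 2 * (norm x)\<^sup>2 + 2 * (norm (y :: 'a::real_normed_vector))\<^sup>2"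
  using norm_add_square_le[of x "- y"] by simp

lemma L2_add:
  fixes f g :: "'a \<Rightarrow> 'b::{real_normed_vector, second_countable_topology}"
  assumes "L2 M f" "L2 M g" shows "L2 M (\<lambda>x. f x + g x)"
  by (rule L2_I[where g="\<lambda>x. 2 * (norm (f x))\<^sup>2 + 2 * (norm (g x))\<^sup>2"])
    (use assms in \<open>auto simp: L2_def intro: norm_add_square_le\<close>)

lemma L2_diff:
  fixes f g :: "'a \<Rightarrow> 'b::{real_normed_vector, second_countable_topology}"
  assumes "L2 M f" "L2 M g" shows "L2 M (\<lambda>x. f x - g x)"
  by (rule L2_I[where g="\<lambda>x. 2 * (norm (f x))\<^sup>2 + 2 * (norm (g x))\<^sup>2"])
    (use assms in \<open>auto simp: L2_def intro: norm_diff_square_le\<close>)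

lemma L2_norm_square_diff_integrable:
  fixes f g :: "'a \<Rightarrow> 'b::{real_normed_vector, second_countable_topology}"
  assumes "L2 M f" "L2 M g" shows "integrable M (\<lambda>x. (norm (f x - g x))\<^sup>2)"
  using L2_diff[OF assms] by (simp add: L2_def)

lemma L2_scaleR_bounded:
  fixes f :: "'a \<Rightarrow> 'b::{real_normed_vector, second_countable_topology}"
  assumes f: "L2 M f" and g: "g \<in> borel_measurable M" "\<And>x. \<bar>g x\<bar> \<le> B"
  shows "L2 M (\<lambda>x. g x *\<^sub>R f x)"
proof (rule L2_I)
  show "integrable M (\<lambda>x. B\<^sup>2 * (norm (f x))\<^sup>2)" using f by (simp add: L2_def)
  show "(norm (g x *\<^sub>R f x))\<^sup>2 \<le> B\<^sup>2 * (norm (f x))\<^sup>2" for x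
    using power_mono[OF g(2)[of x] abs_ge_zero, of 2] by (simp add: power_mult_distrib mult_right_mono)
qed (use f g in \<open>auto simp: L2_def\<close>)

text \<open>Young's inequality gives the pointwise bound of the difference of squares by \<open>(1 +
  1/e) \<bar>F n - f\<bar>\<^sup>2 + e \<bar>f\<bar>\<^sup>2\<close>. With \<open>e\<close> fixed
  the first part tends to 0, and the second is as small as desired; no Cauchy-Schwarz inequality for
  integrals is involved.\<close>

lemma tendsto_weighted_L2:
  fixes f g :: "'a \<Rightarrow> 'b::{real_normed_vector, second_countable_topology}"
  assumes F: "\<And>n. L2 M (F n)" and f: "L2 M f"
    and lim: "(\<lambda>n. \<integral>x. (norm (F n x - f x))\<^sup>2 \<partial>M) \<longlonglongrightarrow> 0"
    and W: "W \<in> borel_measurable M" "AE x in M. \<bar>W x\<bar> \<le> B"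
  shows "(\<lambda>n. \<integral>x. W x * (norm (F n x))\<^sup>2 \<partial>M) \<longlonglongrightarrow> (\<integral>x. W x * (norm (f x))\<^sup>2 \<partial>M)"
    "L2 M g \<Longrightarrow> integrable M (\<lambda>x. W x * (norm (g x))\<^sup>2)"
proof -
  have int: "integrable M (\<lambda>x. W x * (norm (g x))\<^sup>2)" if "L2 M g" for g :: "'a \<Rightarrow> 'b"
  proof (rule Bochner_Integration.integrable_bound)
    show "integrable M (\<lambda>x. \<bar>B\<bar> * (norm (g x))\<^sup>2)" using that by (simp add: L2_def)
    show "AE x in M. norm (W x * (norm (g x))\<^sup>2) \<le> norm (\<bar>B\<bar> * (norm (g x))\<^sup>2)"
      using W(2) by eventually_elim (auto simp: abs_mult intro!: mult_right_mono)
  qed (use W that in \<open>auto simp: L2_def\<close>)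
  then show "L2 M g \<Longrightarrow> integrable M (\<lambda>x. W x * (norm (g x))\<^sup>2)" .
  define d where "d n = (\<integral>x. (norm (F n x - f x))\<^sup>2 \<partial>M)" for n
  define N where "N = (\<integral>x. (norm (f x))\<^sup>2 \<partial>M)"
  have N: "0 \<le> N" unfolding N_def by simp
  have dint: "integrable M (\<lambda>x. (norm (F n x - f x))\<^sup>2)" for n
    using F f by (rule L2_norm_square_diff_integrable)
  have fint: "integrable M (\<lambda>x. (norm (f x))\<^sup>2)" using f by (simp add: L2_def)
  have key: "\<bar>(\<integral>x. W x * (norm (F n x))\<^sup>2 \<partial>M) - (\<integral>x. W x * (norm (f x))\<^sup>2 \<partial>M)\<bar> \<le> \<bar>B\<bar> * ((1 + 1/e) * d n + e * N)"
    if e: "0 < e" for n e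
  proof -
    have pt: "\<bar>(norm (F n x))\<^sup>2 - (norm (f x))\<^sup>2\<bar> \<le> (1 + 1/e) * (norm (F n x - f x))\<^sup>2 + e * (norm (f x))\<^sup>2" for x
    proof -
      define a b c where "a = norm (F n x)" and "b = norm (f x)" and "c = norm (F n x - f x)"
      have abc: "0 \<le> a" "0 \<le> b" "0 \<le> c" "\<bar>a - b\<bar> \<le> c"
        unfolding a_def b_def c_def by (auto intro: norm_triangle_ineq3)
      have "\<bar>a\<^sup>2 - b\<^sup>2\<bar> = \<bar>a - b\<bar> * (a + b)" using abc by (simp add: power2_eq_square square_diff_square_factored abs_mult)
      also have "\<dots> \<le> c * (c + 2 * b)" using abc by (intro mult_mono) auto
      also have "\<dots> = c\<^sup>2 + 2 * (c * b)" by (simp add: power2_eq_square algebra_simps)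
      also have "2 * (c * b) \<le> c\<^sup>2 / e + e * b\<^sup>2"
      proof -
        have "0 \<le> (c - e * b)\<^sup>2 / e" using e by simp
        also have "\<dots> = c\<^sup>2 / e + e * b\<^sup>2 - 2 * (c * b)" using e by (simp add: field_simps power2_eq_square)
        finally show ?thesis by simp
      qed
      finally show ?thesis unfolding a_def b_def c_def by (simp add: algebra_simps)
    qed
    have "(\<integral>x. W x * (norm (F n x))\<^sup>2 \<partial>M) - (\<integral>x. W x * (norm (f x))\<^sup>2 \<partial>M)
        = (\<integral>x. W x * (norm (F n x))\<^sup>2 - W x * (norm (f x))\<^sup>2 \<partial>M)"
      using int[OF F] int[OF f] by simp
    also have "\<bar>\<dots>\<bar> \<le> (\<integral>x. \<bar>B\<bar> * ((1 + 1/e) * (norm (F n x - f x))\<^sup>2 + e * (norm (f x))\<^sup>2) \<partial>M)"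
    proof (intro order_trans[OF integral_abs_bound] integral_mono_AE)
      show "AE x in M. \<bar>W x * (norm (F n x))\<^sup>2 - W x * (norm (f x))\<^sup>2\<bar>
          \<le> \<bar>B\<bar> * ((1 + 1/e) * (norm (F n x - f x))\<^sup>2 + e * (norm (f x))\<^sup>2)"
        using W(2)
      proof eventually_elim
        case (elim x)
        have "\<bar>W x * (norm (F n x))\<^sup>2 - W x * (norm (f x))\<^sup>2\<bar> = \<bar>W x\<bar> * \<bar>(norm (F n x))\<^sup>2 - (norm (f x))\<^sup>2\<bar>"
          by (simp add: abs_mult[symmetric] algebra_simps)
        also have "\<dots> \<le> \<bar>B\<bar> * ((1 + 1/e) * (norm (F n x - f x))\<^sup>2 + e * (norm (f x))\<^sup>2)"
          using elim pt[of x] by (intro mult_mono) auto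
        finally show ?case .
      qed
    qed (use int[OF F] int[OF f] dint fint in auto)
    also have "\<dots> = \<bar>B\<bar> * ((1 + 1/e) * d n + e * N)"
      using dint fint by (simp add: d_def N_def)
    finally show ?thesis .
  qed
  show "(\<lambda>n. \<integral>x. W x * (norm (F n x))\<^sup>2 \<partial>M) \<longlonglongrightarrow> (\<integral>x. W x * (norm (f x))\<^sup>2 \<partial>M)"
  proof (rule LIMSEQ_I)
    fix r :: real assume r: "0 < r"
    define P where "P = \<bar>B\<bar> * N + 1"
    define e where "e = r / (2 * P)"
    have pos: "0 < P" using N by (simp add: P_def add_nonneg_pos)
    have e: "0 < e" using r pos by (simp add: e_def)
    have "(\<lambda>n. \<bar>B\<bar> * ((1 + 1/e) * d n)) \<longlonglongrightarrow> \<bar>B\<bar> * ((1 + 1/e) * 0)"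
      unfolding d_def by (intro tendsto_intros lim)
    then have "\<forall>\<^sub>F n in sequentially. \<bar>B\<bar> * ((1 + 1/e) * d n) < r / 2"
      using r by (auto dest!: order_tendstoD(2)[where a="r/2"])
    then obtain n0 where n0: "\<And>n. n \<ge> n0 \<Longrightarrow> \<bar>B\<bar> * ((1 + 1/e) * d n) < r / 2"
      by (auto simp: eventually_sequentially)
    have "\<bar>B\<bar> * (e * N) \<le> r / 2"
    proof -
      have "\<bar>B\<bar> * (e * N) \<le> e * P" using e by (simp add: P_def algebra_simps)
      also have "\<dots> = r / 2" using pos by (simp add: e_def)
      finally show ?thesis .
    qed
    then have "norm ((\<integral>x. W x * (norm (F n x))\<^sup>2 \<partial>M) - (\<integral>x. W x * (norm (f x))\<^sup>2 \<partial>M)) < r" if "n \<ge> n0" for n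
      using key[OF e, of n] n0[OF that] unfolding distrib_left[of "\<bar>B\<bar>"] real_norm_def by linarith
    then show "\<exists>no. \<forall>n\<ge>no. norm ((\<integral>x. W x * (norm (F n x))\<^sup>2 \<partial>M) - (\<integral>x. W x * (norm (f x))\<^sup>2 \<partial>M)) < r" by blast
  qed
qed

section \<open>Borel representatives and approximation by continuous functions\<close>

lemma lebesgue_ae_limit_of_continuous:
  fixes f :: "'a::euclidean_space \<Rightarrow> 'b::euclidean_space"
  assumes "f \<in> borel_measurable lebesgue"
  obtains g where "\<And>n. continuous_on UNIV (g n)" "AE x in lborel. (\<lambda>n. g n x) \<longlonglongrightarrow> f x"
proof -
  obtain N g where N: "negligible N" and g: "\<And>n. continuous_on UNIV (g n)"
    and lim: "\<And>x. x \<notin> N \<Longrightarrow> (\<lambda>n. g n x) \<longlonglongrightarrow> f x"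
    using lebesgue_measurable_imp_measurable_on[OF assms, of UNIV] unfolding measurable_on_def by auto
  have "AE x in lebesgue. (\<lambda>n. g n x) \<longlonglongrightarrow> f x"
    using N lim by (intro AE_I'[of N]) (auto simp: negligible_iff_null_sets)
  then have "AE x in lborel. (\<lambda>n. g n x) \<longlonglongrightarrow> f x"
    by (simp add: AE_completion_iff)
  with g that show ?thesis by blast
qed

lemma lebesgue_ex_borel:
  fixes f :: "'a::euclidean_space \<Rightarrow> 'b::euclidean_space"
  assumes "f \<in> borel_measurable lebesgue"
  obtains f' where "f' \<in> borel_measurable lborel" "AE x in lborel. f x = f' x"
proof -
  obtain g where g: "\<And>n. continuous_on UNIV (g n)" and lim: "AE x in lborel. (\<lambda>n. g n x) \<longlonglongrightarrow> f x"
    using lebesgue_ae_limit_of_continuous[OF assms] by blast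
  have [measurable]: "g n \<in> borel_measurable lborel" for n
    using borel_measurable_continuous_onI[OF g] by simp
  have "(\<lambda>x. lim (\<lambda>n. g n x)) \<in> borel_measurable lborel" by measurable
  moreover have "AE x in lborel. f x = lim (\<lambda>n. g n x)"
    using lim by eventually_elim (simp add: limI)
  ultimately show ?thesis using that by blast
qed

lemma borel_measurable_lebesgue: "f \<in> borel_measurable lborel \<Longrightarrow> f \<in> borel_measurable lebesgue"
  by (rule measurable_completion)

text \<open>The radial retraction onto the ball of radius \<open>r\<close>; the maximum in the
  denominator makes its continuity evident.\<close>

definition truncate :: "real \<Rightarrow> 'b::real_normed_vector \<Rightarrow> 'b" where
  "truncate r y = (r / max r (norm y)) *\<^sub>R y"

lemma truncate:
  fixes y :: "'a::real_normed_vector"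
  assumes "0 < r"
  shows "norm (truncate r y) \<le> r" "norm (truncate r y) \<le> norm y" "norm y \<le> r \<Longrightarrow> truncate r y = y"
    "continuous_on UNIV (truncate r :: 'a \<Rightarrow> 'a)"
proof -
  have m: "0 < max r (norm y)" for y :: 'a by (rule less_le_trans[OF assms max.cobounded1])
  have small: "truncate r y = y" if "norm y \<le> r"
    using assms that by (simp add: truncate_def max_absorb1)
  have big: "norm (truncate r y) = r" if "\<not> norm y \<le> r"
  proof -
    have "0 < norm y" using assms that by linarith
    then show ?thesis using assms that by (simp add: truncate_def max_absorb2)
  qed
  show "norm (truncate r y) \<le> r" "norm (truncate r y) \<le> norm y"
    using small big by (cases "norm y \<le> r"; simp)+
  show "norm y \<le> r \<Longrightarrow> truncate r y = y"
    using assms by (simp add: truncate_def max_def)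
  show "continuous_on UNIV (truncate r :: 'a \<Rightarrow> 'a)"
    unfolding truncate_def using m by (intro continuous_intros) (metis less_irrefl m)
qed

text \<open>Two applications of dominated convergence. The function is first truncated in space and
  in value. The result is an almost everywhere limit of continuous functions, and these are
  truncated and cut off in the same way, so that a constant on a ball dominates them.\<close>

lemma L2_dense_continuous:
  fixes f :: "'a::euclidean_space \<Rightarrow> 'b::euclidean_space"
  assumes f: "L2 lborel f" and e: "0 < e"
  obtains g R where "continuous_on UNIV g" "\<And>x. x \<notin> cball 0 R \<Longrightarrow> g x = 0" "0 < (R::real)"
    "(\<integral>x. (norm (f x - g x))\<^sup>2 \<partial>lborel) < e" "L2 lborel g"
proof -
  have [measurable]: "f \<in> borel_measurable lborel" using f by (simp add: L2_def)
  define F where "F n x = indicator (cball 0 (Suc n)) x *\<^sub>R truncate (Suc n) (f x)" for n :: nat and x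
  have [measurable]: "(truncate (real (Suc n)) :: 'b \<Rightarrow> 'b) \<in> borel_measurable borel" for n :: nat
    by (rule borel_measurable_continuous_onI) (simp add: truncate)
  have [measurable]: "cball (0::'a) R \<in> sets borel" for R by simp
  have "F n \<in> borel_measurable lborel" for n
    unfolding F_def by measurable
  note [measurable] = this
  have "(\<lambda>n. \<integral>x. (norm (f x - F n x))\<^sup>2 \<partial>lborel) \<longlonglongrightarrow> (\<integral>x. 0 \<partial>(lborel :: 'a measure))"
  proof (rule integral_dominated_convergence)
    show "integrable lborel (\<lambda>x. 4 * (norm (f x))\<^sup>2)" using f by (simp add: L2_def)
    show "AE x in lborel. (\<lambda>n. (norm (f x - F n x))\<^sup>2) \<longlonglongrightarrow> 0"
    proof (rule always_eventually, rule allI)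
      fix x
      obtain n0 :: nat where n0: "norm x + norm (f x) < n0" using reals_Archimedean2 by blast
      have "F n x = f x" if "n \<ge> n0" for n
      proof -
        have "norm x \<le> Suc n" "norm (f x) \<le> Suc n"
          using n0 that norm_ge_zero[of x] norm_ge_zero[of "f x"] by linarith+
        then show ?thesis unfolding F_def using truncate(3)[of "Suc n" "f x"] by simp
      qed
      then have "\<forall>\<^sub>F n in sequentially. (norm (f x - F n x))\<^sup>2 = 0"
        unfolding eventually_sequentially by (metis diff_self norm_zero power_zero_numeral)
      then show "(\<lambda>n. (norm (f x - F n x))\<^sup>2) \<longlonglongrightarrow> 0" by (rule tendsto_eventually)
    qed
    show "AE x in lborel. norm ((norm (f x - F n x))\<^sup>2) \<le> 4 * (norm (f x))\<^sup>2" for n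
    proof (rule always_eventually, rule allI)
      fix x
      have "norm (F n x) \<le> norm (f x)"
        unfolding F_def using truncate(2)[of "Suc n" "f x"] by (auto simp: indicator_def)
      then have "(norm (F n x))\<^sup>2 \<le> (norm (f x))\<^sup>2" by (intro power_mono) auto
      then show "norm ((norm (f x - F n x))\<^sup>2) \<le> 4 * (norm (f x))\<^sup>2"
        using norm_diff_square_le[of "f x" "F n x"] unfolding real_norm_def abs_power2 by linarith
    qed
  qed auto
  then have "\<forall>\<^sub>F n in sequentially. (\<integral>x. (norm (f x - F n x))\<^sup>2 \<partial>lborel) < e / 4"
    using e by (auto dest!: order_tendstoD(2)[where a="e/4"])
  then obtain n where n: "(\<integral>x. (norm (f x - F n x))\<^sup>2 \<partial>lborel) < e / 4"
    by (auto simp: eventually_sequentially)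
  define r where "r = real (Suc n)"
  have r: "0 < r" by (simp add: r_def)
  have FL2: "L2 lborel (F n)"
  proof (rule L2_I)
    show "integrable lborel (\<lambda>x. (norm (f x))\<^sup>2)" using f by (simp add: L2_def)
    show "(norm (F n x))\<^sup>2 \<le> (norm (f x))\<^sup>2" for x
      unfolding F_def using truncate(2)[of "Suc n" "f x"] by (auto simp: indicator_def intro!: power_mono)
  qed simp
  have Fm: "F n \<in> borel_measurable lebesgue"
    by (rule borel_measurable_lebesgue) simp
  obtain g where g: "\<And>m. continuous_on UNIV (g m)" and lim: "AE x in lborel. (\<lambda>m. g m x) \<longlonglongrightarrow> F n x"
    using lebesgue_ae_limit_of_continuous[OF Fm] by blast
  \<comment> \<open>Equal to 1 on the ball of radius \<open>r\<close>, where \<open>F n\<close>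
    lives, and 0 outside twice that ball.\<close>
  define cut where "cut x = max 0 (min 1 (2 - norm x / r))" for x :: 'a
  define h where "h m x = cut x *\<^sub>R truncate r (g m x)" for m x
  have ch: "continuous_on UNIV (h m)" for m
    unfolding h_def cut_def
    by (intro continuous_intros continuous_on_compose2[OF truncate(4)[OF r] g]) (use r in auto)
  have hz: "h m x = 0" if "x \<notin> cball 0 (2 * r)" for m x
  proof -
    have "2 * r \<le> norm x" using that by simp
    then have "2 \<le> norm x / r" using pos_le_divide_eq[OF r] by blast
    then have "cut x = 0" unfolding cut_def by linarith
    then show ?thesis by (simp only: h_def) simp
  qed
  have [measurable]: "h m \<in> borel_measurable lborel" for m
    using borel_measurable_continuous_onI[OF ch] by simp
  have hb: "norm (h m x) \<le> r" for m x
  proof -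
    have "\<bar>cut x\<bar> \<le> 1" by (simp add: cut_def)
    then have "\<bar>cut x\<bar> * norm (truncate r (g m x)) \<le> 1 * r"
      by (intro mult_mono truncate(1) r) auto
    then show ?thesis by (simp add: h_def)
  qed
  have bint: "integrable lborel (\<lambda>x. (2 * r)\<^sup>2 * indicator (cball 0 (2 * r)) x)"
    by (intro integrable_mult_right integrable_real_indicator) (use emeasure_lborel_cball_finite in auto)
  have "(\<lambda>m. \<integral>x. (norm (F n x - h m x))\<^sup>2 \<partial>lborel) \<longlonglongrightarrow> (\<integral>x. 0 \<partial>(lborel :: 'a measure))"
  proof (rule integral_dominated_convergence)
    show "integrable lborel (\<lambda>x::'a. (2 * r)\<^sup>2 * indicator (cball 0 (2 * r)) x)" by (rule bint)
    show "AE x in lborel. (\<lambda>m. (norm (F n x - h m x))\<^sup>2) \<longlonglongrightarrow> 0"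
      using lim
    proof eventually_elim
      case (elim x)
      have "(\<lambda>m. h m x) \<longlonglongrightarrow> cut x *\<^sub>R truncate r (F n x)"
        unfolding h_def
        by (intro tendsto_intros continuous_on_tendsto_compose[OF truncate(4)[OF r] elim]) auto
      also have "cut x *\<^sub>R truncate r (F n x) = F n x"
      proof (cases "norm x \<le> r")
        case True
        have "cut x = 1" using True r by (simp add: cut_def field_simps)
        moreover have "norm (F n x) \<le> r"
          unfolding F_def r_def using truncate(1)[of "real (Suc n)" "f x"] by (simp add: indicator_def)
        ultimately show ?thesis using truncate(3)[OF r] by simp
      next
        case False
        then have "F n x = 0" by (simp add: F_def r_def)
        then show ?thesis by (simp add: truncate_def)
      qed
      finally have "(\<lambda>m. (norm (F n x - h m x))\<^sup>2) \<longlonglongrightarrow> (norm (F n x - F n x))\<^sup>2"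
        by (intro tendsto_intros)
      then show ?case by simp
    qed
    show "AE x in lborel. norm ((norm (F n x - h m x))\<^sup>2) \<le> (2 * r)\<^sup>2 * indicator (cball 0 (2 * r)) x" for m
    proof (rule always_eventually, rule allI)
      fix x :: 'a
      show "norm ((norm (F n x - h m x))\<^sup>2) \<le> (2 * r)\<^sup>2 * indicator (cball 0 (2 * r)) x"
      proof (cases "x \<in> cball 0 (2 * r)")
        case True
        have "norm (F n x) \<le> r"
          unfolding F_def r_def using truncate(1)[of "real (Suc n)" "f x"] by (simp add: indicator_def)
        then have "norm (F n x - h m x) \<le> 2 * r"
          using hb[of m x] norm_triangle_ineq4[of "F n x" "h m x"] by linarith
        then have "(norm (F n x - h m x))\<^sup>2 \<le> (2 * r)\<^sup>2" by (intro power_mono) auto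
        then show ?thesis using True by simp
      next
        case False
        then have "F n x = 0" using r by (auto simp: F_def r_def indicator_def)
        then show ?thesis using hz[OF False] False by simp
      qed
    qed
  qed auto
  then have "\<forall>\<^sub>F m in sequentially. (\<integral>x. (norm (F n x - h m x))\<^sup>2 \<partial>lborel) < e / 4"
    using e by (auto dest!: order_tendstoD(2)[where a="e/4"])
  then obtain m where m: "(\<integral>x. (norm (F n x - h m x))\<^sup>2 \<partial>lborel) < e / 4"
    by (auto simp: eventually_sequentially)
  have hL2: "L2 lborel (h m)"
  proof (rule L2_I[OF _ bint])
    show "(norm (h m x))\<^sup>2 \<le> (2 * r)\<^sup>2 * indicator (cball 0 (2 * r)) x" for x
    proof (cases "x \<in> cball 0 (2 * r)")
      case True
      have "norm (h m x) \<le> 2 * r" using hb[of m x] r by linarith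
      then have "(norm (h m x))\<^sup>2 \<le> (2 * r)\<^sup>2" by (intro power_mono) auto
      then show ?thesis using True by simp
    qed (use hz in auto)
  qed simp
  have "(\<integral>x. (norm (f x - h m x))\<^sup>2 \<partial>lborel) \<le>
      (\<integral>x. 2 * (norm (f x - F n x))\<^sup>2 + 2 * (norm (F n x - h m x))\<^sup>2 \<partial>lborel)"
  proof (rule integral_mono)
    fix x
    show "(norm (f x - h m x))\<^sup>2 \<le> 2 * (norm (f x - F n x))\<^sup>2 + 2 * (norm (F n x - h m x))\<^sup>2"
      using norm_add_square_le[of "f x - F n x" "F n x - h m x"] by simp
  qed (use L2_norm_square_diff_integrable[OF f FL2] L2_norm_square_diff_integrable[OF FL2 hL2]
      L2_norm_square_diff_integrable[OF f hL2] in simp_all)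
  also have "\<dots> < e"
    using n m L2_norm_square_diff_integrable[OF f FL2] L2_norm_square_diff_integrable[OF FL2 hL2] by simp
  finally show ?thesis
    using that[of "h m" "2 * r"] ch hz r hL2 by auto
qed

section \<open>Mollification\<close>

lemma compact_subset_cball:
  fixes S :: "'a::real_normed_vector set"
  assumes "compact S"
  shows "\<exists>r. S \<subseteq> cball 0 r"
  using compact_imp_bounded[OF assms] unfolding bounded_iff by (auto simp: subset_eq)

lemma uniformly_continuous_compact_support:
  fixes g :: "'a::euclidean_space \<Rightarrow> 'b::metric_space"
  assumes g: "continuous_on UNIV g" and z: "\<And>x. x \<notin> cball 0 R \<Longrightarrow> g x = c" and e: "0 < e"
  obtains d where "0 < d" "\<And>x y. dist x y < d \<Longrightarrow> dist (g x) (g y) < e"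
proof -
  \<comment> \<open>The margin 1 matches the bound 1 on the distance: if one of the two points lies
    in the ball of radius \<open>R\<close>, both lie in the larger ball.\<close>
  have "uniformly_continuous_on (cball 0 (R + 1)) g"
    by (intro compact_uniformly_continuous continuous_on_subset[OF g]) auto
  then obtain d where d: "0 < d" "\<And>x y. x \<in> cball 0 (R + 1) \<Longrightarrow> y \<in> cball 0 (R + 1) \<Longrightarrow> dist x y < d \<Longrightarrow> dist (g x) (g y) < e"
    using e unfolding uniformly_continuous_on_def by meson
  have "dist (g x) (g y) < e" if xy: "dist x y < min d 1" for x y
  proof (cases "x \<in> cball 0 R \<or> y \<in> cball 0 R")
    case True
    have "norm x \<le> norm y + dist x y" "norm y \<le> norm x + dist x y"
      using norm_triangle_ineq2[of x y] norm_triangle_ineq3[of x y] by (auto simp: dist_norm)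
    then have "x \<in> cball 0 (R + 1)" "y \<in> cball 0 (R + 1)"
      using True xy by auto
    then show ?thesis using d(2) xy by auto
  next
    case False
    then have "g x = g y" using z by simp
    then show ?thesis using e by simp
  qed
  moreover have "0 < min d 1" using d(1) by simp
  ultimately show ?thesis using that by blast
qed

text \<open>The support need not be centred at 0. Averaging with an off-centre kernel also shifts
  the function, and this is how functions are approximated up to the boundary.\<close>

definition kernel :: "real \<Rightarrow> (real^2 \<Rightarrow> real) \<Rightarrow> bool" where
  "kernel R k \<longleftrightarrow> 0 < R \<and> continuous_on UNIV k \<and> (\<forall>x. 0 \<le> k x) \<and> (\<forall>x. x \<notin> cball 0 R \<longrightarrow> k x = 0) \<and>
    (\<integral>x. k x \<partial>lborel) = 1"

definition moll :: "(real^2 \<Rightarrow> real) \<Rightarrow> real \<Rightarrow> (real^2 \<Rightarrow> 'b::euclidean_space) \<Rightarrow> real^2 \<Rightarrow> 'b" where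
  "moll k \<epsilon> f x = (\<integral>z. k z *\<^sub>R f (x + \<epsilon> *\<^sub>R z) \<partial>lborel)"

lemma nn_integral_affine:
  fixes f :: "'a::euclidean_space \<Rightarrow> ennreal"
  assumes [measurable]: "f \<in> borel_measurable borel" and c: "c \<noteq> 0"
  shows "(\<integral>\<^sup>+x. f x \<partial>lborel) = ennreal (\<bar>c\<bar> ^ DIM('a)) * (\<integral>\<^sup>+z. f (x + c *\<^sub>R z) \<partial>lborel)"
  by (subst lborel_affine[OF c, of x])
    (simp add: nn_integral_density nn_integral_distr nn_integral_cmult ennreal_power)

lemma nn_integral_translate:
  fixes f :: "'a::euclidean_space \<Rightarrow> ennreal"
  assumes [measurable]: "f \<in> borel_measurable borel"
  shows "(\<integral>\<^sup>+z. f (z + x) \<partial>lborel) = (\<integral>\<^sup>+x. f x \<partial>lborel)"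
  using nn_integral_affine[OF assms, of 1 x] by (simp add: add.commute)

lemma integral_affine:
  fixes f :: "'a::euclidean_space \<Rightarrow> 'b::{banach, second_countable_topology}"
  assumes [measurable]: "f \<in> borel_measurable borel" and c: "c \<noteq> 0"
  shows "(\<integral>x. f x \<partial>lborel) = \<bar>c\<bar> ^ DIM('a) *\<^sub>R (\<integral>z. f (x + c *\<^sub>R z) \<partial>lborel)"
    "integrable lborel f \<Longrightarrow> integrable lborel (\<lambda>z. f (x + c *\<^sub>R z))"
proof -
  show "(\<integral>x. f x \<partial>lborel) = \<bar>c\<bar> ^ DIM('a) *\<^sub>R (\<integral>z. f (x + c *\<^sub>R z) \<partial>lborel)"
    by (subst lborel_affine[OF c, of x], subst integral_density, simp, simp, simp, subst integral_distr) simp_all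
  assume int: "integrable lborel f"
  then have "(\<integral>\<^sup>+x. ennreal (norm (f x)) \<partial>lborel) < \<infinity>" by (simp add: integrable_iff_bounded)
  then have "ennreal (\<bar>c\<bar> ^ DIM('a)) * (\<integral>\<^sup>+z. ennreal (norm (f (x + c *\<^sub>R z))) \<partial>lborel) < \<infinity>"
    using nn_integral_affine[of "\<lambda>x. ennreal (norm (f x))" c x] c by simp
  then have "(\<integral>\<^sup>+z. ennreal (norm (f (x + c *\<^sub>R z))) \<partial>lborel) < \<infinity>"
    using c by (auto simp: ennreal_mult_less_top)
  then show "integrable lborel (\<lambda>z. f (x + c *\<^sub>R z))"
    by (simp add: integrable_iff_bounded)
qed

lemma kernel_facts:
  assumes "kernel R k"
  shows "k \<in> borel_measurable borel" "integrable lborel k" "0 \<le> k x" "0 < R" "(\<integral>x. k x \<partial>lborel) = 1"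
    "x \<notin> cball 0 R \<Longrightarrow> k x = 0"
  using assms unfolding kernel_def
  by (auto intro!: borel_measurable_continuous_onI integrable_continuous_compact_support[of k "cball 0 R"])

lemma bounded_compact_support:
  fixes g :: "'a::euclidean_space \<Rightarrow> 'b::real_normed_vector"
  assumes g: "continuous_on UNIV g" and S: "compact S" "\<And>x. x \<notin> S \<Longrightarrow> g x = 0"
  obtains B where "0 < B" "\<And>x. norm (g x) \<le> B"
proof -
  have "compact (g ` S)"
    by (rule compact_continuous_image[OF continuous_on_subset[OF g subset_UNIV] S(1)])
  then have "bounded (g ` S)" by (rule compact_imp_bounded)
  then obtain B where B: "\<And>x. x \<in> S \<Longrightarrow> norm (g x) \<le> B"
    unfolding bounded_iff by blast
  have "norm (g x) \<le> \<bar>B\<bar> + 1" for x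
    using B[of x] S(2)[of x] by (cases "x \<in> S") auto
  then show ?thesis using that[of "\<bar>B\<bar> + 1"] by simp
qed

lemma kernel_bounded:
  assumes "kernel R k"
  obtains B where "0 < B" "\<And>x. k x \<le> B"
proof -
  have c: "continuous_on UNIV k" "compact (cball (0::real^2) R)" "\<And>x. x \<notin> cball 0 R \<Longrightarrow> k x = 0"
    using assms unfolding kernel_def by auto
  obtain B where B: "0 < B" "\<And>x. norm (k x) \<le> B"
    using bounded_compact_support[OF c] by blast
  have "k x \<le> B" for x using B(2)[of x] by simp
  with B(1) that show ?thesis by blast
qed

lemma moll_integrable:
  fixes f :: "real^2 \<Rightarrow> 'b::euclidean_space"
  assumes k: "kernel R k" and f: "L2 lborel f" and \<epsilon>: "\<epsilon> \<noteq> 0"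
  shows "integrable lborel (\<lambda>z. k z * (norm (f (x + \<epsilon> *\<^sub>R z)))\<^sup>2)" (is ?A)
    "integrable lborel (\<lambda>z. k z *\<^sub>R f (x + \<epsilon> *\<^sub>R z))" (is ?B)
proof -
  note [measurable] = kernel_facts(1)[OF k]
  have [measurable]: "f \<in> borel_measurable borel" using f by (simp add: L2_def)
  obtain B where B: "0 < B" "\<And>x. k x \<le> B" using kernel_bounded[OF k] by blast
  have int: "integrable lborel (\<lambda>z. (norm (f (x + \<epsilon> *\<^sub>R z)))\<^sup>2)"
    using integral_affine(2)[of "\<lambda>x. (norm (f x))\<^sup>2" \<epsilon> x] f \<epsilon> by (simp add: L2_def)
  show A: ?A
  proof (rule Bochner_Integration.integrable_bound)
    show "integrable lborel (\<lambda>z. B * (norm (f (x + \<epsilon> *\<^sub>R z)))\<^sup>2)" using int by simp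
    show "AE z in lborel. norm (k z * (norm (f (x + \<epsilon> *\<^sub>R z)))\<^sup>2) \<le> norm (B * (norm (f (x + \<epsilon> *\<^sub>R z)))\<^sup>2)"
      using B kernel_facts(3)[OF k] by (auto intro!: always_eventually mult_right_mono simp: abs_mult)
  qed simp
  show ?B
  proof (rule Bochner_Integration.integrable_bound)
    show "integrable lborel (\<lambda>z. k z + k z * (norm (f (x + \<epsilon> *\<^sub>R z)))\<^sup>2)"
      using A kernel_facts(2)[OF k] by simp
    have "k z * norm (f (x + \<epsilon> *\<^sub>R z)) \<le> k z + k z * (norm (f (x + \<epsilon> *\<^sub>R z)))\<^sup>2" for z
    proof -
      define t where "t = norm (f (x + \<epsilon> *\<^sub>R z))"
      have "0 \<le> t" by (simp add: t_def)
      then have "t \<le> 1 + t\<^sup>2" using zero_le_power2[of "t - 1"] zero_le_power2[of t] by (simp add: power2_diff)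
      then have "k z * t \<le> k z * (1 + t\<^sup>2)" using kernel_facts(3)[OF k] by (rule mult_left_mono)
      then show ?thesis by (simp add: t_def distrib_left)
    qed
    then show "AE z in lborel. norm (k z *\<^sub>R f (x + \<epsilon> *\<^sub>R z)) \<le> norm (k z + k z * (norm (f (x + \<epsilon> *\<^sub>R z)))\<^sup>2)"
      using kernel_facts(3)[OF k] by (intro always_eventually allI) (auto intro: order_trans[OF _ abs_ge_self])
  qed simp
qed

text \<open>Jensen's inequality for the probability density \<open>k\<close>, read off from the
  nonnegativity of the variance of \<open>norm f\<close> about its mean \<open>m\<close>.\<close>

lemma moll_norm_square_le:
  fixes f :: "real^2 \<Rightarrow> 'b::euclidean_space"
  assumes k: "kernel R k" and f: "L2 lborel f" and \<epsilon>: "\<epsilon> \<noteq> 0"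
  shows "(norm (moll k \<epsilon> f x))\<^sup>2 \<le> (\<integral>z. k z * (norm (f (x + \<epsilon> *\<^sub>R z)))\<^sup>2 \<partial>lborel)"
proof -
  note I = moll_integrable[OF k f \<epsilon>, of x]
  have k0: "0 \<le> k z" for z by (rule kernel_facts(3)[OF k])
  define m where "m = (\<integral>z. k z * norm (f (x + \<epsilon> *\<^sub>R z)) \<partial>lborel)"
  have I2: "integrable lborel (\<lambda>z. k z * norm (f (x + \<epsilon> *\<^sub>R z)))"
    using integrable_norm[OF I(2)] k0 by simp
  have "norm (moll k \<epsilon> f x) \<le> (\<integral>z. norm (k z *\<^sub>R f (x + \<epsilon> *\<^sub>R z)) \<partial>lborel)"
    unfolding moll_def by (rule integral_norm_bound)
  also have "\<dots> = m" unfolding m_def using k0 by simp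
  finally have 1: "(norm (moll k \<epsilon> f x))\<^sup>2 \<le> m\<^sup>2" by (intro power_mono) auto
  have "0 \<le> (\<integral>z. k z * (norm (f (x + \<epsilon> *\<^sub>R z)) - m)\<^sup>2 \<partial>lborel)"
    using k0 by (intro Bochner_Integration.integral_nonneg) simp
  also have "\<dots> = (\<integral>z. k z * (norm (f (x + \<epsilon> *\<^sub>R z)))\<^sup>2 - 2 * m * (k z * norm (f (x + \<epsilon> *\<^sub>R z))) + m\<^sup>2 * k z \<partial>lborel)"
    by (intro Bochner_Integration.integral_cong refl) (simp add: power2_eq_square algebra_simps)
  also have "\<dots> = (\<integral>z. k z * (norm (f (x + \<epsilon> *\<^sub>R z)))\<^sup>2 \<partial>lborel) - 2 * m * m + m\<^sup>2 * 1"
    using I I2 kernel_facts(2,5)[OF k] by (simp add: m_def)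
  finally have "m\<^sup>2 \<le> (\<integral>z. k z * (norm (f (x + \<epsilon> *\<^sub>R z)))\<^sup>2 \<partial>lborel)"
    by (simp add: power2_eq_square)
  with 1 show ?thesis by linarith
qed

lemma moll_measurable:
  assumes "kernel R k" and [measurable]: "f \<in> borel_measurable borel"
  shows "moll k \<epsilon> f \<in> borel_measurable borel"
proof -
  note [measurable] = kernel_facts(1)[OF assms(1)]
  have "(\<lambda>x. \<integral>z. k z *\<^sub>R f (x + \<epsilon> *\<^sub>R z) \<partial>lborel) \<in> borel_measurable borel" by measurable
  then show ?thesis by (simp add: moll_def[abs_def])
qed

text \<open>Averaging is a contraction: integrate the pointwise Jensen bound, exchange the integrals
  and use translation invariance, so that \<open>k\<close> integrates to 1.\<close>

lemma moll_L2:
  fixes f :: "real^2 \<Rightarrow> 'b::euclidean_space"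
  assumes k: "kernel R k" and f: "L2 lborel f" and \<epsilon>: "\<epsilon> \<noteq> 0"
  shows "L2 lborel (moll k \<epsilon> f)" "(\<integral>x. (norm (moll k \<epsilon> f x))\<^sup>2 \<partial>lborel) \<le> (\<integral>x. (norm (f x))\<^sup>2 \<partial>lborel)"
proof -
  note [measurable] = kernel_facts(1)[OF k]
  have [measurable]: "f \<in> borel_measurable borel" using f by (simp add: L2_def)
  note [measurable] = moll_measurable[OF k \<open>f \<in> borel_measurable borel\<close>]
  have k0: "0 \<le> k z" for z by (rule kernel_facts(3)[OF k])
  have "(\<integral>\<^sup>+x. ennreal ((norm (moll k \<epsilon> f x))\<^sup>2) \<partial>lborel)
      \<le> (\<integral>\<^sup>+x. (\<integral>\<^sup>+z. ennreal (k z * (norm (f (x + \<epsilon> *\<^sub>R z)))\<^sup>2) \<partial>lborel) \<partial>lborel)"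
  proof (rule nn_integral_mono)
    fix x
    have "ennreal ((norm (moll k \<epsilon> f x))\<^sup>2) \<le> ennreal (\<integral>z. k z * (norm (f (x + \<epsilon> *\<^sub>R z)))\<^sup>2 \<partial>lborel)"
      by (intro ennreal_leI moll_norm_square_le[OF k f \<epsilon>])
    also have "\<dots> = (\<integral>\<^sup>+z. ennreal (k z * (norm (f (x + \<epsilon> *\<^sub>R z)))\<^sup>2) \<partial>lborel)"
      using moll_integrable(1)[OF k f \<epsilon>] k0 by (intro nn_integral_eq_integral[symmetric]) auto
    finally show "ennreal ((norm (moll k \<epsilon> f x))\<^sup>2) \<le> (\<integral>\<^sup>+z. ennreal (k z * (norm (f (x + \<epsilon> *\<^sub>R z)))\<^sup>2) \<partial>lborel)" .
  qed
  also have "\<dots> = (\<integral>\<^sup>+z. (\<integral>\<^sup>+x. ennreal (k z * (norm (f (x + \<epsilon> *\<^sub>R z)))\<^sup>2) \<partial>lborel) \<partial>lborel)"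
    by (rule lborel_pair.Fubini') measurable
  also have "\<dots> = (\<integral>\<^sup>+z. ennreal (k z) * (\<integral>\<^sup>+x. ennreal ((norm (f x))\<^sup>2) \<partial>lborel) \<partial>lborel)"
  proof (rule nn_integral_cong)
    fix z
    have "(\<integral>\<^sup>+x. ennreal (k z * (norm (f (x + \<epsilon> *\<^sub>R z)))\<^sup>2) \<partial>lborel)
        = (\<integral>\<^sup>+x. ennreal (k z) * ennreal ((norm (f (x + \<epsilon> *\<^sub>R z)))\<^sup>2) \<partial>lborel)"
      using k0 by (intro nn_integral_cong) (simp add: ennreal_mult)
    also have "\<dots> = ennreal (k z) * (\<integral>\<^sup>+x. ennreal ((norm (f (x + \<epsilon> *\<^sub>R z)))\<^sup>2) \<partial>lborel)"
      by (rule nn_integral_cmult) measurable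
    also have "(\<integral>\<^sup>+x. ennreal ((norm (f (x + \<epsilon> *\<^sub>R z)))\<^sup>2) \<partial>lborel) = (\<integral>\<^sup>+x. ennreal ((norm (f x))\<^sup>2) \<partial>lborel)"
      by (rule nn_integral_translate) measurable
    finally show "(\<integral>\<^sup>+x. ennreal (k z * (norm (f (x + \<epsilon> *\<^sub>R z)))\<^sup>2) \<partial>lborel)
        = ennreal (k z) * (\<integral>\<^sup>+x. ennreal ((norm (f x))\<^sup>2) \<partial>lborel)" .
  qed
  also have "\<dots> = (\<integral>\<^sup>+z. ennreal (k z) \<partial>lborel) * (\<integral>\<^sup>+x. ennreal ((norm (f x))\<^sup>2) \<partial>lborel)"
    by (rule nn_integral_multc) measurable
  also have "(\<integral>\<^sup>+z. ennreal (k z) \<partial>lborel) = 1"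
    using nn_integral_eq_integral[OF kernel_facts(2)[OF k]] k0 kernel_facts(5)[OF k] by simp
  also have "1 * (\<integral>\<^sup>+x. ennreal ((norm (f x))\<^sup>2) \<partial>lborel) = ennreal (\<integral>x. (norm (f x))\<^sup>2 \<partial>lborel)"
    using f by (simp add: L2_def nn_integral_eq_integral)
  finally have le: "(\<integral>\<^sup>+x. ennreal ((norm (moll k \<epsilon> f x))\<^sup>2) \<partial>lborel) \<le> ennreal (\<integral>x. (norm (f x))\<^sup>2 \<partial>lborel)" .
  have int: "integrable lborel (\<lambda>x. (norm (moll k \<epsilon> f x))\<^sup>2)"
    by (rule integrableI_bounded) (use le_less_trans[OF le] in auto)
  then show "L2 lborel (moll k \<epsilon> f)" by (simp add: L2_def)
  show "(\<integral>x. (norm (moll k \<epsilon> f x))\<^sup>2 \<partial>lborel) \<le> (\<integral>x. (norm (f x))\<^sup>2 \<partial>lborel)"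
    using le nn_integral_eq_integral[OF int] by simp
qed

lemma moll_diff:
  fixes f g :: "real^2 \<Rightarrow> 'b::euclidean_space"
  assumes k: "kernel R k" and f: "L2 lborel f" "L2 lborel g" and \<epsilon>: "\<epsilon> \<noteq> 0"
  shows "moll k \<epsilon> (\<lambda>x. f x - g x) x = moll k \<epsilon> f x - moll k \<epsilon> g x"
  unfolding moll_def using moll_integrable(2)[OF k f(1) \<epsilon>, of x] moll_integrable(2)[OF k f(2) \<epsilon>, of x]
  by (simp add: scaleR_diff_right)

lemma moll_tendsto_continuous:
  fixes g :: "real^2 \<Rightarrow> 'b::euclidean_space"
  assumes k: "kernel R k" and g: "continuous_on UNIV g" "\<And>x. x \<notin> cball 0 S \<Longrightarrow> g x = 0" "L2 lborel g" and e: "0 < e"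
  obtains d where "0 < d" "\<And>\<epsilon>. 0 < \<epsilon> \<Longrightarrow> \<epsilon> < d \<Longrightarrow> (\<integral>x. (norm (moll k \<epsilon> g x - g x))\<^sup>2 \<partial>lborel) < e"
proof -
  define T where "T = \<bar>S\<bar> + R"
  define V where "V = measure lborel (cball (0::real^2) T)"
  have V0: "0 \<le> V" by (simp add: V_def)
  \<comment> \<open>The error is at most \<open>\<eta>\<close> and vanishes outside the ball of
    radius \<open>T\<close>, so its squared norm is at most \<open>\<eta>\<^sup>2 V\<close>. The
    radius \<open>T\<close> covers the support of \<open>g\<close> and, for
    \<open>\<epsilon> < 1\<close>, that of its average.\<close>
  define \<eta> where "\<eta> = sqrt (e / (2 * (V + 1)))"
  have \<eta>: "0 < \<eta>" "\<eta>\<^sup>2 * V < e"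
  proof -
    have "0 < e / (2 * (V + 1))" using e V0 by simp
    then show "0 < \<eta>" by (simp add: \<eta>_def)
    have "\<eta>\<^sup>2 = e / (2 * (V + 1))" using e V0 by (simp add: \<eta>_def)
    moreover have "e / (2 * (V + 1)) * V < e"
      using e V0 by (simp add: divide_less_eq)
    ultimately show "\<eta>\<^sup>2 * V < e" by simp
  qed
  obtain d where d: "0 < d" "\<And>x y. dist x y < d \<Longrightarrow> dist (g x) (g y) < \<eta>"
    using uniformly_continuous_compact_support[OF g(1,2) \<eta>(1)] by blast
  have R: "0 < R" by (rule kernel_facts(4)[OF k])
  note [measurable] = kernel_facts(1)[OF k]
  have k0: "0 \<le> k z" for z by (rule kernel_facts(3)[OF k])
  have "(\<integral>x. (norm (moll k \<epsilon> g x - g x))\<^sup>2 \<partial>lborel) < e" if \<epsilon>: "0 < \<epsilon>" "\<epsilon> < min (d / R) 1" for \<epsilon>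
  proof -
    have \<epsilon>R: "\<epsilon> * R < d" using \<epsilon> R by (simp add: pos_less_divide_eq)
    have near: "norm (moll k \<epsilon> g x - g x) \<le> \<eta>" for x
    proof -
      note I = moll_integrable(2)[OF k g(3), of \<epsilon> x]
      have "moll k \<epsilon> g x - g x = (\<integral>z. k z *\<^sub>R g (x + \<epsilon> *\<^sub>R z) - k z *\<^sub>R g x \<partial>lborel)"
        unfolding moll_def using I \<epsilon> kernel_facts(2,5)[OF k] by simp
      also have "norm \<dots> \<le> (\<integral>z. k z * \<eta> \<partial>lborel)"
      proof (rule Bochner_Integration.integral_norm_bound_integral)
        fix z
        have "k z * norm (g (x + \<epsilon> *\<^sub>R z) - g x) \<le> k z * \<eta>"
        proof (cases "z \<in> cball 0 R")
          case True
          have "\<epsilon> * norm z \<le> \<epsilon> * R" using True \<epsilon> by (intro mult_left_mono) auto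
          then have "norm (\<epsilon> *\<^sub>R z) < d" using \<epsilon>R \<epsilon> unfolding norm_scaleR by linarith
          then have "dist (x + \<epsilon> *\<^sub>R z) x < d" by (simp add: dist_norm)
          then have "norm (g (x + \<epsilon> *\<^sub>R z) - g x) \<le> \<eta>" using d(2) by (simp add: dist_norm less_imp_le)
          then show ?thesis using k0 by (rule mult_left_mono)
        next
          case False
          then show ?thesis using kernel_facts(6)[OF k False] by simp
        qed
        then show "norm (k z *\<^sub>R g (x + \<epsilon> *\<^sub>R z) - k z *\<^sub>R g x) \<le> k z * \<eta>"
          using k0 by (simp add: scaleR_diff_right[symmetric])
      qed (use I \<epsilon> kernel_facts(2)[OF k] in auto)
      also have "\<dots> = \<eta>" using kernel_facts(5)[OF k] by simp
      finally show ?thesis .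
    qed
    have far: "moll k \<epsilon> g x - g x = 0" if "x \<notin> cball 0 T" for x
    proof -
      have *: "k z *\<^sub>R g (x + \<epsilon> *\<^sub>R z) = 0" for z
      proof (cases "z \<in> cball 0 R")
        case True
        have "\<epsilon> * norm z \<le> 1 * R" using True \<epsilon> R by (intro mult_mono) auto
        then have "norm (\<epsilon> *\<^sub>R z) \<le> R" using \<epsilon> by simp
        then have "x + \<epsilon> *\<^sub>R z \<notin> cball 0 S"
          using that norm_triangle_ineq2[of x "- (\<epsilon> *\<^sub>R z)"] by (auto simp: T_def)
        then show ?thesis using g(2) by simp
      next
        case False
        then show ?thesis using kernel_facts(6)[OF k False] by simp
      qed
      have "g x = 0" using that R by (intro g(2)) (auto simp: T_def)
      then show ?thesis unfolding moll_def * by simp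
    qed
    have "(\<integral>x. (norm (moll k \<epsilon> g x - g x))\<^sup>2 \<partial>lborel) \<le> (\<integral>x. \<eta>\<^sup>2 * indicator (cball 0 T) x \<partial>(lborel :: (real^2) measure))"
    proof (rule integral_mono)
      show "integrable lborel (\<lambda>x. (norm (moll k \<epsilon> g x - g x))\<^sup>2)"
        using \<epsilon> by (intro L2_norm_square_diff_integrable moll_L2[OF k] g) auto
      show "integrable lborel (\<lambda>x::real^2. \<eta>\<^sup>2 * indicator (cball 0 T) x)"
        by (intro integrable_mult_right integrable_real_indicator) (use emeasure_lborel_cball_finite in auto)
      show "(norm (moll k \<epsilon> g x - g x))\<^sup>2 \<le> \<eta>\<^sup>2 * indicator (cball 0 T) x" for x
        using near[of x] far[of x] by (cases "x \<in> cball 0 T") (auto intro: power_mono)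
    qed
    also have "\<dots> = \<eta>\<^sup>2 * V" by (simp add: V_def)
    finally show ?thesis using \<eta>(2) by simp
  qed
  moreover have "0 < min (d / R) 1" using d(1) R by simp
  ultimately show ?thesis using that by blast
qed

text \<open>A continuous function of compact support is close to \<open>f\<close>, and the
  contraction property keeps the averages close as well.\<close>

lemma moll_tendsto:
  fixes f :: "real^2 \<Rightarrow> 'b::euclidean_space"
  assumes k: "kernel R k" and f: "L2 lborel f" and e: "0 < e"
  obtains d where "0 < d" "\<And>\<epsilon>. 0 < \<epsilon> \<Longrightarrow> \<epsilon> < d \<Longrightarrow> (\<integral>x. (norm (moll k \<epsilon> f x - f x))\<^sup>2 \<partial>lborel) < e"
proof -
  \<comment> \<open>The three errors enter with the weights 4, 4 and 2, altogether less than 10/16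
    of \<open>e\<close>.\<close>
  have e8: "0 < e / 16" using e by simp
  obtain g S where g: "continuous_on UNIV g" "\<And>x. x \<notin> cball 0 S \<Longrightarrow> g x = 0" "0 < S"
    and fg: "(\<integral>x. (norm (f x - g x))\<^sup>2 \<partial>lborel) < e / 16" and gL2: "L2 lborel g"
    using L2_dense_continuous[OF f e8] by blast
  obtain d where d: "0 < d" "\<And>\<epsilon>. 0 < \<epsilon> \<Longrightarrow> \<epsilon> < d \<Longrightarrow> (\<integral>x. (norm (moll k \<epsilon> g x - g x))\<^sup>2 \<partial>lborel) < e / 16"
    using moll_tendsto_continuous[OF k g(1,2) gL2 e8] by blast
  have "(\<integral>x. (norm (moll k \<epsilon> f x - f x))\<^sup>2 \<partial>lborel) < e" if \<epsilon>: "0 < \<epsilon>" "\<epsilon> < d" for \<epsilon>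
  proof -
    let ?a = "\<lambda>x. moll k \<epsilon> (\<lambda>x. f x - g x) x" and ?b = "\<lambda>x. moll k \<epsilon> g x - g x" and ?c = "\<lambda>x. f x - g x"
    have L: "L2 lborel ?a" "L2 lborel ?b" "L2 lborel ?c"
      using \<epsilon> by (auto intro!: moll_L2[OF k] L2_diff f gL2)
    have "(\<integral>x. (norm (moll k \<epsilon> f x - f x))\<^sup>2 \<partial>lborel)
        \<le> (\<integral>x. 4 * (norm (?a x))\<^sup>2 + 4 * (norm (?b x))\<^sup>2 + 2 * (norm (?c x))\<^sup>2 \<partial>lborel)"
    proof (rule integral_mono)
      fix x
      have "moll k \<epsilon> f x - f x = (?a x + ?b x) - ?c x"
        using moll_diff[OF k f gL2] \<epsilon> by simp
      then show "(norm (moll k \<epsilon> f x - f x))\<^sup>2 \<le> 4 * (norm (?a x))\<^sup>2 + 4 * (norm (?b x))\<^sup>2 + 2 * (norm (?c x))\<^sup>2"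
        using norm_diff_square_le[of "?a x + ?b x" "?c x"] norm_add_square_le[of "?a x" "?b x"] by simp
    next
      show "integrable lborel (\<lambda>x. (norm (moll k \<epsilon> f x - f x))\<^sup>2)"
        using \<epsilon> by (intro L2_norm_square_diff_integrable moll_L2[OF k] f) auto
    qed (use L in \<open>auto simp: L2_def\<close>)
    also have "\<dots> = 4 * (\<integral>x. (norm (?a x))\<^sup>2 \<partial>lborel) + 4 * (\<integral>x. (norm (?b x))\<^sup>2 \<partial>lborel) + 2 * (\<integral>x. (norm (?c x))\<^sup>2 \<partial>lborel)"
      using L by (simp add: L2_def)
    also have "\<dots> < e"
      using moll_L2(2)[OF k L(3), of \<epsilon>] \<epsilon> d(2)[OF \<epsilon>] fg e by simp
    finally show ?thesis .
  qed
  with d(1) that show ?thesis by blast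
qed

text \<open>A correlation: the kernel is evaluated at \<open>y - x\<close>, so that it is a
  translated test function in \<open>y\<close>. The sign that differentiation in \<open>x\<close>
  produces cancels the one in the definition of the weak gradient.\<close>

definition conv :: "(real^2 \<Rightarrow> real) \<Rightarrow> (real^2 \<Rightarrow> 'b::euclidean_space) \<Rightarrow> real^2 \<Rightarrow> 'b" where
  "conv K f x = (\<integral>y. K (y - x) *\<^sub>R f y \<partial>lborel)"

lemma conv_integrable:
  fixes f :: "real^2 \<Rightarrow> 'b::euclidean_space"
  assumes g: "continuous_on UNIV g" and S: "compact S" "\<And>x. x \<notin> S \<Longrightarrow> g x = 0" and f: "integrable lborel f"
  shows "integrable lborel (\<lambda>y. g (y - x) *\<^sub>R f y)"
proof -
  have [measurable]: "g \<in> borel_measurable borel" using g by (rule borel_measurable_continuous_onI)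
  have [measurable]: "f \<in> borel_measurable borel" using f borel_measurable_integrable by fastforce
  obtain B where B: "0 < B" "\<And>x. norm (g x) \<le> B" using bounded_compact_support[OF g S] by blast
  show ?thesis
  proof (rule Bochner_Integration.integrable_bound)
    show "integrable lborel (\<lambda>y. B *\<^sub>R f y)" using f by simp
    show "AE y in lborel. norm (g (y - x) *\<^sub>R f y) \<le> norm (B *\<^sub>R f y)"
      using B by (auto intro!: always_eventually mult_right_mono)
  qed measurable
qed

lemma conv_continuous:
  fixes f :: "real^2 \<Rightarrow> 'b::euclidean_space"
  assumes g: "continuous_on UNIV g" and S: "compact S" "\<And>x. x \<notin> S \<Longrightarrow> g x = 0" and f: "integrable lborel f"
  shows "continuous_on UNIV (conv g f)"
  unfolding continuous_on_iff
proof (intro ballI allI impI)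
  fix x and e :: real assume e: "0 < e"
  define N where "N = (\<integral>y. norm (f y) \<partial>lborel)"
  have N: "0 \<le> N" by (simp add: N_def)
  define \<eta> where "\<eta> = e / (N + 1)"
  have \<eta>: "0 < \<eta>" "\<eta> * N < e"
    using e N by (auto simp: \<eta>_def divide_less_eq add_nonneg_pos distrib_left)
  obtain r where r: "S \<subseteq> cball 0 r" using compact_subset_cball[OF S(1)] by blast
  have gz: "g x = 0" if "x \<notin> cball 0 r" for x using S(2) r that by blast
  obtain d where d: "0 < d" "\<And>x y. dist x y < d \<Longrightarrow> dist (g x) (g y) < \<eta>"
    using uniformly_continuous_compact_support[OF g gz \<eta>(1)] by blast
  have "dist (conv g f x') (conv g f x) < e" if "dist x' x < d" for x'
  proof -
    have I: "integrable lborel (\<lambda>y. g (y - x) *\<^sub>R f y)" for x by (rule conv_integrable[OF g S f])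
    have "conv g f x' - conv g f x = (\<integral>y. g (y - x') *\<^sub>R f y - g (y - x) *\<^sub>R f y \<partial>lborel)"
      unfolding conv_def using I by simp
    also have "norm \<dots> \<le> (\<integral>y. \<eta> * norm (f y) \<partial>lborel)"
    proof (rule Bochner_Integration.integral_norm_bound_integral)
      fix y
      have "dist (y - x') (y - x) < d"
        using that by (simp add: dist_norm norm_minus_commute[of x x'])
      then have "dist (g (y - x')) (g (y - x)) \<le> \<eta>"
        using d(2) less_imp_le by blast
      then show "norm (g (y - x') *\<^sub>R f y - g (y - x) *\<^sub>R f y) \<le> \<eta> * norm (f y)"
        by (simp add: scaleR_diff_left[symmetric] dist_norm mult_right_mono)
    qed (use I f in auto)
    also have "\<dots> = \<eta> * N" by (simp add: N_def)
    finally show ?thesis using \<eta>(2) by (simp add: dist_norm)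
  qed
  with d(1) show "\<exists>d>0. \<forall>x'\<in>UNIV. dist x' x < d \<longrightarrow> dist (conv g f x') (conv g f x) < e" by blast
qed

text \<open>The partial derivatives are uniformly continuous because of the compact support, and the
  mean value inequality turns this into a remainder that is uniform in the base point. Each of the
  two coordinates contributes half of \<open>e\<close>.\<close>

lemma C1c_uniformly_differentiable:
  fixes K :: "real^2 \<Rightarrow> real"
  assumes K: "K \<in> C1c UNIV" and e: "0 < e"
  obtains d where "0 < d" "\<And>z h. norm h < d \<Longrightarrow> \<bar>K (z + h) - K z - dirder K z h\<bar> \<le> e * norm h"
proof -
  obtain S where S: "compact S" "\<And>x. x \<notin> S \<Longrightarrow> K x = 0" "\<And>i x. x \<notin> S \<Longrightarrow> partial i K x = 0"
    using C1cE[OF K] by metis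
  obtain r where r: "S \<subseteq> cball 0 r" using compact_subset_cball[OF S(1)] by blast
  note C = C1c_C1[OF K]
  have e2: "0 < e / 2" using e by simp
  have gz: "partial i K x = 0" if "x \<notin> cball 0 r" for x i using S(3) r that by blast
  have "\<exists>d>0. \<forall>x y. dist x y < d \<longrightarrow> dist (partial i K x) (partial i K y) < e / 2" for i
    by (rule uniformly_continuous_compact_support[OF C1_partial_continuous[OF C] gz e2]) blast+
  then obtain dd where dd: "\<And>i. 0 < dd i" "\<And>i x y. dist x y < dd i \<Longrightarrow> dist (partial i K x) (partial i K y) < e / 2"
    by metis
  define d where "d = min (dd 1) (dd 2)"
  have d0: "0 < d" using dd(1) by (simp add: d_def)
  have "\<bar>K (z + h) - K z - dirder K z h\<bar> \<le> e * norm h" if h: "norm h < d" for z h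
  proof -
    have "norm (K (z + h) - K z - dirder K z ((z + h) - z)) \<le> norm ((z + h) - z) * e"
    proof (rule differentiable_bound_linearization[where S="ball z d"])
      show "z + t *\<^sub>R (z + h - z) \<in> ball z d" if "t \<in> {0..1}" for t
      proof -
        have "\<bar>t\<bar> * norm h \<le> 1 * norm h" using that by (intro mult_right_mono) auto
        then show ?thesis using h by (simp add: dist_norm)
      qed
      show "(K has_derivative dirder K w) (at w within ball z d)" for w
        using C1_derivative[OF C] by (rule has_derivative_at_withinI)
      show "z \<in> ball z d" using d0 by simp
      fix w assume w: "w \<in> ball z d"
      show "onorm (dirder K w - dirder K z) \<le> e"
      proof (rule onorm_le)
        fix v
        have p: "\<bar>partial i K w - partial i K z\<bar> \<le> e / 2" for i
        proof -
          have "dist w z < dd i" using w exhaust_2[of i] by (auto simp: d_def dist_commute)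
          then show ?thesis using dd(2)[of w z i] by (simp add: dist_real_def)
        qed
        have "norm ((dirder K w - dirder K z) v) = \<bar>v $ 1 * (partial 1 K w - partial 1 K z) + v $ 2 * (partial 2 K w - partial 2 K z)\<bar>"
          by (simp add: dirder_2 algebra_simps)
        also have "\<dots> \<le> \<bar>v $ 1\<bar> * \<bar>partial 1 K w - partial 1 K z\<bar> + \<bar>v $ 2\<bar> * \<bar>partial 2 K w - partial 2 K z\<bar>"
          using abs_triangle_ineq[of "v $ 1 * (partial 1 K w - partial 1 K z)" "v $ 2 * (partial 2 K w - partial 2 K z)"]
          by (simp only: abs_mult)
        also have "\<dots> \<le> norm v * (e / 2) + norm v * (e / 2)"
          using component_le_norm_cart[of v] p by (intro add_mono mult_mono) auto
        finally show "norm ((dirder K w - dirder K z) v) \<le> e * norm v" by simp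
      qed
    qed
    then show ?thesis by (simp add: mult.commute)
  qed
  moreover have "0 < d" using dd(1) by (simp add: d_def)
  ultimately show ?thesis using that by blast
qed

text \<open>Differentiation under the integral: the remainder of \<open>K\<close> is uniform in the
  base point, so its integral against \<open>f\<close> is at most that remainder times the integral
  of \<open>norm f\<close>.\<close>

lemma conv_C1:
  fixes f :: "real^2 \<Rightarrow> 'b::euclidean_space"
  assumes K: "K \<in> C1c UNIV" and f: "integrable lborel f"
  shows "C1 (conv K f)" "partial i (conv K f) x = - conv (partial i K) f x"
proof -
  obtain S where S: "compact S" "\<And>x. x \<notin> S \<Longrightarrow> K x = 0" "\<And>i x. x \<notin> S \<Longrightarrow> partial i K x = 0"
    using C1cE[OF K] by metis
  note C = C1c_C1[OF K]
  have I: "integrable lborel (\<lambda>y. K (y - x) *\<^sub>R f y)" for x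
    by (rule conv_integrable[OF C1_continuous[OF C] S(1,2) f])
  have Ip: "integrable lborel (\<lambda>y. partial i K (y - x) *\<^sub>R f y)" for x i
    by (rule conv_integrable[OF C1_partial_continuous[OF C] S(1,3) f])
  define D where "D x h = - (\<Sum>i\<in>UNIV. h $ i *\<^sub>R conv (partial i K) f x)" for x and h :: "real^2"
  have eqd: "(\<lambda>y. dirder K (y - x) h *\<^sub>R f y)
      = (\<lambda>y. h $ 1 *\<^sub>R (partial 1 K (y - x) *\<^sub>R f y) + h $ 2 *\<^sub>R (partial 2 K (y - x) *\<^sub>R f y))" for x h
    by (simp add: dirder_2 scaleR_add_left fun_eq_iff)
  have Ips: "integrable lborel (\<lambda>y. h $ i *\<^sub>R (partial i K (y - x) *\<^sub>R f y))" for x i and h :: "real^2"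
    by (rule integrable_scaleR_right) (rule Ip)
  have Id: "integrable lborel (\<lambda>y. dirder K (y - x) h *\<^sub>R f y)" for x h
    unfolding eqd by (intro Bochner_Integration.integrable_add Ips)
  have D_int: "D x h = - (\<integral>y. dirder K (y - x) h *\<^sub>R f y \<partial>lborel)" for x h
    unfolding eqd Bochner_Integration.integral_add[OF Ips Ips] integral_scaleR_right
    by (simp add: D_def conv_def sum_2)
  define N where "N = (\<integral>y. norm (f y) \<partial>lborel)"
  have N: "0 \<le> N" by (simp add: N_def)
  have der: "(conv K f has_derivative D x) (at x)" for x
    unfolding has_derivative_within_alt
  proof (intro conjI allI impI)
    show "bounded_linear (D x)"
      unfolding D_def
      by (intro bounded_linear_minus bounded_linear_sum bounded_linear_scaleR_const bounded_linear_vec_nth)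
    fix e :: real assume e: "0 < e"
    define \<eta> where "\<eta> = e / (N + 1)"
    have \<eta>: "0 < \<eta>" "\<eta> * N \<le> e"
      using e N by (auto simp: \<eta>_def divide_le_eq add_nonneg_pos distrib_left)
    obtain d where d: "0 < d" "\<And>z h. norm h < d \<Longrightarrow> \<bar>K (z + h) - K z - dirder K z h\<bar> \<le> \<eta> * norm h"
      using C1c_uniformly_differentiable[OF K \<eta>(1)] by blast
    have "norm (conv K f x' - conv K f x - D x (x' - x)) \<le> e * norm (x' - x)" if "norm (x' - x) < d" for x'
    proof -
      have "conv K f x' - conv K f x - D x (x' - x)
          = (\<integral>y. K (y - x') *\<^sub>R f y - K (y - x) *\<^sub>R f y + dirder K (y - x) (x' - x) *\<^sub>R f y \<partial>lborel)"
      proof -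
        let ?A = "\<lambda>y. K (y - x') *\<^sub>R f y" and ?B = "\<lambda>y. K (y - x) *\<^sub>R f y" and ?C = "\<lambda>y. dirder K (y - x) (x' - x) *\<^sub>R f y"
        have "(\<integral>y. ?A y - ?B y + ?C y \<partial>lborel) = (\<integral>y. ?A y - ?B y \<partial>lborel) + (\<integral>y. ?C y \<partial>lborel)"
          by (intro Bochner_Integration.integral_add Bochner_Integration.integrable_diff I Id)
        also have "(\<integral>y. ?A y - ?B y \<partial>lborel) = (\<integral>y. ?A y \<partial>lborel) - (\<integral>y. ?B y \<partial>lborel)"
          by (intro Bochner_Integration.integral_diff I)
        finally show ?thesis unfolding conv_def D_int by (simp only: diff_minus_eq_add)
      qed
      also have "norm \<dots> \<le> (\<integral>y. (\<eta> * norm (x' - x)) * norm (f y) \<partial>lborel)"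
      proof (rule Bochner_Integration.integral_norm_bound_integral)
        fix y
        have "dirder K (y - x) (x - x') = - dirder K (y - x) (x' - x)"
          by (simp add: dirder_2 algebra_simps)
        then have "\<bar>K (y - x') - K (y - x) + dirder K (y - x) (x' - x)\<bar> \<le> \<eta> * norm (x' - x)"
          using d(2)[of "x - x'" "y - x"] that by (simp add: norm_minus_commute)
        then have "\<bar>K (y - x') - K (y - x) + dirder K (y - x) (x' - x)\<bar> * norm (f y) \<le> \<eta> * norm (x' - x) * norm (f y)"
          by (rule mult_right_mono) simp
        then show "norm (K (y - x') *\<^sub>R f y - K (y - x) *\<^sub>R f y + dirder K (y - x) (x' - x) *\<^sub>R f y) \<le> \<eta> * norm (x' - x) * norm (f y)"
          by (simp add: scaleR_diff_left[symmetric] scaleR_add_left[symmetric])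
      qed (use I Id f in auto)
      also have "\<dots> = (\<eta> * N) * norm (x' - x)" by (simp add: N_def)
      also have "\<dots> \<le> e * norm (x' - x)" using \<eta>(2) by (rule mult_right_mono) simp
      finally show ?thesis .
    qed
    with d(1) show "\<exists>d>0. \<forall>y\<in>UNIV. norm (y - x) < d \<longrightarrow> norm (conv K f y - conv K f x - D x (y - x)) \<le> e * norm (y - x)"
      by blast
  qed
  have D_axis: "D x (axis i 1) = - conv (partial i K) f x" for x i
    unfolding D_int conv_def by simp
  show "C1 (conv K f)"
    by (rule C1I[OF der], unfold D_axis)
      (intro continuous_intros conv_continuous[OF C1_partial_continuous[OF C] S(1,3) f])
  show "partial i (conv K f) x = - conv (partial i K) f x"
    using partialI[OF der] D_axis by simp
qed

lemma moll_eq_conv: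
  fixes f :: "real^2 \<Rightarrow> 'b::euclidean_space"
  assumes [measurable]: "k \<in> borel_measurable borel" "f \<in> borel_measurable borel" and \<epsilon>: "0 < \<epsilon>"
  shows "moll k \<epsilon> f x = conv (\<lambda>w. k ((1 / \<epsilon>) *\<^sub>R w) / \<epsilon>\<^sup>2) f x"
proof -
  have "conv (\<lambda>w. k ((1 / \<epsilon>) *\<^sub>R w) / \<epsilon>\<^sup>2) f x
      = \<bar>\<epsilon>\<bar> ^ DIM(real^2) *\<^sub>R (\<integral>z. (k ((1 / \<epsilon>) *\<^sub>R ((x + \<epsilon> *\<^sub>R z) - x)) / \<epsilon>\<^sup>2) *\<^sub>R f (x + \<epsilon> *\<^sub>R z) \<partial>lborel)"
    unfolding conv_def using \<epsilon> by (intro integral_affine) auto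
  also have "\<dots> = \<epsilon>\<^sup>2 *\<^sub>R (\<integral>z. (k z / \<epsilon>\<^sup>2) *\<^sub>R f (x + \<epsilon> *\<^sub>R z) \<partial>lborel)"
    using \<epsilon> by simp
  also have "\<dots> = (\<integral>z. \<epsilon>\<^sup>2 *\<^sub>R ((k z / \<epsilon>\<^sup>2) *\<^sub>R f (x + \<epsilon> *\<^sub>R z)) \<partial>lborel)"
    by (simp only: integral_scaleR_right)
  also have "\<dots> = moll k \<epsilon> f x"
    unfolding moll_def using \<epsilon> by (intro Bochner_Integration.integral_cong refl) simp
  finally show ?thesis by simp
qed

lemma C1c_rescale:
  fixes k :: "real^2 \<Rightarrow> real"
  assumes k: "k \<in> C1c UNIV" and \<epsilon>: "0 < \<epsilon>"
  shows "(\<lambda>w. k ((1 / \<epsilon>) *\<^sub>R w) / \<epsilon>\<^sup>2) \<in> C1c UNIV"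
proof -
  obtain S where S: "compact S" "\<And>x. x \<notin> S \<Longrightarrow> k x = 0" using k unfolding C1c_iff by blast
  have D: "((\<lambda>w. k ((1 / \<epsilon>) *\<^sub>R w) / \<epsilon>\<^sup>2) has_derivative (\<lambda>h. dirder k ((1 / \<epsilon>) *\<^sub>R w) ((1 / \<epsilon>) *\<^sub>R h) / \<epsilon>\<^sup>2)) (at w)" for w
  proof -
    have "((\<lambda>w. (1 / \<epsilon>) *\<^sub>R w) has_derivative (\<lambda>h. (1 / \<epsilon>) *\<^sub>R h)) (at w)"
      by (intro derivative_intros)
    from has_derivative_compose[OF this C1_derivative[OF C1c_C1[OF k]]]
    have "((\<lambda>w. k ((1 / \<epsilon>) *\<^sub>R w)) has_derivative (\<lambda>h. dirder k ((1 / \<epsilon>) *\<^sub>R w) ((1 / \<epsilon>) *\<^sub>R h))) (at w)" .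
    from has_derivative_mult_left[OF this, of "1 / \<epsilon>\<^sup>2"] show ?thesis
      by simp
  qed
  have "C1 (\<lambda>w. k ((1 / \<epsilon>) *\<^sub>R w) / \<epsilon>\<^sup>2)"
    by (rule C1I[OF D]) (intro continuous_intros dirder_continuous C1c_C1[OF k], use \<epsilon> in auto)
  moreover have "compact ((\<lambda>w. \<epsilon> *\<^sub>R w) ` S)" by (rule compact_scaling[OF S(1)])
  moreover have "k ((1 / \<epsilon>) *\<^sub>R w) / \<epsilon>\<^sup>2 = 0" if "w \<notin> (\<lambda>w. \<epsilon> *\<^sub>R w) ` S" for w
  proof -
    have "(1 / \<epsilon>) *\<^sub>R w \<notin> S"
    proof
      assume "(1 / \<epsilon>) *\<^sub>R w \<in> S"
      then have "\<epsilon> *\<^sub>R ((1 / \<epsilon>) *\<^sub>R w) \<in> (\<lambda>w. \<epsilon> *\<^sub>R w) ` S" by (rule imageI)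
      then show False using that \<epsilon> by simp
    qed
    then show ?thesis using S(2) by simp
  qed
  ultimately show ?thesis unfolding C1c_iff by blast
qed

section \<open>Sobolev pairs\<close>

lemma L2_integrable_mult_compact_support:
  fixes U :: "real^2 \<Rightarrow> 'b::euclidean_space" and g :: "real^2 \<Rightarrow> real"
  assumes U: "L2 lborel U" and g: "continuous_on UNIV g" and S: "compact S" "\<And>x. x \<notin> S \<Longrightarrow> g x = 0"
  shows "integrable lborel (\<lambda>x. g x *\<^sub>R U x)"
proof -
  have [measurable]: "g \<in> borel_measurable borel" using g by (rule borel_measurable_continuous_onI)
  have [measurable]: "U \<in> borel_measurable borel" using U by (simp add: L2_def)
  have int: "integrable lborel (\<lambda>x. (g x)\<^sup>2 + (norm (U x))\<^sup>2)"
  proof (intro Bochner_Integration.integrable_add)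
    show "integrable lborel (\<lambda>x. (g x)\<^sup>2)"
      by (rule integrable_continuous_compact_support[of _ S])
        (use S g compact_imp_bounded in \<open>auto intro: continuous_on_power\<close>)
    show "integrable lborel (\<lambda>x. (norm (U x))\<^sup>2)" using U by (simp add: L2_def)
  qed
  show ?thesis
  proof (rule Bochner_Integration.integrable_bound[OF int])
    show "AE x in lborel. norm (g x *\<^sub>R U x) \<le> norm ((g x)\<^sup>2 + (norm (U x))\<^sup>2)"
    proof (intro always_eventually allI)
      fix x
      have "2 * (\<bar>g x\<bar> * norm (U x)) \<le> (g x)\<^sup>2 + (norm (U x))\<^sup>2"
        using sum_squares_bound[of "\<bar>g x\<bar>" "norm (U x)"] by simp
      moreover have "0 \<le> \<bar>g x\<bar> * norm (U x)" by simp
      ultimately have "\<bar>g x\<bar> * norm (U x) \<le> (g x)\<^sup>2 + (norm (U x))\<^sup>2" by linarith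
      then show "norm (g x *\<^sub>R U x) \<le> norm ((g x)\<^sup>2 + (norm (U x))\<^sup>2)" by simp
    qed
  qed measurable
qed

lemma grad_nth [simp]: "grad f x $ i = partial i f x"
  by (simp add: grad_def)

lemma norm_grad_square: "(norm (grad f x))\<^sup>2 = (norm (partial 1 f x))\<^sup>2 + (norm (partial 2 f x))\<^sup>2"
  by (simp add: norm_vec_def L2_set_def sum_2)

lemma C1_grad_continuous: "C1 f \<Longrightarrow> continuous_on S (grad f)"
  unfolding grad_def by (intro continuous_on_vec_lambda C1_partial_continuous)

lemma L2_continuous_compact_support:
  fixes f :: "real^2 \<Rightarrow> 'b::euclidean_space"
  assumes f: "continuous_on UNIV f" and S: "compact S" "\<And>x. x \<notin> S \<Longrightarrow> f x = 0"
  shows "L2 lborel f"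
  unfolding L2_def
proof
  show "f \<in> borel_measurable lborel" using borel_measurable_continuous_onI[OF f] by simp
  show "integrable lborel (\<lambda>x. (norm (f x))\<^sup>2)"
    by (rule integrable_continuous_compact_support[of _ S])
      (use S f compact_imp_bounded in \<open>auto intro!: continuous_on_power continuous_on_norm\<close>)
qed

lemma C1c_L2:
  fixes f :: "real^2 \<Rightarrow> complex"
  assumes "f \<in> C1c \<Omega>"
  shows "L2 lborel f" "L2 lborel (grad f)"
proof -
  obtain S where S: "compact S" "\<And>x. x \<notin> S \<Longrightarrow> f x = 0" "\<And>i x. x \<notin> S \<Longrightarrow> partial i f x = 0"
    using C1cE[OF assms] by metis
  note C = C1c_C1[OF assms]
  show "L2 lborel f" by (rule L2_continuous_compact_support[OF C1_continuous[OF C] S(1,2)])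
  have "grad f x = 0" if "x \<notin> S" for x using S(3)[OF that] by (simp add: vec_eq_iff)
  then show "L2 lborel (grad f)" by (rule L2_continuous_compact_support[OF C1_grad_continuous[OF C] S(1)])
qed

text \<open>A pair consisting of (a Borel representative of) a Sobolev function and its weak gradient,
  both extended by zero.\<close>

definition wpair :: "(real^2) set \<Rightarrow> (real^2 \<Rightarrow> complex) \<Rightarrow> (real^2 \<Rightarrow> complex^2) \<Rightarrow> bool" where
  "wpair \<Omega> U V \<longleftrightarrow> L2 lborel U \<and> L2 lborel V \<and> (\<forall>x. x \<notin> \<Omega> \<longrightarrow> U x = 0 \<and> V x = 0) \<and>
    (\<forall>i. \<forall>\<phi>\<in>C1c \<Omega>. (\<integral>x. partial i \<phi> x *\<^sub>R U x \<partial>lborel) = - (\<integral>x. \<phi> x *\<^sub>R (V x $ i) \<partial>lborel))"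

lemma L2_vec_nth:
  fixes V :: "real^2 \<Rightarrow> complex^2"
  assumes "L2 lborel V" shows "L2 lborel (\<lambda>x. V x $ i)"
proof (rule L2_I)
  have "V \<in> borel_measurable borel" using assms by (simp add: L2_def)
  then show "(\<lambda>x. V x $ i) \<in> borel_measurable lborel"
    using borel_measurable_continuous_on[OF linear_continuous_on[OF bounded_linear_vec_nth]] by auto
  show "integrable lborel (\<lambda>x. (norm (V x))\<^sup>2)" using assms by (simp add: L2_def)
  show "(norm (V x $ i))\<^sup>2 \<le> (norm (V x))\<^sup>2" for x
    using member_le_L2_set[of UNIV i "\<lambda>i. norm (V x $ i)"] by (intro power_mono) (simp_all add: norm_vec_def)
qed

lemma moll_vec_nth:
  fixes V :: "real^2 \<Rightarrow> complex^2"
  assumes "kernel R k" "L2 lborel V" "\<epsilon> \<noteq> 0"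
  shows "moll k \<epsilon> (\<lambda>x. V x $ i) x = moll k \<epsilon> V x $ i"
  unfolding moll_def
  using integral_bounded_linear[OF bounded_linear_vec_nth[of i] moll_integrable(2)[OF assms, of x]] by simp

lemma conv_zero:
  assumes "\<And>y. g (y - x) *\<^sub>R f y = 0" shows "conv g f x = 0"
  unfolding conv_def assms by simp

text \<open>Differentiating the average moves the derivative to the kernel. If the translated kernel
  is supported in \<open>\<Omega>\<close>, it is a test function and the weak derivative can be
  moved back to \<open>U\<close>; if \<open>U\<close> and \<open>V\<close> vanish on the support of
  the translated kernel, both sides are 0. The localisations below always reach one of these two
  cases.\<close>

lemma moll_partial:
  fixes U :: "real^2 \<Rightarrow> complex"
  assumes w: "wpair \<Omega> U V" and U: "integrable lborel U"
    and k: "kernel R k" "k \<in> C1c UNIV" and S: "compact S" "\<And>z. z \<notin> S \<Longrightarrow> k z = 0"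
    and \<epsilon>: "0 < \<epsilon>"
    and dich: "(\<forall>z\<in>S. x + \<epsilon> *\<^sub>R z \<in> \<Omega>) \<or> (\<forall>z\<in>S. U (x + \<epsilon> *\<^sub>R z) = 0 \<and> V (x + \<epsilon> *\<^sub>R z) = 0)"
  shows "partial i (moll k \<epsilon> U) x = moll k \<epsilon> V x $ i"
proof -
  define K where "K w = k ((1 / \<epsilon>) *\<^sub>R w) / \<epsilon>\<^sup>2" for w
  have K: "K \<in> C1c UNIV" unfolding K_def by (rule C1c_rescale[OF k(2) \<epsilon>])
  define S' where "S' = (\<lambda>w. \<epsilon> *\<^sub>R w) ` S"
  have cS': "compact S'" unfolding S'_def by (rule compact_scaling[OF S(1)])
  have K0: "K w = 0" if "w \<notin> S'" for w
  proof -
    have "(1 / \<epsilon>) *\<^sub>R w \<notin> S"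
    proof
      assume "(1 / \<epsilon>) *\<^sub>R w \<in> S"
      then have "\<epsilon> *\<^sub>R ((1 / \<epsilon>) *\<^sub>R w) \<in> S'" unfolding S'_def by (rule imageI)
      then show False using that \<epsilon> by simp
    qed
    then show ?thesis using S(2) by (simp add: K_def)
  qed
  have pK0: "partial i K w = 0" if "w \<notin> S'" for w
  proof -
    have "partial i K w = partial i (\<lambda>_. 0) w"
      by (rule partial_cong_open[of "- S'"]) (use that K0 cS' compact_imp_closed in auto)
    then show ?thesis by (simp add: C1_const)
  qed
  have Ub: "U \<in> borel_measurable borel" and VL: "L2 lborel (\<lambda>x. V x $ i)"
    using w L2_vec_nth unfolding wpair_def L2_def by auto
  have Vb: "(\<lambda>x. V x $ i) \<in> borel_measurable borel" using VL by (simp add: L2_def)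
  have eU: "moll k \<epsilon> U = conv K U"
    unfolding K_def by (rule ext, rule moll_eq_conv[OF kernel_facts(1)[OF k(1)] Ub \<epsilon>])
  have eV: "moll k \<epsilon> V x $ i = conv K (\<lambda>x. V x $ i) x"
    unfolding K_def moll_eq_conv[OF kernel_facts(1)[OF k(1)] Vb \<epsilon>, symmetric]
    using w \<epsilon> by (intro moll_vec_nth[OF k(1), symmetric]) (auto simp: wpair_def)
  have "- conv (partial i K) U x = conv K (\<lambda>x. V x $ i) x"
    using dich
  proof
    assume in\<Omega>: "\<forall>z\<in>S. x + \<epsilon> *\<^sub>R z \<in> \<Omega>"
    define \<phi> where "\<phi> y = K (y - x)" for y
    have "C1 \<phi>" unfolding \<phi>_def by (rule C1_translate(1)[OF C1c_C1[OF K]])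
    moreover have "compact ((\<lambda>w. x + w) ` S')" using compact_translation[OF cS', of x] by (simp add: image_def)
    moreover have "(\<lambda>w. x + w) ` S' \<subseteq> \<Omega>" using in\<Omega> by (auto simp: S'_def)
    moreover have "\<phi> y = 0" if "y \<notin> (\<lambda>w. x + w) ` S'" for y
    proof -
      have "y - x \<notin> S'" using that by (metis add.commute diff_add_cancel imageI)
      then show ?thesis using K0 by (simp add: \<phi>_def)
    qed
    ultimately have "\<phi> \<in> C1c \<Omega>" unfolding C1c_iff by blast
    then have "(\<integral>y. partial i \<phi> y *\<^sub>R U y \<partial>lborel) = - (\<integral>y. \<phi> y *\<^sub>R (V y $ i) \<partial>lborel)"
      using w unfolding wpair_def by blast
    moreover have "partial i \<phi> y = partial i K (y - x)" for y
      unfolding \<phi>_def by (rule C1_translate(2)[OF C1c_C1[OF K]])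
    ultimately show ?thesis by (simp add: conv_def \<phi>_def)
  next
    assume z: "\<forall>z\<in>S. U (x + \<epsilon> *\<^sub>R z) = 0 \<and> V (x + \<epsilon> *\<^sub>R z) = 0"
    have 0: "U y = 0 \<and> V y = 0" if "y - x \<in> S'" for y
    proof -
      obtain z' where z': "z' \<in> S" "y - x = \<epsilon> *\<^sub>R z'" using \<open>y - x \<in> S'\<close> unfolding S'_def by blast
      then have "y = x + \<epsilon> *\<^sub>R z'" by (metis add.commute diff_add_cancel)
      then show ?thesis using z z' by simp
    qed
    have "partial i K (y - x) *\<^sub>R U y = 0" for y using 0[of y] pK0[of "y - x"] by (cases "y - x \<in> S'") auto
    moreover have "K (y - x) *\<^sub>R (V y $ i) = 0" for y using 0[of y] K0[of "y - x"] by (cases "y - x \<in> S'") auto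
    ultimately show ?thesis by (simp add: conv_zero)
  qed
  then show ?thesis
    unfolding eU eV conv_C1(2)[OF K U] .
qed

text \<open>The square of the Sobolev distance on \<open>\<Omega>\<close>, hence with a triangle
  inequality only up to the factor 2.\<close>

definition H1_dist :: "(real^2) set \<Rightarrow> (real^2 \<Rightarrow> complex) \<Rightarrow> (real^2 \<Rightarrow> complex) \<Rightarrow> (real^2 \<Rightarrow> complex^2) \<Rightarrow> real" where
  "H1_dist \<Omega> \<phi> U V = (\<integral>x. indicator \<Omega> x * ((norm (\<phi> x - U x))\<^sup>2 + (norm (grad \<phi> x - V x))\<^sup>2) \<partial>lborel)"

definition approximable :: "(real^2) set \<Rightarrow> (real^2 \<Rightarrow> complex) \<Rightarrow> (real^2 \<Rightarrow> complex^2) \<Rightarrow> bool" where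
  "approximable \<Omega> U V \<longleftrightarrow> (\<forall>e>0. \<exists>\<phi>\<in>C1c UNIV. H1_dist \<Omega> \<phi> U V < e)"

lemma H1_dist_integrable:
  assumes \<Omega>: "\<Omega> \<in> sets borel" and "\<phi> \<in> C1c UNIV" "L2 lborel U" "L2 lborel V"
  shows "integrable lborel (\<lambda>x. indicator \<Omega> x * ((norm (\<phi> x - U x))\<^sup>2 + (norm (grad \<phi> x - V x))\<^sup>2))"
proof -
  have "integrable lborel (\<lambda>x. (norm (\<phi> x - U x))\<^sup>2 + (norm (grad \<phi> x - V x))\<^sup>2)"
    using assms C1c_L2[OF assms(2)] by (intro Bochner_Integration.integrable_add L2_norm_square_diff_integrable)
  then have "integrable lborel (\<lambda>x. ((norm (\<phi> x - U x))\<^sup>2 + (norm (grad \<phi> x - V x))\<^sup>2) * indicator \<Omega> x)"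
    using \<Omega> by (intro integrable_real_mult_indicator) auto
  then show ?thesis by (simp only: mult.commute)
qed

lemma approximable_perturb:
  assumes \<Omega>: "\<Omega> \<in> sets borel" and L: "L2 lborel U" "L2 lborel V"
    and ap: "\<And>e. 0 < e \<Longrightarrow> \<exists>U' V'. L2 lborel U' \<and> L2 lborel V' \<and> approximable \<Omega> U' V' \<and>
      (\<integral>x. (norm (U' x - U x))\<^sup>2 \<partial>lborel) + (\<integral>x. (norm (V' x - V x))\<^sup>2 \<partial>lborel) < e"
  shows "approximable \<Omega> U V"
  unfolding approximable_def
proof (intro allI impI)
  fix e :: real assume e: "0 < e"
  then have "0 < e / 4" by simp
  from ap[OF this] obtain U' V' where L': "L2 lborel U'" "L2 lborel V'" and ap': "approximable \<Omega> U' V'"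
    and d: "(\<integral>x. (norm (U' x - U x))\<^sup>2 \<partial>lborel) + (\<integral>x. (norm (V' x - V x))\<^sup>2 \<partial>lborel) < e / 4" by blast
  from ap' \<open>0 < e / 4\<close> obtain \<phi> where \<phi>: "\<phi> \<in> C1c UNIV" "H1_dist \<Omega> \<phi> U' V' < e / 4"
    unfolding approximable_def by blast
  note I = H1_dist_integrable[OF \<Omega> \<phi>(1)]
  note J = L2_norm_square_diff_integrable[OF L'(1) L(1)] L2_norm_square_diff_integrable[OF L'(2) L(2)]
  have "H1_dist \<Omega> \<phi> U V \<le> (\<integral>x. 2 * (indicator \<Omega> x * ((norm (\<phi> x - U' x))\<^sup>2 + (norm (grad \<phi> x - V' x))\<^sup>2))
      + 2 * ((norm (U' x - U x))\<^sup>2 + (norm (V' x - V x))\<^sup>2) \<partial>lborel)"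
    unfolding H1_dist_def
  proof (rule integral_mono)
    fix x
    show "indicator \<Omega> x * ((norm (\<phi> x - U x))\<^sup>2 + (norm (grad \<phi> x - V x))\<^sup>2)
      \<le> 2 * (indicator \<Omega> x * ((norm (\<phi> x - U' x))\<^sup>2 + (norm (grad \<phi> x - V' x))\<^sup>2))
      + 2 * ((norm (U' x - U x))\<^sup>2 + (norm (V' x - V x))\<^sup>2)"
      using norm_add_square_le[of "\<phi> x - U' x" "U' x - U x"] norm_add_square_le[of "grad \<phi> x - V' x" "V' x - V x"]
      by (cases "x \<in> \<Omega>") auto
  qed (use I[OF L] I[OF L'] J in auto)
  also have "\<dots> = 2 * H1_dist \<Omega> \<phi> U' V' + 2 * ((\<integral>x. (norm (U' x - U x))\<^sup>2 \<partial>lborel) + (\<integral>x. (norm (V' x - V x))\<^sup>2 \<partial>lborel))"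
    using I[OF L'] J by (simp add: H1_dist_def)
  also have "\<dots> < e"
  proof -
    have "2 * c + 2 * s < e" if "c < e / 4" "s < e / 4" for c s using that by linarith
    then show ?thesis using \<phi>(2) d by blast
  qed
  finally show "\<exists>\<phi>\<in>C1c UNIV. H1_dist \<Omega> \<phi> U V < e" using \<phi>(1) by blast
qed

lemma grad_add: "C1 f \<Longrightarrow> C1 g \<Longrightarrow> grad (\<lambda>x. f x + g x) x = grad f x + grad g x"
  by (simp add: vec_eq_iff C1_add)

lemma grad_diff: "C1 f \<Longrightarrow> C1 g \<Longrightarrow> grad (\<lambda>x. f x - g x) x = grad f x - grad g x"
  by (simp add: vec_eq_iff C1_diff)

lemma approximable_add:
  assumes \<Omega>: "\<Omega> \<in> sets borel" and L: "L2 lborel U1" "L2 lborel V1" "L2 lborel U2" "L2 lborel V2"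
    and ap: "approximable \<Omega> U1 V1" "approximable \<Omega> U2 V2"
  shows "approximable \<Omega> (\<lambda>x. U1 x + U2 x) (\<lambda>x. V1 x + V2 x)"
  unfolding approximable_def
proof (intro allI impI)
  fix e :: real assume e: "0 < e"
  then have "0 < e / 4" by simp
  with ap obtain \<phi> \<psi> where \<phi>: "\<phi> \<in> C1c UNIV" "H1_dist \<Omega> \<phi> U1 V1 < e / 4"
    and \<psi>: "\<psi> \<in> C1c UNIV" "H1_dist \<Omega> \<psi> U2 V2 < e / 4"
    unfolding approximable_def by meson
  note I = H1_dist_integrable[OF \<Omega> \<phi>(1) L(1,2)] H1_dist_integrable[OF \<Omega> \<psi>(1) L(3,4)]
  have C: "(\<lambda>x. \<phi> x + \<psi> x) \<in> C1c UNIV" by (rule C1c_add[OF \<phi>(1) \<psi>(1)])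
  have "H1_dist \<Omega> (\<lambda>x. \<phi> x + \<psi> x) (\<lambda>x. U1 x + U2 x) (\<lambda>x. V1 x + V2 x)
      \<le> (\<integral>x. 2 * (indicator \<Omega> x * ((norm (\<phi> x - U1 x))\<^sup>2 + (norm (grad \<phi> x - V1 x))\<^sup>2))
      + 2 * (indicator \<Omega> x * ((norm (\<psi> x - U2 x))\<^sup>2 + (norm (grad \<psi> x - V2 x))\<^sup>2)) \<partial>lborel)"
    unfolding H1_dist_def
  proof (rule integral_mono)
    fix x
    have g: "grad (\<lambda>x. \<phi> x + \<psi> x) x = grad \<phi> x + grad \<psi> x"
      by (rule grad_add[OF C1c_C1[OF \<phi>(1)] C1c_C1[OF \<psi>(1)]])
    have "\<phi> x + \<psi> x - (U1 x + U2 x) = (\<phi> x - U1 x) + (\<psi> x - U2 x)"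
      "grad \<phi> x + grad \<psi> x - (V1 x + V2 x) = (grad \<phi> x - V1 x) + (grad \<psi> x - V2 x)" by simp_all
    note E = this
    show "indicator \<Omega> x * ((norm (\<phi> x + \<psi> x - (U1 x + U2 x)))\<^sup>2 + (norm (grad (\<lambda>x. \<phi> x + \<psi> x) x - (V1 x + V2 x)))\<^sup>2)
      \<le> 2 * (indicator \<Omega> x * ((norm (\<phi> x - U1 x))\<^sup>2 + (norm (grad \<phi> x - V1 x))\<^sup>2))
      + 2 * (indicator \<Omega> x * ((norm (\<psi> x - U2 x))\<^sup>2 + (norm (grad \<psi> x - V2 x))\<^sup>2))"
      unfolding g E using norm_add_square_le[of "\<phi> x - U1 x" "\<psi> x - U2 x"] norm_add_square_le[of "grad \<phi> x - V1 x" "grad \<psi> x - V2 x"]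
      by (cases "x \<in> \<Omega>") auto
  qed (use I H1_dist_integrable[OF \<Omega> C L2_add[OF L(1,3)] L2_add[OF L(2,4)]] in auto)
  also have "\<dots> = 2 * H1_dist \<Omega> \<phi> U1 V1 + 2 * H1_dist \<Omega> \<psi> U2 V2"
    using I by (simp add: H1_dist_def)
  also have "\<dots> < e" using \<psi>(2) \<phi>(2) by linarith
  finally show "\<exists>\<phi>\<in>C1c UNIV. H1_dist \<Omega> \<phi> (\<lambda>x. U1 x + U2 x) (\<lambda>x. V1 x + V2 x) < e" using C by blast
qed

text \<open>A normalised bump around any centre. The centre 0 gives the usual mollifier, another
  centre \<open>c\<close> a mollifier combined with a shift by \<open>\<epsilon> c\<close>.\<close>

lemma exists_kernel:
  fixes c :: "real^2"
  obtains k :: "real^2 \<Rightarrow> real" and R :: real where "kernel R k" "k \<in> C1c UNIV" "\<And>z. z \<notin> cball c 1 \<Longrightarrow> k z = 0"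
proof -
  obtain \<eta> :: "real^2 \<Rightarrow> real" where \<eta>: "\<eta> \<in> C1c UNIV" "\<And>x. 0 \<le> \<eta> x" "\<And>x. \<eta> x \<le> 1"
      "\<And>x. x \<in> ball c (1/2) \<Longrightarrow> \<eta> x = 1" "\<And>x. x \<notin> ball c 1 \<Longrightarrow> \<eta> x = 0"
    using exists_bump[of 1 c] by auto
  define A where "A = (\<integral>x. \<eta> x \<partial>lborel)"
  have "0 < measure lborel (ball c (1/2))" using content_ball_pos[of "1/2" c] by simp
  also have "measure lborel (ball c (1/2)) = (\<integral>x. indicator (ball c (1/2)) x \<partial>lborel)" by simp
  also have "\<dots> \<le> A" unfolding A_def
  proof (rule integral_mono)
    show "integrable lborel (indicat_real (ball c (1/2)))"
      by (intro integrable_real_indicator) (use emeasure_lborel_ball_finite in auto)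
    show "integrable lborel \<eta>" by (rule C1c_integrable[OF \<eta>(1)])
    show "indicat_real (ball c (1/2)) x \<le> \<eta> x" for x
      using \<eta>(2,4)[of x] by (cases "x \<in> ball c (1/2)") auto
  qed
  finally have A: "0 < A" .
  define k where "k x = (1 / A) *\<^sub>R \<eta> x" for x
  have k: "k \<in> C1c UNIV"
    unfolding k_def by (rule C1c_bounded_linear[OF \<eta>(1) bounded_linear_scaleR_right])
  have z: "k z = 0" if "z \<notin> cball c 1" for z
    using \<eta>(5)[of z] that by (auto simp: k_def)
  have "kernel (norm c + 1) k"
    unfolding kernel_def
  proof (intro conjI allI impI)
    show "continuous_on UNIV k" by (rule C1_continuous[OF C1c_C1[OF k]])
    show "0 \<le> k x" for x using A \<eta>(2) by (simp add: k_def)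
    show "(\<integral>x. k x \<partial>lborel) = 1" using A by (simp add: k_def A_def)
    fix x :: "real^2" assume "x \<notin> cball 0 (norm c + 1)"
    then have "x \<notin> cball c 1" using norm_triangle_ineq2[of x c] by (auto simp: dist_norm norm_minus_commute)
    then show "k x = 0" by (rule z)
  qed (simp add: add_nonneg_pos)
  with k z that show ?thesis by blast
qed

text \<open>The average at \<open>x\<close> sees the values at \<open>x + \<epsilon> z\<close> with
  \<open>z\<close> in the ball around \<open>c\<close>. Under the dichotomy the gradient of the
  averaged function is, at all points of \<open>\<Omega>\<close>, the average of \<open>V\<close>,
  so the Sobolev error is at most the sum of the two mollification errors on the whole
  plane.\<close>

lemma approximable_shift:
  assumes \<Omega>: "\<Omega> \<in> sets borel" and w: "wpair \<Omega> U V" and bdd: "\<And>x. x \<notin> cball 0 r \<Longrightarrow> U x = 0"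
    and \<delta>: "0 < \<delta>" and dich: "\<And>\<epsilon> x. 0 < \<epsilon> \<Longrightarrow> \<epsilon> < \<delta> \<Longrightarrow> x \<in> \<Omega> \<Longrightarrow>
      (\<forall>z\<in>cball c 1. x + \<epsilon> *\<^sub>R z \<in> \<Omega>) \<or> (\<forall>z\<in>cball c 1. U (x + \<epsilon> *\<^sub>R z) = 0 \<and> V (x + \<epsilon> *\<^sub>R z) = 0)"
  shows "approximable \<Omega> U V"
  unfolding approximable_def
proof (intro allI impI)
  fix e :: real assume e: "0 < e"
  obtain k R where k: "kernel R k" "k \<in> C1c UNIV" "\<And>z. z \<notin> cball c 1 \<Longrightarrow> k z = 0"
    by (rule exists_kernel) (rule that)
  have U: "L2 lborel U" and V: "L2 lborel V" using w by (auto simp: wpair_def)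
  \<comment> \<open>Square integrability and bounded support give integrability, through
    \<open>t \<le> 1 + t\<^sup>2\<close> on the ball.\<close>
  have Ui: "integrable lborel U"
  proof -
    have [measurable]: "U \<in> borel_measurable borel" using U by (simp add: L2_def)
    have int: "integrable lborel (\<lambda>x. indicator (cball 0 r) x + (norm (U x))\<^sup>2)"
    proof (intro Bochner_Integration.integrable_add integrable_real_indicator)
      show "integrable lborel (\<lambda>x. (norm (U x))\<^sup>2)" using U by (simp add: L2_def)
    qed (use emeasure_lborel_cball_finite in auto)
    show ?thesis
    proof (rule Bochner_Integration.integrable_bound[OF int])
      show "AE x in lborel. norm (U x) \<le> norm (indicator (cball 0 r) x + (norm (U x))\<^sup>2)"
      proof (intro always_eventually allI)
        fix x
        have "2 * norm (U x) \<le> 1 + (norm (U x))\<^sup>2"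
          using zero_le_power2[of "norm (U x) - 1"] by (simp add: power2_diff)
        then have "norm (U x) \<le> 1 + (norm (U x))\<^sup>2" using norm_ge_zero[of "U x"] by linarith
        then show "norm (U x) \<le> norm (indicator (cball 0 r) x + (norm (U x))\<^sup>2)"
          using bdd[of x] by (cases "x \<in> cball 0 r") auto
      qed
    qed measurable
  qed
  have e2: "0 < e / 2" using e by simp
  obtain d1 where d1: "0 < d1" "\<And>\<epsilon>. 0 < \<epsilon> \<Longrightarrow> \<epsilon> < d1 \<Longrightarrow> (\<integral>x. (norm (moll k \<epsilon> U x - U x))\<^sup>2 \<partial>lborel) < e / 2"
    using moll_tendsto[OF k(1) U e2] by blast
  obtain d2 where d2: "0 < d2" "\<And>\<epsilon>. 0 < \<epsilon> \<Longrightarrow> \<epsilon> < d2 \<Longrightarrow> (\<integral>x. (norm (moll k \<epsilon> V x - V x))\<^sup>2 \<partial>lborel) < e / 2"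
    using moll_tendsto[OF k(1) V e2] by blast
  define \<epsilon> where "\<epsilon> = min \<delta> (min d1 d2) / 2"
  have \<epsilon>: "0 < \<epsilon>" "\<epsilon> < \<delta>" "\<epsilon> < d1" "\<epsilon> < d2" using \<delta> d1(1) d2(1) by (auto simp: \<epsilon>_def)
  define \<phi> where "\<phi> = moll k \<epsilon> U"
  have Kc: "(\<lambda>w. k ((1 / \<epsilon>) *\<^sub>R w) / \<epsilon>\<^sup>2) \<in> C1c UNIV" by (rule C1c_rescale[OF k(2) \<epsilon>(1)])
  have Ub: "U \<in> borel_measurable borel" using U by (simp add: L2_def)
  have "\<phi> = conv (\<lambda>w. k ((1 / \<epsilon>) *\<^sub>R w) / \<epsilon>\<^sup>2) U"
    unfolding \<phi>_def by (rule ext, rule moll_eq_conv[OF kernel_facts(1)[OF k(1)] Ub \<epsilon>(1)])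
  then have "C1 \<phi>" using conv_C1(1)[OF Kc Ui] by simp
  moreover have "\<phi> x = 0" if x: "x \<notin> cball 0 (\<bar>r\<bar> + \<epsilon> * (norm c + 1))" for x
  proof -
    have *: "k z *\<^sub>R U (x + \<epsilon> *\<^sub>R z) = 0" for z
    proof (cases "z \<in> cball c 1")
      case True
      have "norm z \<le> norm c + 1" using True norm_triangle_ineq2[of z c] by (auto simp: dist_norm norm_minus_commute)
      then have "norm (\<epsilon> *\<^sub>R z) \<le> \<epsilon> * (norm c + 1)" using \<epsilon>(1) by simp
      then have "x + \<epsilon> *\<^sub>R z \<notin> cball 0 r"
        using x norm_triangle_ineq2[of x "- (\<epsilon> *\<^sub>R z)"] by auto
      then show ?thesis using bdd by simp
    next
      case False
      then show ?thesis using k(3) by simp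
    qed
    show ?thesis unfolding \<phi>_def moll_def * by simp
  qed
  ultimately have \<phi>C: "\<phi> \<in> C1c UNIV"
    unfolding C1c_iff using compact_cball by blast
  have gr: "grad \<phi> x = moll k \<epsilon> V x" if "x \<in> \<Omega>" for x
    unfolding vec_eq_iff grad_nth \<phi>_def
    using moll_partial[OF w Ui k(1,2) compact_cball k(3) \<epsilon>(1) dich[OF \<epsilon>(1,2) that]] by blast
  have LU: "L2 lborel (moll k \<epsilon> U)" and LV: "L2 lborel (moll k \<epsilon> V)"
    using moll_L2(1)[OF k(1) U] moll_L2(1)[OF k(1) V] \<epsilon>(1) by auto
  note J = L2_norm_square_diff_integrable[OF LU U] L2_norm_square_diff_integrable[OF LV V]
  have "H1_dist \<Omega> \<phi> U V \<le> (\<integral>x. (norm (moll k \<epsilon> U x - U x))\<^sup>2 + (norm (moll k \<epsilon> V x - V x))\<^sup>2 \<partial>lborel)"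
    unfolding H1_dist_def
  proof (rule integral_mono)
    show "integrable lborel (\<lambda>x. indicator \<Omega> x * ((norm (\<phi> x - U x))\<^sup>2 + (norm (grad \<phi> x - V x))\<^sup>2))"
      by (rule H1_dist_integrable[OF \<Omega> \<phi>C U V])
    show "indicator \<Omega> x * ((norm (\<phi> x - U x))\<^sup>2 + (norm (grad \<phi> x - V x))\<^sup>2)
        \<le> (norm (moll k \<epsilon> U x - U x))\<^sup>2 + (norm (moll k \<epsilon> V x - V x))\<^sup>2" for x
      using gr[of x] by (cases "x \<in> \<Omega>") (auto simp: \<phi>_def)
  qed (use J in auto)
  also have "\<dots> < e" using J d1(2)[OF \<epsilon>(1,3)] d2(2)[OF \<epsilon>(1,4)] by simp
  finally show "\<exists>\<phi>\<in>C1c UNIV. H1_dist \<Omega> \<phi> U V < e" using \<phi>C by blast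
qed

text \<open>The Leibniz rule, obtained by testing the given pair with
  \<open>\<phi> \<theta>\<close>, which is again an admissible test function.\<close>

lemma wpair_mult:
  fixes \<theta> :: "real^2 \<Rightarrow> real"
  assumes w: "wpair \<Omega> U V" and \<theta>: "C1 \<theta>" "\<And>x. \<bar>\<theta> x\<bar> \<le> B" "\<And>i x. \<bar>partial i \<theta> x\<bar> \<le> B"
  shows "wpair \<Omega> (\<lambda>x. \<theta> x *\<^sub>R U x) (\<lambda>x. \<theta> x *\<^sub>R V x + (\<chi> i. partial i \<theta> x *\<^sub>R U x))"
proof -
  have U: "L2 lborel U" and V: "L2 lborel V" using w by (auto simp: wpair_def)
  have [measurable]: "U \<in> borel_measurable borel" using U by (simp add: L2_def)
  have m[measurable]: "\<theta> \<in> borel_measurable borel" "partial i \<theta> \<in> borel_measurable borel" for i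
    using C1_continuous[OF \<theta>(1)] C1_partial_continuous[OF \<theta>(1)] by (auto intro: borel_measurable_continuous_onI)
  have L1: "L2 lborel (\<lambda>x. \<theta> x *\<^sub>R U x)" "L2 lborel (\<lambda>x. \<theta> x *\<^sub>R V x)" "L2 lborel (\<lambda>x. partial i \<theta> x *\<^sub>R U x)" for i
    using \<theta> by (auto intro!: L2_scaleR_bounded[OF U, of _ B] L2_scaleR_bounded[OF V, of _ B])
  have L3: "L2 lborel (\<lambda>x. \<chi> i. partial i \<theta> x *\<^sub>R U x)"
  proof (rule L2_I)
    have e: "(\<chi> i. partial i \<theta> x *\<^sub>R U x) = partial 1 \<theta> x *\<^sub>R axis 1 (U x) + partial 2 \<theta> x *\<^sub>R axis 2 (U x)" for x
      by (simp add: vec_eq_iff forall_2 axis_def)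
    have "continuous_on UNIV (\<lambda>x::complex. if j = i then x else 0)" for i j :: 2
      by (cases "j = i") (auto intro: continuous_on_id)
    then have "continuous_on UNIV (axis i :: complex \<Rightarrow> complex^2)" for i
      unfolding axis_def[abs_def] by (intro continuous_on_vec_lambda)
    then have ax: "(\<lambda>x. axis i (U x)) \<in> borel_measurable borel" for i :: 2
      by (rule borel_measurable_continuous_on) simp
    show "(\<lambda>x. \<chi> i. partial i \<theta> x *\<^sub>R U x) \<in> borel_measurable lborel"
      unfolding e using ax by measurable
    show "integrable lborel (\<lambda>x. (norm (partial 1 \<theta> x *\<^sub>R U x))\<^sup>2 + (norm (partial 2 \<theta> x *\<^sub>R U x))\<^sup>2)"
      using L1(3) by (auto simp: L2_def)
    show "(norm (\<chi> i. partial i \<theta> x *\<^sub>R U x))\<^sup>2 \<le> (norm (partial 1 \<theta> x *\<^sub>R U x))\<^sup>2 + (norm (partial 2 \<theta> x *\<^sub>R U x))\<^sup>2" for x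
      by (simp add: norm_vec_def L2_set_def sum_2)
  qed
  have "(\<integral>x. partial i \<phi> x *\<^sub>R (\<theta> x *\<^sub>R U x) \<partial>lborel)
      = - (\<integral>x. \<phi> x *\<^sub>R ((\<theta> x *\<^sub>R V x + (\<chi> i. partial i \<theta> x *\<^sub>R U x)) $ i) \<partial>lborel)" if \<phi>: "\<phi> \<in> C1c \<Omega>" for i \<phi>
  proof -
    obtain S where S: "compact S" "\<And>x. x \<notin> S \<Longrightarrow> \<phi> x = 0" "\<And>i x. x \<notin> S \<Longrightarrow> partial i \<phi> x = 0"
      using C1cE[OF \<phi>] by metis
    note C\<phi> = C1c_C1[OF \<phi>]
    have P: "(\<lambda>x. \<phi> x * \<theta> x) \<in> C1c \<Omega>" using C1c_scaleR_right[OF \<phi> \<theta>(1)] by simp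
    have pP: "partial i (\<lambda>x. \<phi> x * \<theta> x) x = \<phi> x * partial i \<theta> x + partial i \<phi> x * \<theta> x" for x
      by (rule C1_mult(2)[OF C\<phi> \<theta>(1)])
    have I1: "integrable lborel (\<lambda>x. (\<phi> x * partial i \<theta> x) *\<^sub>R U x)"
      by (rule L2_integrable_mult_compact_support[OF U _ S(1)])
        (use S in \<open>auto intro!: continuous_intros C1_continuous[OF C\<phi>] C1_partial_continuous[OF \<theta>(1)]\<close>)
    have I2: "integrable lborel (\<lambda>x. (partial i \<phi> x * \<theta> x) *\<^sub>R U x)"
      by (rule L2_integrable_mult_compact_support[OF U _ S(1)])
        (use S in \<open>auto intro!: continuous_intros C1_partial_continuous[OF C\<phi>] C1_continuous[OF \<theta>(1)]\<close>)
    have I3: "integrable lborel (\<lambda>x. (\<phi> x * \<theta> x) *\<^sub>R (V x $ i))"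
      by (rule L2_integrable_mult_compact_support[OF L2_vec_nth[OF V] _ S(1)])
        (use S in \<open>auto intro!: continuous_intros C1_continuous[OF C\<phi>] C1_continuous[OF \<theta>(1)]\<close>)
    have "(\<integral>x. (\<phi> x * partial i \<theta> x) *\<^sub>R U x \<partial>lborel) + (\<integral>x. (partial i \<phi> x * \<theta> x) *\<^sub>R U x \<partial>lborel)
        = (\<integral>x. partial i (\<lambda>x. \<phi> x * \<theta> x) x *\<^sub>R U x \<partial>lborel)"
      unfolding pP scaleR_add_left using I1 I2 by simp
    also have "\<dots> = - (\<integral>x. (\<phi> x * \<theta> x) *\<^sub>R (V x $ i) \<partial>lborel)"
      using w P unfolding wpair_def by blast
    finally have *: "(\<integral>x. (partial i \<phi> x * \<theta> x) *\<^sub>R U x \<partial>lborel)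
        = - ((\<integral>x. (\<phi> x * \<theta> x) *\<^sub>R (V x $ i) \<partial>lborel) + (\<integral>x. (\<phi> x * partial i \<theta> x) *\<^sub>R U x \<partial>lborel))"
      by (simp add: algebra_simps eq_neg_iff_add_eq_0)
    have "(\<lambda>x. \<phi> x *\<^sub>R ((\<theta> x *\<^sub>R V x + (\<chi> i. partial i \<theta> x *\<^sub>R U x)) $ i))
        = (\<lambda>x. (\<phi> x * \<theta> x) *\<^sub>R (V x $ i) + (\<phi> x * partial i \<theta> x) *\<^sub>R U x)"
      by (simp add: fun_eq_iff scaleR_add_right)
    then show ?thesis using * I1 I3 by simp
  qed
  then show ?thesis
    unfolding wpair_def using L1 L2_add[OF L1(2) L3] w
    by (auto simp: wpair_def vec_eq_iff)
qed

section \<open>Arc length on graphs\<close>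

locale graph_frame =
  fixes a b :: "real^2" and g g' :: "real \<Rightarrow> real"
  assumes frame: "frame a b"
    and g: "(g has_real_derivative g' t) (at t)"
    and g': "continuous_on UNIV g'"
begin

definition \<gamma> :: "real \<Rightarrow> real^2" where "\<gamma> t = t *\<^sub>R a + g t *\<^sub>R b"

text \<open>Half-open in the first coordinate, so that consecutive arcs are disjoint and arc
  integrals add up exactly.\<close>

definition arc :: "real \<Rightarrow> real \<Rightarrow> (real^2) set" where
  "arc A B = {x. x \<bullet> b = g (x \<bullet> a) \<and> A \<le> x \<bullet> a \<and> x \<bullet> a < B}"

lemmas ab = frame_inner[OF frame]

lemma g_continuous: "continuous_on S g"
  by (meson DERIV_continuous_on DERIV_subset g has_field_derivative_at_within)

lemma \<gamma>_continuous: "continuous_on S \<gamma>"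
  unfolding \<gamma>_def by (intro continuous_intros g_continuous)

lemma \<gamma>_inner: "\<gamma> t \<bullet> a = t" "\<gamma> t \<bullet> b = g t"
  by (simp_all add: \<gamma>_def inner_simps ab)

lemma on_graph: "x \<bullet> b = g (x \<bullet> a) \<Longrightarrow> x = \<gamma> (x \<bullet> a)"
  using frame_expansion[OF frame, of x] by (simp add: \<gamma>_def)

lemma arc_eq: "arc A B = \<gamma> ` {A..<B}"
proof
  show "arc A B \<subseteq> \<gamma> ` {A..<B}"
  proof
    fix x assume "x \<in> arc A B"
    then have "x = \<gamma> (x \<bullet> a)" "x \<bullet> a \<in> {A..<B}" by (auto simp: arc_def intro: on_graph)
    then show "x \<in> \<gamma> ` {A..<B}" by (rule image_eqI)
  qed
qed (auto simp: arc_def \<gamma>_inner)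

lemma arc_borel [measurable]: "arc A B \<in> sets borel"
proof -
  have [measurable]: "g \<in> borel_measurable borel"
    by (rule borel_measurable_continuous_onI[OF g_continuous])
  show ?thesis unfolding arc_def by measurable
qed

lemma frame_norm_square: "(norm (s *\<^sub>R a + t *\<^sub>R b))\<^sup>2 = s\<^sup>2 + t\<^sup>2"
  by (simp add: power2_norm_eq_inner inner_simps ab) (simp add: power2_eq_square)

lemma frame_norm_le: "norm (s *\<^sub>R a + t *\<^sub>R b) \<le> \<bar>s\<bar> + \<bar>t\<bar>"
  using norm_triangle_ineq[of "s *\<^sub>R a" "t *\<^sub>R b"] frame by (simp add: frame_def)

lemma slope_bounded:
  obtains G where "0 \<le> G" "\<And>t. t \<in> {A..B} \<Longrightarrow> \<bar>g' t\<bar> \<le> G"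
proof -
  have "bounded (g' ` {A..B})"
    by (intro compact_imp_bounded compact_continuous_image continuous_on_subset[OF g']) auto
  then obtain G where G: "\<And>t. t \<in> {A..B} \<Longrightarrow> \<bar>g' t\<bar> \<le> G"
    unfolding bounded_iff real_norm_def by blast
  have "\<bar>g' t\<bar> \<le> \<bar>G\<bar>" if "t \<in> {A..B}" for t using G[OF that] by simp
  then show ?thesis using that[of "\<bar>G\<bar>"] by simp
qed

lemma g_mvt:
  assumes "s < t" obtains z where "s < z" "z < t" "g t - g s = (t - s) * g' z"
  using MVT2[OF assms, of g g'] g by blast

lemma g_lipschitz:
  assumes G: "\<And>t. t \<in> {A..B} \<Longrightarrow> \<bar>g' t\<bar> \<le> G" and "s \<in> {A..B}" "t \<in> {A..B}"
  shows "\<bar>g s - g t\<bar> \<le> G * \<bar>s - t\<bar>"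
proof -
  have *: "\<bar>g v - g u\<bar> \<le> G * \<bar>v - u\<bar>" if uv: "u < v" "u \<in> {A..B}" "v \<in> {A..B}" for u v
  proof -
    obtain z where z: "u < z" "z < v" "g v - g u = (v - u) * g' z" using g_mvt[OF uv(1)] by blast
    have "\<bar>v - u\<bar> * \<bar>g' z\<bar> \<le> \<bar>v - u\<bar> * G" using z uv by (intro mult_left_mono G) auto
    then show ?thesis unfolding z(3) abs_mult by (simp add: mult.commute)
  qed
  show ?thesis using *[of s t] *[of t s] assms(2,3)
    by (cases s t rule: linorder_cases) (auto simp: abs_minus_commute)
qed

lemma \<gamma>_lipschitz:
  assumes G: "\<And>t. t \<in> {A..B} \<Longrightarrow> \<bar>g' t\<bar> \<le> G" and st: "s \<in> {A..B}" "t \<in> {A..B}"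
  shows "dist (\<gamma> s) (\<gamma> t) \<le> (1 + G) * \<bar>s - t\<bar>"
proof -
  have "\<gamma> s - \<gamma> t = (s - t) *\<^sub>R a + (g s - g t) *\<^sub>R b" by (simp add: \<gamma>_def algebra_simps)
  then have "dist (\<gamma> s) (\<gamma> t) \<le> \<bar>s - t\<bar> + \<bar>g s - g t\<bar>"
    using frame_norm_le[of "s - t" "g s - g t"] by (simp add: dist_norm)
  also have "\<dots> \<le> (1 + G) * \<bar>s - t\<bar>" using g_lipschitz[OF G st] by (simp add: distrib_right)
  finally show ?thesis .
qed

text \<open>The constant \<open>1 + G\<close> is not the sharp one, but it is used only for
  finiteness, for the trace inequality and for error terms.\<close>

lemma arc_measure_le:
  assumes G: "\<And>t. t \<in> {A..B} \<Longrightarrow> \<bar>g' t\<bar> \<le> G" "0 \<le> G" and st: "A \<le> s" "s < t" "t \<le> B"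
  shows "emeasure hausdorff1 (arc s t) \<le> ennreal ((1 + G) * (t - s))"
proof -
  have "hausdorff1_outer (\<gamma> ` {s..<t}) \<le> ennreal ((1 + G) * (t - s))"
    by (rule hausdorff1_outer_lipschitz_arc[OF st(2)])
      (use G st in \<open>auto intro!: \<gamma>_lipschitz[OF G(1)]\<close>)
  then show ?thesis by (simp add: emeasure_hausdorff1 arc_eq[symmetric])
qed

lemma arc_finite: "emeasure hausdorff1 (arc A B) < \<infinity>"
proof (cases "A < B")
  case True
  obtain G where "0 \<le> G" "\<And>t. t \<in> {A..B} \<Longrightarrow> \<bar>g' t\<bar> \<le> G" using slope_bounded by blast
  then show ?thesis using arc_measure_le[of A B G A B] True by (simp add: le_less_trans)
next
  case False
  then have "arc A B = {}" by (auto simp: arc_def)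
  then show ?thesis by simp
qed

text \<open>Connected sets are at least as long as their chords. As the arc omits its right end
  point, the bound is proved for \<open>u < t\<close> and passes to the limit.\<close>

lemma arc_measure_ge:
  assumes "s < t"
  shows "dist (\<gamma> s) (\<gamma> t) \<le> measure hausdorff1 (arc s t)"
proof -
  have 1: "dist (\<gamma> s) (\<gamma> u) \<le> measure hausdorff1 (arc s t)" if u: "s < u" "u < t" for u
  proof -
    have "connected (arc s t)"
      unfolding arc_eq by (intro connected_continuous_image \<gamma>_continuous) simp
    then have "ennreal (dist (\<gamma> s) (\<gamma> u)) \<le> hausdorff1_outer (arc s t)"
      by (rule hausdorff1_outer_connected) (use u in \<open>auto simp: arc_eq\<close>)
    then have "ennreal (dist (\<gamma> s) (\<gamma> u)) \<le> ennreal (measure hausdorff1 (arc s t))"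
      using arc_finite[of s t] by (simp add: emeasure_hausdorff1[symmetric] emeasure_eq_ennreal_measure)
    then show ?thesis by simp
  qed
  have "((\<lambda>u. dist (\<gamma> s) (\<gamma> u)) \<longlongrightarrow> dist (\<gamma> s) (\<gamma> t)) (at_left t)"
    using \<gamma>_continuous[of UNIV] by (intro tendsto_intros) (auto simp: continuous_on_def intro: tendsto_within_subset)
  moreover have "\<forall>\<^sub>F u in at_left t. dist (\<gamma> s) (\<gamma> u) \<le> measure hausdorff1 (arc s t)"
    unfolding eventually_at_left_field using assms 1 by blast
  ultimately show ?thesis by (intro tendsto_upperbound[of _ _ "at_left t"]) auto
qed

lemma arc_integrable:
  fixes \<psi> :: "real^2 \<Rightarrow> real"
  assumes \<psi>: "continuous_on UNIV \<psi>"
  shows "integrable hausdorff1 (\<lambda>x. indicator (arc s t) x * \<psi> x)"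
proof -
  have [measurable]: "\<psi> \<in> borel_measurable borel" using \<psi> by (rule borel_measurable_continuous_onI)
  have "bounded (\<psi> ` \<gamma> ` {s..t})"
    by (intro compact_imp_bounded compact_continuous_image \<gamma>_continuous continuous_on_subset[OF \<psi>]) auto
  then obtain B where B: "\<And>u. u \<in> {s..t} \<Longrightarrow> \<bar>\<psi> (\<gamma> u)\<bar> \<le> B"
    unfolding bounded_iff real_norm_def by blast
  have i: "integrable hausdorff1 (\<lambda>x. B * indicator (arc s t) x)"
    by (intro integrable_mult_right integrable_real_indicator) (use arc_finite in auto)
  show ?thesis
  proof (rule Bochner_Integration.integrable_bound[OF i])
    show "AE x in hausdorff1. norm (indicator (arc s t) x * \<psi> x) \<le> norm (B * indicator (arc s t) x)"
    proof (intro always_eventually allI)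
      fix x
      show "norm (indicator (arc s t) x * \<psi> x) \<le> norm (B * indicator (arc s t) x)"
      proof (cases "x \<in> arc s t")
        case True
        then obtain u where "u \<in> {s..<t}" "x = \<gamma> u" unfolding arc_eq by blast
        then have "\<bar>\<psi> x\<bar> \<le> B" using B[of u] by auto
        then show ?thesis using True by simp
      qed simp
    qed
  qed measurable
qed

definition arc_int :: "(real^2 \<Rightarrow> real) \<Rightarrow> real \<Rightarrow> real \<Rightarrow> real" where
  "arc_int \<psi> s t = (\<integral>x. indicator (arc s t) x * \<psi> x \<partial>hausdorff1)"

lemma arc_int_combine:
  assumes "continuous_on UNIV \<psi>" "s \<le> t" "t \<le> u"
  shows "arc_int \<psi> s u = arc_int \<psi> s t + arc_int \<psi> t u"
proof -
  have "indicator (arc s u) x * \<psi> x = indicator (arc s t) x * \<psi> x + indicator (arc t u) x * \<psi> x" for x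
    using assms(2,3) by (auto simp: arc_def indicator_def)
  then show ?thesis unfolding arc_int_def
    using arc_integrable[OF assms(1)] by (simp add: Bochner_Integration.integral_add)
qed

lemma arc_int_bounds:
  assumes \<psi>: "continuous_on UNIV \<psi>" and c: "\<And>u. u \<in> {s..<t} \<Longrightarrow> l \<le> \<psi> (\<gamma> u) \<and> \<psi> (\<gamma> u) \<le> c"
  shows "l * measure hausdorff1 (arc s t) \<le> arc_int \<psi> s t" "arc_int \<psi> s t \<le> c * measure hausdorff1 (arc s t)"
proof -
  have i: "integrable hausdorff1 (\<lambda>x. B * indicator (arc s t) x)" for B :: real
    by (intro integrable_mult_right integrable_real_indicator) (use arc_finite in auto)
  have v: "(\<integral>x. B * indicator (arc s t) x \<partial>hausdorff1) = B * measure hausdorff1 (arc s t)" for B :: real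
    by simp
  have *: "l \<le> \<psi> x \<and> \<psi> x \<le> c" if "x \<in> arc s t" for x using that c unfolding arc_eq by blast
  show "l * measure hausdorff1 (arc s t) \<le> arc_int \<psi> s t"
    unfolding arc_int_def v[symmetric] by (intro integral_mono i arc_integrable \<psi>) (use * in \<open>auto simp: indicator_def\<close>)
  show "arc_int \<psi> s t \<le> c * measure hausdorff1 (arc s t)"
    unfolding arc_int_def v[symmetric] by (intro integral_mono i arc_integrable \<psi>) (use * in \<open>auto simp: indicator_def\<close>)
qed

end

text \<open>Takes the place of a derivative that is nowhere positive, for functions whose
  differentiability is not known: the increments over \<open>n\<close> equal short pieces are
  summed. It lets arc integrals be compared with Lebesgue integrals by a look at short arcs
  only.\<close>

lemma nonincreasing_of_small_increments:
  fixes f :: "real \<Rightarrow> real"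
  assumes AB: "A < B" and C: "0 \<le> C"
    and inc: "\<And>e. 0 < e \<Longrightarrow> \<exists>\<delta>>0. \<forall>s t. A \<le> s \<and> s < t \<and> t \<le> B \<and> t - s < \<delta> \<longrightarrow> f t - f s \<le> C * e * (t - s)"
  shows "f B \<le> f A"
proof (rule field_le_epsilon)
  fix e0 :: real assume e0: "0 < e0"
  \<comment> \<open>The summand 1 keeps the denominator positive when \<open>C = 0\<close>.\<close>
  define e where "e = e0 / ((C + 1) * (B - A))"
  have e: "0 < e" using e0 C AB by (simp add: e_def)
  have "C * e * (B - A) \<le> (C + 1) * e * (B - A)" using e AB by (intro mult_right_mono) auto
  also have "\<dots> = e0" using C AB by (simp add: e_def add_nonneg_eq_0_iff)
  finally have eC: "C * e * (B - A) \<le> e0" .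
  obtain \<delta> where \<delta>: "0 < \<delta>" "\<And>s t. A \<le> s \<Longrightarrow> s < t \<Longrightarrow> t \<le> B \<Longrightarrow> t - s < \<delta> \<Longrightarrow> f t - f s \<le> C * e * (t - s)"
    using inc[OF e] by blast
  obtain n :: nat where n: "(B - A) / \<delta> < real n" using reals_Archimedean2 by blast
  have "0 < (B - A) / \<delta>" using AB \<delta> by simp
  then have n0: "0 < real n" using n by linarith
  define h where "h = (B - A) / n"
  have h: "0 < h" "h < \<delta>" "real n * h = B - A"
    using AB n0 n \<delta>(1) by (auto simp: h_def field_simps)
  have "f (A + real k * h) - f A \<le> C * e * (real k * h)" if "k \<le> n" for k
    using that
  proof (induction k)
    case (Suc k)
    have "real (Suc k) * h \<le> real n * h" using Suc.prems h(1) by (intro mult_right_mono) auto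
    then have le: "A + real (Suc k) * h \<le> B" using h(3) by simp
    have "f (A + real (Suc k) * h) - f (A + real k * h) \<le> C * e * ((A + real (Suc k) * h) - (A + real k * h))"
      using h(1,2) by (intro \<delta>(2) le) (auto simp: algebra_simps)
    also have "\<dots> = C * e * h" by (simp add: algebra_simps)
    finally show ?case using Suc by (simp add: algebra_simps)
  qed simp
  from this[of n] h(3) eC show "f B \<le> f A + e0" by simp
qed

context graph_frame
begin

lemma compose_uniformly_continuous:
  fixes h :: "real \<Rightarrow> 'c::metric_space"
  assumes "continuous_on {A..B} h" "0 < e"
  obtains d where "0 < d" "\<And>s t. s \<in> {A..B} \<Longrightarrow> t \<in> {A..B} \<Longrightarrow> \<bar>s - t\<bar> < d \<Longrightarrow> dist (h s) (h t) \<le> e"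
proof -
  have "uniformly_continuous_on {A..B} h" by (rule compact_uniformly_continuous[OF assms(1)]) simp
  then obtain d where "d > 0" "\<forall>x\<in>{A..B}. \<forall>x'\<in>{A..B}. dist x' x < d \<longrightarrow> dist (h x') (h x) < e"
    unfolding uniformly_continuous_on_def using assms(2) by blast
  then show ?thesis using that[of d] by (auto simp: dist_real_def less_imp_le)
qed

text \<open>An integral over a short interval is its length times a value of the integrand at an
  intermediate point, the form in which increments are compared below.\<close>

lemma antiderivative:
  assumes AB: "A < B" and j: "continuous_on UNIV j"
  obtains J where "J B - J A = (\<integral>t. indicator {A..B} t * j t \<partial>lborel)"
    "\<And>s t. A \<le> s \<Longrightarrow> s < t \<Longrightarrow> t \<le> B \<Longrightarrow> \<exists>z. s < z \<and> z < t \<and> J t - J s = (t - s) * (j z :: real)"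
proof -
  obtain J where J: "\<And>t. t \<in> {A..B} \<Longrightarrow> (J has_vector_derivative j t) (at t within {A..B})"
    using antiderivative_continuous[OF continuous_on_subset[OF j]] by blast
  have "(\<integral>t. indicator {A..B} t *\<^sub>R j t \<partial>lborel) = J B - J A"
    by (rule integral_FTC_atLeastAtMost) (use AB J continuous_on_subset[OF j] in auto)
  moreover have "\<exists>z. s < z \<and> z < t \<and> J t - J s = (t - s) * j z" if st: "A \<le> s" "s < t" "t \<le> B" for s t
  proof -
    have "continuous_on {A..B} J" by (rule continuous_on_vector_derivative[OF J])
    then have c: "continuous_on {s..t} J" by (rule continuous_on_subset) (use st in auto)
    have d: "(J has_real_derivative j z) (at z)" if "s < z" "z < t" for z
    proof -
      have "(J has_vector_derivative j z) (at z within {A<..<B})"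
        using J[of z] that st by (auto intro: has_vector_derivative_within_subset)
      then show ?thesis
        using that st by (simp add: has_real_derivative_iff_has_vector_derivative at_within_open[of z "{A<..<B}"])
    qed
    show ?thesis
    proof -
      have "J differentiable (at z)" if "s < z" "z < t" for z
        using d[OF that] unfolding real_differentiable_def by blast
      then obtain l z where z: "s < z" "z < t" "DERIV J z :> l" "J t - J s = (t - s) * l"
        using MVT[OF st(2) c] by blast
      have "l = j z" by (rule DERIV_unique[OF z(3) d[OF z(1,2)]])
      then show ?thesis using z by blast
    qed
  qed
  ultimately show ?thesis using that by auto
qed

lemma arc_int_le:
  assumes \<psi>: "continuous_on UNIV \<psi>" and pos: "\<And>x. 0 \<le> \<psi> x" and AB: "A < B"
    and G: "\<And>t. t \<in> {A..B} \<Longrightarrow> \<bar>g' t\<bar> \<le> G" "0 \<le> G"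
  shows "arc_int \<psi> A B \<le> (1 + G) * (\<integral>t. indicator {A..B} t * \<psi> (\<gamma> t) \<partial>lborel)"
proof -
  have c: "continuous_on S (\<lambda>t. \<psi> (\<gamma> t))" for S
    by (intro continuous_on_compose2[OF \<psi> \<gamma>_continuous]) auto
  obtain J where J: "J B - J A = (\<integral>t. indicator {A..B} t * \<psi> (\<gamma> t) \<partial>lborel)"
    "\<And>s t. A \<le> s \<Longrightarrow> s < t \<Longrightarrow> t \<le> B \<Longrightarrow> \<exists>z. s < z \<and> z < t \<and> J t - J s = (t - s) * \<psi> (\<gamma> z)"
    using antiderivative[OF AB c] by blast
  define f where "f t = arc_int \<psi> A t - (1 + G) * J t" for t
  have "f B \<le> f A"
  \<comment> \<open>The oscillation \<open>e\<close> of the integrand enters twice: from the points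
    of the arc to its initial point, and from there to the intermediate point
    \<open>z\<close>.\<close>
  proof (rule nonincreasing_of_small_increments[OF AB, of "2 * (1 + G)"])
    fix e :: real assume e: "0 < e"
    obtain d where d: "0 < d" "\<And>s t. s \<in> {A..B} \<Longrightarrow> t \<in> {A..B} \<Longrightarrow> \<bar>s - t\<bar> < d \<Longrightarrow> dist (\<psi> (\<gamma> s)) (\<psi> (\<gamma> t)) \<le> e"
      using compose_uniformly_continuous[OF c e] by blast
    have "f t - f s \<le> 2 * (1 + G) * e * (t - s)" if st: "A \<le> s" "s < t" "t \<le> B" "t - s < d" for s t
    proof -
      obtain z where z: "s < z" "z < t" "J t - J s = (t - s) * \<psi> (\<gamma> z)" using J(2) st by blast
      have near: "\<bar>\<psi> (\<gamma> u) - \<psi> (\<gamma> s)\<bar> \<le> e" if "u \<in> {s..<t}" for u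
        using d(2)[of u s] that st by (simp add: dist_real_def)
      have "arc_int \<psi> s t \<le> (\<psi> (\<gamma> s) + e) * measure hausdorff1 (arc s t)"
      proof (rule arc_int_bounds(2)[OF \<psi>, of _ _ "\<psi> (\<gamma> s) - e"])
        fix u assume "u \<in> {s..<t}"
        then show "\<psi> (\<gamma> s) - e \<le> \<psi> (\<gamma> u) \<and> \<psi> (\<gamma> u) \<le> \<psi> (\<gamma> s) + e"
          using near[of u] by linarith
      qed
      also have "\<dots> \<le> (\<psi> (\<gamma> s) + e) * ((1 + G) * (t - s))"
      proof (rule mult_left_mono)
        have "ennreal (measure hausdorff1 (arc s t)) \<le> ennreal ((1 + G) * (t - s))"
          using arc_measure_le[OF G st(1,2,3)] arc_finite[of s t] by (simp add: emeasure_eq_ennreal_measure)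
        then show "measure hausdorff1 (arc s t) \<le> (1 + G) * (t - s)"
          using G(2) st(2) by (simp add: ennreal_le_iff)
      qed (use pos[of "\<gamma> s"] e in simp)
      also have "\<dots> \<le> (\<psi> (\<gamma> z) + 2 * e) * ((1 + G) * (t - s))"
        using near[of z] z G(2) st(2) by (intro mult_right_mono) auto
      finally have "arc_int \<psi> s t \<le> (\<psi> (\<gamma> z) + 2 * e) * ((1 + G) * (t - s))" .
      moreover have "arc_int \<psi> A t = arc_int \<psi> A s + arc_int \<psi> s t"
        using st by (intro arc_int_combine[OF \<psi>]) auto
      moreover have "(1 + G) * J t - (1 + G) * J s = (1 + G) * ((t - s) * \<psi> (\<gamma> z))"
        unfolding z(3)[symmetric] by (simp add: algebra_simps)
      moreover have "(\<psi> (\<gamma> z) + 2 * e) * ((1 + G) * (t - s)) = (1 + G) * ((t - s) * \<psi> (\<gamma> z)) + 2 * (1 + G) * e * (t - s)"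
        by (simp add: algebra_simps)
      ultimately show ?thesis unfolding f_def by linarith
    qed
    with d(1) show "\<exists>\<delta>>0. \<forall>s t. A \<le> s \<and> s < t \<and> t \<le> B \<and> t - s < \<delta> \<longrightarrow> f t - f s \<le> 2 * (1 + G) * e * (t - s)" by blast
  qed (use G in simp)
  moreover have "arc_int \<psi> A A = 0" by (simp add: arc_int_def arc_def)
  ultimately show ?thesis unfolding f_def J(1)[symmetric] by (simp add: algebra_simps)
qed

text \<open>On a short arc the flux is nearly the scalar product of \<open>X\<close> with the rotated chord, and the
  chord is no longer than the arc.\<close>

lemma flux_le_arc_int:
  fixes X :: "real^2 \<Rightarrow> real^2"
  assumes X: "continuous_on UNIV X" and AB: "A < B"
  shows "(\<integral>t. indicator {A..B} t * (X (\<gamma> t) \<bullet> (b - g' t *\<^sub>R a)) \<partial>lborel) \<le> arc_int (\<lambda>x. norm (X x)) A B"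
proof -
  let ?\<psi> = "\<lambda>x. norm (X x)"
  have \<psi>: "continuous_on UNIV ?\<psi>" by (intro continuous_intros X)
  have cX: "continuous_on S (\<lambda>t. X (\<gamma> t))" for S
    by (intro continuous_on_compose2[OF X \<gamma>_continuous]) auto
  have cg': "continuous_on S g'" for S by (rule continuous_on_subset[OF g']) simp
  have c: "continuous_on S (\<lambda>t. X (\<gamma> t) \<bullet> (b - g' t *\<^sub>R a))" for S
    by (intro continuous_intros cX cg')
  obtain G where G: "0 \<le> G" "\<And>t. t \<in> {A..B} \<Longrightarrow> \<bar>g' t\<bar> \<le> G" using slope_bounded by blast
  have "bounded (X ` \<gamma> ` {A..B})"
    by (intro compact_imp_bounded compact_continuous_image \<gamma>_continuous continuous_on_subset[OF X]) auto
  then obtain N0 where N0: "\<And>t. t \<in> {A..B} \<Longrightarrow> norm (X (\<gamma> t)) \<le> N0"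
    unfolding bounded_iff by blast
  define N where "N = \<bar>N0\<bar>"
  have N: "0 \<le> N" "\<And>t. t \<in> {A..B} \<Longrightarrow> norm (X (\<gamma> t)) \<le> N"
    using N0 unfolding N_def by (simp, meson abs_ge_self order_trans)
  obtain J where J: "J B - J A = (\<integral>t. indicator {A..B} t * (X (\<gamma> t) \<bullet> (b - g' t *\<^sub>R a)) \<partial>lborel)"
    "\<And>s t. A \<le> s \<Longrightarrow> s < t \<Longrightarrow> t \<le> B \<Longrightarrow> \<exists>z. s < z \<and> z < t \<and> J t - J s = (t - s) * (X (\<gamma> z) \<bullet> (b - g' z *\<^sub>R a))"
    using antiderivative[OF AB c] by blast
  define f where "f t = J t - arc_int ?\<psi> A t" for t
  have "f B \<le> f A"
  proof (rule nonincreasing_of_small_increments[OF AB, of "2 * (1 + G) + N"])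
    fix e :: real assume e: "0 < e"
    obtain d1 where d1: "0 < d1" "\<And>s t. s \<in> {A..B} \<Longrightarrow> t \<in> {A..B} \<Longrightarrow> \<bar>s - t\<bar> < d1 \<Longrightarrow> dist (X (\<gamma> s)) (X (\<gamma> t)) \<le> e"
      using compose_uniformly_continuous[OF cX e] by blast
    obtain d2 where d2: "0 < d2" "\<And>s t. s \<in> {A..B} \<Longrightarrow> t \<in> {A..B} \<Longrightarrow> \<bar>s - t\<bar> < d2 \<Longrightarrow> dist (g' s) (g' t) \<le> e"
      using compose_uniformly_continuous[OF cg' e] by blast
    define d where "d = min d1 d2"
    have "f t - f s \<le> (2 * (1 + G) + N) * e * (t - s)" if st: "A \<le> s" "s < t" "t \<le> B" "t - s < d" for s t
    proof -
      define m where "m = measure hausdorff1 (arc s t)"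
      obtain z where z: "s < z" "z < t" "J t - J s = (t - s) * (X (\<gamma> z) \<bullet> (b - g' z *\<^sub>R a))" using J(2) st by blast
      obtain y where y: "s < y" "y < t" "g t - g s = (t - s) * g' y" using g_mvt[OF st(2)] by blast
      have m_le: "m \<le> (1 + G) * (t - s)"
      proof -
        have "ennreal m \<le> ennreal ((1 + G) * (t - s))"
          using arc_measure_le[OF G(2,1) st(1,2,3)] arc_finite[of s t] by (simp add: m_def emeasure_eq_ennreal_measure)
        then show ?thesis using G(1) st(2) by (simp add: ennreal_le_iff)
      qed
      have m_ge: "norm ((t - s) *\<^sub>R b - (g t - g s) *\<^sub>R a) \<le> m"
      proof -
        have "norm ((t - s) *\<^sub>R b - (g t - g s) *\<^sub>R a) = norm ((t - s) *\<^sub>R a + (g t - g s) *\<^sub>R b)"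
        proof -
          have "(norm ((t - s) *\<^sub>R b - (g t - g s) *\<^sub>R a))\<^sup>2 = (norm ((t - s) *\<^sub>R a + (g t - g s) *\<^sub>R b))\<^sup>2"
            using frame_norm_square[of "- (g t - g s)" "t - s"] frame_norm_square[of "t - s" "g t - g s"]
            by (simp add: algebra_simps power2_commute[of "g s"])
          then show ?thesis by (rule power2_eq_imp_eq) auto
        qed
        also have "(t - s) *\<^sub>R a + (g t - g s) *\<^sub>R b = \<gamma> t - \<gamma> s" by (simp add: \<gamma>_def algebra_simps)
        also have "norm (\<gamma> t - \<gamma> s) \<le> m"
          using arc_measure_ge[OF st(2)] by (simp add: m_def dist_norm norm_minus_commute)
        finally show ?thesis .
      qed
      have near: "norm (X (\<gamma> u) - X (\<gamma> s)) \<le> e" if "u \<in> {s..t}" for u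
        using d1(2)[of u s] that st by (simp add: dist_norm d_def)
      have "(norm (X (\<gamma> s)) - e) * m \<le> arc_int ?\<psi> s t"
        unfolding m_def
      proof (rule arc_int_bounds(1)[OF \<psi>, of _ _ _ "norm (X (\<gamma> s)) + e"])
        fix u assume "u \<in> {s..<t}"
        then have "norm (X (\<gamma> u) - X (\<gamma> s)) \<le> e" by (intro near) auto
        then show "norm (X (\<gamma> s)) - e \<le> norm (X (\<gamma> u)) \<and> norm (X (\<gamma> u)) \<le> norm (X (\<gamma> s)) + e"
          using norm_triangle_ineq3[of "X (\<gamma> u)" "X (\<gamma> s)"] by (simp add: abs_le_iff)
      qed
      moreover have "e * m \<le> e * ((1 + G) * (t - s))" using m_le e by (intro mult_left_mono) auto
      ultimately have low: "norm (X (\<gamma> s)) * m \<le> arc_int ?\<psi> s t + (1 + G) * e * (t - s)"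
        by (simp add: algebra_simps)
      \<comment> \<open>By the choice of \<open>y\<close> the rotated chord is
        \<open>(t - s)\<close> times \<open>b - g' y *\<^sub>R a\<close>. What remains after pairing
        it with \<open>X (\<gamma> s)\<close> is the oscillation of the slope between
        \<open>y\<close> and \<open>z\<close> and that of \<open>X\<close> between \<open>s\<close>
        and \<open>z\<close>.\<close>
      have "(t - s) * (X (\<gamma> z) \<bullet> (b - g' z *\<^sub>R a)) =
          X (\<gamma> s) \<bullet> ((t - s) *\<^sub>R b - (g t - g s) *\<^sub>R a)
          + (t - s) * ((g' y - g' z) * (X (\<gamma> s) \<bullet> a) + (X (\<gamma> z) - X (\<gamma> s)) \<bullet> (b - g' z *\<^sub>R a))"
        unfolding y(3) by (simp add: inner_simps algebra_simps)
      also have "\<dots> \<le> norm (X (\<gamma> s)) * m + (t - s) * (e * N + e * (1 + G))"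
      proof (intro add_mono mult_left_mono)
        have "X (\<gamma> s) \<bullet> ((t - s) *\<^sub>R b - (g t - g s) *\<^sub>R a) \<le> norm (X (\<gamma> s)) * norm ((t - s) *\<^sub>R b - (g t - g s) *\<^sub>R a)"
          by (rule norm_cauchy_schwarz)
        also have "\<dots> \<le> norm (X (\<gamma> s)) * m" by (intro mult_left_mono m_ge) auto
        finally show "X (\<gamma> s) \<bullet> ((t - s) *\<^sub>R b - (g t - g s) *\<^sub>R a) \<le> norm (X (\<gamma> s)) * m" .
        have "\<bar>y - z\<bar> < d2" using y(1,2) z(1,2) st(4) by (auto simp: d_def)
        then have "\<bar>g' y - g' z\<bar> \<le> e" using d2(2)[of y z] y(1,2) z(1,2) st by (simp add: dist_real_def)
        moreover have "\<bar>X (\<gamma> s) \<bullet> a\<bar> \<le> N"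
          using Cauchy_Schwarz_ineq2[of "X (\<gamma> s)" a] N(2)[of s] frame st by (simp add: frame_def)
        ultimately have "\<bar>g' y - g' z\<bar> * \<bar>X (\<gamma> s) \<bullet> a\<bar> \<le> e * N" using e by (intro mult_mono) auto
        then show "(g' y - g' z) * (X (\<gamma> s) \<bullet> a) \<le> e * N"
          by (metis abs_le_D1 abs_mult)
        have "norm (b - g' z *\<^sub>R a) \<le> 1 + G"
          using norm_triangle_ineq4[of b "g' z *\<^sub>R a"] G(2)[of z] z st frame by (simp add: frame_def)
        then have "norm (X (\<gamma> z) - X (\<gamma> s)) * norm (b - g' z *\<^sub>R a) \<le> e * (1 + G)"
          using near[of z] z e by (intro mult_mono) auto
        then show "(X (\<gamma> z) - X (\<gamma> s)) \<bullet> (b - g' z *\<^sub>R a) \<le> e * (1 + G)"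
          using norm_cauchy_schwarz order_trans by blast
      qed (use st in simp)
      finally have "J t - J s \<le> norm (X (\<gamma> s)) * m + (t - s) * (e * N + e * (1 + G))"
        unfolding z(3) .
      with low have "J t - J s \<le> arc_int ?\<psi> s t + (2 * (1 + G) + N) * e * (t - s)"
        by (simp add: algebra_simps)
      moreover have "arc_int ?\<psi> A t = arc_int ?\<psi> A s + arc_int ?\<psi> s t"
        using st by (intro arc_int_combine[OF \<psi>]) auto
      ultimately show ?thesis unfolding f_def by linarith
    qed
    moreover have "0 < d" using d1(1) d2(1) by (simp add: d_def)
    ultimately show "\<exists>\<delta>>0. \<forall>s t. A \<le> s \<and> s < t \<and> t \<le> B \<and> t - s < \<delta> \<longrightarrow> f t - f s \<le> (2 * (1 + G) + N) * e * (t - s)" by blast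
  qed (use G N in simp)
  moreover have "arc_int ?\<psi> A A = 0" by (simp add: arc_int_def arc_def)
  ultimately show ?thesis unfolding f_def J(1)[symmetric] by simp
qed

end

section \<open>Local trace inequality and divergence theorem\<close>

definition divg :: "(real^2 \<Rightarrow> real^2) \<Rightarrow> real^2 \<Rightarrow> real" where
  "divg X x = partial 1 X x $ 1 + partial 2 X x $ 2"

text \<open>The divergence is the trace of the derivative and so does not depend on the orthonormal
  basis. The three relations \<open>c\<close> say that the matrix with columns \<open>a\<close> and
  \<open>b\<close> has orthonormal rows too.\<close>

lemma divg_frame:
  assumes "frame a b"
  shows "divg X x = dirder X x a \<bullet> a + dirder X x b \<bullet> b"
proof -
  have e: "axis i 1 = (a $ i) *\<^sub>R a + (b $ i) *\<^sub>R b" for i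
    using frame_expansion[OF assms, of "axis i 1"] by (simp add: inner_axis')
  have c: "a $ 1 * a $ 1 + b $ 1 * b $ 1 = 1" "a $ 1 * a $ 2 + b $ 1 * b $ 2 = 0" "a $ 2 * a $ 2 + b $ 2 * b $ 2 = 1"
    using arg_cong[OF e[of 1], of "\<lambda>v. v $ 1"] arg_cong[OF e[of 1], of "\<lambda>v. v $ 2"] arg_cong[OF e[of 2], of "\<lambda>v. v $ 2"]
    by (simp_all add: axis_def)
  define u v where "u = partial 1 X x" and "v = partial 2 X x"
  have "dirder X x a \<bullet> a + dirder X x b \<bullet> b
      = (a $ 1 * a $ 1 + b $ 1 * b $ 1) * u $ 1 + (a $ 1 * a $ 2 + b $ 1 * b $ 2) * (u $ 2 + v $ 1)
        + (a $ 2 * a $ 2 + b $ 2 * b $ 2) * v $ 2"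
    unfolding dirder_2 u_def[symmetric] v_def[symmetric]
    by (simp add: inner_vec_def sum_2 algebra_simps)
  then show ?thesis unfolding c by (simp add: divg_def u_def v_def)
qed

lemma nn_integral_frame:
  assumes "frame a b" and [measurable]: "f \<in> borel_measurable borel"
  shows "(\<integral>\<^sup>+x. f x \<partial>lborel) = (\<integral>\<^sup>+t. (\<integral>\<^sup>+s. f (t *\<^sub>R a + s *\<^sub>R b) \<partial>lborel) \<partial>lborel)"
proof -
  have [measurable]: "(\<lambda>z::real \<times> real. fst z *\<^sub>R a + snd z *\<^sub>R b) \<in> borel_measurable borel"
    by (intro borel_measurable_continuous_onI continuous_intros)
  have "(\<integral>\<^sup>+x. f x \<partial>lborel) = (\<integral>\<^sup>+z. f (fst z *\<^sub>R a + snd z *\<^sub>R b) \<partial>lborel)"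
    by (subst distr_lborel_frame[OF assms(1), symmetric], subst nn_integral_distr) auto
  also have "\<dots> = (\<integral>\<^sup>+z. f (fst z *\<^sub>R a + snd z *\<^sub>R b) \<partial>(lborel \<Otimes>\<^sub>M lborel))"
    by (simp add: lborel_prod)
  also have "\<dots> = (\<integral>\<^sup>+t. (\<integral>\<^sup>+s. f (t *\<^sub>R a + s *\<^sub>R b) \<partial>lborel) \<partial>lborel)"
    by (subst lborel.nn_integral_fst[symmetric]) auto
  finally show ?thesis .
qed

lemma complex_norm_square_derivative:
  fixes f :: "real \<Rightarrow> complex"
  assumes "(f has_vector_derivative f') (at t within S)"
  shows "((\<lambda>s. (norm (f s))\<^sup>2) has_vector_derivative 2 * (f t \<bullet> f')) (at t within S)"
proof -
  have "((\<lambda>s. f s \<bullet> f s) has_derivative (\<lambda>h. f t \<bullet> (h *\<^sub>R f') + (h *\<^sub>R f') \<bullet> f t)) (at t within S)"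
    using assms unfolding has_vector_derivative_def by (intro has_derivative_inner)
  moreover have "(\<lambda>h. f t \<bullet> (h *\<^sub>R f') + (h *\<^sub>R f') \<bullet> f t) = (\<lambda>h. h *\<^sub>R (2 * (f t \<bullet> f')))"
    by (simp add: fun_eq_iff inner_commute[of f' "f t"])
  ultimately show ?thesis
    unfolding has_vector_derivative_def power2_norm_eq_inner by simp
qed

lemma norm_dirder_le: "norm (dirder f x h) \<le> norm (grad f x) * norm h"
proof -
  have "norm (dirder f x h) \<le> \<bar>h $ 1\<bar> * norm (partial 1 f x) + \<bar>h $ 2\<bar> * norm (partial 2 f x)"
    unfolding dirder_2 using norm_triangle_ineq[of "h $ 1 *\<^sub>R partial 1 f x" "h $ 2 *\<^sub>R partial 2 f x"] by simp
  also have "\<dots> = (\<Sum>i\<in>UNIV. \<bar>h $ i\<bar> * norm (grad f x $ i))" by (simp add: sum_2)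
  also have "\<dots> \<le> L2_set (\<lambda>i. h $ i) UNIV * L2_set (\<lambda>i. norm (grad f x $ i)) UNIV"
    using L2_set_mult_ineq[of "\<lambda>i. h $ i" "\<lambda>i. norm (grad f x $ i)" UNIV] by simp
  also have "\<dots> = norm (grad f x) * norm h" by (simp add: norm_vec_def L2_set_def)
  finally show ?thesis .
qed

text \<open>With \<open>w s = \<bar>\<phi> (y - s b)\<bar>\<^sup>2\<close>, the integral of the
  derivative of \<open>- (h - s) w\<close> over the segment is \<open>h w 0\<close>. The derivative
  of \<open>w\<close> is at most \<open>2 \<bar>\<phi>\<bar> \<bar>grad \<phi>\<bar>\<close>, hence
  at most the integrand on the right, and its factor is at most \<open>h\<close>.\<close>

lemma segment_trace:
  fixes \<phi> :: "real^2 \<Rightarrow> complex"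
  assumes \<phi>: "C1 \<phi>" and h: "0 < h" and b: "norm b = 1"
  shows "h * (norm (\<phi> y))\<^sup>2 \<le> (1 + h) * (\<integral>s. indicator {0..h} s * ((norm (\<phi> (y - s *\<^sub>R b)))\<^sup>2 + (norm (grad \<phi> (y - s *\<^sub>R b)))\<^sup>2) \<partial>lborel)"
proof -
  define w where "w s = (norm (\<phi> (y - s *\<^sub>R b)))\<^sup>2" for s
  define w' where "w' s = 2 * (\<phi> (y - s *\<^sub>R b) \<bullet> dirder \<phi> (y - s *\<^sub>R b) (- b))" for s
  define q where "q s = (norm (\<phi> (y - s *\<^sub>R b)))\<^sup>2 + (norm (grad \<phi> (y - s *\<^sub>R b)))\<^sup>2" for s
  have dw: "(w has_vector_derivative w' s) (at s within S)" for s S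
  proof -
    have "((\<lambda>s. y - s *\<^sub>R b) has_vector_derivative - b) (at s within S)"
      by (auto intro!: derivative_eq_intros)
    then show ?thesis
      unfolding w_def w'_def by (intro complex_norm_square_derivative has_vector_derivative_along[OF \<phi>])
  qed
  have cw: "continuous_on S w" for S
    unfolding w_def by (intro continuous_intros continuous_on_compose2[OF C1_continuous[OF \<phi>, of UNIV]]) auto
  have cw': "continuous_on S w'" for S
    unfolding w'_def by (intro continuous_intros dirder_continuous[OF \<phi>] continuous_on_compose2[OF C1_continuous[OF \<phi>, of UNIV]]) auto
  have cq: "continuous_on S q" for S
    unfolding q_def by (intro continuous_intros continuous_on_compose2[OF C1_continuous[OF \<phi>, of UNIV]]
      continuous_on_compose2[OF C1_grad_continuous[OF \<phi>, of UNIV]]) auto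
  have "((\<lambda>s. - ((h - s) * w s)) has_vector_derivative (w s - (h - s) * w' s)) (at s within {0..h})" for s
    using dw[of s "{0..h}"] unfolding has_real_derivative_iff_has_vector_derivative[symmetric]
    by (auto intro!: derivative_eq_intros simp: algebra_simps)
  then have "(\<integral>s. indicator {0..h} s *\<^sub>R (w s - (h - s) * w' s) \<partial>lborel) = - ((h - h) * w h) - (- ((h - 0) * w 0))"
    using h by (intro integral_FTC_atLeastAtMost continuous_intros cw cw') auto
  then have "h * w 0 = (\<integral>s. indicator {0..h} s *\<^sub>R (w s - (h - s) * w' s) \<partial>lborel)" by simp
  also have "\<dots> \<le> (\<integral>s. indicator {0..h} s *\<^sub>R ((1 + h) * q s) \<partial>lborel)"
  proof (rule integral_mono)
    show "integrable lborel (\<lambda>s. indicator {0..h} s *\<^sub>R (w s - (h - s) * w' s))"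
      by (intro borel_integrable_compact continuous_intros cw cw') auto
    show "integrable lborel (\<lambda>s. indicator {0..h} s *\<^sub>R ((1 + h) * q s))"
      by (intro borel_integrable_compact continuous_intros cq) auto
    fix s
    show "indicator {0..h} s *\<^sub>R (w s - (h - s) * w' s) \<le> indicator {0..h} s *\<^sub>R ((1 + h) * q s)"
    proof (cases "s \<in> {0..h}")
      case True
      define A B where "A = norm (\<phi> (y - s *\<^sub>R b))" and "B = norm (grad \<phi> (y - s *\<^sub>R b))"
      have "\<bar>w' s\<bar> \<le> 2 * (A * norm (dirder \<phi> (y - s *\<^sub>R b) (- b)))"
        unfolding w'_def A_def using Cauchy_Schwarz_ineq2[of "\<phi> (y - s *\<^sub>R b)" "dirder \<phi> (y - s *\<^sub>R b) (- b)"] by (simp add: abs_mult)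
      also have "\<dots> \<le> 2 * (A * B)"
        using norm_dirder_le[of \<phi> "y - s *\<^sub>R b" "- b"] b by (intro mult_left_mono) (auto simp: A_def B_def)
      also have "\<dots> \<le> q s" using sum_squares_bound[of A B] by (simp add: q_def A_def B_def)
      finally have 1: "\<bar>w' s\<bar> \<le> q s" .
      have "\<bar>h - s\<bar> * \<bar>w' s\<bar> \<le> h * q s" using True 1 by (intro mult_mono) auto
      then have "- ((h - s) * w' s) \<le> h * q s" by (metis abs_le_D2 abs_mult)
      moreover have "w s \<le> q s" by (simp add: w_def q_def)
      ultimately show ?thesis using True by (simp add: distrib_right)
    qed simp
  qed
  also have "\<dots> = (1 + h) * (\<integral>s. indicator {0..h} s * q s \<partial>lborel)"
    by (simp add: mult.left_commute)
  finally show ?thesis by (simp add: w_def q_def)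
qed

text \<open>The domain lies below the graph, because it is going to be the exterior of a set that
  \<open>C2_boundary\<close> places above it. Inside the ball the graph is exactly the frontier, so
  the domain does not lie on both sides of it.\<close>

locale chart = graph_frame a b g g' for a b :: "real^2" and g g' :: "real \<Rightarrow> real" +
  fixes \<Omega> :: "(real^2) set" and p :: "real^2" and r :: real
  assumes r: "0 < r" and p: "p \<in> frontier \<Omega>"
    and below: "x \<in> ball p r \<Longrightarrow> x \<in> \<Omega> \<longleftrightarrow> x \<bullet> b < g (x \<bullet> a)"
    and on: "x \<in> ball p r \<Longrightarrow> x \<in> frontier \<Omega> \<longleftrightarrow> x \<bullet> b = g (x \<bullet> a)"
    and \<Omega>: "\<Omega> \<in> sets borel"
begin

lemma norm_ab: "norm a = 1" "norm b = 1"
  using frame by (auto simp: frame_def)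

text \<open>From each boundary point \<open>\<gamma> t\<close> a segment in direction
  \<open>- b\<close> leads into the domain. The one-dimensional estimate on these segments is
  integrated over \<open>t\<close>, Fubini turns the result into an area integral, and the arc
  integral is at most \<open>1 + G\<close> times the integral over \<open>t\<close>.\<close>

lemma trace_local:
  "\<exists>\<delta>>0. \<exists>C\<ge>0. emeasure hausdorff1 (frontier \<Omega> \<inter> ball p \<delta>) < \<infinity> \<and>
    (\<forall>\<phi>::real^2 \<Rightarrow> complex. \<phi> \<in> C1c UNIV \<longrightarrow>
      (\<integral>\<^sup>+x. indicator (frontier \<Omega> \<inter> ball p \<delta>) x * ennreal ((norm (\<phi> x))\<^sup>2) \<partial>hausdorff1)
      \<le> ennreal C * (\<integral>\<^sup>+x. indicator \<Omega> x * ennreal ((norm (\<phi> x))\<^sup>2 + (norm (grad \<phi> x))\<^sup>2) \<partial>lborel))"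
proof -
  define t0 where "t0 = p \<bullet> a"
  have p\<gamma>: "p = \<gamma> t0" unfolding t0_def by (rule on_graph) (use p on r in auto)
  obtain G where G: "0 \<le> G" "\<And>t. t \<in> {t0 - 1..t0 + 1} \<Longrightarrow> \<bar>g' t\<bar> \<le> G" using slope_bounded by blast
  \<comment> \<open>For \<open>\<bar>t - t0\<bar> \<le> \<delta>\<close> the point
    \<open>\<gamma> t\<close> is within \<open>r / 4\<close> of \<open>p\<close>; a segment of
    length \<open>h = r / 4\<close> from there stays in the chart ball.\<close>
  define \<delta> where "\<delta> = min (min 1 r) (r / (4 * (1 + G)))"
  have \<delta>: "0 < \<delta>" "\<delta> \<le> 1" "\<delta> \<le> r" using r G by (auto simp: \<delta>_def)
  have "\<delta> \<le> r / (4 * (1 + G))" by (simp add: \<delta>_def)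
  then have \<delta>r: "(1 + G) * \<delta> \<le> r / 4" using G by (simp add: field_simps)
  define A B h where "A = t0 - \<delta>" and "B = t0 + \<delta>" and "h = r / 4"
  have AB: "A < B" and h: "0 < h" using \<delta> r by (auto simp: A_def B_def h_def)
  have G': "\<bar>g' t\<bar> \<le> G" if "t \<in> {A..B}" for t using that \<delta> by (intro G) (auto simp: A_def B_def)
  have near: "\<gamma> t - s *\<^sub>R b \<in> ball p r" if "t \<in> {A..B}" "s \<in> {0..h}" for t s
  proof -
    have "dist (\<gamma> t) (\<gamma> t0) \<le> (1 + G) * \<bar>t - t0\<bar>"
      using that \<delta> by (intro \<gamma>_lipschitz[of "t0 - 1" "t0 + 1"] G) (auto simp: A_def B_def)
    also have "\<dots> \<le> (1 + G) * \<delta>"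
      using that G by (intro mult_left_mono) (auto simp: A_def B_def abs_le_iff)
    finally have "norm (\<gamma> t - p) \<le> r / 4" using \<delta>r by (simp add: p\<gamma> dist_norm)
    moreover have "norm (s *\<^sub>R b) \<le> r / 4" using that norm_ab by (auto simp: h_def)
    moreover have "dist p (\<gamma> t - s *\<^sub>R b) \<le> norm (\<gamma> t - p) + norm (s *\<^sub>R b)"
      using norm_triangle_ineq4[of "\<gamma> t - p" "s *\<^sub>R b"] by (simp add: dist_norm norm_minus_commute algebra_simps)
    ultimately show ?thesis using r by simp
  qed
  have inside: "\<gamma> t - s *\<^sub>R b \<in> \<Omega>" if "t \<in> {A..B}" "s \<in> {0<..h}" for t s
    using below[OF near[OF that(1), of s]] that(2) by (simp add: inner_simps \<gamma>_inner ab)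
  have sub: "frontier \<Omega> \<inter> ball p \<delta> \<subseteq> arc A B"
  proof
    fix x assume x: "x \<in> frontier \<Omega> \<inter> ball p \<delta>"
    then have "x \<bullet> b = g (x \<bullet> a)" using on[of x] \<delta> by auto
    moreover have "\<bar>(x - p) \<bullet> a\<bar> \<le> norm (x - p)"
      using Cauchy_Schwarz_ineq2[of "x - p" a] norm_ab by simp
    then have "\<bar>x \<bullet> a - t0\<bar> < \<delta>"
      using x by (simp add: t0_def inner_diff_left dist_norm norm_minus_commute)
    ultimately show "x \<in> arc A B" by (auto simp: arc_def A_def B_def)
  qed
  have fin: "emeasure hausdorff1 (frontier \<Omega> \<inter> ball p \<delta>) < \<infinity>"
    using emeasure_mono[OF sub, of hausdorff1] arc_finite[of A B] by (simp add: le_less_trans)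
  define C where "C = (1 + G) * ((1 + h) / h)"
  have C: "0 \<le> C" using G h by (simp add: C_def)
  have C': "ennreal C = ennreal (1 + G) * ennreal ((1 + h) / h)"
    unfolding C_def using G h by (intro ennreal_mult) auto
  have "(\<integral>\<^sup>+x. indicator (frontier \<Omega> \<inter> ball p \<delta>) x * ennreal ((norm (\<phi> x))\<^sup>2) \<partial>hausdorff1)
      \<le> ennreal C * (\<integral>\<^sup>+x. indicator \<Omega> x * ennreal ((norm (\<phi> x))\<^sup>2 + (norm (grad \<phi> x))\<^sup>2) \<partial>lborel)"
    if \<phi>: "\<phi> \<in> C1c UNIV" for \<phi> :: "real^2 \<Rightarrow> complex"
  proof -
    note C\<phi> = C1c_C1[OF \<phi>]
    define q where "q x = (norm (\<phi> x))\<^sup>2 + (norm (grad \<phi> x))\<^sup>2" for x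
    have q0: "0 \<le> q x" for x by (simp add: q_def)
    have cq: "continuous_on S q" for S
      unfolding q_def by (intro continuous_intros C1_continuous[OF C\<phi>] C1_grad_continuous[OF C\<phi>])
    have [measurable]: "q \<in> borel_measurable borel" by (rule borel_measurable_continuous_onI[OF cq])
    have [measurable]: "g \<in> borel_measurable borel" by (rule borel_measurable_continuous_onI[OF g_continuous])
    have [measurable]: "\<gamma> \<in> borel_measurable borel" by (rule borel_measurable_continuous_onI[OF \<gamma>_continuous])
    define \<psi> where "\<psi> x = (norm (\<phi> x))\<^sup>2" for x
    have c\<psi>: "continuous_on S \<psi>" for S unfolding \<psi>_def by (intro continuous_intros C1_continuous[OF C\<phi>])
    have \<psi>0: "0 \<le> \<psi> x" for x by (simp add: \<psi>_def)
    have c\<psi>\<gamma>: "continuous_on S (\<lambda>t. \<psi> (\<gamma> t))" for S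
      by (intro continuous_on_compose2[OF c\<psi> \<gamma>_continuous]) auto
    have [measurable]: "(\<lambda>t. \<psi> (\<gamma> t)) \<in> borel_measurable borel" by (rule borel_measurable_continuous_onI[OF c\<psi>\<gamma>])
    have i\<psi>: "integrable lborel (\<lambda>t. indicator {A..B} t * \<psi> (\<gamma> t))"
      using borel_integrable_compact[OF _ c\<psi>\<gamma>, of "{A..B}"] by simp
    have inner: "(\<integral>\<^sup>+t. ennreal (indicator {A..B} t * \<psi> (\<gamma> t)) \<partial>lborel)
        \<le> ennreal ((1 + h) / h) * (\<integral>\<^sup>+x. indicator \<Omega> x * ennreal (q x) \<partial>lborel)"
    proof -
    have "(\<integral>\<^sup>+t. ennreal (indicator {A..B} t * \<psi> (\<gamma> t)) \<partial>lborel)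
        \<le> (\<integral>\<^sup>+t. ennreal ((1 + h) / h) * (\<integral>\<^sup>+\<sigma>. indicator \<Omega> (t *\<^sub>R a + \<sigma> *\<^sub>R b) * ennreal (q (t *\<^sub>R a + \<sigma> *\<^sub>R b)) \<partial>lborel) \<partial>lborel)"
    proof (rule nn_integral_mono)
      fix t
      show "ennreal (indicator {A..B} t * \<psi> (\<gamma> t))
          \<le> ennreal ((1 + h) / h) * (\<integral>\<^sup>+\<sigma>. indicator \<Omega> (t *\<^sub>R a + \<sigma> *\<^sub>R b) * ennreal (q (t *\<^sub>R a + \<sigma> *\<^sub>R b)) \<partial>lborel)"
      proof (cases "t \<in> {A..B}")
        case True
        have cqs: "continuous_on S (\<lambda>s. q (\<gamma> t - s *\<^sub>R b))" for S
          by (intro continuous_on_compose2[OF cq[of UNIV]] continuous_intros) auto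
        have iq: "integrable lborel (\<lambda>s. indicator {0..h} s * q (\<gamma> t - s *\<^sub>R b))"
          using borel_integrable_compact[OF _ cqs, of "{0..h}"] by simp
        have "\<psi> (\<gamma> t) \<le> (1 + h) / h * (\<integral>s. indicator {0..h} s * q (\<gamma> t - s *\<^sub>R b) \<partial>lborel)"
          using segment_trace[OF C\<phi> h norm_ab(2), of "\<gamma> t"] h by (simp add: \<psi>_def q_def field_simps)
        then have "ennreal (\<psi> (\<gamma> t)) \<le> ennreal ((1 + h) / h * (\<integral>s. indicator {0..h} s * q (\<gamma> t - s *\<^sub>R b) \<partial>lborel))"
          by (rule ennreal_leI)
        also have "\<dots> = ennreal ((1 + h) / h) * ennreal (\<integral>s. indicator {0..h} s * q (\<gamma> t - s *\<^sub>R b) \<partial>lborel)"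
          using h q0 by (intro ennreal_mult) (auto intro!: Bochner_Integration.integral_nonneg)
        also have "ennreal (\<integral>s. indicator {0..h} s * q (\<gamma> t - s *\<^sub>R b) \<partial>lborel) = (\<integral>\<^sup>+s. ennreal (indicator {0..h} s * q (\<gamma> t - s *\<^sub>R b)) \<partial>lborel)"
          using iq q0 by (intro nn_integral_eq_integral[symmetric]) auto
        \<comment> \<open>The end point \<open>s = 0\<close> lies on the boundary and not in the
          domain; it is dropped as a null set.\<close>
        also have "\<dots> = (\<integral>\<^sup>+s. ennreal (indicator {0<..h} s * q (\<gamma> t - s *\<^sub>R b)) \<partial>lborel)"
        proof (rule nn_integral_cong_AE)
          show "AE s in lborel. ennreal (indicator {0..h} s * q (\<gamma> t - s *\<^sub>R b)) = ennreal (indicator {0<..h} s * q (\<gamma> t - s *\<^sub>R b))"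
            using AE_lborel_singleton[of "0::real"] by eventually_elim (auto simp: indicator_def)
        qed
        also have "\<dots> \<le> (\<integral>\<^sup>+s. indicator \<Omega> (t *\<^sub>R a + (g t + (-1) * s) *\<^sub>R b) * ennreal (q (t *\<^sub>R a + (g t + (-1) * s) *\<^sub>R b)) \<partial>lborel)"
        proof (rule nn_integral_mono)
          fix s
          have "t *\<^sub>R a + (g t + (-1) * s) *\<^sub>R b = \<gamma> t - s *\<^sub>R b" by (simp add: \<gamma>_def algebra_simps)
          then show "ennreal (indicator {0<..h} s * q (\<gamma> t - s *\<^sub>R b))
              \<le> indicator \<Omega> (t *\<^sub>R a + (g t + (-1) * s) *\<^sub>R b) * ennreal (q (t *\<^sub>R a + (g t + (-1) * s) *\<^sub>R b))"
            using inside[OF True, of s] by (cases "s \<in> {0<..h}") auto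
        qed
        also have "\<dots> = (\<integral>\<^sup>+\<sigma>. indicator \<Omega> (t *\<^sub>R a + \<sigma> *\<^sub>R b) * ennreal (q (t *\<^sub>R a + \<sigma> *\<^sub>R b)) \<partial>lborel)"
        proof -
          have [measurable]: "(\<lambda>\<sigma>. t *\<^sub>R a + \<sigma> *\<^sub>R b) \<in> borel_measurable borel"
            by (intro borel_measurable_continuous_onI continuous_intros)
          have m: "(\<lambda>\<sigma>. indicator \<Omega> (t *\<^sub>R a + \<sigma> *\<^sub>R b) * ennreal (q (t *\<^sub>R a + \<sigma> *\<^sub>R b))) \<in> borel_measurable borel"
            using \<Omega> by measurable
          show ?thesis
            using nn_integral_real_affine[OF m, of "-1" "g t"] by simp
        qed
        finally show ?thesis using True by (simp add: mult_left_mono)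
      qed simp
    qed
    also have "\<dots> = ennreal ((1 + h) / h) * (\<integral>\<^sup>+t. (\<integral>\<^sup>+\<sigma>. indicator \<Omega> (t *\<^sub>R a + \<sigma> *\<^sub>R b) * ennreal (q (t *\<^sub>R a + \<sigma> *\<^sub>R b)) \<partial>lborel) \<partial>lborel)"
    proof (rule nn_integral_cmult)
      have [measurable]: "(\<lambda>z::real \<times> real. fst z *\<^sub>R a + snd z *\<^sub>R b) \<in> borel_measurable borel"
        by (intro borel_measurable_continuous_onI continuous_intros)
      show "(\<lambda>t. \<integral>\<^sup>+\<sigma>. indicator \<Omega> (t *\<^sub>R a + \<sigma> *\<^sub>R b) * ennreal (q (t *\<^sub>R a + \<sigma> *\<^sub>R b)) \<partial>lborel) \<in> borel_measurable lborel"
        using \<Omega> by measurable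
    qed
    also have "(\<integral>\<^sup>+t. (\<integral>\<^sup>+\<sigma>. indicator \<Omega> (t *\<^sub>R a + \<sigma> *\<^sub>R b) * ennreal (q (t *\<^sub>R a + \<sigma> *\<^sub>R b)) \<partial>lborel) \<partial>lborel)
        = (\<integral>\<^sup>+x. indicator \<Omega> x * ennreal (q x) \<partial>lborel)"
      by (rule nn_integral_frame[OF frame, symmetric]) (use \<Omega> in measurable)
    finally show ?thesis .
    qed
    have "(\<integral>\<^sup>+x. indicator (frontier \<Omega> \<inter> ball p \<delta>) x * ennreal (\<psi> x) \<partial>hausdorff1)
        \<le> (\<integral>\<^sup>+x. ennreal (indicator (arc A B) x * \<psi> x) \<partial>hausdorff1)"
      using sub by (intro nn_integral_mono) (auto simp: indicator_def)
    also have "\<dots> = ennreal (arc_int \<psi> A B)"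
      unfolding arc_int_def using \<psi>0 by (intro nn_integral_eq_integral arc_integrable c\<psi>) simp
    also have "\<dots> \<le> ennreal ((1 + G) * (\<integral>t. indicator {A..B} t * \<psi> (\<gamma> t) \<partial>lborel))"
      by (intro ennreal_leI arc_int_le[OF c\<psi> \<psi>0 AB G' G(1)])
    also have "\<dots> = ennreal (1 + G) * (\<integral>\<^sup>+t. ennreal (indicator {A..B} t * \<psi> (\<gamma> t)) \<partial>lborel)"
      using i\<psi> \<psi>0 G by (subst nn_integral_eq_integral) (auto simp: ennreal_mult)
    also have "\<dots> \<le> ennreal (1 + G) * (ennreal ((1 + h) / h) * (\<integral>\<^sup>+x. indicator \<Omega> x * ennreal (q x) \<partial>lborel))"
      by (intro mult_left_mono inner) simp
    finally show ?thesis
      unfolding C' \<psi>_def q_def mult.assoc .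
  qed
  with \<delta>(1) C fin show ?thesis by blast
qed

lemma \<gamma>_vector_derivative: "(\<gamma> has_vector_derivative (a + g' t *\<^sub>R b)) (at t within S)"
proof -
  have "(g has_real_derivative g' t) (at t within S)"
    using g by (rule has_field_derivative_at_within)
  then show ?thesis unfolding \<gamma>_def by (auto intro!: derivative_eq_intros)
qed

text \<open>In the coordinates \<open>Z t s = \<gamma> t + s b\<close> the domain is
  \<open>s < 0\<close>, and the divergence is the sum of the \<open>t\<close>-derivative of
  \<open>X \<bullet> a\<close> and the \<open>s\<close>-derivative of
  \<open>X \<bullet> (b - g' t *\<^sub>R a)\<close>. The former integrates to 0 along
  \<open>t\<close>; the latter leaves the flux through the graph. Since
  \<open>b - g' t *\<^sub>R a\<close> is constant in \<open>s\<close>, the slope is never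
  differentiated.\<close>

lemma divergence_local:
  assumes X: "X \<in> C1c (ball p r)"
  shows "(\<integral>x. indicator \<Omega> x * divg X x \<partial>lborel) \<le> (\<integral>x. indicator (frontier \<Omega>) x * norm (X x) \<partial>hausdorff1)"
    "integrable hausdorff1 (\<lambda>x. indicator (frontier \<Omega>) x * norm (X x))"
proof -
  obtain S where S: "compact S" "S \<subseteq> ball p r" "\<And>x. x \<notin> S \<Longrightarrow> X x = 0" "\<And>i x. x \<notin> S \<Longrightarrow> partial i X x = 0"
    using C1cE[OF X] by metis
  obtain R where R: "S \<subseteq> cball 0 R" using compact_subset_cball[OF S(1)] by blast
  note CX = C1c_C1[OF X]
  define T where "T = \<bar>R\<bar> + 1"
  have T: "0 < T" by (simp add: T_def)
  have far: "x \<notin> S" if "T \<le> \<bar>x \<bullet> a\<bar> \<or> T \<le> \<bar>x \<bullet> b\<bar>" for x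
  proof
    assume "x \<in> S"
    then have "norm x \<le> R" using R by auto
    moreover have "\<bar>x \<bullet> a\<bar> \<le> norm x" "\<bar>x \<bullet> b\<bar> \<le> norm x"
      using Cauchy_Schwarz_ineq2[of x a] Cauchy_Schwarz_ineq2[of x b] norm_ab by auto
    ultimately show False using that by (auto simp: T_def)
  qed
  have "bounded (g ` {-T..T})"
    by (intro compact_imp_bounded compact_continuous_image g_continuous) auto
  then obtain N where N: "\<And>t. t \<in> {-T..T} \<Longrightarrow> \<bar>g t\<bar> \<le> N"
    unfolding bounded_iff real_norm_def by blast
  \<comment> \<open>For \<open>\<bar>t\<bar> < T\<close> the graph stays below height
    \<open>N\<close>, so \<open>W \<le> \<bar>s\<bar>\<close> brings the second coordinate beyond
    \<open>T\<close> and thus outside the support.\<close>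
  define W where "W = T + \<bar>N\<bar>"
  have W: "0 < W" using T by (simp add: W_def)
  define Z where "Z t s = \<gamma> t + s *\<^sub>R b" for t s
  have Z_inner: "Z t s \<bullet> a = t" "Z t s \<bullet> b = g t + s" for t s
    by (simp_all add: Z_def inner_simps \<gamma>_inner ab)
  have farZ: "Z t s \<notin> S" if "T \<le> \<bar>t\<bar> \<or> W \<le> \<bar>s\<bar>" for t s
  proof (cases "T \<le> \<bar>t\<bar>")
    case True
    then show ?thesis by (intro far) (simp add: Z_inner)
  next
    case False
    then have "\<bar>g t\<bar> \<le> N" by (intro N) auto
    then have "T \<le> \<bar>g t + s\<bar>" using that False by (auto simp: W_def)
    then show ?thesis by (intro far) (simp add: Z_inner)
  qed
  have cZ: "continuous_on UNIV (\<lambda>z. Z (fst z) (snd z))"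
    unfolding Z_def by (intro continuous_intros continuous_on_compose2[OF \<gamma>_continuous[of UNIV]]) auto
  define D1 where "D1 t s = dirder X (Z t s) (a + g' t *\<^sub>R b) \<bullet> a" for t s
  define D2 where "D2 t s = dirder X (Z t s) b \<bullet> (b - g' t *\<^sub>R a)" for t s
  have cg'f: "continuous_on UNIV (\<lambda>z::real \<times> real. g' (fst z))"
    by (intro continuous_on_compose2[OF g'] continuous_intros) auto
  have cD1: "continuous_on UNIV (\<lambda>z. D1 (fst z) (snd z))"
    unfolding D1_def by (intro continuous_intros dirder_continuous[OF CX] cZ cg'f)
  have cD2: "continuous_on UNIV (\<lambda>z. D2 (fst z) (snd z))"
    unfolding D2_def by (intro continuous_intros dirder_continuous[OF CX] cZ cg'f)
  have cp: "continuous_on S (\<lambda>t. (t, s))" "continuous_on S (\<lambda>s. (t, s))" for S :: "real set" and t s :: real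
    by (intro continuous_intros)+
  have z: "dirder X (Z t s) v = 0" if "T \<le> \<bar>t\<bar> \<or> W \<le> \<bar>s\<bar>" for t s v
    using farZ[OF that] S(4) by (simp add: dirder_def)
  have zX: "X (Z t s) = 0" if "T \<le> \<bar>t\<bar> \<or> W \<le> \<bar>s\<bar>" for t s
    using farZ[OF that] S(3) by simp
  have bdd: "bounded ({-T..T} \<times> {-W..W})" by (intro bounded_Times) auto
  have D_out: "D1 t s = 0 \<and> D2 t s = 0" if "(t, s) \<notin> {-T..T} \<times> {-W..W}" for t s
    unfolding D1_def D2_def using that by (subst (1 2) z) auto
  have iD: "integrable (lborel \<Otimes>\<^sub>M lborel) (\<lambda>(t, s). indicator {..<0} s * D t s)"
    if "continuous_on UNIV (\<lambda>z. D (fst z) (snd z))" "\<And>t s. (t, s) \<notin> {-T..T} \<times> {-W..W} \<Longrightarrow> D t s = 0" for D :: "real \<Rightarrow> real \<Rightarrow> real"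
  proof -
    have "integrable lborel (\<lambda>z. D (fst z) (snd z))"
      by (rule integrable_continuous_compact_support[OF that(1) bdd]) (use that(2) in \<open>auto simp: mem_Times_iff\<close>)
    moreover have "(UNIV \<times> {..<0}) \<in> sets (lborel :: (real \<times> real) measure)"
      unfolding sets_lborel by (intro borel_open open_Times) auto
    ultimately have "integrable lborel (\<lambda>z. D (fst z) (snd z) * indicator (UNIV \<times> {..<0}) z)"
      by (rule integrable_real_mult_indicator[rotated])
    moreover have "(\<lambda>z. D (fst z) (snd z) * indicator (UNIV \<times> {..<0}) z) = (\<lambda>(t, s). indicator {..<0} s * D t s)"
      by (auto simp: fun_eq_iff indicator_def)
    ultimately show ?thesis by (simp add: lborel_prod)
  qed
  have iD1: "integrable (lborel \<Otimes>\<^sub>M lborel) (\<lambda>(t, s). indicator {..<0} s * D1 t s)"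
    and iD2: "integrable (lborel \<Otimes>\<^sub>M lborel) (\<lambda>(t, s). indicator {..<0} s * D2 t s)"
    using iD[OF cD1] iD[OF cD2] D_out by blast+
  have div_eq: "divg X (Z t s) = D1 t s + D2 t s" for t s
  proof -
    have "dirder X (Z t s) (a + g' t *\<^sub>R b) = dirder X (Z t s) a + g' t *\<^sub>R dirder X (Z t s) b"
      by (simp add: dirder_2 algebra_simps)
    then show ?thesis
      unfolding divg_frame[OF frame] D1_def D2_def by (simp add: inner_simps)
  qed
  have cdiv: "continuous_on UNIV (divg X)"
    unfolding divg_def by (intro continuous_intros C1_partial_continuous[OF CX])
  have [measurable]: "divg X \<in> borel_measurable borel" by (rule borel_measurable_continuous_onI[OF cdiv])
  have idiv: "integrable lborel (\<lambda>x. indicator \<Omega> x * divg X x)"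
  proof -
    have "integrable lborel (divg X)"
      by (rule integrable_continuous_compact_support[OF cdiv, of S])
        (use S compact_imp_bounded in \<open>auto simp: divg_def\<close>)
    then have "integrable lborel (\<lambda>x. divg X x * indicator \<Omega> x)"
      using \<Omega> by (intro integrable_real_mult_indicator) auto
    then show ?thesis by (simp only: mult.commute)
  qed
  have m: "(\<lambda>x. indicator \<Omega> x * divg X x) \<in> borel_measurable borel" using \<Omega> by measurable
  have ip: "integrable (lborel \<Otimes>\<^sub>M lborel) (\<lambda>(t, \<sigma>). indicator \<Omega> (t *\<^sub>R a + \<sigma> *\<^sub>R b) * divg X (t *\<^sub>R a + \<sigma> *\<^sub>R b))"
    using idiv unfolding integral_frame(2)[OF frame m] by (simp add: lborel_prod split_def)
  have "(\<integral>x. indicator \<Omega> x * divg X x \<partial>lborel)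
      = (\<integral>(t, \<sigma>). indicator \<Omega> (t *\<^sub>R a + \<sigma> *\<^sub>R b) * divg X (t *\<^sub>R a + \<sigma> *\<^sub>R b) \<partial>(lborel \<Otimes>\<^sub>M lborel))"
    using integral_frame(1)[OF frame m] by (simp add: lborel_prod split_def)
  also have "\<dots> = (\<integral>t. (\<integral>\<sigma>. indicator \<Omega> (t *\<^sub>R a + \<sigma> *\<^sub>R b) * divg X (t *\<^sub>R a + \<sigma> *\<^sub>R b) \<partial>lborel) \<partial>lborel)"
    using lborel_pair.integral_fst[OF ip] by simp
  also have "\<dots> = (\<integral>t. (\<integral>s. indicator {..<0} s * D1 t s + indicator {..<0} s * D2 t s \<partial>lborel) \<partial>lborel)"
  proof (rule Bochner_Integration.integral_cong[OF refl])
    fix t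
    have "(\<integral>\<sigma>. indicator \<Omega> (t *\<^sub>R a + \<sigma> *\<^sub>R b) * divg X (t *\<^sub>R a + \<sigma> *\<^sub>R b) \<partial>lborel)
        = (\<integral>s. indicator \<Omega> (t *\<^sub>R a + (g t + 1 * s) *\<^sub>R b) * divg X (t *\<^sub>R a + (g t + 1 * s) *\<^sub>R b) \<partial>lborel)"
      using lborel_integral_real_affine[of 1 "\<lambda>\<sigma>. indicator \<Omega> (t *\<^sub>R a + \<sigma> *\<^sub>R b) * divg X (t *\<^sub>R a + \<sigma> *\<^sub>R b)" "g t"] by simp
    also have "\<dots> = (\<integral>s. indicator {..<0} s * D1 t s + indicator {..<0} s * D2 t s \<partial>lborel)"
    proof (rule Bochner_Integration.integral_cong[OF refl])
      fix s
      have e: "t *\<^sub>R a + (g t + 1 * s) *\<^sub>R b = Z t s" by (simp add: Z_def \<gamma>_def algebra_simps)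
      have "indicator \<Omega> (Z t s) * divg X (Z t s) = indicator {..<0} s * divg X (Z t s)"
      proof (cases "Z t s \<in> S")
        case True
        then have "Z t s \<in> \<Omega> \<longleftrightarrow> s < 0" using below[of "Z t s"] S(2) by (auto simp: Z_inner)
        then show ?thesis by (simp add: indicator_def)
      next
        case False
        then show ?thesis using S(4) by (simp add: divg_def)
      qed
      then show "indicator \<Omega> (t *\<^sub>R a + (g t + 1 * s) *\<^sub>R b) * divg X (t *\<^sub>R a + (g t + 1 * s) *\<^sub>R b)
          = indicator {..<0} s * D1 t s + indicator {..<0} s * D2 t s"
        unfolding e div_eq by (simp add: distrib_left)
    qed
    finally show "(\<integral>\<sigma>. indicator \<Omega> (t *\<^sub>R a + \<sigma> *\<^sub>R b) * divg X (t *\<^sub>R a + \<sigma> *\<^sub>R b) \<partial>lborel)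
        = (\<integral>s. indicator {..<0} s * D1 t s + indicator {..<0} s * D2 t s \<partial>lborel)" .
  qed
  also have "\<dots> = (\<integral>(t, s). indicator {..<0} s * D1 t s + indicator {..<0} s * D2 t s \<partial>(lborel \<Otimes>\<^sub>M lborel))"
    using lborel_pair.integral_fst[of "\<lambda>t s. indicator {..<0} s * D1 t s + indicator {..<0} s * D2 t s"]
      Bochner_Integration.integrable_add[OF iD1 iD2] by (simp add: split_def)
  also have "\<dots> = (\<integral>(t, s). indicator {..<0} s * D1 t s \<partial>(lborel \<Otimes>\<^sub>M lborel)) + (\<integral>(t, s). indicator {..<0} s * D2 t s \<partial>(lborel \<Otimes>\<^sub>M lborel))"
    using Bochner_Integration.integral_add[OF iD1 iD2] by (simp add: split_def)
  also have "(\<integral>(t, s). indicator {..<0} s * D1 t s \<partial>(lborel \<Otimes>\<^sub>M lborel)) = (\<integral>s. (\<integral>t. indicator {..<0} s * D1 t s \<partial>lborel) \<partial>lborel)"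
    using lborel_pair.integral_snd[OF iD1] by simp
  also have "\<dots> = 0"
  proof -
    have "(\<integral>t. D1 t s \<partial>lborel) = 0" for s
    proof (rule integral_derivative_compact_support[where R=T])
      fix t
      have "((\<lambda>t. Z t s) has_vector_derivative (a + g' t *\<^sub>R b)) (at t)"
        unfolding Z_def using \<gamma>_vector_derivative[of t UNIV] by (auto intro!: derivative_eq_intros)
      from has_vector_derivative_along[OF CX this]
      have "((\<lambda>t. X (Z t s)) has_derivative (\<lambda>h. h *\<^sub>R dirder X (Z t s) (a + g' t *\<^sub>R b))) (at t)"
        by (simp add: has_vector_derivative_def)
      from has_derivative_inner_left[OF this, of a]
      show "((\<lambda>t. X (Z t s) \<bullet> a) has_vector_derivative D1 t s) (at t)"
        by (simp add: has_vector_derivative_def D1_def)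
      show "continuous_on UNIV (\<lambda>t. D1 t s)"
        using continuous_on_compose2[OF cD1 cp(1)] by simp
      show "T \<le> \<bar>t\<bar> \<Longrightarrow> X (Z t s) \<bullet> a = 0" using zX by simp
      show "T < \<bar>t\<bar> \<Longrightarrow> D1 t s = 0" using z by (simp add: D1_def)
    qed
    then show ?thesis by simp
  qed
  also have "(\<integral>(t, s). indicator {..<0} s * D2 t s \<partial>(lborel \<Otimes>\<^sub>M lborel)) = (\<integral>t. (\<integral>s. indicator {..<0} s * D2 t s \<partial>lborel) \<partial>lborel)"
    using lborel_pair.integral_fst[OF iD2] by simp
  also have "\<dots> = (\<integral>t. indicator {-T..T} t * (X (\<gamma> t) \<bullet> (b - g' t *\<^sub>R a)) \<partial>lborel)"
  proof (rule Bochner_Integration.integral_cong[OF refl])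
    fix t
    have "(\<integral>s. indicator {..<0} s * D2 t s \<partial>lborel) = (\<integral>s. indicator {-W..0} s *\<^sub>R D2 t s \<partial>lborel)"
    proof (rule integral_cong_AE)
      have [measurable]: "(\<lambda>s. D2 t s) \<in> borel_measurable borel"
        using continuous_on_compose2[OF cD2 cp(2)] by (intro borel_measurable_continuous_onI) simp
      show "(\<lambda>s. indicator {..<0} s * D2 t s) \<in> borel_measurable lborel" "(\<lambda>s. indicator {-W..0} s *\<^sub>R D2 t s) \<in> borel_measurable lborel"
        by measurable
      show "AE s in lborel. indicator {..<0} s * D2 t s = indicator {-W..0} s *\<^sub>R D2 t s"
        using AE_lborel_singleton[of "0::real"]
      proof eventually_elim
        case (elim s)
        show ?case
        proof (cases "s < -W")
          case True
          then have "D2 t s = 0" using D_out by auto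
          then show ?thesis by simp
        qed (use elim in \<open>auto simp: indicator_def\<close>)
      qed
    qed
    also have "\<dots> = X (Z t 0) \<bullet> (b - g' t *\<^sub>R a) - X (Z t (-W)) \<bullet> (b - g' t *\<^sub>R a)"
    proof (rule integral_FTC_atLeastAtMost)
      fix s
      have "((\<lambda>s. Z t s) has_vector_derivative b) (at s within {-W..0})"
        unfolding Z_def by (auto intro!: derivative_eq_intros)
      from has_vector_derivative_along[OF CX this]
      have "((\<lambda>s. X (Z t s)) has_derivative (\<lambda>h. h *\<^sub>R dirder X (Z t s) b)) (at s within {-W..0})"
        by (simp add: has_vector_derivative_def)
      from has_derivative_inner_left[OF this, of "b - g' t *\<^sub>R a"]
      show "((\<lambda>s. X (Z t s) \<bullet> (b - g' t *\<^sub>R a)) has_vector_derivative D2 t s) (at s within {-W..0})"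
        by (simp add: has_vector_derivative_def D2_def)
      show "continuous_on {-W..0} (D2 t)"
        using continuous_on_compose2[OF cD2 cp(2)] by simp
    qed (use W in simp)
    also have "\<dots> = X (\<gamma> t) \<bullet> (b - g' t *\<^sub>R a)"
      using zX[of t "-W"] W by (simp add: Z_def)
    also have "\<dots> = indicator {-T..T} t * (X (\<gamma> t) \<bullet> (b - g' t *\<^sub>R a))"
    proof (cases "t \<in> {-T..T}")
      case False
      then have "T \<le> \<bar>t\<bar>" by auto
      then show ?thesis using zX[of t 0] False by (simp add: Z_def)
    qed simp
    finally show "(\<integral>s. indicator {..<0} s * D2 t s \<partial>lborel) = indicator {-T..T} t * (X (\<gamma> t) \<bullet> (b - g' t *\<^sub>R a))" .
  qed
  also have "\<dots> \<le> arc_int (\<lambda>x. norm (X x)) (-T) T"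
    using T by (intro flux_le_arc_int C1_continuous[OF CX]) simp
  finally have le: "(\<integral>x. indicator \<Omega> x * divg X x \<partial>lborel) \<le> arc_int (\<lambda>x. norm (X x)) (-T) T" by simp
  have eq: "(\<lambda>x. indicator (frontier \<Omega>) x * norm (X x)) = (\<lambda>x. indicator (arc (-T) T) x * norm (X x))"
  proof
    fix x
    show "indicator (frontier \<Omega>) x * norm (X x) = indicator (arc (-T) T) x * norm (X x)"
    proof (cases "x \<in> S")
      case True
      then have "\<bar>x \<bullet> a\<bar> < T" using far[of x] by linarith
      then have "x \<in> frontier \<Omega> \<longleftrightarrow> x \<in> arc (-T) T"
        using on[of x] S(2) True by (auto simp: arc_def)
      then show ?thesis by (simp add: indicator_def)
    next
      case False
      then show ?thesis using S(3) by simp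
    qed
  qed
  show "integrable hausdorff1 (\<lambda>x. indicator (frontier \<Omega>) x * norm (X x))"
    unfolding eq by (intro arc_integrable continuous_intros C1_continuous[OF CX])
  show "(\<integral>x. indicator \<Omega> x * divg X x \<partial>lborel) \<le> (\<integral>x. indicator (frontier \<Omega>) x * norm (X x) \<partial>hausdorff1)"
    using le unfolding eq arc_int_def .
qed

end

section \<open>Domains with locally graphical boundary\<close>

text \<open>What the analysis retains of the exterior of \<open>K\<close>: the domain may be
  unbounded, but its frontier is compact and therefore covered by finitely many charts.\<close>

definition graph_domain :: "(real^2) set \<Rightarrow> bool" where
  "graph_domain \<Omega> \<longleftrightarrow> open \<Omega> \<and> compact (frontier \<Omega>) \<and>
    (\<forall>p\<in>frontier \<Omega>. \<exists>r a b g g'. chart a b g g' \<Omega> p r)"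

lemma compact_ball_cover:
  assumes S: "compact S" and r: "\<And>p. p \<in> S \<Longrightarrow> 0 < r p"
  shows "\<exists>I\<subseteq>S. finite I \<and> S \<subseteq> (\<Union>p\<in>I. ball p (r p))"
proof -
  have "S \<subseteq> (\<Union>p\<in>S. ball p (r p))" using r by force
  then show ?thesis
    using compactE_image[OF S, of S "\<lambda>p. ball p (r p)"] by (metis open_ball)
qed

lemma L2_zero: "L2 M (\<lambda>x. 0 :: 'b::real_normed_vector)"
  by (simp add: L2_def)

text \<open>By Fubini, as every line parallel to \<open>b\<close> meets the graph in a single
  point.\<close>

lemma (in graph_frame) graph_null: "{x. x \<bullet> b = g (x \<bullet> a)} \<in> null_sets lborel"
proof -
  have [measurable]: "g \<in> borel_measurable borel" by (rule borel_measurable_continuous_onI[OF g_continuous])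
  have [measurable]: "{x. x \<bullet> b = g (x \<bullet> a)} \<in> sets borel" by measurable
  have "emeasure lborel {x. x \<bullet> b = g (x \<bullet> a)} = (\<integral>\<^sup>+x. indicator {x. x \<bullet> b = g (x \<bullet> a)} x \<partial>lborel)"
    by simp
  also have "\<dots> = (\<integral>\<^sup>+t. (\<integral>\<^sup>+s. indicator {x. x \<bullet> b = g (x \<bullet> a)} (t *\<^sub>R a + s *\<^sub>R b) \<partial>lborel) \<partial>lborel)"
    by (rule nn_integral_frame[OF frame]) measurable
  also have "\<dots> = (\<integral>\<^sup>+t. (\<integral>\<^sup>+s. indicator {g t} s \<partial>(lborel :: real measure)) \<partial>(lborel :: real measure))"
    by (intro nn_integral_cong) (auto simp: indicator_def inner_simps ab)
  also have "\<dots> = 0" by simp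
  finally show ?thesis by (auto simp: null_sets_def)
qed

text \<open>Needed to exchange integrals over the closed set \<open>M\<close> for integrals over its
  interior.\<close>

lemma graph_domain_frontier_null:
  assumes "graph_domain \<Omega>" shows "frontier \<Omega> \<in> null_sets lborel"
proof -
  have "\<exists>r>0. \<exists>S. frontier \<Omega> \<inter> ball p r \<subseteq> S \<and> S \<in> null_sets lborel" if p: "p \<in> frontier \<Omega>" for p
  proof -
    obtain r a b g g' where "chart a b g g' \<Omega> p r"
      using assms p unfolding graph_domain_def by blast
    then interpret chart a b g g' \<Omega> p r .
    have "frontier \<Omega> \<inter> ball p r \<subseteq> {x. x \<bullet> b = g (x \<bullet> a)}" using on by auto
    with r graph_null show ?thesis by (intro exI[of _ r] conjI exI[of _ "{x. x \<bullet> b = g (x \<bullet> a)}"])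
  qed
  then have "\<forall>p\<in>frontier \<Omega>. \<exists>y. 0 < fst y \<and> frontier \<Omega> \<inter> ball p (fst y) \<subseteq> snd y \<and> snd y \<in> null_sets lborel"
    by (auto simp: Bex_def)
  from bchoice[OF this] obtain f where
    f: "\<forall>p\<in>frontier \<Omega>. 0 < fst (f p) \<and> frontier \<Omega> \<inter> ball p (fst (f p)) \<subseteq> snd (f p) \<and> snd (f p) \<in> null_sets lborel"
    by blast
  define r S where "r p = fst (f p)" and "S p = snd (f p)" for p
  have rS: "0 < r p \<and> frontier \<Omega> \<inter> ball p (r p) \<subseteq> S p \<and> S p \<in> null_sets lborel" if "p \<in> frontier \<Omega>" for p
    using f that by (simp add: r_def S_def)
  have "compact (frontier \<Omega>)" using assms by (simp add: graph_domain_def)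
  then obtain I where I: "I \<subseteq> frontier \<Omega>" "finite I" "frontier \<Omega> \<subseteq> (\<Union>p\<in>I. ball p (r p))"
    using compact_ball_cover[of "frontier \<Omega>" r] rS by blast
  have "(\<Union>p\<in>I. S p) \<in> null_sets lborel"
    using I rS by (intro null_sets.finite_UN) auto
  moreover have "frontier \<Omega> \<subseteq> (\<Union>p\<in>I. S p)"
    using I rS by blast
  moreover have "frontier \<Omega> \<in> sets lborel" by simp
  ultimately show ?thesis using null_sets_subset by blast
qed

text \<open>Integrals of nonnegative functions over the frontier are subadditive in the pieces, so
  finitely many local estimates simply add up.\<close>

lemma graph_domain_trace:
  assumes dom: "graph_domain \<Omega>"
  obtains C where "0 \<le> C" "emeasure hausdorff1 (frontier \<Omega>) < \<infinity>"
    "\<And>\<phi>::real^2 \<Rightarrow> complex. \<phi> \<in> C1c UNIV \<Longrightarrow>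
      (\<integral>\<^sup>+x. indicator (frontier \<Omega>) x * ennreal ((norm (\<phi> x))\<^sup>2) \<partial>hausdorff1)
      \<le> ennreal C * (\<integral>\<^sup>+x. indicator \<Omega> x * ennreal ((norm (\<phi> x))\<^sup>2 + (norm (grad \<phi> x))\<^sup>2) \<partial>lborel)"
proof -
  define Q where "Q p \<delta> C \<longleftrightarrow> 0 < \<delta> \<and> C \<ge> 0 \<and> emeasure hausdorff1 (frontier \<Omega> \<inter> ball p \<delta>) < \<infinity> \<and>
    (\<forall>\<phi>::real^2 \<Rightarrow> complex. \<phi> \<in> C1c UNIV \<longrightarrow>
      (\<integral>\<^sup>+x. indicator (frontier \<Omega> \<inter> ball p \<delta>) x * ennreal ((norm (\<phi> x))\<^sup>2) \<partial>hausdorff1)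
      \<le> ennreal C * (\<integral>\<^sup>+x. indicator \<Omega> x * ennreal ((norm (\<phi> x))\<^sup>2 + (norm (grad \<phi> x))\<^sup>2) \<partial>lborel))" for p \<delta> C
  have "\<exists>\<delta> C. Q p \<delta> C" if p: "p \<in> frontier \<Omega>" for p
  proof -
    obtain r a b g g' where "chart a b g g' \<Omega> p r"
      using dom p unfolding graph_domain_def by blast
    then interpret chart a b g g' \<Omega> p r .
    show ?thesis using trace_local unfolding Q_def by blast
  qed
  then have "\<forall>p\<in>frontier \<Omega>. \<exists>y. Q p (fst y) (snd y)" by (metis fst_conv snd_conv)
  from bchoice[OF this] obtain f where f: "\<forall>p\<in>frontier \<Omega>. Q p (fst (f p)) (snd (f p))" by blast
  define \<delta> C where "\<delta> p = fst (f p)" and "C p = snd (f p)" for p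
  have "Q p (\<delta> p) (C p)" if "p \<in> frontier \<Omega>" for p
    unfolding \<delta>_def C_def by (rule bspec[OF f that])
  note P = this[unfolded Q_def]
  have P1: "0 < \<delta> p" "0 \<le> C p" "emeasure hausdorff1 (frontier \<Omega> \<inter> ball p (\<delta> p)) < \<infinity>" if "p \<in> frontier \<Omega>" for p
    by (rule P[OF that, THEN conjunct1] P[OF that, THEN conjunct2, THEN conjunct1]
        P[OF that, THEN conjunct2, THEN conjunct2, THEN conjunct1])+
  note P2 = P[THEN conjunct2, THEN conjunct2, THEN conjunct2, rule_format]
  have "compact (frontier \<Omega>)" using dom by (simp add: graph_domain_def)
  then obtain I where I: "I \<subseteq> frontier \<Omega>" "finite I" "frontier \<Omega> \<subseteq> (\<Union>p\<in>I. ball p (\<delta> p))"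
    using compact_ball_cover[of "frontier \<Omega>" \<delta>, OF _ P1(1)] by blast
  show ?thesis
  proof (rule that[of "\<Sum>p\<in>I. C p"])
    show "0 \<le> (\<Sum>p\<in>I. C p)" using I(1) P1(2) by (intro sum_nonneg) blast
    have sb: "frontier \<Omega> \<inter> ball p d \<in> sets hausdorff1" for p d
      unfolding sets_hausdorff1 by (intro sets.Int) auto
    then have "(\<Union>p\<in>I. frontier \<Omega> \<inter> ball p (\<delta> p)) \<in> sets hausdorff1"
      using I by (intro sets.finite_UN) auto
    then have "emeasure hausdorff1 (frontier \<Omega>) \<le> emeasure hausdorff1 (\<Union>p\<in>I. frontier \<Omega> \<inter> ball p (\<delta> p))"
      using I by (intro emeasure_mono) blast+
    also have "\<dots> \<le> (\<Sum>p\<in>I. emeasure hausdorff1 (frontier \<Omega> \<inter> ball p (\<delta> p)))"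
      using I sb by (intro emeasure_subadditive_finite) blast+
    also have "\<dots> < \<infinity>" using I P1(3) by (simp add: subset_eq)
    finally show "emeasure hausdorff1 (frontier \<Omega>) < \<infinity>" .
    fix \<phi> :: "real^2 \<Rightarrow> complex" assume \<phi>: "\<phi> \<in> C1c UNIV"
    have [measurable]: "\<phi> \<in> borel_measurable borel"
      by (rule borel_measurable_continuous_onI[OF C1_continuous[OF C1c_C1[OF \<phi>]]])
    let ?Z = "\<integral>\<^sup>+x. indicator \<Omega> x * ennreal ((norm (\<phi> x))\<^sup>2 + (norm (grad \<phi> x))\<^sup>2) \<partial>lborel"
    have "(\<integral>\<^sup>+x. indicator (frontier \<Omega>) x * ennreal ((norm (\<phi> x))\<^sup>2) \<partial>hausdorff1)
        \<le> (\<integral>\<^sup>+x. (\<Sum>p\<in>I. indicator (frontier \<Omega> \<inter> ball p (\<delta> p)) x * ennreal ((norm (\<phi> x))\<^sup>2)) \<partial>hausdorff1)"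
    proof (rule nn_integral_mono)
      fix x
      show "indicator (frontier \<Omega>) x * ennreal ((norm (\<phi> x))\<^sup>2)
          \<le> (\<Sum>p\<in>I. indicator (frontier \<Omega> \<inter> ball p (\<delta> p)) x * ennreal ((norm (\<phi> x))\<^sup>2))"
      proof (cases "x \<in> frontier \<Omega>")
        case True
        then obtain p where p: "p \<in> I" "x \<in> ball p (\<delta> p)" using I by blast
        then have "indicator (frontier \<Omega>) x * ennreal ((norm (\<phi> x))\<^sup>2)
            = indicator (frontier \<Omega> \<inter> ball p (\<delta> p)) x * ennreal ((norm (\<phi> x))\<^sup>2)" using True by simp
        also have "\<dots> \<le> (\<Sum>p\<in>I. indicator (frontier \<Omega> \<inter> ball p (\<delta> p)) x * ennreal ((norm (\<phi> x))\<^sup>2))"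
          using p I by (intro member_le_sum) auto
        finally show ?thesis .
      qed simp
    qed
    also have "\<dots> = (\<Sum>p\<in>I. \<integral>\<^sup>+x. indicator (frontier \<Omega> \<inter> ball p (\<delta> p)) x * ennreal ((norm (\<phi> x))\<^sup>2) \<partial>hausdorff1)"
    proof (rule nn_integral_sum)
      fix p
      have [measurable]: "frontier \<Omega> \<inter> ball p (\<delta> p) \<in> sets borel" by (intro sets.Int) auto
      have "(\<lambda>x. indicator (frontier \<Omega> \<inter> ball p (\<delta> p)) x * ennreal ((norm (\<phi> x))\<^sup>2)) \<in> borel_measurable borel"
        by measurable
      then show "(\<lambda>x. indicator (frontier \<Omega> \<inter> ball p (\<delta> p)) x * ennreal ((norm (\<phi> x))\<^sup>2)) \<in> borel_measurable hausdorff1"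
        by (simp add: measurable_cong_sets[OF sets_hausdorff1 refl])
    qed
    also have "\<dots> \<le> (\<Sum>p\<in>I. ennreal (C p) * ?Z)"
      using I(1) by (intro sum_mono P2 \<phi>) blast
    also have "\<dots> = (\<Sum>p\<in>I. ennreal (C p)) * ?Z" by (rule sum_distrib_right[symmetric])
    also have "(\<Sum>p\<in>I. ennreal (C p)) = ennreal (\<Sum>p\<in>I. C p)"
      using I(1) P1(2) by (intro sum_ennreal) blast
    finally show "(\<integral>\<^sup>+x. indicator (frontier \<Omega>) x * ennreal ((norm (\<phi> x))\<^sup>2) \<partial>hausdorff1)
        \<le> ennreal (\<Sum>p\<in>I. C p) * ?Z" .
  qed
qed

text \<open>The functions live in the balls of half the chart radius, which leaves room for shifts
  inside the chart. They sum to 1 on the union \<open>N\<close> of the balls of a quarter of the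
  radius, a neighbourhood of the whole frontier.\<close>

lemma graph_domain_partition:
  assumes dom: "graph_domain \<Omega>"
  obtains I r \<theta> N where "finite I" "I \<subseteq> frontier \<Omega>"
    "\<And>p. p \<in> I \<Longrightarrow> \<exists>a b g g'. chart a b g g' \<Omega> p (r p)"
    "\<And>p. p \<in> I \<Longrightarrow> \<theta> p \<in> C1c UNIV" "\<And>p x. p \<in> I \<Longrightarrow> (0::real) \<le> \<theta> p x"
    "\<And>p x. p \<in> I \<Longrightarrow> x \<notin> ball p (r p / 2) \<Longrightarrow> \<theta> p x = 0"
    "\<And>x. (\<Sum>p\<in>I. \<theta> p x) \<le> 1" "open N" "frontier \<Omega> \<subseteq> N" "\<And>x. x \<in> N \<Longrightarrow> (\<Sum>p\<in>I. \<theta> p x) = 1"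
proof -
  have "\<forall>p\<in>frontier \<Omega>. \<exists>r. \<exists>a b g g'. chart a b g g' \<Omega> p r"
    using dom unfolding graph_domain_def by blast
  then obtain r where r: "\<forall>p\<in>frontier \<Omega>. \<exists>a b g g'. chart a b g g' \<Omega> p (r p)"
    by (rule bchoice[THEN exE])
  have r0: "0 < r p" if "p \<in> frontier \<Omega>" for p
    using r that chart.r by blast
  have "compact (frontier \<Omega>)" using dom by (simp add: graph_domain_def)
  moreover have "0 < r p / 2 / 2" if "p \<in> frontier \<Omega>" for p using r0[OF that] by simp
  ultimately obtain I where I: "I \<subseteq> frontier \<Omega>" "finite I" "frontier \<Omega> \<subseteq> (\<Union>p\<in>I. ball p (r p / 2 / 2))"
    using compact_ball_cover[of "frontier \<Omega>" "\<lambda>p. r p / 2 / 2"] by blast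
  have "0 < r p / 2" if "p \<in> I" for p using r0 I that by auto
  from partition_of_unity[of I "\<lambda>p. r p / 2", OF I(2) this] obtain \<theta> :: "real^2 \<Rightarrow> real^2 \<Rightarrow> real" where \<theta>:
    "\<And>p. p \<in> I \<Longrightarrow> \<theta> p \<in> C1c UNIV" "\<And>p x. p \<in> I \<Longrightarrow> 0 \<le> \<theta> p x"
    "\<And>p x. p \<in> I \<Longrightarrow> x \<notin> ball p (r p / 2) \<Longrightarrow> \<theta> p x = 0"
    "\<And>x. (\<Sum>p\<in>I. \<theta> p x) \<le> 1"
    "\<And>x. x \<in> (\<Union>p\<in>I. ball p (r p / 2 / 2)) \<Longrightarrow> (\<Sum>p\<in>I. \<theta> p x) = 1"
    by blast
  show ?thesis
    by (rule that[OF I(2,1) _ \<theta>(1,2,3,4) _ I(3) \<theta>(5)]) (use r I in auto)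
qed

section \<open>The divergence theorem as an inequality on graph domains\<close>

lemma divg_add: "C1 X \<Longrightarrow> C1 Y \<Longrightarrow> divg (\<lambda>x. X x + Y x) x = divg X x + divg Y x"
  by (simp add: divg_def C1_add)

lemma divg_sum:
  assumes "finite I" "\<And>k. k \<in> I \<Longrightarrow> C1 (X k)"
  shows "divg (\<lambda>x. \<Sum>k\<in>I. X k x) x = (\<Sum>k\<in>I. divg (X k) x)"
proof -
  have "partial i (\<lambda>x. \<Sum>k\<in>I. X k x) x = (\<Sum>k\<in>I. partial i (X k) x)" for i
    using C1_sum[of I X, OF assms] by blast
  then show ?thesis by (simp add: divg_def sum.distrib)
qed

lemma divg_continuous: "C1 X \<Longrightarrow> continuous_on S (divg X)"
  unfolding divg_def by (intro continuous_intros C1_partial_continuous)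

lemma divg_integrable:
  assumes "X \<in> C1c UNIV" "\<Omega> \<in> sets borel"
  shows "integrable lborel (\<lambda>x. indicator \<Omega> x * divg X x)"
proof -
  obtain S where S: "compact S" "\<And>i x. x \<notin> S \<Longrightarrow> partial i X x = 0" using C1cE[OF assms(1)] by metis
  have "integrable lborel (divg X)"
    by (rule integrable_continuous_compact_support[OF divg_continuous[OF C1c_C1[OF assms(1)]], of S])
      (use S compact_imp_bounded in \<open>auto simp: divg_def\<close>)
  then have "integrable lborel (\<lambda>x. divg X x * indicator \<Omega> x)"
    using assms(2) by (intro integrable_real_mult_indicator) auto
  then show ?thesis by (simp only: mult.commute)
qed

lemma integral_divg_zero:
  assumes "X \<in> C1c UNIV" shows "(\<integral>x. divg X x \<partial>lborel) = 0"
proof -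
  have i: "integrable lborel (\<lambda>x. partial i X x $ j)" for i j
    using integrable_bounded_linear[OF bounded_linear_vec_nth C1c_integrable(2)[OF assms]] .
  have "(\<integral>x. partial i X x $ j \<partial>lborel) = 0" for i j
    using integral_bounded_linear[OF bounded_linear_vec_nth[of j] C1c_integrable(2)[OF assms, of i]]
    by (simp add: integral_partial_zero[OF assms])
  then show ?thesis unfolding divg_def using i by simp
qed

text \<open>Every point outside \<open>\<Omega>\<close> has a neighbourhood in \<open>N\<close> or
  off the closure of \<open>\<Omega>\<close>, and on both the truncated function is 0.\<close>

lemma C1c_cut_off:
  fixes X :: "real^2 \<Rightarrow> 'b::real_normed_vector"
  assumes X: "X \<in> C1c UNIV" and \<Omega>: "open \<Omega>" and N: "open N" "frontier \<Omega> \<subseteq> N" "\<And>x. x \<in> N \<Longrightarrow> X x = 0"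
  shows "(\<lambda>x. if x \<in> \<Omega> then X x else 0) \<in> C1c UNIV"
    "partial i (\<lambda>x. if x \<in> \<Omega> then X x else 0) x = (if x \<in> \<Omega> then partial i X x else 0)"
proof -
  let ?Y = "\<lambda>x. if x \<in> \<Omega> then X x else 0"
  have out: "x \<in> N \<union> - closure \<Omega>" if "x \<notin> \<Omega>" for x
    using that N(2) \<Omega> by (auto simp: frontier_def interior_open)
  have o2: "open (N \<union> - closure \<Omega>)" using N(1) by auto
  have z: "?Y y = 0" if "y \<in> N \<union> - closure \<Omega>" for y
    using that N(3) closure_subset[of \<Omega>] by auto
  have "C1 ?Y"
  proof (rule C1_local)
    fix x
    show "\<exists>U g. open U \<and> x \<in> U \<and> C1 g \<and> (\<forall>y\<in>U. ?Y y = g y)"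
    proof (cases "x \<in> \<Omega>")
      case True
      then show ?thesis using \<Omega> C1c_C1[OF X] by (intro exI[of _ \<Omega>] exI[of _ X]) auto
    next
      case False
      then show ?thesis using o2 z out
        by (intro exI[of _ "N \<union> - closure \<Omega>"] exI[of _ "\<lambda>_. 0"]) (auto intro: C1_const)
    qed
  qed
  moreover obtain S where "compact S" "\<And>x. x \<notin> S \<Longrightarrow> X x = 0" using C1cE[OF X] by metis
  ultimately show "?Y \<in> C1c UNIV" unfolding C1c_iff by auto
  show "partial i ?Y x = (if x \<in> \<Omega> then partial i X x else 0)"
  proof (cases "x \<in> \<Omega>")
    case True
    then show ?thesis using partial_cong_open[OF \<Omega> True, of ?Y X] by simp
  next
    case False
    then have "partial i ?Y x = partial i (\<lambda>_. 0) x"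
      using z by (intro partial_cong_open[OF o2 out]) auto
    then show ?thesis using False by (simp add: C1_const)
  qed
qed

lemma frontier_integrable:
  assumes fin: "emeasure hausdorff1 (frontier \<Omega>) < \<infinity>" and f: "continuous_on UNIV f" "\<And>x. norm (f x) \<le> B"
  shows "integrable hausdorff1 (\<lambda>x. indicator (frontier \<Omega>) x * (f x :: real))"
proof -
  have [measurable]: "f \<in> borel_measurable borel" using f(1) by (rule borel_measurable_continuous_onI)
  have [measurable]: "frontier \<Omega> \<in> sets borel" by simp
  have i: "integrable hausdorff1 (\<lambda>x. B * indicator (frontier \<Omega>) x)"
    by (intro integrable_mult_right integrable_real_indicator) (use fin in auto)
  show ?thesis
    by (rule Bochner_Integration.integrable_bound[OF i])
      (use f(2) in \<open>auto intro!: always_eventually simp: indicator_def intro: order_trans[OF _ abs_ge_self]\<close>)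
qed

lemma C1c_norm_bounded:
  assumes "f \<in> C1c UNIV" obtains B where "0 < B" "\<And>x. norm (f x) \<le> B"
proof -
  obtain S where S: "compact S" "\<And>x. x \<notin> S \<Longrightarrow> f x = 0" using C1cE[OF assms] by metis
  show ?thesis using bounded_compact_support[OF C1_continuous[OF C1c_C1[OF assms]] S] that by blast
qed

text \<open>The field splits into pieces carried by single charts and a rest \<open>X0\<close> that
  vanishes near the frontier. The rest, cut off at the frontier, is a field of compact support in
  the plane and has total divergence 0. The boundary terms of the pieces add up to at most that of
  \<open>X\<close>, because the partition functions are nonnegative with sum at most 1.\<close>

lemma graph_domain_divergence:
  assumes dom: "graph_domain \<Omega>" and X: "X \<in> C1c UNIV"
  shows "(\<integral>x. indicator \<Omega> x * divg X x \<partial>lborel) \<le> (\<integral>x. indicator (frontier \<Omega>) x * norm (X x) \<partial>hausdorff1)"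
proof -
  obtain I r \<theta> N where I: "finite I" "I \<subseteq> frontier \<Omega>"
    and ch: "\<And>p. p \<in> I \<Longrightarrow> \<exists>a b g g'. chart a b g g' \<Omega> p (r p)"
    and \<theta>: "\<And>p. p \<in> I \<Longrightarrow> \<theta> p \<in> C1c UNIV" "\<And>p x. p \<in> I \<Longrightarrow> (0::real) \<le> \<theta> p x"
      "\<And>p x. p \<in> I \<Longrightarrow> x \<notin> ball p (r p / 2) \<Longrightarrow> \<theta> p x = 0" "\<And>x. (\<Sum>p\<in>I. \<theta> p x) \<le> 1"
    and N: "open N" "frontier \<Omega> \<subseteq> N" "\<And>x. x \<in> N \<Longrightarrow> (\<Sum>p\<in>I. \<theta> p x) = 1"
    using graph_domain_partition[OF dom] by blast
  have \<Omega>: "open \<Omega>" and \<Omega>b: "\<Omega> \<in> sets borel" using dom by (auto simp: graph_domain_def)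
  define Y where "Y p x = \<theta> p x *\<^sub>R X x" for p x
  have Y: "Y p \<in> C1c UNIV" if "p \<in> I" for p
    unfolding Y_def by (rule C1c_scaleR_left[OF X C1c_C1[OF \<theta>(1)[OF that]]])
  have loc: "(\<integral>x. indicator \<Omega> x * divg (Y p) x \<partial>lborel) \<le> (\<integral>x. indicator (frontier \<Omega>) x * norm (Y p x) \<partial>hausdorff1)
      \<and> integrable hausdorff1 (\<lambda>x. indicator (frontier \<Omega>) x * norm (Y p x))" if pI: "p \<in> I" for p
  proof -
    obtain a b g g' where "chart a b g g' \<Omega> p (r p)" using ch[OF pI] by blast
    then interpret chart a b g g' \<Omega> p "r p" .
    have "Y p \<in> C1c (ball p (r p))"
      unfolding C1c_iff
    proof (intro conjI exI[of _ "cball p (r p / 2)"] allI impI)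
      show "C1 (Y p)" by (rule C1c_C1[OF Y[OF pI]])
      show "cball p (r p / 2) \<subseteq> ball p (r p)" using r by auto
      show "Y p x = 0" if "x \<notin> cball p (r p / 2)" for x using \<theta>(3)[OF pI, of x] that by (simp add: Y_def)
    qed simp
    then show ?thesis using divergence_local by blast
  qed
  define Ys where "Ys x = (\<Sum>p\<in>I. Y p x)" for x
  have Ys: "Ys \<in> C1c UNIV" unfolding Ys_def by (rule C1c_sum[OF I(1) Y])
  define X0 where "X0 x = X x - Ys x" for x
  have X0: "X0 \<in> C1c UNIV" unfolding X0_def by (rule C1c_diff[OF X Ys])
  have Ys_eq: "Ys x = (\<Sum>p\<in>I. \<theta> p x) *\<^sub>R X x" for x by (simp add: Ys_def Y_def scaleR_sum_left)
  have X0N: "X0 x = 0" if "x \<in> N" for x using N(3)[OF that] by (simp add: X0_def Ys_eq)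
  let ?Z = "\<lambda>x. if x \<in> \<Omega> then X0 x else 0"
  note Z = C1c_cut_off[OF X0 \<Omega> N(1,2) X0N]
  have "(\<integral>x. indicator \<Omega> x * divg X0 x \<partial>lborel) = (\<integral>x. divg ?Z x \<partial>lborel)"
    by (intro Bochner_Integration.integral_cong refl) (simp add: divg_def Z(2))
  also have "\<dots> = 0" by (rule integral_divg_zero[OF Z(1)])
  finally have zero: "(\<integral>x. indicator \<Omega> x * divg X0 x \<partial>lborel) = 0" .
  have "divg X x = (\<Sum>p\<in>I. divg (Y p) x) + divg X0 x" for x
  proof -
    have "X = (\<lambda>x. Ys x + X0 x)" by (simp add: X0_def)
    then have "divg X x = divg Ys x + divg X0 x"
      using divg_add[OF C1c_C1[OF Ys] C1c_C1[OF X0]] by metis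
    also have "divg Ys x = (\<Sum>p\<in>I. divg (Y p) x)"
      unfolding Ys_def by (rule divg_sum[OF I(1) C1c_C1[OF Y]])
    finally show ?thesis .
  qed
  then have "(\<integral>x. indicator \<Omega> x * divg X x \<partial>lborel) = (\<integral>x. (\<Sum>p\<in>I. indicator \<Omega> x * divg (Y p) x) + indicator \<Omega> x * divg X0 x \<partial>lborel)"
    by (simp add: distrib_left sum_distrib_left)
  also have "\<dots> = (\<Sum>p\<in>I. \<integral>x. indicator \<Omega> x * divg (Y p) x \<partial>lborel) + (\<integral>x. indicator \<Omega> x * divg X0 x \<partial>lborel)"
  proof -
    have "integrable lborel (\<lambda>x. \<Sum>p\<in>I. indicator \<Omega> x * divg (Y p) x)"
      by (intro Bochner_Integration.integrable_sum divg_integrable[OF Y \<Omega>b])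
    then show ?thesis
      unfolding Bochner_Integration.integral_add[OF _ divg_integrable[OF X0 \<Omega>b]]
        Bochner_Integration.integral_sum[OF divg_integrable[OF Y \<Omega>b], symmetric]
      using Bochner_Integration.integral_add[OF _ divg_integrable[OF X0 \<Omega>b]]
        Bochner_Integration.integral_sum[of I lborel, OF divg_integrable[OF Y \<Omega>b]] by (simp only:)
  qed
  also have "\<dots> \<le> (\<Sum>p\<in>I. \<integral>x. indicator (frontier \<Omega>) x * norm (Y p x) \<partial>hausdorff1)"
    unfolding zero using loc by (simp add: sum_mono)
  also have "\<dots> = (\<integral>x. (\<Sum>p\<in>I. indicator (frontier \<Omega>) x * norm (Y p x)) \<partial>hausdorff1)"
    using loc by (intro Bochner_Integration.integral_sum[symmetric]) blast
  also have "\<dots> \<le> (\<integral>x. indicator (frontier \<Omega>) x * norm (X x) \<partial>hausdorff1)"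
  proof (rule integral_mono)
    show "integrable hausdorff1 (\<lambda>x. \<Sum>p\<in>I. indicator (frontier \<Omega>) x * norm (Y p x))"
      using loc by (intro Bochner_Integration.integrable_sum) blast
    obtain B where B: "\<And>x. norm (X x) \<le> B" by (rule C1c_norm_bounded[OF X]) (rule that)
    show "integrable hausdorff1 (\<lambda>x. indicator (frontier \<Omega>) x * norm (X x))"
    proof -
      have "emeasure hausdorff1 (frontier \<Omega>) < \<infinity>" using graph_domain_trace[OF dom] by blast
      then show ?thesis
        by (rule frontier_integrable) (use B in \<open>auto intro!: continuous_intros C1_continuous[OF C1c_C1[OF X]]\<close>)
    qed
    fix x
    have "(\<Sum>p\<in>I. norm (Y p x)) = (\<Sum>p\<in>I. \<theta> p x) * norm (X x)"
      unfolding sum_distrib_right Y_def by (rule sum.cong) (auto simp: \<theta>(2))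
    also have "\<dots> \<le> 1 * norm (X x)" by (intro mult_right_mono \<theta>(4)) auto
    finally show "(\<Sum>p\<in>I. indicator (frontier \<Omega>) x * norm (Y p x)) \<le> indicator (frontier \<Omega>) x * norm (X x)"
      unfolding sum_distrib_left[symmetric] by (intro mult_left_mono) auto
  qed
  finally show ?thesis .
qed

section \<open>Density of smooth functions\<close>

lemma wpair_mult_C1c:
  fixes \<theta> :: "real^2 \<Rightarrow> real"
  assumes w: "wpair \<Omega> U V" and \<theta>: "\<theta> \<in> C1c UNIV"
  shows "wpair \<Omega> (\<lambda>x. \<theta> x *\<^sub>R U x) (\<lambda>x. \<theta> x *\<^sub>R V x + (\<chi> i. partial i \<theta> x *\<^sub>R U x))"
    "wpair \<Omega> (\<lambda>x. (1 - \<theta> x) *\<^sub>R U x) (\<lambda>x. (1 - \<theta> x) *\<^sub>R V x - (\<chi> i. partial i \<theta> x *\<^sub>R U x))"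
proof -
  note C = C1c_C1[OF \<theta>]
  obtain S where S: "compact S" "\<And>x. x \<notin> S \<Longrightarrow> \<theta> x = 0" "\<And>i x. x \<notin> S \<Longrightarrow> partial i \<theta> x = 0"
    using C1cE[OF \<theta>] by metis
  obtain B where B: "\<And>x. norm (\<theta> x) \<le> B" by (rule C1c_norm_bounded[OF \<theta>]) (rule that)
  have "\<exists>B. \<forall>x. norm (partial i \<theta> x) \<le> B" for i
    using bounded_compact_support[OF C1_partial_continuous[OF C] S(1,3)] by blast
  then obtain B' where B': "\<And>i x. norm (partial i \<theta> x) \<le> B' i" by metis
  define M where "M = max (1 + B) (max (B' 1) (B' 2))"
  have M: "\<bar>\<theta> x\<bar> \<le> M" "\<bar>1 - \<theta> x\<bar> \<le> M" for x
    using B[of x] by (auto simp: M_def abs_le_iff)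
  have Mp: "\<bar>partial i \<theta> x\<bar> \<le> M" for i x
    using B'[of i x] exhaust_2[of i] by (auto simp: M_def)
  show "wpair \<Omega> (\<lambda>x. \<theta> x *\<^sub>R U x) (\<lambda>x. \<theta> x *\<^sub>R V x + (\<chi> i. partial i \<theta> x *\<^sub>R U x))"
    by (rule wpair_mult[OF w C M(1) Mp])
  have C1m: "C1 (\<lambda>x. 1 - \<theta> x)" and pm: "partial i (\<lambda>x. 1 - \<theta> x) x = - partial i \<theta> x" for i x
    using C1_diff[OF C1_const(1) C] by (auto simp: C1_const)
  have e: "(\<chi> i. partial i (\<lambda>x. 1 - \<theta> x) x *\<^sub>R U x) = - (\<chi> i. partial i \<theta> x *\<^sub>R U x)" for x
    by (simp add: vec_eq_iff pm)
  have "wpair \<Omega> (\<lambda>x. (1 - \<theta> x) *\<^sub>R U x) (\<lambda>x. (1 - \<theta> x) *\<^sub>R V x + (\<chi> i. partial i (\<lambda>x. 1 - \<theta> x) x *\<^sub>R U x))"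
    by (rule wpair_mult[OF w C1m M(2)]) (simp add: pm Mp)
  then show "wpair \<Omega> (\<lambda>x. (1 - \<theta> x) *\<^sub>R U x) (\<lambda>x. (1 - \<theta> x) *\<^sub>R V x - (\<chi> i. partial i \<theta> x *\<^sub>R U x))"
    by (simp add: e)
qed

text \<open>The kernel is centred at a vector \<open>c\<close> that points below the graph, steeply
  enough for a whole ball around it to lie in the cone that the slope bound \<open>G\<close> allows.
  The average at a point of the domain then uses values of \<open>U\<close> inside the domain
  only.\<close>

lemma (in chart) approximable_near_boundary:
  assumes w: "wpair \<Omega> U V" and z: "\<And>x. x \<notin> ball p (r / 2) \<Longrightarrow> U x = 0 \<and> V x = 0"
  shows "approximable \<Omega> U V"
proof -
  obtain G where G: "0 \<le> G" "\<And>t. t \<in> {p \<bullet> a - r..p \<bullet> a + r} \<Longrightarrow> \<bar>g' t\<bar> \<le> G" using slope_bounded by blast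
  \<comment> \<open>A vector within distance 1 of \<open>c\<close> moves by at most 1 along
    \<open>a\<close> and by at least \<open>G\<close> downwards, while the graph falls by at most
    \<open>G\<close> over that distance.\<close>
  define c where "c = - (G + 1) *\<^sub>R b"
  \<comment> \<open>Vectors of the ball around \<open>c\<close> have length at most
    \<open>G + 2\<close>, so that all shifts remain below \<open>r / 4\<close>.\<close>
  define \<delta> where "\<delta> = r / (4 * (G + 2))"
  have \<delta>: "0 < \<delta>" using r G by (simp add: \<delta>_def)
  have coord: "x \<bullet> a \<in> {p \<bullet> a - r..p \<bullet> a + r}" if "x \<in> ball p r" for x
  proof -
    have "\<bar>(x - p) \<bullet> a\<bar> \<le> norm (x - p)" using Cauchy_Schwarz_ineq2[of "x - p" a] norm_ab by simp
    then show ?thesis using that by (auto simp: inner_diff_left dist_norm norm_minus_commute abs_le_iff)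
  qed
  show ?thesis
  proof (rule approximable_shift[OF \<Omega> w _ \<delta>, of "norm p + r" c])
    show "U x = 0" if "x \<notin> cball 0 (norm p + r)" for x
    proof -
      have "r / 2 \<le> dist p x" using that norm_triangle_ineq3[of p x] r by (simp add: dist_norm)
      then show ?thesis using z[of x] by simp
    qed
    fix \<epsilon> x assume \<epsilon>: "0 < \<epsilon>" "\<epsilon> < \<delta>" and x: "x \<in> \<Omega>"
    have small: "norm (\<epsilon> *\<^sub>R y) < r / 4" if "y \<in> cball c 1" for y
    proof -
      have "norm y \<le> norm c + norm (y - c)" using norm_triangle_ineq[of c "y - c"] by simp
      also have "norm (y - c) \<le> 1" using that by (simp add: dist_norm norm_minus_commute)
      also have "norm c = G + 1" using G norm_ab by (simp add: c_def)
      finally have "norm y \<le> G + 2" by simp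
      then have "\<epsilon> * norm y \<le> \<epsilon> * (G + 2)" using \<epsilon> by (intro mult_left_mono) auto
      also have "\<dots> < \<delta> * (G + 2)" using \<epsilon> G by (intro mult_strict_right_mono) auto
      also have "\<dots> = r / 4"
      proof -
        have "r / (4 * k) * k = r / 4" if "0 < k" for k using that by simp
        then show ?thesis unfolding \<delta>_def using G(1) by (metis add_nonneg_pos zero_less_numeral)
      qed
      finally show ?thesis using \<epsilon> by simp
    qed
    show "(\<forall>y\<in>cball c 1. x + \<epsilon> *\<^sub>R y \<in> \<Omega>) \<or> (\<forall>y\<in>cball c 1. U (x + \<epsilon> *\<^sub>R y) = 0 \<and> V (x + \<epsilon> *\<^sub>R y) = 0)"
    \<comment> \<open>Shifts shorter than \<open>r / 4\<close> keep the nearer points inside the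
      chart ball and the farther ones outside the ball of radius \<open>r / 2\<close>, off which the
      pair vanishes.\<close>
    proof (cases "dist p x < 3 * r / 4")
      case True
      have "x + \<epsilon> *\<^sub>R y \<in> \<Omega>" if y: "y \<in> cball c 1" for y
      proof -
        have xb: "x \<in> ball p r" using True r by simp
        have "dist p (x + \<epsilon> *\<^sub>R y) \<le> dist p x + norm (\<epsilon> *\<^sub>R y)"
          using norm_triangle_ineq4[of "p - x" "\<epsilon> *\<^sub>R y"] by (simp add: dist_norm algebra_simps)
        then have yb: "x + \<epsilon> *\<^sub>R y \<in> ball p r" using small[OF y] True r by simp
        define v where "v = y - c"
        have v: "norm v \<le> 1" using y by (simp add: v_def dist_norm norm_minus_commute)
        have va: "\<bar>v \<bullet> a\<bar> \<le> 1" "\<bar>v \<bullet> b\<bar> \<le> 1"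
          using Cauchy_Schwarz_ineq2[of v a] Cauchy_Schwarz_ineq2[of v b] v norm_ab by auto
        have yc: "y \<bullet> a = v \<bullet> a" "y \<bullet> b = v \<bullet> b - (G + 1)"
          by (simp_all add: v_def c_def inner_simps ab)
        have lt: "x \<bullet> b < g (x \<bullet> a)" using below[OF xb] x by simp
        have "\<bar>g (x \<bullet> a) - g ((x + \<epsilon> *\<^sub>R y) \<bullet> a)\<bar> \<le> G * \<bar>x \<bullet> a - (x + \<epsilon> *\<^sub>R y) \<bullet> a\<bar>"
          by (rule g_lipschitz[OF G(2) coord[OF xb] coord[OF yb]])
        also have "\<dots> = G * (\<epsilon> * \<bar>v \<bullet> a\<bar>)" using \<epsilon> by (simp add: inner_simps yc abs_mult)
        also have "\<dots> \<le> G * (\<epsilon> * 1)" using G \<epsilon> va by (intro mult_left_mono) auto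
        finally have g_lip: "g (x \<bullet> a) \<le> g ((x + \<epsilon> *\<^sub>R y) \<bullet> a) + G * \<epsilon>" by (simp add: abs_le_iff)
        have "(x + \<epsilon> *\<^sub>R y) \<bullet> b = x \<bullet> b + \<epsilon> * (v \<bullet> b) - \<epsilon> * (G + 1)"
          by (simp add: inner_simps yc algebra_simps)
        also have "\<epsilon> * (v \<bullet> b) \<le> \<epsilon> * 1" using va \<epsilon> by (intro mult_left_mono) auto
        finally have "(x + \<epsilon> *\<^sub>R y) \<bullet> b \<le> x \<bullet> b - G * \<epsilon>" by (simp add: algebra_simps)
        then show ?thesis using lt g_lip below[OF yb] by linarith
      qed
      then show ?thesis by blast
    next
      case False
      have "U (x + \<epsilon> *\<^sub>R y) = 0 \<and> V (x + \<epsilon> *\<^sub>R y) = 0" if y: "y \<in> cball c 1" for y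
      proof (rule z)
        have "dist p x \<le> dist p (x + \<epsilon> *\<^sub>R y) + norm (\<epsilon> *\<^sub>R y)"
          using norm_triangle_ineq[of "p - (x + \<epsilon> *\<^sub>R y)" "\<epsilon> *\<^sub>R y"] by (simp add: dist_norm algebra_simps)
        then show "x + \<epsilon> *\<^sub>R y \<notin> ball p (r / 2)" using small[OF y] False by simp
      qed
      then show ?thesis by blast
    qed
  qed
qed

text \<open>Averages over small centred balls suffice. A ball that leaves \<open>\<Omega>\<close>
  contains a frontier point on a segment from its centre, so it lies in the neighbourhood
  \<open>N\<close> where the pair vanishes.\<close>

lemma approximable_interior:
  assumes w: "wpair \<Omega> U V" and bdd: "\<And>x. x \<notin> cball 0 R \<Longrightarrow> U x = 0"
    and \<Omega>: "open \<Omega>" "compact (frontier \<Omega>)" and N: "open N" "frontier \<Omega> \<subseteq> N" "\<And>x. x \<in> N \<Longrightarrow> U x = 0 \<and> V x = 0"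
  shows "approximable \<Omega> U V"
proof -
  obtain d where d: "0 < d" "(\<Union>x\<in>frontier \<Omega>. ball x d) \<subseteq> N"
    using compact_subset_open_imp_ball_epsilon_subset[OF \<Omega>(2) N(1,2)] by blast
  have d2: "0 < d / 2" using d by simp
  have \<Omega>b: "\<Omega> \<in> sets borel" using \<Omega>(1) by simp
  show ?thesis
  proof (rule approximable_shift[OF \<Omega>b w bdd d2, of R 0])
    fix \<epsilon> x assume \<epsilon>: "0 < \<epsilon>" "\<epsilon> < d / 2" and x: "x \<in> \<Omega>"
    show "(\<forall>y\<in>cball 0 1. x + \<epsilon> *\<^sub>R y \<in> \<Omega>) \<or> (\<forall>y\<in>cball 0 1. U (x + \<epsilon> *\<^sub>R y) = 0 \<and> V (x + \<epsilon> *\<^sub>R y) = 0)"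
    proof (cases "\<forall>y\<in>cball 0 1. x + \<epsilon> *\<^sub>R y \<in> \<Omega>")
      case False
      then obtain y0 where y0: "y0 \<in> cball 0 1" "x + \<epsilon> *\<^sub>R y0 \<notin> \<Omega>" by blast
      have "closed_segment x (x + \<epsilon> *\<^sub>R y0) \<inter> frontier \<Omega> \<noteq> {}"
        by (rule connected_Int_frontier) (use x y0 in auto)
      then obtain q where q: "q \<in> closed_segment x (x + \<epsilon> *\<^sub>R y0)" "q \<in> frontier \<Omega>" by blast
      have "norm (q - x) \<le> norm ((x + \<epsilon> *\<^sub>R y0) - x)" using segment_bound(1)[OF q(1)] by simp
      also have "\<dots> = \<epsilon> * norm y0" using \<epsilon> by simp
      also have "\<dots> \<le> \<epsilon> * 1" using y0 \<epsilon> by (intro mult_left_mono) auto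
      finally have qx: "norm (q - x) \<le> \<epsilon>" by simp
      have "U (x + \<epsilon> *\<^sub>R y) = 0 \<and> V (x + \<epsilon> *\<^sub>R y) = 0" if y: "y \<in> cball 0 1" for y
      proof (rule N(3))
        have "dist q (x + \<epsilon> *\<^sub>R y) \<le> norm (q - x) + norm (\<epsilon> *\<^sub>R y)"
          using norm_triangle_ineq4[of "q - x" "\<epsilon> *\<^sub>R y"] by (simp add: dist_norm algebra_simps)
        also have "norm (\<epsilon> *\<^sub>R y) \<le> \<epsilon>" using y \<epsilon> by simp
        finally have "dist q (x + \<epsilon> *\<^sub>R y) < d" using qx \<epsilon> by simp
        then have "x + \<epsilon> *\<^sub>R y \<in> ball q d" by simp
        then show "x + \<epsilon> *\<^sub>R y \<in> N" using d(2) q(2) by blast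
      qed
      then show ?thesis by blast
    qed simp
  qed
qed

lemma approximable_sum:
  assumes \<Omega>: "\<Omega> \<in> sets borel" and "finite I" "\<And>k. k \<in> I \<Longrightarrow> L2 lborel (U k) \<and> L2 lborel (V k) \<and> approximable \<Omega> (U k) (V k)"
  shows "L2 lborel (\<lambda>x. \<Sum>k\<in>I. U k x) \<and> L2 lborel (\<lambda>x. \<Sum>k\<in>I. V k x) \<and> approximable \<Omega> (\<lambda>x. \<Sum>k\<in>I. U k x) (\<lambda>x. \<Sum>k\<in>I. V k x)"
  using assms(2,3)
proof (induction rule: finite_induct)
  case empty
  have g: "grad (\<lambda>_. 0) x = 0" for x by (simp add: vec_eq_iff C1_const)
  have "(\<lambda>_. 0) \<in> C1c UNIV" by (auto simp: C1c_iff C1_const)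
  moreover have "H1_dist \<Omega> (\<lambda>_. 0) (\<lambda>_. 0) (\<lambda>_. 0) = 0" by (simp add: H1_dist_def g)
  ultimately have "approximable \<Omega> (\<lambda>_. 0) (\<lambda>_. 0)" unfolding approximable_def by metis
  then show ?case by (simp add: L2_zero)
next
  case (insert k I)
  have "L2 lborel (U k)" "L2 lborel (V k)" "approximable \<Omega> (U k) (V k)" using insert.prems by auto
  moreover have "L2 lborel (\<lambda>x. \<Sum>k\<in>I. U k x)" "L2 lborel (\<lambda>x. \<Sum>k\<in>I. V k x)" "approximable \<Omega> (\<lambda>x. \<Sum>k\<in>I. U k x) (\<lambda>x. \<Sum>k\<in>I. V k x)"
    using insert.IH insert.prems by auto
  ultimately show ?case
    using insert.hyps by (simp add: L2_add approximable_add[OF \<Omega>])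
qed

text \<open>The partition of unity splits the pair into pieces near single boundary points,
  approximated by oblique shifts, and a piece that vanishes near the frontier, approximated by plain
  mollification.\<close>

lemma approximable_bounded_support:
  assumes dom: "graph_domain \<Omega>" and w: "wpair \<Omega> U V" and bdd: "\<And>x. x \<notin> cball 0 R \<Longrightarrow> U x = 0"
  shows "approximable \<Omega> U V"
proof -
  obtain I r \<theta> N where I: "finite I" "I \<subseteq> frontier \<Omega>"
    and ch: "\<And>p. p \<in> I \<Longrightarrow> \<exists>a b g g'. chart a b g g' \<Omega> p (r p)"
    and \<theta>: "\<And>p. p \<in> I \<Longrightarrow> \<theta> p \<in> C1c UNIV" "\<And>p x. p \<in> I \<Longrightarrow> (0::real) \<le> \<theta> p x"
      "\<And>p x. p \<in> I \<Longrightarrow> x \<notin> ball p (r p / 2) \<Longrightarrow> \<theta> p x = 0" "\<And>x. (\<Sum>p\<in>I. \<theta> p x) \<le> 1"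
    and N: "open N" "frontier \<Omega> \<subseteq> N" "\<And>x. x \<in> N \<Longrightarrow> (\<Sum>p\<in>I. \<theta> p x) = 1"
    using graph_domain_partition[OF dom] by blast
  have \<Omega>: "open \<Omega>" "compact (frontier \<Omega>)" and \<Omega>b: "\<Omega> \<in> sets borel" using dom by (auto simp: graph_domain_def)
  define \<Theta> where "\<Theta> x = (\<Sum>p\<in>I. \<theta> p x)" for x
  have \<Theta>: "\<Theta> \<in> C1c UNIV" unfolding \<Theta>_def by (rule C1c_sum[OF I(1) \<theta>(1)])
  have p\<Theta>: "partial i \<Theta> x = (\<Sum>p\<in>I. partial i (\<theta> p) x)" for i x
    unfolding \<Theta>_def using C1_sum[OF I(1), of \<theta>] C1c_C1[OF \<theta>(1)] by blast
  define U' where "U' p x = \<theta> p x *\<^sub>R U x" for p x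
  define V' where "V' p x = \<theta> p x *\<^sub>R V x + (\<chi> i. partial i (\<theta> p) x *\<^sub>R U x)" for p x
  define U0 where "U0 x = (1 - \<Theta> x) *\<^sub>R U x" for x
  define V0 where "V0 x = (1 - \<Theta> x) *\<^sub>R V x - (\<chi> i. partial i \<Theta> x *\<^sub>R U x)" for x
  have w': "wpair \<Omega> (U' p) (V' p)" if "p \<in> I" for p
    unfolding U'_def V'_def by (rule wpair_mult_C1c(1)[OF w \<theta>(1)[OF that]])
  have w0: "wpair \<Omega> U0 V0"
    unfolding U0_def V0_def by (rule wpair_mult_C1c(2)[OF w \<Theta>])
  have "L2 lborel (U' p) \<and> L2 lborel (V' p) \<and> approximable \<Omega> (U' p) (V' p)" if pI: "p \<in> I" for p
  proof (intro conjI)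
    show "L2 lborel (U' p)" "L2 lborel (V' p)" using w'[OF pI] by (auto simp: wpair_def)
    obtain a b g g' where "chart a b g g' \<Omega> p (r p)" using ch[OF pI] by blast
    then interpret chart a b g g' \<Omega> p "r p" .
    let ?h = "r p / 2"
    show "approximable \<Omega> (U' p) (V' p)"
    proof (rule approximable_near_boundary[OF w'[OF pI]])
      fix x assume x: "x \<notin> ball p ?h"
      have 1: "\<theta> p x = 0" by (rule \<theta>(3)[OF pI x])
      \<comment> \<open>This covers the sphere that bounds the half ball: the value 0 is a minimum
        of the nonnegative function \<open>\<theta> p\<close>, so the derivative vanishes there
        too.\<close>
      have "partial i (\<theta> p) x = 0" for i
      proof -
        have D: "(\<theta> p has_derivative dirder (\<theta> p) x) (at x)" by (rule C1_derivative[OF C1c_C1[OF \<theta>(1)[OF pI]]])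
        have "dirder (\<theta> p) x = (\<lambda>h. 0)"
          by (rule has_derivative_local_min[OF D]) (use \<theta>(2)[OF pI] 1 in \<open>auto intro: always_eventually\<close>)
        then show ?thesis using dirder_axis[of "\<theta> p" x i] by simp
      qed
      then show "U' p x = 0 \<and> V' p x = 0" using 1 by (simp add: U'_def V'_def vec_eq_iff)
    qed
  qed
  note S = approximable_sum[OF \<Omega>b I(1) this]
  have "approximable \<Omega> U0 V0"
  proof (rule approximable_interior[OF w0 _ \<Omega> N(1,2)])
    show "U0 x = 0" if "x \<notin> cball 0 R" for x using bdd[OF that] by (simp add: U0_def)
    fix x assume x: "x \<in> N"
    have "partial i \<Theta> x = 0" for i
    proof -
      have "partial i \<Theta> x = partial i (\<lambda>_. 1) x"
        by (rule partial_cong_open[OF N(1) x]) (simp add: \<Theta>_def N(3))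
      then show ?thesis by (simp add: C1_const)
    qed
    then show "U0 x = 0 \<and> V0 x = 0" using N(3)[OF x] by (simp add: U0_def V0_def \<Theta>_def vec_eq_iff)
  qed
  then have "approximable \<Omega> (\<lambda>x. (\<Sum>p\<in>I. U' p x) + U0 x) (\<lambda>x. (\<Sum>p\<in>I. V' p x) + V0 x)"
    using S w0 by (intro approximable_add[OF \<Omega>b]) (auto simp: wpair_def)
  moreover have "(\<lambda>x. (\<Sum>p\<in>I. U' p x) + U0 x) = U"
    by (simp add: fun_eq_iff U'_def U0_def \<Theta>_def scaleR_sum_left scaleR_diff_left)
  moreover have "(\<lambda>x. (\<Sum>p\<in>I. V' p x) + V0 x) = V"
    by (simp add: fun_eq_iff vec_eq_iff V'_def V0_def \<Theta>_def[symmetric] sum.distrib scaleR_diff_left p\<Theta>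
        scaleR_sum_left[symmetric])
  ultimately show ?thesis by simp
qed

text \<open>A single bump function is rescaled; the chain rule makes its derivatives decay like the
  inverse of the radius.\<close>

lemma cutoff_sequence:
  "\<exists>(\<eta> :: nat \<Rightarrow> real^2 \<Rightarrow> real) B. \<forall>n. \<eta> n \<in> C1c UNIV \<and> (\<forall>x. 0 \<le> \<eta> n x \<and> \<eta> n x \<le> 1 \<and>
    (norm x < real (Suc n) \<longrightarrow> \<eta> n x = 1) \<and> (2 * real (Suc n) \<le> norm x \<longrightarrow> \<eta> n x = 0) \<and>
    (\<forall>i. \<bar>partial i (\<eta> n) x\<bar> \<le> B / real (Suc n)))"
proof -
  obtain \<eta> :: "real^2 \<Rightarrow> real" where \<eta>: "\<eta> \<in> C1c UNIV" "\<And>x. 0 \<le> \<eta> x" "\<And>x. \<eta> x \<le> 1"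
      "\<And>x. x \<in> ball 0 (2/2) \<Longrightarrow> \<eta> x = 1" "\<And>x. x \<notin> ball 0 2 \<Longrightarrow> \<eta> x = 0"
    using exists_bump[of 2 0] by auto
  note C = C1c_C1[OF \<eta>(1)]
  obtain S where S: "compact S" "\<And>x. x \<notin> S \<Longrightarrow> \<eta> x = 0" "\<And>i x. x \<notin> S \<Longrightarrow> partial i \<eta> x = 0"
    using C1cE[OF \<eta>(1)] by metis
  have "\<exists>B. \<forall>x. norm (partial i \<eta> x) \<le> B" for i
    using bounded_compact_support[OF C1_partial_continuous[OF C] S(1,3)] by metis
  then obtain B' where B': "\<And>i x. norm (partial i \<eta> x) \<le> B' i" by metis
  define B where "B = max (B' 1) (B' 2)"
  have B: "\<bar>partial i \<eta> x\<bar> \<le> B" for i x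
    using B'[of i x] exhaust_2[of i] by (auto simp: B_def)
  define cutf where "cutf n x = \<eta> ((1 / real (Suc n)) *\<^sub>R x)" for n x
  have D: "(cutf n has_derivative (\<lambda>h. dirder \<eta> ((1 / real (Suc n)) *\<^sub>R x) ((1 / real (Suc n)) *\<^sub>R h))) (at x)" for n x
  proof -
    have "((\<lambda>w. (1 / real (Suc n)) *\<^sub>R w) has_derivative (\<lambda>h. (1 / real (Suc n)) *\<^sub>R h)) (at x)"
      by (intro derivative_intros)
    from has_derivative_compose[OF this C1_derivative[OF C]] show ?thesis unfolding cutf_def .
  qed
  have Ccut: "C1 (cutf n)" for n
    by (rule C1I[OF D]) (intro dirder_continuous[OF C] continuous_intros)
  have pcut: "partial i (cutf n) x = (1 / real (Suc n)) * partial i \<eta> ((1 / real (Suc n)) *\<^sub>R x)" for i n x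
  proof -
    have "dirder \<eta> y (c *\<^sub>R axis i 1) = c * dirder \<eta> y (axis i 1)" for y c
      by (simp add: dirder_2 algebra_simps del: dirder_axis)
    then show ?thesis using partialI[OF D, of i] by simp
  qed
  have one: "cutf n x = 1" if "norm x < real (Suc n)" for n x
    unfolding cutf_def using that by (intro \<eta>(4)) (simp add: pos_divide_less_eq)
  have zero: "cutf n x = 0" if "2 * real (Suc n) \<le> norm x" for n x
    unfolding cutf_def using that by (intro \<eta>(5)) (simp add: pos_le_divide_eq not_less)
  have "cutf n \<in> C1c UNIV" for n
    unfolding C1c_iff using Ccut zero[of n]
    by (intro conjI exI[of _ "cball 0 (2 * real (Suc n))"]) auto
  moreover have "\<bar>partial i (cutf n) x\<bar> \<le> B / real (Suc n)" for n i x
    unfolding pcut using B by (simp add: abs_mult divide_right_mono)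
  moreover have "0 \<le> cutf n x \<and> cutf n x \<le> 1" for n x using \<eta> by (simp add: cutf_def)
  ultimately show ?thesis using one zero by (intro exI[of _ cutf] exI[of _ B]) blast
qed

text \<open>Reduction to bounded support: the cut-off changes the weak gradient by the additional
  term \<open>grad \<eta>\<close> times \<open>U\<close>, whose norm decays like the inverse of the
  radius.\<close>

theorem graph_domain_density:
  assumes dom: "graph_domain \<Omega>" and w: "wpair \<Omega> U V"
  shows "approximable \<Omega> U V"
proof -
  have \<Omega>b: "\<Omega> \<in> sets borel" using dom by (auto simp: graph_domain_def)
  have U: "L2 lborel U" and V: "L2 lborel V" using w by (auto simp: wpair_def)
  obtain \<eta> :: "nat \<Rightarrow> real^2 \<Rightarrow> real" and B where \<eta>0: "\<forall>n. \<eta> n \<in> C1c UNIV \<and> (\<forall>x. 0 \<le> \<eta> n x \<and> \<eta> n x \<le> 1 \<and>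
    (norm x < real (Suc n) \<longrightarrow> \<eta> n x = 1) \<and> (2 * real (Suc n) \<le> norm x \<longrightarrow> \<eta> n x = 0) \<and>
    (\<forall>i. \<bar>partial i (\<eta> n) x\<bar> \<le> B / real (Suc n)))"
    using cutoff_sequence by blast
  have \<eta>: "\<And>n. \<eta> n \<in> C1c UNIV" "\<And>n x. 0 \<le> \<eta> n x" "\<And>n x. \<eta> n x \<le> 1"
    "\<And>n x. norm x < real (Suc n) \<Longrightarrow> \<eta> n x = 1" "\<And>n x. 2 * real (Suc n) \<le> norm x \<Longrightarrow> \<eta> n x = 0"
    "\<And>n i x. \<bar>partial i (\<eta> n) x\<bar> \<le> B / real (Suc n)"
    using \<eta>0 by blast+
  define Uc where "Uc n x = \<eta> n x *\<^sub>R U x" for n x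
  define Vc where "Vc n x = \<eta> n x *\<^sub>R V x + (\<chi> i. partial i (\<eta> n) x *\<^sub>R U x)" for n x
  have wn: "wpair \<Omega> (Uc n) (Vc n)" for n
    unfolding Uc_def Vc_def by (rule wpair_mult_C1c(1)[OF w \<eta>(1)])
  have ap: "approximable \<Omega> (Uc n) (Vc n)" for n
    by (rule approximable_bounded_support[OF dom wn, of "2 * real (Suc n)"]) (simp add: Uc_def \<eta>(5))
  have Ln: "L2 lborel (Uc n)" "L2 lborel (Vc n)" for n using wn by (auto simp: wpair_def)
  have lim: "(\<lambda>n. \<integral>x. (norm (\<eta> n x *\<^sub>R F x - F x))\<^sup>2 \<partial>lborel) \<longlonglongrightarrow> 0" if F: "L2 lborel F" for F :: "real^2 \<Rightarrow> 'c::euclidean_space"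
  proof -
    have [measurable]: "F \<in> borel_measurable borel" "\<eta> n \<in> borel_measurable borel" for n
      using F C1_continuous[OF C1c_C1[OF \<eta>(1)]] by (auto simp: L2_def intro: borel_measurable_continuous_onI)
    have "(\<lambda>n. \<integral>x. (norm (\<eta> n x *\<^sub>R F x - F x))\<^sup>2 \<partial>lborel) \<longlonglongrightarrow> (\<integral>x. 0 \<partial>(lborel :: (real^2) measure))"
    proof (rule integral_dominated_convergence)
      show "integrable lborel (\<lambda>x. (norm (F x))\<^sup>2)" using F by (simp add: L2_def)
      show "AE x in lborel. (\<lambda>n. (norm (\<eta> n x *\<^sub>R F x - F x))\<^sup>2) \<longlonglongrightarrow> 0"
      proof (intro always_eventually allI)
        fix x :: "real^2"
        obtain n0 :: nat where n0: "norm x < real n0" using reals_Archimedean2 by blast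
        have "\<forall>\<^sub>F n in sequentially. (norm (\<eta> n x *\<^sub>R F x - F x))\<^sup>2 = 0"
          unfolding eventually_sequentially
        proof (intro exI[of _ n0] allI impI)
          fix n assume "n0 \<le> n"
          then have "\<eta> n x = 1" using n0 by (intro \<eta>(4)) simp
          then show "(norm (\<eta> n x *\<^sub>R F x - F x))\<^sup>2 = 0" by simp
        qed
        then show "(\<lambda>n. (norm (\<eta> n x *\<^sub>R F x - F x))\<^sup>2) \<longlonglongrightarrow> 0" by (rule tendsto_eventually)
      qed
      show "AE x in lborel. norm ((norm (\<eta> n x *\<^sub>R F x - F x))\<^sup>2) \<le> (norm (F x))\<^sup>2" for n
      proof (intro always_eventually allI)
        fix x
        have "\<eta> n x *\<^sub>R F x - F x = (\<eta> n x - 1) *\<^sub>R F x" by (simp add: algebra_simps)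
        moreover have "\<bar>\<eta> n x - 1\<bar> * norm (F x) \<le> 1 * norm (F x)"
          using \<eta>(2,3)[of n x] by (intro mult_right_mono) auto
        ultimately have "norm (\<eta> n x *\<^sub>R F x - F x) \<le> norm (F x)" by simp
        then show "norm ((norm (\<eta> n x *\<^sub>R F x - F x))\<^sup>2) \<le> (norm (F x))\<^sup>2" by (simp add: power_mono)
      qed
    qed auto
    then show ?thesis by simp
  qed
  have Vbound: "(\<integral>x. (norm (Vc n x - V x))\<^sup>2 \<partial>lborel) \<le> 2 * (\<integral>x. (norm (\<eta> n x *\<^sub>R V x - V x))\<^sup>2 \<partial>lborel)
      + 4 * (B / real (Suc n))\<^sup>2 * (\<integral>x. (norm (U x))\<^sup>2 \<partial>lborel)" for n
  proof -
    have m: "L2 lborel (\<lambda>x. \<eta> n x *\<^sub>R V x)"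
      by (rule L2_scaleR_bounded[OF V, of _ 1])
        (use \<eta>(2,3) C1_continuous[OF C1c_C1[OF \<eta>(1)]] in \<open>auto intro!: borel_measurable_continuous_onI\<close>)
    have i: "integrable lborel (\<lambda>x. (norm (\<eta> n x *\<^sub>R V x - V x))\<^sup>2)" "integrable lborel (\<lambda>x. (norm (U x))\<^sup>2)"
      using L2_norm_square_diff_integrable[OF m V] U by (auto simp: L2_def)
    have "(\<integral>x. (norm (Vc n x - V x))\<^sup>2 \<partial>lborel)
        \<le> (\<integral>x. 2 * (norm (\<eta> n x *\<^sub>R V x - V x))\<^sup>2 + 4 * (B / real (Suc n))\<^sup>2 * (norm (U x))\<^sup>2 \<partial>lborel)"
    proof (rule integral_mono)
      show "integrable lborel (\<lambda>x. (norm (Vc n x - V x))\<^sup>2)" by (rule L2_norm_square_diff_integrable[OF Ln(2) V])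
      fix x
      have pb: "(norm (partial i (\<eta> n) x *\<^sub>R U x))\<^sup>2 \<le> (B / real (Suc n))\<^sup>2 * (norm (U x))\<^sup>2" for i
      proof -
        have "\<bar>partial i (\<eta> n) x\<bar> * norm (U x) \<le> B / real (Suc n) * norm (U x)"
          by (intro mult_right_mono \<eta>(6)) auto
        then have "(\<bar>partial i (\<eta> n) x\<bar> * norm (U x))\<^sup>2 \<le> (B / real (Suc n) * norm (U x))\<^sup>2"
          by (intro power_mono) auto
        then show ?thesis by (simp only: norm_scaleR power_mult_distrib)
      qed
      have "(norm (\<chi> i. partial i (\<eta> n) x *\<^sub>R U x))\<^sup>2 = (norm (partial 1 (\<eta> n) x *\<^sub>R U x))\<^sup>2 + (norm (partial 2 (\<eta> n) x *\<^sub>R U x))\<^sup>2"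
        by (simp add: norm_vec_def L2_set_def sum_2)
      also have "\<dots> \<le> 2 * ((B / real (Suc n))\<^sup>2 * (norm (U x))\<^sup>2)" using pb[of 1] pb[of 2] by linarith
      finally have gb: "(norm (\<chi> i. partial i (\<eta> n) x *\<^sub>R U x))\<^sup>2 \<le> 2 * ((B / real (Suc n))\<^sup>2 * (norm (U x))\<^sup>2)" .
      have e: "Vc n x - V x = (\<eta> n x *\<^sub>R V x - V x) + (\<chi> i. partial i (\<eta> n) x *\<^sub>R U x)" by (simp add: Vc_def)
      have "(norm (Vc n x - V x))\<^sup>2 \<le> 2 * (norm (\<eta> n x *\<^sub>R V x - V x))\<^sup>2 + 2 * (norm (\<chi> i. partial i (\<eta> n) x *\<^sub>R U x))\<^sup>2"
        unfolding e by (rule norm_add_square_le)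
      then show "(norm (Vc n x - V x))\<^sup>2 \<le> 2 * (norm (\<eta> n x *\<^sub>R V x - V x))\<^sup>2 + 4 * (B / real (Suc n))\<^sup>2 * (norm (U x))\<^sup>2"
        using gb by linarith
    qed (use i in auto)
    also have "\<dots> = 2 * (\<integral>x. (norm (\<eta> n x *\<^sub>R V x - V x))\<^sup>2 \<partial>lborel) + 4 * (B / real (Suc n))\<^sup>2 * (\<integral>x. (norm (U x))\<^sup>2 \<partial>lborel)"
      using i by simp
    finally show ?thesis .
  qed
  have bl: "(\<lambda>n. B / real (Suc n)) \<longlonglongrightarrow> 0"
    by (rule real_tendsto_divide_at_top[OF tendsto_const filterlim_compose[OF filterlim_real_sequentially filterlim_Suc]])
  have "(\<lambda>n. (\<integral>x. (norm (Uc n x - U x))\<^sup>2 \<partial>lborel) + (2 * (\<integral>x. (norm (\<eta> n x *\<^sub>R V x - V x))\<^sup>2 \<partial>lborel)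
      + 4 * (B / real (Suc n))\<^sup>2 * (\<integral>x. (norm (U x))\<^sup>2 \<partial>lborel)))
      \<longlonglongrightarrow> 0 + (2 * 0 + 4 * 0\<^sup>2 * (\<integral>x. (norm (U x))\<^sup>2 \<partial>lborel))"
    unfolding Uc_def
    by (intro tendsto_intros bl lim[OF U] lim[OF V])
  then have tend: "(\<lambda>n. (\<integral>x. (norm (Uc n x - U x))\<^sup>2 \<partial>lborel) + (2 * (\<integral>x. (norm (\<eta> n x *\<^sub>R V x - V x))\<^sup>2 \<partial>lborel)
      + 4 * (B / real (Suc n))\<^sup>2 * (\<integral>x. (norm (U x))\<^sup>2 \<partial>lborel))) \<longlonglongrightarrow> 0" by simp
  show ?thesis
  proof (rule approximable_perturb[OF \<Omega>b U V])
    fix e :: real assume "0 < e"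
    then have "\<forall>\<^sub>F n in sequentially. (\<integral>x. (norm (Uc n x - U x))\<^sup>2 \<partial>lborel) + (2 * (\<integral>x. (norm (\<eta> n x *\<^sub>R V x - V x))\<^sup>2 \<partial>lborel)
      + 4 * (B / real (Suc n))\<^sup>2 * (\<integral>x. (norm (U x))\<^sup>2 \<partial>lborel)) < e"
      using order_tendstoD(2)[OF tend] by blast
    then obtain n where "(\<integral>x. (norm (Uc n x - U x))\<^sup>2 \<partial>lborel) + (2 * (\<integral>x. (norm (\<eta> n x *\<^sub>R V x - V x))\<^sup>2 \<partial>lborel)
      + 4 * (B / real (Suc n))\<^sup>2 * (\<integral>x. (norm (U x))\<^sup>2 \<partial>lborel)) < e"
      unfolding eventually_sequentially by blast
    then have "(\<integral>x. (norm (Uc n x - U x))\<^sup>2 \<partial>lborel) + (\<integral>x. (norm (Vc n x - V x))\<^sup>2 \<partial>lborel) < e"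
      using Vbound[of n] by linarith
    with ap[of n] Ln[of n] show "\<exists>U' V'. L2 lborel U' \<and> L2 lborel V' \<and> approximable \<Omega> U' V' \<and>
      (\<integral>x. (norm (U' x - U x))\<^sup>2 \<partial>lborel) + (\<integral>x. (norm (V' x - V x))\<^sup>2 \<partial>lborel) < e" by blast
  qed
qed

text \<open>In a chart ball \<open>K\<close> is the part above the graph. The part below is open and
  disjoint from \<open>K\<close>, hence exterior, and the graph itself is reached from both sides by
  moving along \<open>b\<close>. It follows that \<open>K\<close> and its exterior have the same
  frontier.\<close>

lemma C2_boundary_graph_domain:
  assumes K: "open K" "bounded K" "C2_boundary K"
  shows "graph_domain (interior (- K))" "frontier (interior (- K)) = frontier K"
proof -
  define \<Omega> where "\<Omega> = interior (- K)"
  have \<Omega>: "open \<Omega>" "\<Omega> = - closure K" by (simp add: \<Omega>_def) (simp add: \<Omega>_def interior_complement)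
  have disj: "K \<inter> closure \<Omega> = {}"
    using open_Int_closure_eq_empty[OF K(1), of \<Omega>] \<Omega>(2) closure_subset[of K] by auto
  have local: "\<exists>r a b g g'. chart a b g g' \<Omega> p r" if p: "p \<in> frontier K" for p
  proof -
    obtain r g and T :: "real^2 \<Rightarrow> real^2" where r: "0 < r" and T: "orthogonal_transformation T" and C2: "C2_real g"
      and chart: "K \<inter> ball p r = {x \<in> ball p r. T x $ 2 > g (T x $ 1)}"
      using K(3) p unfolding C2_boundary_def by blast
    obtain g' g'' where g: "\<And>t. (g has_real_derivative g' t) (at t)" and g2: "\<And>t. (g' has_real_derivative g'' t) (at t)"
      using C2 unfolding C2_real_def by blast
    obtain T' :: "real^2 \<Rightarrow> real^2" where T': "orthogonal_transformation T'" "\<And>x. T (T' x) = x" "\<And>x. T' (T x) = x"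
      using T by (metis bij_inv_eq_iff orthogonal_transformation_bij orthogonal_transformation_inv)
    \<comment> \<open>The inverse of the orthogonal map \<open>T\<close> is its adjoint, so the
      coordinates of \<open>T x\<close> are the inner products of \<open>x\<close> with the images
      of the axes under the inverse.\<close>
    define a b where "a = T' (axis 1 1)" and "b = T' (axis 2 1)"
    have T_in: "T x \<bullet> y = x \<bullet> T' y" for x y
      using T unfolding orthogonal_transformation_def by (metis T'(2))
    have Ta: "T x $ 1 = x \<bullet> a" "T x $ 2 = x \<bullet> b" for x
      using T_in[of x "axis 1 1"] T_in[of x "axis 2 1"] by (simp_all add: a_def b_def inner_axis)
    have fr: "frame a b"
    proof -
      have "a \<bullet> b = axis 1 1 \<bullet> (axis 2 1 :: real^2)"
        using T'(1) unfolding a_def b_def orthogonal_transformation_def by blast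
      then have "a \<bullet> b = 0" by (simp add: inner_axis_axis)
      moreover have "norm a = 1" "norm b = 1"
        unfolding a_def b_def by (simp_all add: orthogonal_transformation_norm[OF T'(1)])
      ultimately show ?thesis by (simp add: frame_def)
    qed
    have K_iff: "x \<in> K \<longleftrightarrow> g (x \<bullet> a) < x \<bullet> b" if "x \<in> ball p r" for x
      using chart that unfolding Ta by blast
    have cg: "continuous_on S g" for S
      by (meson DERIV_continuous_on g has_field_derivative_at_within)
    have cga: "continuous_on S (\<lambda>x. g (x \<bullet> a))" for S
      by (intro continuous_on_compose2[OF cg[of UNIV]] continuous_intros) auto
    have shift: "\<exists>s>0. s < e \<and> x + s *\<^sub>R b \<in> ball p r \<and> x - s *\<^sub>R b \<in> ball p r" if x: "x \<in> ball p r" "0 < e" for x e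
    proof -
      define s where "s = min e (r - dist p x) / 2"
      have s: "0 < s" "s < e" "s < r - dist p x" using x by (auto simp: s_def)
      have nb: "norm b = 1" using fr by (simp add: frame_def)
      have "dist p (x + s *\<^sub>R b) \<le> dist p x + s" "dist p (x - s *\<^sub>R b) \<le> dist p x + s"
        using norm_triangle_ineq4[of "p - x" "s *\<^sub>R b"] norm_triangle_ineq[of "p - x" "s *\<^sub>R b"] s nb
        by (simp_all add: dist_norm algebra_simps)
      then show ?thesis using s by (intro exI[of _ s]) auto
    qed
    have ib: "(x + s *\<^sub>R b) \<bullet> a = x \<bullet> a" "(x + s *\<^sub>R b) \<bullet> b = x \<bullet> b + s"
      "(x - s *\<^sub>R b) \<bullet> a = x \<bullet> a" "(x - s *\<^sub>R b) \<bullet> b = x \<bullet> b - s" for x s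
      by (simp_all add: inner_simps frame_inner[OF fr])
    have nb: "norm b = 1" using fr by (simp add: frame_def)
    have lt: "x \<in> \<Omega>" if x: "x \<in> ball p r" "x \<bullet> b < g (x \<bullet> a)" for x
    proof -
      have "open (ball p r \<inter> {x. x \<bullet> b < g (x \<bullet> a)})"
        by (intro open_Int open_ball open_Collect_less cga continuous_intros)
      moreover have "ball p r \<inter> {x. x \<bullet> b < g (x \<bullet> a)} \<subseteq> - K" using K_iff by force
      ultimately have "ball p r \<inter> {x. x \<bullet> b < g (x \<bullet> a)} \<subseteq> interior (- K)" by (intro interior_maximal)
      then show ?thesis unfolding \<Omega>_def using x by blast
    qed
    have eq: "x \<in> closure K \<and> x \<in> closure \<Omega>" if x: "x \<in> ball p r" "x \<bullet> b = g (x \<bullet> a)" for x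
      unfolding closure_approachable
    proof (intro conjI allI impI)
      fix e :: real assume "0 < e"
      then obtain s where s: "s > 0" "s < e" "x + s *\<^sub>R b \<in> ball p r" "x - s *\<^sub>R b \<in> ball p r" using shift[OF x(1)] by blast
      have "x + s *\<^sub>R b \<in> K" using K_iff[OF s(3)] x(2) s(1) by (simp add: ib)
      moreover have "dist (x + s *\<^sub>R b) x < e" using s nb by (simp add: dist_norm)
      ultimately show "\<exists>y\<in>K. dist y x < e" by blast
      have "x - s *\<^sub>R b \<in> \<Omega>" using lt[OF s(4)] x(2) s(1) by (simp add: ib)
      moreover have "dist (x - s *\<^sub>R b) x < e" using s nb by (simp add: dist_norm)
      ultimately show "\<exists>y\<in>\<Omega>. dist y x < e" by blast
    qed
    have below: "x \<in> \<Omega> \<longleftrightarrow> x \<bullet> b < g (x \<bullet> a)" if x: "x \<in> ball p r" for x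
    proof
      assume "x \<in> \<Omega>"
      then have "x \<notin> closure K" using \<Omega>(2) by simp
      then show "x \<bullet> b < g (x \<bullet> a)"
        using K_iff[OF x] eq[OF x] closure_subset[of K] by (cases "x \<bullet> b" "g (x \<bullet> a)" rule: linorder_cases) auto
    qed (rule lt[OF x])
    have on: "x \<in> frontier \<Omega> \<longleftrightarrow> x \<bullet> b = g (x \<bullet> a)" if x: "x \<in> ball p r" for x
    proof
      assume "x \<in> frontier \<Omega>"
      then have "x \<in> closure \<Omega>" "x \<notin> \<Omega>" using \<Omega>(1) by (auto simp: frontier_def interior_open)
      then have "x \<notin> K" "\<not> x \<bullet> b < g (x \<bullet> a)" using disj below[OF x] by auto
      then show "x \<bullet> b = g (x \<bullet> a)" using K_iff[OF x] by linarith
    next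
      assume e: "x \<bullet> b = g (x \<bullet> a)"
      then show "x \<in> frontier \<Omega>" using eq[OF x e] below[OF x] \<Omega>(1) by (auto simp: frontier_def interior_open)
    qed
    have pr: "p \<in> ball p r" using r by simp
    have "p \<in> closure K" "p \<notin> K" using p K(1) by (auto simp: frontier_def interior_open)
    then have "p \<notin> \<Omega>" using \<Omega>(2) by simp
    then have "p \<bullet> b = g (p \<bullet> a)" using below[OF pr] K_iff[OF pr] \<open>p \<notin> K\<close> by linarith
    then have pf: "p \<in> frontier \<Omega>" using on[OF pr] by simp
    have cg': "continuous_on UNIV g'"
      by (meson DERIV_continuous_on g2 has_field_derivative_at_within)
    have "chart a b g g' \<Omega> p r"
      by unfold_locales (use fr g cg' r pf below on \<Omega>(1) in auto)
    then show ?thesis by blast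
  qed
  have sub: "frontier \<Omega> \<subseteq> frontier K"
  proof
    fix x assume "x \<in> frontier \<Omega>"
    then have "x \<in> closure \<Omega>" "x \<notin> \<Omega>" using \<Omega>(1) by (auto simp: frontier_def interior_open)
    then show "x \<in> frontier K" using disj \<Omega>(2) K(1) by (auto simp: frontier_def interior_open)
  qed
  have "frontier K \<subseteq> frontier \<Omega>" using local chart.p by blast
  with sub have eq: "frontier \<Omega> = frontier K" by blast
  have "compact (frontier K)" using K(2) by (rule compact_frontier_bounded)
  then show "graph_domain (interior (- K))"
    unfolding graph_domain_def \<Omega>_def[symmetric] eq using local \<Omega>(1) by blast
  show "frontier (interior (- K)) = frontier K" using eq by (simp add: \<Omega>_def)
qed

section \<open>Traces and weak gradients\<close>

text \<open>The argument of Riesz and Fischer with a prescribed rate, which spares the choice of a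
  subsequence: the rate makes the increments summable almost everywhere, and Fatou's lemma carries
  the Cauchy estimate to the pointwise limit.\<close>

lemma L2_fast_Cauchy_limit:
  fixes f :: "nat \<Rightarrow> 'a \<Rightarrow> 'b::{banach, second_countable_topology}"
  assumes M: "finite_measure M" and f: "\<And>n. L2 M (f n)"
    and Cauchy: "\<And>n k. n \<le> k \<Longrightarrow> (\<integral>x. (norm (f n x - f k x))\<^sup>2 \<partial>M) \<le> D * (1/16) ^ n"
  obtains g where "L2 M g" "(\<lambda>n. \<integral>x. (norm (f n x - g x))\<^sup>2 \<partial>M) \<longlonglongrightarrow> 0"
proof -
  interpret finite_measure M by (rule M)
  have [measurable]: "f n \<in> borel_measurable M" for n using f by (simp add: L2_def)
  have int: "integrable M (\<lambda>x. (norm (f n x - f k x))\<^sup>2)" for n k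
    by (rule L2_norm_square_diff_integrable[OF f f])
  have "0 \<le> (\<integral>x. (norm (f 0 x - f 0 x))\<^sup>2 \<partial>M)" by simp
  with Cauchy[of 0 0] have D: "0 \<le> D" by simp
  define m where "m = measure M (space M)"
  have step: "(\<integral>\<^sup>+x. ennreal (norm (f n x - f (Suc n) x)) \<partial>M) \<le> ennreal ((D + m) * (1/4) ^ n)" for n
  proof -
    define d where "d x = norm (f n x - f (Suc n) x)" for x
    \<comment> \<open>Either \<open>d x\<close> is at most \<open>4^-n\<close>, or
      \<open>4^n * d x\<close> is at least 1. Since the integral of \<open>d\<^sup>2\<close> is of
      order \<open>16^-n\<close> and the measure is finite, the integral of \<open>d\<close> is of
      order \<open>4^-n\<close>.\<close>
    have pt: "d x \<le> 4 ^ n * (d x)\<^sup>2 + (1/4) ^ n" for x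
    proof (cases "d x \<le> (1/4) ^ n")
      case False
      have "1 = (4::real) ^ n * (1/4) ^ n" by (simp add: power_mult_distrib[symmetric])
      also have "\<dots> \<le> 4 ^ n * d x" using False by (intro mult_left_mono) auto
      finally have "1 * d x \<le> (4 ^ n * d x) * d x" by (intro mult_right_mono) (auto simp: d_def)
      moreover have "(0::real) \<le> (1/4) ^ n" by simp
      ultimately show ?thesis unfolding power2_eq_square by (simp add: mult.assoc add_increasing2)
    qed (simp add: add_increasing)
    have i: "integrable M (\<lambda>x. 4 ^ n * (d x)\<^sup>2)" using int[of n "Suc n"] by (simp add: d_def)
    have i2: "integrable M (\<lambda>x. 4 ^ n * (d x)\<^sup>2 + (1/4) ^ n)"
      by (intro Bochner_Integration.integrable_add i) simp
    have "(\<integral>\<^sup>+x. ennreal (d x) \<partial>M) \<le> (\<integral>\<^sup>+x. ennreal (4 ^ n * (d x)\<^sup>2 + (1/4) ^ n) \<partial>M)"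
      by (intro nn_integral_mono ennreal_leI pt)
    also have "\<dots> = ennreal (\<integral>x. 4 ^ n * (d x)\<^sup>2 + (1/4) ^ n \<partial>M)"
      by (rule nn_integral_eq_integral[OF i2]) auto
    also have "(\<integral>x. 4 ^ n * (d x)\<^sup>2 + (1/4) ^ n \<partial>M) = 4 ^ n * (\<integral>x. (d x)\<^sup>2 \<partial>M) + (1/4) ^ n * m"
      using i by (simp add: m_def)
    also have "\<dots> \<le> 4 ^ n * (D * (1/16) ^ n) + (1/4) ^ n * m"
      using Cauchy[of n "Suc n"] by (intro add_right_mono mult_left_mono) (auto simp: d_def)
    also have "\<dots> = (D + m) * (1/4) ^ n"
    proof -
      have "(4::real) ^ n * (1/16) ^ n = (1/4) ^ n" by (simp add: power_mult_distrib[symmetric])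
      then have "4 ^ n * (D * (1/16) ^ n) = D * (1/4) ^ n" by (metis mult.left_commute)
      then show ?thesis by (simp add: algebra_simps)
    qed
    finally show ?thesis unfolding d_def by (simp add: ennreal_leI)
  qed
  have m0: "0 \<le> D + m" using D by (simp add: m_def)
  have "(\<integral>\<^sup>+x. (\<Sum>n. ennreal (norm (f n x - f (Suc n) x))) \<partial>M)
      = (\<Sum>n. \<integral>\<^sup>+x. ennreal (norm (f n x - f (Suc n) x)) \<partial>M)"
    by (rule nn_integral_suminf) measurable
  also have "\<dots> \<le> (\<Sum>n. ennreal ((D + m) * (1/4) ^ n))" by (intro suminf_le step) auto
  also have "\<dots> = ennreal (\<Sum>n. (D + m) * (1/4) ^ n)"
    using m0 by (intro suminf_ennreal2 summable_mult summable_geometric) auto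
  also have "\<dots> < \<infinity>" by simp
  finally have "(\<integral>\<^sup>+x. (\<Sum>n. ennreal (norm (f n x - f (Suc n) x))) \<partial>M) \<noteq> \<infinity>" by simp
  then have "AE x in M. (\<Sum>n. ennreal (norm (f n x - f (Suc n) x))) \<noteq> \<infinity>"
    by (intro nn_integral_noteq_infinite) auto
  then have conv: "AE x in M. (\<lambda>n. f n x) \<longlonglongrightarrow> lim (\<lambda>n. f n x)"
  proof eventually_elim
    case (elim x)
    have "summable (\<lambda>n. norm (f n x - f (Suc n) x))"
      using elim by (intro summable_suminf_not_top) auto
    then have "summable (\<lambda>n. f n x - f (Suc n) x)" by (rule summable_norm_cancel)
    then have "(\<lambda>n. \<Sum>i<n. f i x - f (Suc i) x) \<longlonglongrightarrow> (\<Sum>i. f i x - f (Suc i) x)" by (rule summable_LIMSEQ)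
    then have "(\<lambda>n. f 0 x - f n x) \<longlonglongrightarrow> (\<Sum>i. f i x - f (Suc i) x)" by (simp only: sum_lessThan_telescope'[where f="\<lambda>i. f i x"])
    from tendsto_diff[OF tendsto_const[of "f 0 x"] this]
    have "convergent (\<lambda>n. f n x)" by (auto simp: convergent_def)
    then show ?case by (simp add: convergent_LIMSEQ_iff)
  qed
  \<comment> \<open>Where the sequence diverges \<open>lim\<close> has no meaning, but that happens
    on a null set only.\<close>
  define g where "g x = lim (\<lambda>n. f n x)" for x
  have [measurable]: "g \<in> borel_measurable M" unfolding g_def by measurable
  have fatou: "(\<integral>\<^sup>+x. ennreal ((norm (f n x - g x))\<^sup>2) \<partial>M) \<le> ennreal (D * (1/16) ^ n)" for n
  proof -
    have "(\<integral>\<^sup>+x. ennreal ((norm (f n x - g x))\<^sup>2) \<partial>M)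
        = (\<integral>\<^sup>+x. liminf (\<lambda>k. ennreal ((norm (f n x - f k x))\<^sup>2)) \<partial>M)"
    proof (rule nn_integral_cong_AE, use conv in eventually_elim)
      case (elim x)
      then have "(\<lambda>k. ennreal ((norm (f n x - f k x))\<^sup>2)) \<longlonglongrightarrow> ennreal ((norm (f n x - g x))\<^sup>2)"
        unfolding g_def by (intro tendsto_ennrealI tendsto_intros)
      then show ?case by (intro lim_imp_Liminf[symmetric]) auto
    qed
    also have "\<dots> \<le> liminf (\<lambda>k. \<integral>\<^sup>+x. ennreal ((norm (f n x - f k x))\<^sup>2) \<partial>M)"
      by (rule nn_integral_liminf) measurable
    also have "\<dots> \<le> ennreal (D * (1/16) ^ n)"
    proof (rule Liminf_le)
      show "\<forall>\<^sub>F k in sequentially. (\<integral>\<^sup>+x. ennreal ((norm (f n x - f k x))\<^sup>2) \<partial>M) \<le> ennreal (D * (1/16) ^ n)"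
        using eventually_ge_at_top[of n]
      proof eventually_elim
        case (elim k)
        then show ?case using Cauchy[of n k] int[of n k] by (simp add: nn_integral_eq_integral ennreal_leI)
      qed
    qed simp
    finally show ?thesis .
  qed
  have i: "integrable M (\<lambda>x. (norm (f n x - g x))\<^sup>2)" for n
    by (rule integrableI_bounded) (use le_less_trans[OF fatou[of n] ennreal_less_top] in auto)
  have le: "(\<integral>x. (norm (f n x - g x))\<^sup>2 \<partial>M) \<le> D * (1/16) ^ n" for n
    using fatou[of n] i[of n] D by (simp add: nn_integral_eq_integral)
  have "L2 M (\<lambda>x. f 0 x - g x)" using i[of 0] by (simp add: L2_def)
  from L2_diff[OF f[of 0] this] have "L2 M g" by simp
  moreover have lim: "(\<lambda>n. D * (1/16) ^ n) \<longlonglongrightarrow> 0"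
    by (rule tendsto_mult_right_zero) (simp add: LIMSEQ_power_zero)
  have "(\<lambda>n. \<integral>x. (norm (f n x - g x))\<^sup>2 \<partial>M) \<longlonglongrightarrow> 0"
    by (rule tendsto_sandwich[OF _ _ tendsto_const lim]) (simp_all add: le)
  ultimately show ?thesis by (rule that)
qed

section \<open>Borel representatives and uniqueness of weak gradients\<close>

lemma set_lebesgue_integral_eq_lborel:
  fixes h H :: "'a::euclidean_space \<Rightarrow> 'b::euclidean_space"
  assumes \<Omega>: "\<Omega> \<in> sets borel" and H: "H \<in> borel_measurable lborel" and eq: "AE x in lborel. x \<in> \<Omega> \<longrightarrow> h x = H x"
  shows "(LINT x:\<Omega>|lebesgue. h x) = (\<integral>x. indicator \<Omega> x *\<^sub>R H x \<partial>lborel)"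
proof -
  have [measurable]: "\<Omega> \<in> sets borel" "H \<in> borel_measurable borel" using \<Omega> H by auto
  have m: "(\<lambda>x. indicator \<Omega> x *\<^sub>R H x) \<in> borel_measurable lborel" by measurable
  have e: "AE x in lebesgue. indicator \<Omega> x *\<^sub>R H x = indicator \<Omega> x *\<^sub>R h x"
    using AE_completion[OF eq] by eventually_elim (auto simp: indicator_def)
  have "(LINT x:\<Omega>|lebesgue. h x) = (\<integral>x. indicator \<Omega> x *\<^sub>R H x \<partial>lebesgue)"
    unfolding set_lebesgue_integral_def
  proof (rule integral_cong_AE)
    show "(\<lambda>x. indicator \<Omega> x *\<^sub>R h x) \<in> borel_measurable lebesgue"
      by (rule borel_measurable_AE[OF borel_measurable_lebesgue[OF m] e])
  qed (use e borel_measurable_lebesgue[OF m] in \<open>auto elim: eventually_mono\<close>)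
  then show ?thesis by (simp add: integral_completion m)
qed

lemma L2_lebesgue_on_ex_borel:
  fixes u :: "'a::euclidean_space \<Rightarrow> 'b::euclidean_space"
  assumes \<Omega>: "\<Omega> \<in> sets borel" and u: "L2 (lebesgue_on \<Omega>) u"
  obtains U where "L2 lborel U" "\<And>x. x \<notin> \<Omega> \<Longrightarrow> U x = 0" "AE x in lborel. x \<in> \<Omega> \<longrightarrow> u x = U x"
proof -
  have [measurable]: "\<Omega> \<in> sets borel" by (rule \<Omega>)
  have \<Omega>l: "\<Omega> \<inter> space lebesgue \<in> sets lebesgue" using \<Omega> by simp
  have "(\<lambda>x. indicator \<Omega> x *\<^sub>R u x) \<in> borel_measurable lebesgue"
    using u unfolding L2_def by (simp add: borel_measurable_restrict_space_iff[OF \<Omega>l])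
  from lebesgue_ex_borel[OF this] obtain f' where f': "f' \<in> borel_measurable lborel"
    "AE x in lborel. indicator \<Omega> x *\<^sub>R u x = f' x" by blast
  have [measurable]: "f' \<in> borel_measurable borel" using f' by simp
  define U where "U x = indicator \<Omega> x *\<^sub>R f' x" for x
  have m[measurable]: "U \<in> borel_measurable lborel" unfolding U_def by measurable
  have eq: "AE x in lborel. x \<in> \<Omega> \<longrightarrow> u x = U x"
    using f'(2) by eventually_elim (auto simp: U_def indicator_def split: if_splits)
  have "integrable lebesgue (\<lambda>x. indicator \<Omega> x *\<^sub>R (norm (u x))\<^sup>2)"
    using u unfolding L2_def by (simp add: integrable_restrict_space[OF \<Omega>l])
  moreover
  have mU: "(\<lambda>x. (norm (U x))\<^sup>2) \<in> borel_measurable lborel" by measurable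
  have "(\<lambda>x. (norm (U x))\<^sup>2) \<in> borel_measurable lebesgue" by (rule borel_measurable_lebesgue[OF mU])
  moreover have "AE x in lebesgue. indicator \<Omega> x *\<^sub>R (norm (u x))\<^sup>2 = (norm (U x))\<^sup>2"
    using AE_completion[OF eq] by eventually_elim (auto simp: U_def indicator_def)
  ultimately have "integrable lebesgue (\<lambda>x. (norm (U x))\<^sup>2)" by (rule integrable_cong_AE_imp)

  then have "integrable lborel (\<lambda>x. (norm (U x))\<^sup>2)" unfolding integrable_completion[OF mU] .
  then have "L2 lborel U" using m by (simp add: L2_def)
  then show ?thesis using eq that by (auto simp: U_def)
qed

text \<open>Functions measurable for the completed measure on \<open>\<Omega>\<close> are exchanged
  for Borel functions on the plane, zero outside \<open>\<Omega>\<close>, for which Fubini and the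
  mollification results are stated.\<close>

lemma weak_gradient_wpair:
  assumes \<Omega>: "open \<Omega>" and u: "L2 (lebesgue_on \<Omega>) u" and G: "weak_gradient \<Omega> u G"
  obtains U V where "wpair \<Omega> U V" "AE x in lborel. x \<in> \<Omega> \<longrightarrow> u x = U x \<and> G x = V x"
proof -
  have \<Omega>b: "\<Omega> \<in> sets borel" using \<Omega> by simp
  obtain U where U: "L2 lborel U" "\<And>x. x \<notin> \<Omega> \<Longrightarrow> U x = 0" "AE x in lborel. x \<in> \<Omega> \<longrightarrow> u x = U x"
    using L2_lebesgue_on_ex_borel[OF \<Omega>b u] by blast
  have "L2 (lebesgue_on \<Omega>) G" using G by (simp add: weak_gradient_def)
  then obtain V where V: "L2 lborel V" "\<And>x. x \<notin> \<Omega> \<Longrightarrow> V x = 0" "AE x in lborel. x \<in> \<Omega> \<longrightarrow> G x = V x"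
    using L2_lebesgue_on_ex_borel[OF \<Omega>b] by blast
  have "(\<integral>x. partial i \<phi> x *\<^sub>R U x \<partial>lborel) = - (\<integral>x. \<phi> x *\<^sub>R (V x $ i) \<partial>lborel)" if \<phi>: "\<phi> \<in> C1c \<Omega>" for i \<phi>
  proof -
    have C: "C1 \<phi>" by (rule C1c_C1[OF \<phi>])
    have m[measurable]: "partial i \<phi> \<in> borel_measurable borel" "\<phi> \<in> borel_measurable borel"
      using C1_partial_continuous[OF C] C1_continuous[OF C] by (auto intro: borel_measurable_continuous_onI)
    have [measurable]: "U \<in> borel_measurable borel" "(\<lambda>x. V x $ i) \<in> borel_measurable borel"
      using U(1) L2_vec_nth[OF V(1)] by (auto simp: L2_def)
    have "(LINT x:\<Omega>|lebesgue. partial i \<phi> x *\<^sub>R u x) = (\<integral>x. indicator \<Omega> x *\<^sub>R (partial i \<phi> x *\<^sub>R U x) \<partial>lborel)"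
      by (rule set_lebesgue_integral_eq_lborel[OF \<Omega>b])
        (auto intro: eventually_mono[OF U(3)])
    also have "\<dots> = (\<integral>x. partial i \<phi> x *\<^sub>R U x \<partial>lborel)"
      by (rule Bochner_Integration.integral_cong) (use U(2) in \<open>auto simp: indicator_def\<close>)
    finally have 1: "(LINT x:\<Omega>|lebesgue. partial i \<phi> x *\<^sub>R u x) = (\<integral>x. partial i \<phi> x *\<^sub>R U x \<partial>lborel)" .
    have "(LINT x:\<Omega>|lebesgue. \<phi> x *\<^sub>R (G x $ i)) = (\<integral>x. indicator \<Omega> x *\<^sub>R (\<phi> x *\<^sub>R (V x $ i)) \<partial>lborel)"
      by (rule set_lebesgue_integral_eq_lborel[OF \<Omega>b])
        (auto intro: eventually_mono[OF V(3)])
    also have "\<dots> = (\<integral>x. \<phi> x *\<^sub>R (V x $ i) \<partial>lborel)"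
      by (rule Bochner_Integration.integral_cong) (use V(2) in \<open>fastforce simp: indicator_def\<close>)+
    finally have 2: "(LINT x:\<Omega>|lebesgue. \<phi> x *\<^sub>R (G x $ i)) = (\<integral>x. \<phi> x *\<^sub>R (V x $ i) \<partial>lborel)" .
    have "(LINT x:\<Omega>|lebesgue. partial i \<phi> x *\<^sub>R u x) = - (LINT x:\<Omega>|lebesgue. \<phi> x *\<^sub>R (G x $ i))"
      using G \<phi> unfolding weak_gradient_def by blast
    then show ?thesis unfolding 1 2 .
  qed
  then have "wpair \<Omega> U V" unfolding wpair_def using U V by blast
  moreover have "AE x in lborel. x \<in> \<Omega> \<longrightarrow> u x = U x \<and> G x = V x" using U(3) V(3) by eventually_elim auto
  ultimately show ?thesis by (rule that)
qed

text \<open>The fundamental lemma of the calculus of variations: at points farther than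
  \<open>\<delta>\<close> from the complement the translated kernel is a test function for
  \<open>\<epsilon> \<le> \<delta>\<close>, so the averages of \<open>h\<close> vanish there, and
  they converge to \<open>h\<close>. The complement has to be nonempty because the distance to the
  empty set is 0 by convention.\<close>

lemma weakly_zero:
  fixes h :: "real^2 \<Rightarrow> complex"
  assumes \<Omega>: "open \<Omega>" "\<Omega> \<noteq> UNIV" and h: "L2 lborel h" and z: "\<And>\<phi>. \<phi> \<in> C1c \<Omega> \<Longrightarrow> (\<integral>x. \<phi> x *\<^sub>R h x \<partial>lborel) = 0"
  shows "AE x in lborel. x \<in> \<Omega> \<longrightarrow> h x = 0"
proof -
  have [measurable]: "h \<in> borel_measurable borel" using h by (simp add: L2_def)
  obtain k R where k: "kernel R k" "k \<in> C1c UNIV" "\<And>z. z \<notin> cball (0::real^2) 1 \<Longrightarrow> k z = 0"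
    by (rule exists_kernel) (rule that)
  define \<Omega>' where "\<Omega>' \<delta> = {x. \<delta> < infdist x (- \<Omega>)}" for \<delta> :: real
  have ne: "- \<Omega> \<noteq> {}" using \<Omega>(2) by auto
  have [measurable]: "\<Omega>' \<delta> \<in> sets borel" for \<delta> unfolding \<Omega>'_def
    by (intro borel_open open_Collect_less continuous_intros)
  have ball: "y \<in> \<Omega>" if "x \<in> \<Omega>' \<delta>" "dist x y \<le> \<delta>" for x y \<delta>
  proof (rule ccontr)
    assume "y \<notin> \<Omega>"
    then have "infdist x (- \<Omega>) \<le> dist x y" by (intro infdist_le) auto
    then show False using that by (simp add: \<Omega>'_def)
  qed
  have moll0: "moll k \<epsilon> h x = 0" if x: "x \<in> \<Omega>' \<delta>" and \<epsilon>: "0 < \<epsilon>" "\<epsilon> \<le> \<delta>" for x \<epsilon> \<delta>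
  proof -
    define K where "K w = k ((1 / \<epsilon>) *\<^sub>R w) / \<epsilon>\<^sup>2" for w
    have K: "K \<in> C1c UNIV" unfolding K_def by (rule C1c_rescale[OF k(2) \<epsilon>(1)])
    define \<phi> where "\<phi> y = K (y - x)" for y
    have "C1 \<phi>" unfolding \<phi>_def by (rule C1_translate(1)[OF C1c_C1[OF K]])
    moreover have "cball x \<epsilon> \<subseteq> \<Omega>" using ball[OF x] \<epsilon>(2) by auto
    moreover have "\<phi> y = 0" if "y \<notin> cball x \<epsilon>" for y
    proof -
      have "(1 / \<epsilon>) *\<^sub>R (y - x) \<notin> cball 0 1"
        using that \<epsilon>(1) by (simp add: dist_norm norm_minus_commute divide_simps)
      then show ?thesis using k(3) by (simp add: \<phi>_def K_def)
    qed
    ultimately have "\<phi> \<in> C1c \<Omega>" unfolding C1c_iff using compact_cball by blast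
    from z[OF this] have "conv K h x = 0" by (simp add: conv_def \<phi>_def)
    then show ?thesis using moll_eq_conv[OF kernel_facts(1)[OF k(1)] _ \<epsilon>(1), of h x]
      unfolding K_def by simp
  qed
  have small: "(\<integral>x. indicator (\<Omega>' \<delta>) x * (norm (h x))\<^sup>2 \<partial>lborel) < e" if \<delta>: "0 < \<delta>" and e: "0 < e" for \<delta> e :: real
  proof -
    obtain d where d: "0 < d" "\<And>\<epsilon>. 0 < \<epsilon> \<Longrightarrow> \<epsilon> < d \<Longrightarrow> (\<integral>x. (norm (moll k \<epsilon> h x - h x))\<^sup>2 \<partial>lborel) < e"
      using moll_tendsto[OF k(1) h e] by blast
    define \<epsilon> where "\<epsilon> = min (d / 2) \<delta>"
    have \<epsilon>: "0 < \<epsilon>" "\<epsilon> < d" "\<epsilon> \<le> \<delta>" using d \<delta> by (auto simp: \<epsilon>_def)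
    have "(\<integral>x. indicator (\<Omega>' \<delta>) x * (norm (h x))\<^sup>2 \<partial>lborel) \<le> (\<integral>x. (norm (moll k \<epsilon> h x - h x))\<^sup>2 \<partial>lborel)"
    proof (rule integral_mono)
      have "integrable lborel (\<lambda>x. (norm (h x))\<^sup>2 * indicator (\<Omega>' \<delta>) x)"
        using h by (intro integrable_real_mult_indicator) (auto simp: L2_def)
      then show "integrable lborel (\<lambda>x. indicator (\<Omega>' \<delta>) x * (norm (h x))\<^sup>2)" by (simp only: mult.commute)
      show "integrable lborel (\<lambda>x. (norm (moll k \<epsilon> h x - h x))\<^sup>2)"
        using \<epsilon>(1) by (intro L2_norm_square_diff_integrable h moll_L2[OF k(1) h]) auto
      show "indicator (\<Omega>' \<delta>) x * (norm (h x))\<^sup>2 \<le> (norm (moll k \<epsilon> h x - h x))\<^sup>2" for x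
        using moll0[OF _ \<epsilon>(1,3), of x] by (cases "x \<in> \<Omega>' \<delta>") auto
    qed
    also have "\<dots> < e" by (rule d(2)[OF \<epsilon>(1,2)])
    finally show ?thesis .
  qed
  have "AE x in lborel. x \<in> \<Omega>' \<delta> \<longrightarrow> h x = 0" if \<delta>: "0 < \<delta>" for \<delta>
  proof -
    have "integrable lborel (\<lambda>x. (norm (h x))\<^sup>2 * indicator (\<Omega>' \<delta>) x)"
      using h by (intro integrable_real_mult_indicator) (auto simp: L2_def)
    then have i: "integrable lborel (\<lambda>x. indicator (\<Omega>' \<delta>) x * (norm (h x))\<^sup>2)" by (simp only: mult.commute)
    have "(\<integral>x. indicator (\<Omega>' \<delta>) x * (norm (h x))\<^sup>2 \<partial>lborel) \<le> 0"
      by (rule field_le_epsilon) (use small[OF \<delta>] in \<open>auto intro: less_imp_le\<close>)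
    moreover have "0 \<le> (\<integral>x. indicator (\<Omega>' \<delta>) x * (norm (h x))\<^sup>2 \<partial>lborel)" by (rule Bochner_Integration.integral_nonneg) auto
    ultimately have "(\<integral>x. indicator (\<Omega>' \<delta>) x * (norm (h x))\<^sup>2 \<partial>lborel) = 0" by simp
    then have "AE x in lborel. indicator (\<Omega>' \<delta>) x * (norm (h x))\<^sup>2 = 0"
      using integral_nonneg_eq_0_iff_AE[OF i] by auto
    then show ?thesis by eventually_elim (auto simp: indicator_def)
  qed
  then have "AE x in lborel. \<forall>n. x \<in> \<Omega>' (1 / real (Suc n)) \<longrightarrow> h x = 0" by (subst AE_all_countable) simp
  then show ?thesis
  proof eventually_elim
    case (elim x)
    show ?case
    proof
      assume "x \<in> \<Omega>"
      then have "0 < infdist x (- \<Omega>)"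
        using \<Omega>(1) ne in_closed_iff_infdist_zero[of "- \<Omega>" x] infdist_nonneg[of x "- \<Omega>"] by (auto simp: less_le)
      then obtain n where "1 / real (Suc n) < infdist x (- \<Omega>)" using nat_approx_posE by blast
      then show "h x = 0" using elim by (auto simp: \<Omega>'_def)
    qed
  qed
qed

section \<open>The trace inequality and the existence of traces\<close>

lemma finite_measure_arclength:
  fixes S :: "'a::euclidean_space set"
  assumes "emeasure hausdorff1 S < \<infinity>" "S \<in> sets borel"
  shows "finite_measure (arclength S)"
proof (rule finite_measureI)
  have "emeasure (arclength S) (space (arclength S)) = emeasure hausdorff1 S"
    unfolding arclength_def space_restrict_space using assms(2) by (subst emeasure_restrict_space) auto
  then show "emeasure (arclength S) (space (arclength S)) \<noteq> \<infinity>" using assms(1) by auto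
qed

lemma borel_measurable_arclength:
  fixes f :: "'a::euclidean_space \<Rightarrow> 'b::topological_space"
  assumes "f \<in> borel_measurable borel" shows "f \<in> borel_measurable (arclength S)"
  unfolding arclength_def by (rule measurable_restrict_space1) (use assms in \<open>simp cong: measurable_cong_sets\<close>)

lemma C1c_L2_arclength:
  fixes \<phi> :: "real^2 \<Rightarrow> complex"
  assumes "finite_measure (arclength S)" "\<phi> \<in> C1c UNIV"
  shows "L2 (arclength S) \<phi>"
proof -
  interpret finite_measure "arclength S" by fact
  obtain B where B: "0 < B" "\<And>x. norm (\<phi> x) \<le> B" using C1c_norm_bounded[OF assms(2)] by blast
  have b[measurable]: "\<phi> \<in> borel_measurable (arclength S)"
    by (intro borel_measurable_arclength borel_measurable_continuous_onI C1_continuous C1c_C1[OF assms(2)])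
  have "integrable (arclength S) (\<lambda>x. (norm (\<phi> x))\<^sup>2)"
    by (rule integrable_const_bound[where B="B\<^sup>2"]) (use B in \<open>auto intro!: power_mono\<close>)
  with b show ?thesis by (simp add: L2_def)
qed

text \<open>The distance of \<open>\<phi>\<close> to the pair of zero functions is its squared
  Sobolev norm, so this is the boundedness of the restriction map, now for integrals with real
  values.\<close>

lemma trace_inequality:
  assumes dom: "graph_domain \<Omega>"
  obtains C where "0 \<le> C" "emeasure hausdorff1 (frontier \<Omega>) < \<infinity>" "finite_measure (arclength (frontier \<Omega>))"
    "\<And>\<phi>. \<phi> \<in> C1c UNIV \<Longrightarrow> (\<integral>x. (norm (\<phi> x))\<^sup>2 \<partial>arclength (frontier \<Omega>)) \<le> C * H1_dist \<Omega> \<phi> (\<lambda>_. 0) (\<lambda>_. 0)"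
proof -
  have \<Omega>: "\<Omega> \<in> sets borel" using dom by (auto simp: graph_domain_def)
  have F: "frontier \<Omega> \<in> sets borel" by simp
  obtain C where C: "0 \<le> C" and fin: "emeasure hausdorff1 (frontier \<Omega>) < \<infinity>"
    and tr: "\<And>\<phi>::real^2 \<Rightarrow> complex. \<phi> \<in> C1c UNIV \<Longrightarrow>
      (\<integral>\<^sup>+x. indicator (frontier \<Omega>) x * ennreal ((norm (\<phi> x))\<^sup>2) \<partial>hausdorff1)
      \<le> ennreal C * (\<integral>\<^sup>+x. indicator \<Omega> x * ennreal ((norm (\<phi> x))\<^sup>2 + (norm (grad \<phi> x))\<^sup>2) \<partial>lborel)"
    using graph_domain_trace[OF dom] by blast
  have fm: "finite_measure (arclength (frontier \<Omega>))" by (rule finite_measure_arclength[OF fin F])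
  have "(\<integral>x. (norm (\<phi> x))\<^sup>2 \<partial>arclength (frontier \<Omega>)) \<le> C * H1_dist \<Omega> \<phi> (\<lambda>_. 0) (\<lambda>_. 0)"
    if \<phi>: "\<phi> \<in> C1c UNIV" for \<phi>
  proof -
    have i: "integrable (arclength (frontier \<Omega>)) (\<lambda>x. (norm (\<phi> x))\<^sup>2)"
      using C1c_L2_arclength[OF fm \<phi>] by (simp add: L2_def)
    have j: "integrable lborel (\<lambda>x. indicator \<Omega> x * ((norm (\<phi> x))\<^sup>2 + (norm (grad \<phi> x))\<^sup>2))"
      using H1_dist_integrable[OF \<Omega> \<phi> L2_zero L2_zero] by simp
    have H0: "0 \<le> H1_dist \<Omega> \<phi> (\<lambda>_. 0) (\<lambda>_. 0)"
      unfolding H1_dist_def by (rule Bochner_Integration.integral_nonneg) auto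
    have "ennreal (\<integral>x. (norm (\<phi> x))\<^sup>2 \<partial>arclength (frontier \<Omega>))
        = (\<integral>\<^sup>+x. ennreal ((norm (\<phi> x))\<^sup>2) \<partial>arclength (frontier \<Omega>))"
      by (rule nn_integral_eq_integral[OF i, symmetric]) simp
    also have "\<dots> = (\<integral>\<^sup>+x. indicator (frontier \<Omega>) x * ennreal ((norm (\<phi> x))\<^sup>2) \<partial>hausdorff1)"
      unfolding arclength_def using F by (subst nn_integral_restrict_space) (simp_all add: mult.commute)
    also have "\<dots> \<le> ennreal C * (\<integral>\<^sup>+x. indicator \<Omega> x * ennreal ((norm (\<phi> x))\<^sup>2 + (norm (grad \<phi> x))\<^sup>2) \<partial>lborel)"
      by (rule tr[OF \<phi>])
    also have "(\<integral>\<^sup>+x. indicator \<Omega> x * ennreal ((norm (\<phi> x))\<^sup>2 + (norm (grad \<phi> x))\<^sup>2) \<partial>lborel)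
        = (\<integral>\<^sup>+x. ennreal (indicator \<Omega> x * ((norm (\<phi> x))\<^sup>2 + (norm (grad \<phi> x))\<^sup>2)) \<partial>lborel)"
      by (rule nn_integral_cong) (simp add: indicator_def)
    also have "\<dots> = ennreal (H1_dist \<Omega> \<phi> (\<lambda>_. 0) (\<lambda>_. 0))"
      using nn_integral_eq_integral[OF j] by (simp add: H1_dist_def)
    finally show ?thesis using C H0 by (simp add: ennreal_mult[symmetric])
  qed
  with C fin fm show ?thesis by (rule that)
qed

lemma H1_dist_triangle:
  assumes \<Omega>: "\<Omega> \<in> sets borel" and \<phi>: "\<phi> \<in> C1c UNIV" and \<psi>: "\<psi> \<in> C1c UNIV" and L: "L2 lborel U" "L2 lborel V"
  shows "H1_dist \<Omega> (\<lambda>x. \<phi> x - \<psi> x) (\<lambda>_. 0) (\<lambda>_. 0) \<le> 2 * H1_dist \<Omega> \<phi> U V + 2 * H1_dist \<Omega> \<psi> U V"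
proof -
  note I = H1_dist_integrable[OF \<Omega> \<phi> L] H1_dist_integrable[OF \<Omega> \<psi> L]
  have C: "(\<lambda>x. \<phi> x - \<psi> x) \<in> C1c UNIV" by (rule C1c_diff[OF \<phi> \<psi>])
  have g: "grad (\<lambda>x. \<phi> x - \<psi> x) x = grad \<phi> x - grad \<psi> x" for x
    by (rule grad_diff[OF C1c_C1[OF \<phi>] C1c_C1[OF \<psi>]])
  have "H1_dist \<Omega> (\<lambda>x. \<phi> x - \<psi> x) (\<lambda>_. 0) (\<lambda>_. 0)
      \<le> (\<integral>x. 2 * (indicator \<Omega> x * ((norm (\<phi> x - U x))\<^sup>2 + (norm (grad \<phi> x - V x))\<^sup>2))
          + 2 * (indicator \<Omega> x * ((norm (\<psi> x - U x))\<^sup>2 + (norm (grad \<psi> x - V x))\<^sup>2)) \<partial>lborel)"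
    unfolding H1_dist_def
  proof (rule integral_mono)
    fix x
    show "indicator \<Omega> x * ((norm ((\<phi> x - \<psi> x) - 0))\<^sup>2 + (norm (grad (\<lambda>x. \<phi> x - \<psi> x) x - 0))\<^sup>2)
      \<le> 2 * (indicator \<Omega> x * ((norm (\<phi> x - U x))\<^sup>2 + (norm (grad \<phi> x - V x))\<^sup>2))
          + 2 * (indicator \<Omega> x * ((norm (\<psi> x - U x))\<^sup>2 + (norm (grad \<psi> x - V x))\<^sup>2))"
      using norm_diff_square_le[of "\<phi> x - U x" "\<psi> x - U x"] norm_diff_square_le[of "grad \<phi> x - V x" "grad \<psi> x - V x"]
      by (simp add: g indicator_def)
  qed (use I H1_dist_integrable[OF \<Omega> C L2_zero L2_zero] in auto)
  also have "\<dots> = 2 * H1_dist \<Omega> \<phi> U V + 2 * H1_dist \<Omega> \<psi> U V"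
    using I by (simp add: H1_dist_def)
  finally show ?thesis .
qed

lemma H1_dist_nonneg: "0 \<le> H1_dist \<Omega> \<phi> U V"
  unfolding H1_dist_def by (rule Bochner_Integration.integral_nonneg) auto

text \<open>Approximations of quality \<open>16^-n\<close> exist by density; the trace inequality
  applied to their differences makes their boundary values Cauchy at the rate that the limit lemma
  requires.\<close>

lemma trace_sequence:
  assumes dom: "graph_domain \<Omega>" and w: "wpair \<Omega> U V"
  obtains \<phi> g where "\<And>n. \<phi> n \<in> C1c UNIV" "(\<lambda>n. H1_dist \<Omega> (\<phi> n) U V) \<longlonglongrightarrow> 0"
    "L2 (arclength (frontier \<Omega>)) g"
    "(\<lambda>n. \<integral>x. (norm (\<phi> n x - g x))\<^sup>2 \<partial>arclength (frontier \<Omega>)) \<longlonglongrightarrow> 0"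
proof -
  have \<Omega>: "\<Omega> \<in> sets borel" using dom by (auto simp: graph_domain_def)
  have L: "L2 lborel U" "L2 lborel V" using w by (auto simp: wpair_def)
  obtain C where C: "0 \<le> C" "emeasure hausdorff1 (frontier \<Omega>) < \<infinity>" and fm: "finite_measure (arclength (frontier \<Omega>))"
    and tr: "\<And>\<phi>. \<phi> \<in> C1c UNIV \<Longrightarrow> (\<integral>x. (norm (\<phi> x))\<^sup>2 \<partial>arclength (frontier \<Omega>)) \<le> C * H1_dist \<Omega> \<phi> (\<lambda>_. 0) (\<lambda>_. 0)"
    by (rule trace_inequality[OF dom]) (rule that)
  have "\<forall>n. \<exists>\<phi>. \<phi> \<in> C1c UNIV \<and> H1_dist \<Omega> \<phi> U V < (1/16) ^ n"
  proof
    fix n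
    have "0 < (1/16 :: real) ^ n" by simp
    then show "\<exists>\<phi>. \<phi> \<in> C1c UNIV \<and> H1_dist \<Omega> \<phi> U V < (1/16) ^ n"
      using graph_domain_density[OF dom w] unfolding approximable_def by blast
  qed
  then obtain \<phi> where \<phi>: "\<And>n. \<phi> n \<in> C1c UNIV" "\<And>n. H1_dist \<Omega> (\<phi> n) U V < (1/16) ^ n" by metis
  have "(\<integral>x. (norm (\<phi> n x - \<phi> k x))\<^sup>2 \<partial>arclength (frontier \<Omega>)) \<le> (4 * C) * (1/16) ^ n" if "n \<le> k" for n k
  proof -
    have "(1/16) ^ k \<le> (1/16 :: real) ^ n" using that by (intro power_decreasing) auto
    then have "2 * H1_dist \<Omega> (\<phi> n) U V + 2 * H1_dist \<Omega> (\<phi> k) U V \<le> 4 * (1/16) ^ n"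
      using \<phi>(2)[of n] \<phi>(2)[of k] by linarith
    with H1_dist_triangle[OF \<Omega> \<phi>(1)[of n] \<phi>(1)[of k] L]
    have "H1_dist \<Omega> (\<lambda>x. \<phi> n x - \<phi> k x) (\<lambda>_. 0) (\<lambda>_. 0) \<le> 4 * (1/16) ^ n" by linarith
    from mult_left_mono[OF this C(1)] tr[OF C1c_diff[OF \<phi>(1)[of n] \<phi>(1)[of k]]] show ?thesis by (simp add: mult.commute)
  qed
  from L2_fast_Cauchy_limit[OF fm C1c_L2_arclength[OF fm \<phi>(1)] this]
  obtain g where g: "L2 (arclength (frontier \<Omega>)) g"
    "(\<lambda>n. \<integral>x. (norm (\<phi> n x - g x))\<^sup>2 \<partial>arclength (frontier \<Omega>)) \<longlonglongrightarrow> 0" by blast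
  have lim: "(\<lambda>n. (1/16 :: real) ^ n) \<longlonglongrightarrow> 0" by (simp add: LIMSEQ_power_zero)
  have "(\<lambda>n. H1_dist \<Omega> (\<phi> n) U V) \<longlonglongrightarrow> 0"
    by (rule tendsto_sandwich[OF _ _ tendsto_const lim]) (simp_all add: \<phi>(2) less_imp_le H1_dist_nonneg)
  with \<phi>(1) show ?thesis using g by (rule that)
qed

text \<open>The two Lebesgue integrals in the definition add up to \<open>H1_dist\<close>, and being
  nonnegative they tend to 0 together exactly if their sum does.\<close>

lemma is_trace_iff:
  assumes \<Omega>: "open \<Omega>" and w: "wpair \<Omega> U V" and eq: "AE x in lborel. x \<in> \<Omega> \<longrightarrow> u x = U x \<and> wgrad \<Omega> u x = V x"
  shows "is_trace \<Omega> u g \<longleftrightarrow> L2 (arclength (frontier \<Omega>)) g \<and>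
    (\<exists>\<phi>. (\<forall>n. \<phi> n \<in> C1c UNIV) \<and> (\<lambda>n. H1_dist \<Omega> (\<phi> n) U V) \<longlonglongrightarrow> 0 \<and>
      (\<lambda>n. \<integral>x. (norm (\<phi> n x - g x))\<^sup>2 \<partial>arclength (frontier \<Omega>)) \<longlonglongrightarrow> 0)"
proof -
  have \<Omega>b: "\<Omega> \<in> sets borel" using \<Omega> by simp
  have L: "L2 lborel U" "L2 lborel V" using w by (auto simp: wpair_def)
  then have [measurable]: "U \<in> borel_measurable borel" "V \<in> borel_measurable borel" by (auto simp: L2_def)
  have "(\<lambda>n. LINT x:\<Omega>|lebesgue. (norm (\<phi> n x - u x))\<^sup>2) \<longlonglongrightarrow> 0 \<and>
      (\<lambda>n. LINT x:\<Omega>|lebesgue. (norm (grad (\<phi> n) x - wgrad \<Omega> u x))\<^sup>2) \<longlonglongrightarrow> 0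
    \<longleftrightarrow> (\<lambda>n. H1_dist \<Omega> (\<phi> n) U V) \<longlonglongrightarrow> 0"
    if \<phi>: "\<And>n. \<phi> n \<in> C1c UNIV" for \<phi> :: "nat \<Rightarrow> real^2 \<Rightarrow> complex"
  proof -
    define P where "P n = (LINT x:\<Omega>|lebesgue. (norm (\<phi> n x - u x))\<^sup>2)" for n
    define Q where "Q n = (LINT x:\<Omega>|lebesgue. (norm (grad (\<phi> n) x - wgrad \<Omega> u x))\<^sup>2)" for n
    have [measurable]: "\<phi> n \<in> borel_measurable borel" "grad (\<phi> n) \<in> borel_measurable borel" for n
      using C1_continuous[OF C1c_C1[OF \<phi>]] C1_grad_continuous[OF C1c_C1[OF \<phi>]]
      by (auto intro: borel_measurable_continuous_onI)
    have P: "P n = (\<integral>x. indicator \<Omega> x * (norm (\<phi> n x - U x))\<^sup>2 \<partial>lborel)" for n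
      unfolding P_def by (subst set_lebesgue_integral_eq_lborel[OF \<Omega>b, where H="\<lambda>x. (norm (\<phi> n x - U x))\<^sup>2"])
        (auto intro: eventually_mono[OF eq])
    have Q: "Q n = (\<integral>x. indicator \<Omega> x * (norm (grad (\<phi> n) x - V x))\<^sup>2 \<partial>lborel)" for n
      unfolding Q_def by (subst set_lebesgue_integral_eq_lborel[OF \<Omega>b, where H="\<lambda>x. (norm (grad (\<phi> n) x - V x))\<^sup>2"])
        (auto intro: eventually_mono[OF eq])
    have i: "integrable lborel (\<lambda>x. indicator \<Omega> x * (norm (\<phi> n x - U x))\<^sup>2)"
      "integrable lborel (\<lambda>x. indicator \<Omega> x * (norm (grad (\<phi> n) x - V x))\<^sup>2)" for n
      using integrable_real_mult_indicator[OF _ L2_norm_square_diff_integrable[OF C1c_L2(1)[OF \<phi>[of n]] L(1)], of \<Omega>]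
        integrable_real_mult_indicator[OF _ L2_norm_square_diff_integrable[OF C1c_L2(2)[OF \<phi>[of n]] L(2)], of \<Omega>] \<Omega>b
      by (simp_all add: mult.commute)
    have H: "H1_dist \<Omega> (\<phi> n) U V = P n + Q n" for n
      unfolding H1_dist_def P Q using Bochner_Integration.integral_add[OF i[of n]] by (simp add: distrib_left)
    have nn: "0 \<le> P n" "0 \<le> Q n" for n
      unfolding P Q by (auto intro!: Bochner_Integration.integral_nonneg)
    show ?thesis unfolding P_def[symmetric] Q_def[symmetric] H
    proof (intro iffI conjI)
      assume "P \<longlonglongrightarrow> 0 \<and> Q \<longlonglongrightarrow> 0"
      then show "(\<lambda>n. P n + Q n) \<longlonglongrightarrow> 0" using tendsto_add[of P 0 sequentially Q 0] by simp
    next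
      assume l: "(\<lambda>n. P n + Q n) \<longlonglongrightarrow> 0"
      show "P \<longlonglongrightarrow> 0" by (rule tendsto_sandwich[OF _ _ tendsto_const l]) (simp_all add: nn)
      show "Q \<longlonglongrightarrow> 0" by (rule tendsto_sandwich[OF _ _ tendsto_const l]) (simp_all add: nn)
    qed
  qed
  then show ?thesis unfolding is_trace_def by blast
qed

lemma weak_gradient_wgrad: "u \<in> H1 \<Omega> \<Longrightarrow> weak_gradient \<Omega> u (wgrad \<Omega> u)"
  unfolding H1_def wgrad_def by (blast intro: someI_ex[where P="weak_gradient \<Omega> u"])

lemma H1_representative:
  assumes "open \<Omega>" "u \<in> H1 \<Omega>"
  obtains U V where "wpair \<Omega> U V" "AE x in lborel. x \<in> \<Omega> \<longrightarrow> u x = U x \<and> wgrad \<Omega> u x = V x"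
  using weak_gradient_wpair[OF assms(1) _ weak_gradient_wgrad[OF assms(2)]] assms(2) unfolding H1_def by blast

text \<open>Existence justifies the choice. Whatever is said later about the chosen trace is derived
  from \<open>is_trace\<close>.\<close>

lemma is_trace_trace_on_boundary:
  assumes dom: "graph_domain \<Omega>" and u: "u \<in> H1 \<Omega>"
  shows "is_trace \<Omega> u (trace_on_boundary \<Omega> u)"
proof -
  have \<Omega>: "open \<Omega>" using dom by (simp add: graph_domain_def)
  obtain U V where w: "wpair \<Omega> U V" and eq: "AE x in lborel. x \<in> \<Omega> \<longrightarrow> u x = U x \<and> wgrad \<Omega> u x = V x"
    using H1_representative[OF \<Omega> u] by blast
  obtain \<phi> g where \<phi>: "\<And>n. \<phi> n \<in> C1c UNIV" "(\<lambda>n. H1_dist \<Omega> (\<phi> n) U V) \<longlonglongrightarrow> 0"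
    and g: "L2 (arclength (frontier \<Omega>)) g"
      "(\<lambda>n. \<integral>x. (norm (\<phi> n x - g x))\<^sup>2 \<partial>arclength (frontier \<Omega>)) \<longlonglongrightarrow> 0"
    using trace_sequence[OF dom w] by blast
  have "is_trace \<Omega> u g"
    unfolding is_trace_iff[OF \<Omega> w eq] by (intro conjI exI[of _ \<phi>] allI \<phi> g)
  then have "\<exists>g. is_trace \<Omega> u g" by blast
  then show ?thesis unfolding trace_on_boundary_def by (rule someI_ex)
qed

section \<open>The Hardy inequality\<close>

text \<open>The profiles contain a logarithm and make sense only from some positive radius on.
  Continued by the tangent line they yield fields on the whole plane, as the divergence theorem
  requires.\<close>

lemma C1_linear_extension:
  fixes h h' :: "real \<Rightarrow> real"
  assumes D: "\<And>t. a \<le> t \<Longrightarrow> (h has_real_derivative h' t) (at t)"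
  shows "((\<lambda>s. if a \<le> s then h s else h a + h' a * (s - a)) has_real_derivative h' (max a t)) (at t)"
proof -
  let ?E = "\<lambda>s. if a \<le> s then h s else h a + h' a * (s - a)"
  have L: "((\<lambda>s. h a + h' a * (s - a)) has_real_derivative h' a) (at t)" for t
    by (auto intro!: derivative_eq_intros)
  consider "a < t" | "t < a" | "t = a" by linarith
  then show ?thesis
  proof cases
    case 1
    have "(?E has_real_derivative h' t) (at t)"
      by (rule DERIV_cong_ev[OF refl _ refl, THEN iffD2, OF _ D])
        (use 1 eventually_nhds_in_open[of "{a<..}" t] in \<open>auto elim: eventually_mono\<close>)
    then show ?thesis using 1 by (simp add: max_def)
  next
    case 2
    have "(?E has_real_derivative h' a) (at t)"
      by (rule DERIV_cong_ev[OF refl _ refl, THEN iffD2, OF _ L])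
        (use 2 eventually_nhds_in_open[of "{..<a}" t] in \<open>auto elim: eventually_mono\<close>)
    then show ?thesis using 2 by (simp add: max_def)
  next
    case 3
    have r: "((\<lambda>y. (h y - h a) / (y - a)) \<longlongrightarrow> h' a) (at_right a)"
      using D[OF order_refl] unfolding has_field_derivative_iff by (rule filterlim_mono) (auto simp: at_le)
    have "((\<lambda>y. (?E y - ?E a) / (y - a)) \<longlongrightarrow> h' a) (at a)"
    proof (rule filterlim_split_at)
      have "\<forall>\<^sub>F y in at_left a. (?E y - ?E a) / (y - a) = h' a"
        using eventually_at_left_real[of "a - 1" a] by (auto elim!: eventually_mono)
      then show "((\<lambda>y. (?E y - ?E a) / (y - a)) \<longlongrightarrow> h' a) (at_left a)" by (rule tendsto_eventually)
      have "\<forall>\<^sub>F y in at_right a. (h y - h a) / (y - a) = (?E y - ?E a) / (y - a)"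
        using eventually_at_right_real[of a "a + 1"] by (auto elim!: eventually_mono)
      then show "((\<lambda>y. (?E y - ?E a) / (y - a)) \<longlongrightarrow> h' a) (at_right a)" by (rule Lim_transform_eventually[OF r])
    qed
    then show ?thesis unfolding 3 has_field_derivative_iff by simp
  qed
qed

text \<open>Radial functions are written in the variable \<open>x \<bullet> x\<close>, which unlike
  the norm is differentiable at the origin.\<close>

lemma C1_radial:
  assumes "\<And>t. (h has_real_derivative h' t) (at t)" "continuous_on UNIV h'"
  shows "C1 (\<lambda>x :: real^2. h (x \<bullet> x))" "partial i (\<lambda>x :: real^2. h (x \<bullet> x)) x = h' (x \<bullet> x) * (2 * x $ i)"
proof -
  have C: "C1 (\<lambda>x :: real^2. x \<bullet> x)" by (rule C1_inner(1)[OF C1_ident(1) C1_ident(1)])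
  have p: "partial i (\<lambda>x :: real^2. x \<bullet> x) x = 2 * x $ i"
    using C1_inner(2)[OF C1_ident(1) C1_ident(1), of i x] by (simp add: C1_ident inner_axis inner_axis')
  show "C1 (\<lambda>x :: real^2. h (x \<bullet> x))" by (rule C1_compose_real(1)[OF C assms])
  show "partial i (\<lambda>x :: real^2. h (x \<bullet> x)) x = h' (x \<bullet> x) * (2 * x $ i)"
    using C1_compose_real(2)[OF C assms, of i x] by (simp add: p)
qed

lemma divg_scaleR_ident:
  assumes "C1 m"
  shows "divg (\<lambda>x. m x *\<^sub>R x) x = 2 * m x + (partial 1 m x * x $ 1 + partial 2 m x * x $ 2)"
  using C1_scaleR(2)[OF assms C1_ident(1), of _ x] by (simp add: divg_def C1_ident axis_def)

lemma inner_2: "(x :: real^2) \<bullet> x = (x $ 1)\<^sup>2 + (x $ 2)\<^sup>2"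
  by (simp add: inner_vec_def sum_2 power2_eq_square)

text \<open>The function \<open>f = ln (\<bar>x\<bar> / \<rho>) + c\<close> in the variable
  \<open>s = \<bar>x\<bar>\<^sup>2\<close>.\<close>

definition log_profile :: "real \<Rightarrow> real \<Rightarrow> real \<Rightarrow> real" where
  "log_profile \<rho> c s = ln (s / \<rho>\<^sup>2) / 2 + c"

lemma log_profile:
  assumes "0 < \<rho>"
  shows "0 < s \<Longrightarrow> (log_profile \<rho> c has_real_derivative 1 / (2 * s)) (at s)"
    "\<rho>\<^sup>2 \<le> s \<Longrightarrow> c \<le> log_profile \<rho> c s"
    "(x :: real^2) \<noteq> 0 \<Longrightarrow> log_profile \<rho> c (x \<bullet> x) = ln (norm x / \<rho>) + c"
proof -
  show "(log_profile \<rho> c has_real_derivative 1 / (2 * s)) (at s)" if "0 < s"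
    unfolding log_profile_def using that assms by (auto intro!: derivative_eq_intros simp: field_simps)
  show "c \<le> log_profile \<rho> c s" if "\<rho>\<^sup>2 \<le> s"
    using that assms by (simp add: log_profile_def)
  show "log_profile \<rho> c (x \<bullet> x) = ln (norm x / \<rho>) + c" if "x \<noteq> 0"
    unfolding log_profile_def power2_norm_eq_inner[symmetric] power_divide[symmetric]
    using that assms by (simp add: ln_realpow)
qed

lemma Hardy_C1c:
  assumes dom: "graph_domain \<Omega>" and \<rho>: "0 < \<rho>" and c: "0 < c" and \<Omega>\<rho>: "\<And>x. x \<in> \<Omega> \<Longrightarrow> \<rho> \<le> norm x"
    and \<phi>: "\<phi> \<in> C1c UNIV"
  shows "1/4 * (\<integral>x. indicator \<Omega> x * ((norm (\<phi> x))\<^sup>2 / ((norm x)\<^sup>2 * (ln (norm x / \<rho>) + c)\<^sup>2)) \<partial>lborel)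
    \<le> (\<integral>x. indicator \<Omega> x * (norm (grad \<phi> x))\<^sup>2 \<partial>lborel)
      + 1 / (2 * \<rho> * c) * (\<integral>x. (norm (\<phi> x))\<^sup>2 \<partial>arclength (frontier \<Omega>))"
proof -
  have \<Omega>b: "\<Omega> \<in> sets borel" using dom by (auto simp: graph_domain_def)
  note C\<phi> = C1c_C1[OF \<phi>]
  define f where "f = log_profile \<rho> c"
  \<comment> \<open>The factor of the field:
    \<open>F x = h (x \<bullet> x) *\<^sub>R x\<close>.\<close>
  define h where "h s = 1 / (2 * s * f s)" for s
  define h' where "h' s = - (2 * f s + 1) / (4 * s\<^sup>2 * (f s)\<^sup>2)" for s
  have pos: "0 < s" "c \<le> f s" "0 < f s" if "\<rho>\<^sup>2 \<le> s" for s
  proof -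
    have "0 < \<rho>\<^sup>2" using \<rho> by simp
    with that show "0 < s" by linarith
    show "c \<le> f s" unfolding f_def by (rule log_profile(2)[OF \<rho> that])
    with c show "0 < f s" by linarith
  qed
  have hD: "(h has_real_derivative h' s) (at s)" if "\<rho>\<^sup>2 \<le> s" for s
  proof -
    have "(f has_real_derivative 1 / (2 * s)) (at s)"
      unfolding f_def by (rule log_profile(1)[OF \<rho> pos(1)[OF that]])
    then have "(h has_real_derivative - (2 * f s + 2 * s * (1 / (2 * s))) / (2 * s * f s)\<^sup>2) (at s)"
      unfolding h_def using pos[OF that]
      by (auto intro!: derivative_eq_intros simp: power2_eq_square)
    then show ?thesis using pos[OF that] by (simp add: h'_def power_mult_distrib)
  qed
  have fc: "continuous_on {\<rho>\<^sup>2..} f"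
    unfolding f_def by (rule DERIV_continuous_on) (use log_profile(1)[OF \<rho>] pos(1) in \<open>blast intro: DERIV_subset\<close>)
  have h'c: "continuous_on {\<rho>\<^sup>2..} h'"
    unfolding h'_def by (intro continuous_intros fc) (use pos in \<open>force\<close>)
  \<comment> \<open>Below \<open>\<rho>\<^sup>2\<close> any \<open>C1\<close> continuation serves,
    since domain and frontier lie in \<open>\<rho> \<le> norm x\<close>.\<close>
  define \<alpha> where "\<alpha> s = (if \<rho>\<^sup>2 \<le> s then h s else h (\<rho>\<^sup>2) + h' (\<rho>\<^sup>2) * (s - \<rho>\<^sup>2))" for s
  define \<alpha>' where "\<alpha>' s = h' (max (\<rho>\<^sup>2) s)" for s
  have \<alpha>D: "(\<alpha> has_real_derivative \<alpha>' s) (at s)" for s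
    unfolding \<alpha>_def \<alpha>'_def by (rule C1_linear_extension[OF hD])
  have \<alpha>'c: "continuous_on UNIV \<alpha>'"
    unfolding \<alpha>'_def by (rule continuous_on_compose2[OF h'c]) (auto intro!: continuous_intros)
  define A where "A x = \<alpha> (x \<bullet> x)" for x :: "real^2"
  define q where "q x = \<phi> x \<bullet> \<phi> x" for x
  have A: "C1 A" "\<And>i x. partial i A x = \<alpha>' (x \<bullet> x) * (2 * x $ i)"
    unfolding A_def using C1_radial[OF \<alpha>D \<alpha>'c] by auto
  have q: "C1 q" "\<And>i x. partial i q x = 2 * (\<phi> x \<bullet> partial i \<phi> x)"
    unfolding q_def using C1_inner[OF C\<phi> C\<phi>] by (auto simp: inner_commute)
  define m where "m x = A x * q x" for x
  have m: "C1 m" "\<And>i x. partial i m x = A x * partial i q x + partial i A x * q x"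
    unfolding m_def using C1_mult[OF A(1) q(1)] by auto
  define X where "X x = m x *\<^sub>R x" for x :: "real^2"
  have X: "X \<in> C1c UNIV"
  proof -
    obtain S where S: "compact S" "\<And>x. x \<notin> S \<Longrightarrow> \<phi> x = 0" using C1cE[OF \<phi>] by metis
    have "X x = 0" if "x \<notin> S" for x using S(2)[OF that] by (simp add: X_def m_def q_def)
    moreover have "C1 X" unfolding X_def by (rule C1_scaleR(1)[OF m(1) C1_ident(1)])
    ultimately show ?thesis unfolding C1c_iff using S(1) by blast
  qed
  have nX: "(\<lambda>x. - X x) \<in> C1c UNIV" by (rule C1c_bounded_linear[OF X bounded_linear_minus[OF bounded_linear_ident]])
  have dnX: "divg (\<lambda>x. - X x) x = - divg X x" for x
    using C1_bounded_linear(2)[OF bounded_linear_minus[OF bounded_linear_ident] C1c_C1[OF X]]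
    by (simp add: divg_def)
  define V where "V x = 1 / ((norm x)\<^sup>2 * (ln (norm x / \<rho>) + c)\<^sup>2)" for x :: "real^2"
  have out: "\<rho>\<^sup>2 \<le> x \<bullet> x" "x \<noteq> 0" if "\<rho> \<le> norm x" for x :: "real^2"
    using power_mono[OF that, of 2] \<rho> that by (auto simp: power2_norm_eq_inner)
  have V: "V x = 1 / ((x \<bullet> x) * (f (x \<bullet> x))\<^sup>2)" if "\<rho> \<le> norm x" for x
    unfolding V_def f_def log_profile(3)[OF \<rho> out(2)[OF that]] by (simp add: power2_norm_eq_inner)
  have pt: "V x / 4 * (norm (\<phi> x))\<^sup>2 + divg X x \<le> (norm (grad \<phi> x))\<^sup>2" if x: "\<rho> \<le> norm x" for x
  proof -
    define s where "s = x \<bullet> x"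
    have s: "\<rho>\<^sup>2 \<le> s" unfolding s_def by (rule out(1)[OF x])
    note ps = pos[OF s]
    have Ax: "A x = h s" using s by (simp add: A_def \<alpha>_def s_def)
    have A'x: "\<alpha>' (x \<bullet> x) = h' s" using s by (simp add: \<alpha>'_def s_def)
    have dX: "divg X x = 2 * (h s * q x) + (h s * (2 * (\<phi> x \<bullet> partial 1 \<phi> x)) * x $ 1
        + h s * (2 * (\<phi> x \<bullet> partial 2 \<phi> x)) * x $ 2) + 2 * s * h' s * q x"
      unfolding X_def divg_scaleR_ident[OF m(1)] m(2) A(2) q(2) A'x unfolding m_def Ax s_def inner_2
      by (simp add: algebra_simps power2_eq_square)
    have sq: "(norm (partial i \<phi> x - (h s * x $ i) *\<^sub>R \<phi> x))\<^sup>2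
        = (norm (partial i \<phi> x))\<^sup>2 - 2 * (h s * x $ i) * (\<phi> x \<bullet> partial i \<phi> x) + (h s)\<^sup>2 * (x $ i)\<^sup>2 * q x" for i
      unfolding power2_norm_eq_inner q_def
      by (simp add: inner_diff inner_commute[of "partial i \<phi> x" "\<phi> x"] power2_eq_square algebra_simps)
    have s2: "(h s)\<^sup>2 * s = (h s)\<^sup>2 * (x $ 1)\<^sup>2 + (h s)\<^sup>2 * (x $ 2)\<^sup>2"
      by (simp add: s_def inner_2 distrib_left)
    have "0 \<le> (norm (partial 1 \<phi> x - (h s * x $ 1) *\<^sub>R \<phi> x))\<^sup>2 + (norm (partial 2 \<phi> x - (h s * x $ 2) *\<^sub>R \<phi> x))\<^sup>2"
      by simp
    also have "\<dots> = (norm (grad \<phi> x))\<^sup>2 - divg X x + (2 * h s + 2 * s * h' s + (h s)\<^sup>2 * s) * q x"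
      unfolding sq norm_grad_square dX s2 by (simp add: algebra_simps)
    \<comment> \<open>This is \<open>div F + \<bar>F\<bar>\<^sup>2\<close> in the variable
      \<open>s\<close>: the first two terms are the divergence and the third is the square. The
      leading parts of the divergence cancel, leaving
      \<open>- 1 / (2 s f\<^sup>2) + 1 / (4 s f\<^sup>2)\<close>.\<close>
    also have "2 * h s + 2 * s * h' s + (h s)\<^sup>2 * s = - (V x / 4)"
      unfolding V[OF x] s_def[symmetric] h_def h'_def using ps
      by (simp add: divide_simps power2_eq_square)
    finally show ?thesis by (simp add: q_def power2_norm_eq_inner)
  qed
  have Vb: "0 \<le> V x" "V x \<le> 1 / (\<rho>\<^sup>2 * c\<^sup>2)" if "\<rho> \<le> norm x" for x
  proof -
    note ps = pos[OF out(1)[OF that]]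
    show "0 \<le> V x" by (simp add: V_def)
    have "\<rho>\<^sup>2 * c\<^sup>2 \<le> (x \<bullet> x) * (f (x \<bullet> x))\<^sup>2"
      using out(1)[OF that] ps c by (intro mult_mono power_mono) auto
    then show "V x \<le> 1 / (\<rho>\<^sup>2 * c\<^sup>2)" unfolding V[OF that] using \<rho> c by (intro frac_le) auto
  qed
  have [measurable]: "V \<in> borel_measurable borel" "\<Omega> \<in> sets borel" using \<Omega>b unfolding V_def by measurable
  have [measurable]: "\<phi> \<in> borel_measurable borel"
    by (intro borel_measurable_continuous_onI C1_continuous[OF C\<phi>])
  have L: "L2 lborel \<phi>" "L2 lborel (grad \<phi>)" using C1c_L2[OF \<phi>] by auto
  have iV: "integrable lborel (\<lambda>x. indicator \<Omega> x * (V x * (norm (\<phi> x))\<^sup>2))"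
  proof (rule Bochner_Integration.integrable_bound)
    show "integrable lborel (\<lambda>x. 1 / (\<rho>\<^sup>2 * c\<^sup>2) * (norm (\<phi> x))\<^sup>2)" using L(1) unfolding L2_def by simp
    show "AE x in lborel. norm (indicator \<Omega> x * (V x * (norm (\<phi> x))\<^sup>2)) \<le> norm (1 / (\<rho>\<^sup>2 * c\<^sup>2) * (norm (\<phi> x))\<^sup>2)"
    proof (rule always_eventually, rule allI)
      fix x
      show "norm (indicator \<Omega> x * (V x * (norm (\<phi> x))\<^sup>2)) \<le> norm (1 / (\<rho>\<^sup>2 * c\<^sup>2) * (norm (\<phi> x))\<^sup>2)"
      proof (cases "x \<in> \<Omega>")
        case True
        from mult_right_mono[OF Vb(2)[OF \<Omega>\<rho>[OF True]], of "(norm (\<phi> x))\<^sup>2"] Vb(1)[OF \<Omega>\<rho>[OF True]] True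
        show ?thesis by (simp add: abs_mult)
      qed simp
    qed
  qed measurable
  have ig: "integrable lborel (\<lambda>x. indicator \<Omega> x * (norm (grad \<phi> x))\<^sup>2)"
    using integrable_real_mult_indicator[of \<Omega> lborel, OF _ L(2)[unfolded L2_def, THEN conjunct2]] \<Omega>b
    by (simp add: mult.commute)
  note iX = divg_integrable[OF X \<Omega>b]
  have 1: "1/4 * (\<integral>x. indicator \<Omega> x * (V x * (norm (\<phi> x))\<^sup>2) \<partial>lborel) + (\<integral>x. indicator \<Omega> x * divg X x \<partial>lborel)
      \<le> (\<integral>x. indicator \<Omega> x * (norm (grad \<phi> x))\<^sup>2 \<partial>lborel)"
  proof -
    have "(\<integral>x. 1/4 * (indicator \<Omega> x * (V x * (norm (\<phi> x))\<^sup>2)) + indicator \<Omega> x * divg X x \<partial>lborel)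
      \<le> (\<integral>x. indicator \<Omega> x * (norm (grad \<phi> x))\<^sup>2 \<partial>lborel)"
    proof (rule integral_mono)
      show "1/4 * (indicator \<Omega> x * (V x * (norm (\<phi> x))\<^sup>2)) + indicator \<Omega> x * divg X x
          \<le> indicator \<Omega> x * (norm (grad \<phi> x))\<^sup>2" for x
        using pt[OF \<Omega>\<rho>, of x] by (cases "x \<in> \<Omega>") auto
    qed (intro ig Bochner_Integration.integrable_add integrable_mult_right iV iX)+
    then show ?thesis using iV iX by simp
  qed
  obtain C where fin: "emeasure hausdorff1 (frontier \<Omega>) < \<infinity>" and fm: "finite_measure (arclength (frontier \<Omega>))"
    using trace_inequality[OF dom] by blast
  have F: "\<rho> \<le> norm x" if "x \<in> frontier \<Omega>" for x
  proof -
    have "closed {x :: real^2. \<rho> \<le> norm x}" by (intro closed_Collect_le continuous_intros)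
    then have "closure \<Omega> \<subseteq> {x. \<rho> \<le> norm x}" using \<Omega>\<rho> by (intro closure_minimal) auto
    then show ?thesis using that by (auto simp: frontier_def)
  qed
  \<comment> \<open>The length of the field is
    \<open>\<bar>\<phi>\<bar>\<^sup>2 / (2 \<bar>x\<bar> f)\<close>, and both
    \<open>\<bar>x\<bar> \<ge> \<rho>\<close> and \<open>f \<ge> c\<close> hold on the
    frontier.\<close>
  have bd: "norm (- X x) \<le> 1 / (2 * \<rho> * c) * (norm (\<phi> x))\<^sup>2" if "\<rho> \<le> norm x" for x
  proof -
    note ps = pos[OF out(1)[OF that]]
    have n: "norm x * norm x = x \<bullet> x" by (simp add: power2_norm_eq_inner[symmetric] power2_eq_square)
    have nx: "0 < norm x" using that \<rho> by linarith
    have "A x * norm x = 1 / (2 * norm x * f (x \<bullet> x))"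
      unfolding A_def \<alpha>_def h_def using out(1)[OF that] nx by (simp add: n[symmetric])
    also have "\<dots> \<le> 1 / (2 * \<rho> * c)"
      using that \<rho> c ps by (intro frac_le mult_mono) auto
    finally have "A x * norm x * q x \<le> 1 / (2 * \<rho> * c) * q x" by (intro mult_right_mono) (auto simp: q_def)
    moreover have "0 \<le> A x" using out(1)[OF that] ps by (simp add: A_def \<alpha>_def h_def)
    ultimately show ?thesis
      by (simp add: X_def m_def q_def abs_mult power2_norm_eq_inner mult.commute mult.left_commute)
  qed
  \<comment> \<open>The divergence enters the pointwise estimate on the smaller side and is needed
    from below; the one-sided divergence theorem is therefore applied to \<open>- X\<close>.\<close>
  have "- (\<integral>x. indicator \<Omega> x * divg X x \<partial>lborel) = (\<integral>x. indicator \<Omega> x * divg (\<lambda>x. - X x) x \<partial>lborel)"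
    by (simp add: dnX)
  also have "\<dots> \<le> (\<integral>x. indicator (frontier \<Omega>) x * norm (- X x) \<partial>hausdorff1)"
    by (rule graph_domain_divergence[OF dom nX])
  also have "\<dots> = (\<integral>x. norm (- X x) \<partial>arclength (frontier \<Omega>))"
    unfolding arclength_def by (subst integral_restrict_space) simp_all
  also have "\<dots> \<le> (\<integral>x. 1 / (2 * \<rho> * c) * (norm (\<phi> x))\<^sup>2 \<partial>arclength (frontier \<Omega>))"
  proof (rule integral_mono)
    interpret finite_measure "arclength (frontier \<Omega>)" by (rule fm)
    obtain B where B: "0 < B" "\<And>x. norm (- X x) \<le> B" using C1c_norm_bounded[OF nX] by blast
    show "integrable (arclength (frontier \<Omega>)) (\<lambda>x. norm (- X x))"
    proof (rule integrable_const_bound[where B=B])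
      show "(\<lambda>x. norm (- X x)) \<in> borel_measurable (arclength (frontier \<Omega>))"
        by (intro borel_measurable_arclength borel_measurable_continuous_onI continuous_intros C1_continuous[OF C1c_C1[OF X]])
    qed (use B in auto)
    show "integrable (arclength (frontier \<Omega>)) (\<lambda>x. 1 / (2 * \<rho> * c) * (norm (\<phi> x))\<^sup>2)"
      using C1c_L2_arclength[OF fm \<phi>] unfolding L2_def by simp
    show "norm (- X x) \<le> 1 / (2 * \<rho> * c) * (norm (\<phi> x))\<^sup>2" if "x \<in> space (arclength (frontier \<Omega>))" for x
      using that bd[OF F, of x] by (simp add: arclength_def space_restrict_space)
  qed
  finally have "- (\<integral>x. indicator \<Omega> x * divg X x \<partial>lborel) \<le> 1 / (2 * \<rho> * c) * (\<integral>x. (norm (\<phi> x))\<^sup>2 \<partial>arclength (frontier \<Omega>))"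
    by simp
  with 1 show ?thesis unfolding V_def by (simp only: times_divide_eq_left mult_1)
qed

lemma H1_dist_tendsto_L2:
  assumes \<Omega>: "\<Omega> \<in> sets borel" and w: "wpair \<Omega> U V" and \<phi>: "\<And>n. \<phi> n \<in> C1c UNIV"
    and lim: "(\<lambda>n. H1_dist \<Omega> (\<phi> n) U V) \<longlonglongrightarrow> 0"
  shows "(\<lambda>n. \<integral>x. (norm (indicator \<Omega> x *\<^sub>R \<phi> n x - U x))\<^sup>2 \<partial>lborel) \<longlonglongrightarrow> 0"
    "(\<lambda>n. \<integral>x. (norm (indicator \<Omega> x *\<^sub>R grad (\<phi> n) x - V x))\<^sup>2 \<partial>lborel) \<longlonglongrightarrow> 0"
    "L2 lborel (\<lambda>x. indicator \<Omega> x *\<^sub>R \<phi> n x)" "L2 lborel (\<lambda>x. indicator \<Omega> x *\<^sub>R grad (\<phi> n) x)"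
proof -
  have z: "U x = 0" "V x = 0" if "x \<notin> \<Omega>" for x using w that by (auto simp: wpair_def)
  have L: "L2 lborel U" "L2 lborel V" using w by (auto simp: wpair_def)
  have m: "indicator \<Omega> \<in> borel_measurable lborel" "\<bar>indicator \<Omega> x :: real\<bar> \<le> 1" for x
    using \<Omega> by (auto simp: indicator_def)
  show 1: "L2 lborel (\<lambda>x. indicator \<Omega> x *\<^sub>R \<phi> n x)" for n
    by (rule L2_scaleR_bounded[OF C1c_L2(1)[OF \<phi>] m])
  show 2: "L2 lborel (\<lambda>x. indicator \<Omega> x *\<^sub>R grad (\<phi> n) x)" for n
    by (rule L2_scaleR_bounded[OF C1c_L2(2)[OF \<phi>] m])
  have "(\<integral>x. (norm (indicator \<Omega> x *\<^sub>R \<phi> n x - U x))\<^sup>2 \<partial>lborel) \<le> H1_dist \<Omega> (\<phi> n) U V" for n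
    unfolding H1_dist_def
    by (rule integral_mono[OF L2_norm_square_diff_integrable[OF 1 L(1)] H1_dist_integrable[OF \<Omega> \<phi> L]])
      (use z in \<open>auto simp: indicator_def\<close>)
  then show "(\<lambda>n. \<integral>x. (norm (indicator \<Omega> x *\<^sub>R \<phi> n x - U x))\<^sup>2 \<partial>lborel) \<longlonglongrightarrow> 0"
    by (intro tendsto_sandwich[OF _ _ tendsto_const lim]) simp_all
  have "(\<integral>x. (norm (indicator \<Omega> x *\<^sub>R grad (\<phi> n) x - V x))\<^sup>2 \<partial>lborel) \<le> H1_dist \<Omega> (\<phi> n) U V" for n
    unfolding H1_dist_def
    by (rule integral_mono[OF L2_norm_square_diff_integrable[OF 2 L(2)] H1_dist_integrable[OF \<Omega> \<phi> L]])
      (use z in \<open>auto simp: indicator_def\<close>)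
  then show "(\<lambda>n. \<integral>x. (norm (indicator \<Omega> x *\<^sub>R grad (\<phi> n) x - V x))\<^sup>2 \<partial>lborel) \<longlonglongrightarrow> 0"
    by (intro tendsto_sandwich[OF _ _ tendsto_const lim]) simp_all
qed

text \<open>The theorem integrates over the closed set \<open>M\<close>, the analysis over its
  interior; the two differ by a null set.\<close>

lemma set_lebesgue_integral_extend:
  fixes h H :: "'a::euclidean_space \<Rightarrow> real"
  assumes M: "M \<in> sets borel" "\<Omega> \<subseteq> M" "M - \<Omega> \<in> null_sets lborel" and H: "H \<in> borel_measurable lborel" "\<And>x. x \<notin> \<Omega> \<Longrightarrow> H x = 0"
    and eq: "AE x in lborel. x \<in> \<Omega> \<longrightarrow> h x = H x"
  shows "(LINT x:M|lebesgue. h x) = (\<integral>x. H x \<partial>lborel)"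
proof -
  have "AE x in lborel. x \<in> M \<longrightarrow> h x = H x" using eq AE_not_in[OF M(3)] by eventually_elim auto
  then have "(LINT x:M|lebesgue. h x) = (\<integral>x. indicator M x *\<^sub>R H x \<partial>lborel)"
    by (rule set_lebesgue_integral_eq_lborel[OF M(1) H(1)])
  also have "\<dots> = (\<integral>x. H x \<partial>lborel)"
    by (rule Bochner_Integration.integral_cong) (use M(2) H(2) in \<open>auto simp: indicator_def\<close>)
  finally show ?thesis .
qed

text \<open>Both weights are bounded: the Hardy weight on \<open>\<Omega>\<close> by
  \<open>1 / (\<rho>\<^sup>2 c\<^sup>2)\<close>, because \<open>\<bar>x\<bar> \<ge> \<rho>\<close>
  makes the logarithm nonnegative, and \<open>\<sigma>\<close> by assumption. So all three integrals
  pass to the limit along a sequence that defines the trace.\<close>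

theorem Hardy_H1:
  assumes dom: "graph_domain \<Omega>" and \<rho>: "0 < \<rho>" and c: "0 < c" and \<Omega>\<rho>: "\<And>x. x \<in> \<Omega> \<Longrightarrow> \<rho> \<le> norm x"
    and M: "M \<in> sets borel" "\<Omega> \<subseteq> M" "M - \<Omega> \<in> null_sets lborel"
    and \<sigma>: "Linfty (arclength (frontier \<Omega>)) \<sigma>" "AE x in arclength (frontier \<Omega>). 1 / (2 * \<rho> * c) \<le> \<sigma> x"
    and u: "u \<in> H1 \<Omega>"
  shows "1/4 * (LINT x:M|lebesgue. (norm (u x))\<^sup>2 / ((norm x)\<^sup>2 * (ln (norm x / \<rho>) + c)\<^sup>2))
    \<le> (LINT x:M|lebesgue. (norm (wgrad \<Omega> u x))\<^sup>2)
      + (LINT x|arclength (frontier \<Omega>). \<sigma> x * (norm (trace_on_boundary \<Omega> u x))\<^sup>2)"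
proof -
  have \<Omega>: "open \<Omega>" and \<Omega>b: "\<Omega> \<in> sets borel" using dom by (auto simp: graph_domain_def)
  define g where "g = trace_on_boundary \<Omega> u"
  obtain U V where w: "wpair \<Omega> U V" and eq: "AE x in lborel. x \<in> \<Omega> \<longrightarrow> u x = U x \<and> wgrad \<Omega> u x = V x"
    using H1_representative[OF \<Omega> u] by blast
  have z: "U x = 0" "V x = 0" if "x \<notin> \<Omega>" for x using w that by (auto simp: wpair_def)
  have L: "L2 lborel U" "L2 lborel V" using w by (auto simp: wpair_def)
  then have [measurable]: "U \<in> borel_measurable borel" "V \<in> borel_measurable borel" by (auto simp: L2_def)
  obtain \<phi> where \<phi>: "\<And>n. \<phi> n \<in> C1c UNIV" and lim: "(\<lambda>n. H1_dist \<Omega> (\<phi> n) U V) \<longlonglongrightarrow> 0"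
    and g: "L2 (arclength (frontier \<Omega>)) g"
      "(\<lambda>n. \<integral>x. (norm (\<phi> n x - g x))\<^sup>2 \<partial>arclength (frontier \<Omega>)) \<longlonglongrightarrow> 0"
    using is_trace_trace_on_boundary[OF dom u] unfolding is_trace_iff[OF \<Omega> w eq] g_def[symmetric] by blast
  note T = H1_dist_tendsto_L2[OF \<Omega>b w \<phi> lim]
  obtain C where fm: "finite_measure (arclength (frontier \<Omega>))" using trace_inequality[OF dom] by blast
  obtain B where \<sigma>m: "\<sigma> \<in> borel_measurable (arclength (frontier \<Omega>))" and B: "AE x in arclength (frontier \<Omega>). \<bar>\<sigma> x\<bar> \<le> B"
    using \<sigma>(1) unfolding Linfty_def by blast
  define W where "W x = 1 / ((norm x)\<^sup>2 * (ln (norm x / \<rho>) + c)\<^sup>2)" for x :: "real^2"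
  define W' where "W' x = indicator \<Omega> x * W x" for x
  have [measurable]: "\<Omega> \<in> sets borel" by (rule \<Omega>b)
  have [measurable]: "W \<in> borel_measurable borel" unfolding W_def by measurable
  have W'm: "W' \<in> borel_measurable lborel" unfolding W'_def by measurable
  have "\<bar>W' x\<bar> \<le> 1 / (\<rho>\<^sup>2 * c\<^sup>2)" for x
  proof (cases "x \<in> \<Omega>")
    case True
    note n = \<Omega>\<rho>[OF True]
    have "0 \<le> ln (norm x / \<rho>)" using n \<rho> by simp
    then have "\<rho>\<^sup>2 * c\<^sup>2 \<le> (norm x)\<^sup>2 * (ln (norm x / \<rho>) + c)\<^sup>2"
      using n \<rho> c by (intro mult_mono power_mono) auto
    then have "W x \<le> 1 / (\<rho>\<^sup>2 * c\<^sup>2)" unfolding W_def using \<rho> c by (intro frac_le) auto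
    moreover have "0 \<le> W x" by (simp add: W_def)
    ultimately show ?thesis using True by (simp add: W'_def)
  qed (simp add: W'_def)
  then have W'b: "AE x in lborel. \<bar>W' x\<bar> \<le> 1 / (\<rho>\<^sup>2 * c\<^sup>2)" by simp
  have 1: "(\<lambda>n. \<integral>x. W' x * (norm (indicator \<Omega> x *\<^sub>R \<phi> n x))\<^sup>2 \<partial>lborel) \<longlonglongrightarrow> (\<integral>x. W' x * (norm (U x))\<^sup>2 \<partial>lborel)"
    by (rule tendsto_weighted_L2(1)[OF T(3) L(1) T(1) W'm W'b])
  have "(\<lambda>n. \<integral>x. 1 * (norm (indicator \<Omega> x *\<^sub>R grad (\<phi> n) x))\<^sup>2 \<partial>lborel) \<longlonglongrightarrow> (\<integral>x. 1 * (norm (V x))\<^sup>2 \<partial>lborel)"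
    by (rule tendsto_weighted_L2(1)[OF T(4) L(2) T(2), where B=1]) simp_all
  then have 2: "(\<lambda>n. \<integral>x. (norm (indicator \<Omega> x *\<^sub>R grad (\<phi> n) x))\<^sup>2 \<partial>lborel) \<longlonglongrightarrow> (\<integral>x. (norm (V x))\<^sup>2 \<partial>lborel)" by simp
  note A = C1c_L2_arclength[OF fm \<phi>]
  have 3: "(\<lambda>n. \<integral>x. \<sigma> x * (norm (\<phi> n x))\<^sup>2 \<partial>arclength (frontier \<Omega>)) \<longlonglongrightarrow> (\<integral>x. \<sigma> x * (norm (g x))\<^sup>2 \<partial>arclength (frontier \<Omega>))"
    by (rule tendsto_weighted_L2(1)[OF A g(1,2) \<sigma>m B])
  have "1/4 * (\<integral>x. W' x * (norm (indicator \<Omega> x *\<^sub>R \<phi> n x))\<^sup>2 \<partial>lborel)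
      \<le> (\<integral>x. (norm (indicator \<Omega> x *\<^sub>R grad (\<phi> n) x))\<^sup>2 \<partial>lborel) + (\<integral>x. \<sigma> x * (norm (\<phi> n x))\<^sup>2 \<partial>arclength (frontier \<Omega>))" for n
  proof -
    have "(\<integral>x. W' x * (norm (indicator \<Omega> x *\<^sub>R \<phi> n x))\<^sup>2 \<partial>lborel)
        = (\<integral>x. indicator \<Omega> x * ((norm (\<phi> n x))\<^sup>2 / ((norm x)\<^sup>2 * (ln (norm x / \<rho>) + c)\<^sup>2)) \<partial>lborel)"
      by (rule Bochner_Integration.integral_cong) (auto simp: W'_def W_def indicator_def)
    moreover have "(\<integral>x. (norm (indicator \<Omega> x *\<^sub>R grad (\<phi> n) x))\<^sup>2 \<partial>lborel) = (\<integral>x. indicator \<Omega> x * (norm (grad (\<phi> n) x))\<^sup>2 \<partial>lborel)"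
      by (rule Bochner_Integration.integral_cong) (auto simp: indicator_def)
    moreover have "1 / (2 * \<rho> * c) * (\<integral>x. (norm (\<phi> n x))\<^sup>2 \<partial>arclength (frontier \<Omega>))
        = (\<integral>x. 1 / (2 * \<rho> * c) * (norm (\<phi> n x))\<^sup>2 \<partial>arclength (frontier \<Omega>))" by simp
    moreover have "\<dots> \<le> (\<integral>x. \<sigma> x * (norm (\<phi> n x))\<^sup>2 \<partial>arclength (frontier \<Omega>))"
    proof (rule integral_mono_AE)
      show "integrable (arclength (frontier \<Omega>)) (\<lambda>x. 1 / (2 * \<rho> * c) * (norm (\<phi> n x))\<^sup>2)"
        using A[of n] unfolding L2_def by simp
      show "integrable (arclength (frontier \<Omega>)) (\<lambda>x. \<sigma> x * (norm (\<phi> n x))\<^sup>2)"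
        by (rule tendsto_weighted_L2(2)[OF A g(1,2) \<sigma>m B A])
      show "AE x in arclength (frontier \<Omega>). 1 / (2 * \<rho> * c) * (norm (\<phi> n x))\<^sup>2 \<le> \<sigma> x * (norm (\<phi> n x))\<^sup>2"
        using \<sigma>(2) by eventually_elim (rule mult_right_mono, auto)
    qed
    ultimately show ?thesis using Hardy_C1c[OF dom \<rho> c \<Omega>\<rho> \<phi>, of n] by linarith
  qed
  then have "1/4 * (\<integral>x. W' x * (norm (U x))\<^sup>2 \<partial>lborel)
      \<le> (\<integral>x. (norm (V x))\<^sup>2 \<partial>lborel) + (\<integral>x. \<sigma> x * (norm (g x))\<^sup>2 \<partial>arclength (frontier \<Omega>))"
    by (intro LIMSEQ_le[OF tendsto_mult_left[OF 1] tendsto_add[OF 2 3]]) blast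
  moreover have "(LINT x:M|lebesgue. (norm (u x))\<^sup>2 / ((norm x)\<^sup>2 * (ln (norm x / \<rho>) + c)\<^sup>2)) = (\<integral>x. W' x * (norm (U x))\<^sup>2 \<partial>lborel)"
    by (rule set_lebesgue_integral_extend[OF M])
      (use W'm z in \<open>auto simp: W'_def W_def intro: eventually_mono[OF eq]\<close>)
  moreover have "(LINT x:M|lebesgue. (norm (wgrad \<Omega> u x))\<^sup>2) = (\<integral>x. (norm (V x))\<^sup>2 \<partial>lborel)"
    by (rule set_lebesgue_integral_extend[OF M]) (use z in \<open>auto intro: eventually_mono[OF eq]\<close>)
  ultimately show ?thesis unfolding g_def by simp
qed

section \<open>Sharpness of the constant\<close>

lemma L2_lebesgue_on:
  fixes f :: "'a::euclidean_space \<Rightarrow> 'b::euclidean_space"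
  assumes "L2 lborel f" "\<Omega> \<in> sets borel" shows "L2 (lebesgue_on \<Omega>) f"
proof -
  have m: "f \<in> borel_measurable lborel" and i: "integrable lborel (\<lambda>x. (norm (f x))\<^sup>2)"
    using assms(1) by (auto simp: L2_def)
  have [measurable]: "f \<in> borel_measurable borel" "\<Omega> \<in> sets borel" using m assms(2) by auto
  have "integrable lborel (\<lambda>x. (norm (f x))\<^sup>2 * indicator \<Omega> x)"
    using assms(2) by (intro integrable_real_mult_indicator i) auto
  then have j: "integrable lborel (\<lambda>x. indicator \<Omega> x *\<^sub>R (norm (f x))\<^sup>2)" by (simp add: mult.commute)
  have "(\<lambda>x. indicator \<Omega> x *\<^sub>R (norm (f x))\<^sup>2) \<in> borel_measurable lborel" by measurable
  from integrable_completion[OF this] j have "integrable lebesgue (\<lambda>x. indicator \<Omega> x *\<^sub>R (norm (f x))\<^sup>2)" by simp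
  moreover have "\<Omega> \<inter> space lebesgue \<in> sets lebesgue" using assms(2) by simp
  ultimately have "integrable (lebesgue_on \<Omega>) (\<lambda>x. (norm (f x))\<^sup>2)"
    by (simp add: integrable_restrict_space)
  then show ?thesis
    using measurable_restrict_space1[OF borel_measurable_lebesgue[OF m]] by (simp add: L2_def)
qed

text \<open>Integration by parts: the partial derivatives of \<open>\<phi> u\<close> have integral
  0.\<close>

lemma weak_gradient_grad:
  assumes \<Omega>: "\<Omega> \<in> sets borel" and u: "u \<in> C1c \<Omega>"
  shows "weak_gradient \<Omega> u (grad u)"
proof -
  note Cu = C1c_C1[OF u]
  have u0: "u x = 0" "partial i u x = 0" if "x \<notin> \<Omega>" for x i using C1cE[OF u] that by (metis subsetD)+
  have [measurable]: "u \<in> borel_measurable borel" "partial i u \<in> borel_measurable borel" for i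
    using C1_continuous[OF Cu] C1_partial_continuous[OF Cu] by (auto intro: borel_measurable_continuous_onI)
  have "(LINT x:\<Omega>|lebesgue. partial i \<phi> x *\<^sub>R u x) = - (LINT x:\<Omega>|lebesgue. \<phi> x *\<^sub>R (grad u x $ i))" if \<phi>: "\<phi> \<in> C1c \<Omega>" for i \<phi>
  proof -
    note C\<phi> = C1c_C1[OF \<phi>]
    have [measurable]: "\<phi> \<in> borel_measurable borel" "partial i \<phi> \<in> borel_measurable borel"
      using C1_continuous[OF C\<phi>] C1_partial_continuous[OF C\<phi>] by (auto intro: borel_measurable_continuous_onI)
    obtain S where S: "compact S" "\<And>x. x \<notin> S \<Longrightarrow> u x = 0" "\<And>i x. x \<notin> S \<Longrightarrow> partial i u x = 0" using C1cE[OF u] by metis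
    have 1: "(LINT x:\<Omega>|lebesgue. partial i \<phi> x *\<^sub>R u x) = (\<integral>x. partial i \<phi> x *\<^sub>R u x \<partial>lborel)"
    proof -
      have "(LINT x:\<Omega>|lebesgue. partial i \<phi> x *\<^sub>R u x) = (\<integral>x. indicator \<Omega> x *\<^sub>R (partial i \<phi> x *\<^sub>R u x) \<partial>lborel)"
        by (rule set_lebesgue_integral_eq_lborel[OF \<Omega>]) auto
      also have "\<dots> = (\<integral>x. partial i \<phi> x *\<^sub>R u x \<partial>lborel)"
        by (rule Bochner_Integration.integral_cong) (use u0 in \<open>auto simp: indicator_def\<close>)
      finally show ?thesis .
    qed
    have 2: "(LINT x:\<Omega>|lebesgue. \<phi> x *\<^sub>R (grad u x $ i)) = (\<integral>x. \<phi> x *\<^sub>R partial i u x \<partial>lborel)"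
    proof -
      have "(LINT x:\<Omega>|lebesgue. \<phi> x *\<^sub>R (grad u x $ i)) = (\<integral>x. indicator \<Omega> x *\<^sub>R (\<phi> x *\<^sub>R partial i u x) \<partial>lborel)"
        by (rule set_lebesgue_integral_eq_lborel[OF \<Omega>]) auto
      also have "\<dots> = (\<integral>x. \<phi> x *\<^sub>R partial i u x \<partial>lborel)"
        by (rule Bochner_Integration.integral_cong) (use u0 in \<open>auto simp: indicator_def\<close>)
      finally show ?thesis .
    qed
    have i: "integrable lborel (\<lambda>x. partial i \<phi> x *\<^sub>R u x)" "integrable lborel (\<lambda>x. \<phi> x *\<^sub>R partial i u x)"
      using S by (intro integrable_continuous_compact_support[of _ S] continuous_intros C1_partial_continuous[OF C\<phi>]
        C1_continuous[OF C\<phi>] C1_partial_continuous[OF Cu] C1_continuous[OF Cu] compact_imp_bounded; simp)+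
    have "(\<lambda>x. \<phi> x *\<^sub>R u x) \<in> C1c UNIV"
      by (rule C1c_scaleR_left[OF C1c_mono[OF u] C\<phi>]) auto
    from integral_partial_zero[OF this, of i]
    have "(\<integral>x. \<phi> x *\<^sub>R partial i u x + partial i \<phi> x *\<^sub>R u x \<partial>lborel) = 0"
      by (simp add: C1_scaleR(2)[OF C\<phi> Cu])
    then show ?thesis unfolding 1 2 using i by (simp add: add_eq_0_iff)
  qed
  then show ?thesis
    unfolding weak_gradient_def using L2_lebesgue_on[OF C1c_L2(2)[OF u] \<Omega>] by blast
qed

text \<open>Makes the two chosen objects computable for test functions: the weak gradient is the
  classical gradient almost everywhere, and the trace vanishes almost everywhere on the
  frontier.\<close>

theorem C1c_H1:
  assumes dom: "graph_domain \<Omega>" and ne: "\<Omega> \<noteq> UNIV"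
    and M: "M \<in> sets borel" "\<Omega> \<subseteq> M" "M - \<Omega> \<in> null_sets lborel"
    and u: "u \<in> C1c \<Omega>"
  shows "u \<in> H1 \<Omega>" "(LINT x:M|lebesgue. (norm (wgrad \<Omega> u x))\<^sup>2) = (\<integral>x. (norm (grad u x))\<^sup>2 \<partial>lborel)"
    "(LINT x|arclength (frontier \<Omega>). \<sigma> x * (norm (trace_on_boundary \<Omega> u x))\<^sup>2) = 0"
proof -
  have \<Omega>: "open \<Omega>" and \<Omega>b: "\<Omega> \<in> sets borel" using dom by (auto simp: graph_domain_def)
  have uU: "u \<in> C1c UNIV" by (rule C1c_mono[OF u]) simp
  note Cu = C1c_C1[OF u]
  have u0: "u x = 0" "partial i u x = 0" if "x \<notin> \<Omega>" for x i using C1cE[OF u] that by (metis subsetD)+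
  have g0: "grad u x = 0" if "x \<notin> \<Omega>" for x using u0(2)[OF that] by (simp add: vec_eq_iff)
  show H: "u \<in> H1 \<Omega>"
    using weak_gradient_grad[OF \<Omega>b u] L2_lebesgue_on[OF C1c_L2(1)[OF u] \<Omega>b] by (auto simp: H1_def)
  obtain U V where w: "wpair \<Omega> U V" and eq: "AE x in lborel. x \<in> \<Omega> \<longrightarrow> u x = U x \<and> wgrad \<Omega> u x = V x"
    using H1_representative[OF \<Omega> H] by blast
  obtain U' V' where w': "wpair \<Omega> U' V'" and eq': "AE x in lborel. x \<in> \<Omega> \<longrightarrow> u x = U' x \<and> grad u x = V' x"
    using weak_gradient_wpair[OF \<Omega> L2_lebesgue_on[OF C1c_L2(1)[OF u] \<Omega>b] weak_gradient_grad[OF \<Omega>b u]] by blast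
  have z: "U x = 0" "V x = 0" "U' x = 0" "V' x = 0" if "x \<notin> \<Omega>" for x using w w' that by (auto simp: wpair_def)
  have L: "L2 lborel U" "L2 lborel V" "L2 lborel U'" "L2 lborel V'" using w w' by (auto simp: wpair_def)
  have eqU: "AE x in lborel. u x = U x" using eq by eventually_elim (use z u0 in metis)
  have eqU': "AE x in lborel. U x = U' x" using eqU eq' by eventually_elim (use z u0 in metis)
  have eqV': "AE x in lborel. grad u x = V' x" using eq' by eventually_elim (use z g0 in metis)
  \<comment> \<open>\<open>V\<close> represents the chosen weak gradient and \<open>V'\<close> the
    classical one. Both belong to the same function, so their difference integrates to 0 against
    every test function.\<close>
  have "AE x in lborel. x \<in> \<Omega> \<longrightarrow> V x $ i - V' x $ i = 0" for i
  proof (rule weakly_zero[OF \<Omega> ne L2_diff[OF L2_vec_nth[OF L(2)] L2_vec_nth[OF L(4)]]])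
    fix \<phi> :: "real^2 \<Rightarrow> real" assume \<phi>: "\<phi> \<in> C1c \<Omega>"
    note C\<phi> = C1c_C1[OF \<phi>]
    obtain S where S: "compact S" "\<And>x. x \<notin> S \<Longrightarrow> \<phi> x = 0" using C1cE[OF \<phi>] by metis
    have i: "integrable lborel (\<lambda>x. \<phi> x *\<^sub>R (V x $ i))" "integrable lborel (\<lambda>x. \<phi> x *\<^sub>R (V' x $ i))"
      using L2_integrable_mult_compact_support[OF L2_vec_nth[OF L(2), of i] C1_continuous[OF C\<phi>] S]
        L2_integrable_mult_compact_support[OF L2_vec_nth[OF L(4), of i] C1_continuous[OF C\<phi>] S] by auto
    have "U \<in> borel_measurable borel" "U' \<in> borel_measurable borel" "partial i \<phi> \<in> borel_measurable borel"
      using L C1_partial_continuous[OF C\<phi>] by (auto simp: L2_def intro: borel_measurable_continuous_onI)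
    then have "(\<integral>x. partial i \<phi> x *\<^sub>R U x \<partial>lborel) = (\<integral>x. partial i \<phi> x *\<^sub>R U' x \<partial>lborel)"
      by (intro integral_cong_AE) (auto intro: eventually_mono[OF eqU'])
    moreover have "(\<integral>x. partial i \<phi> x *\<^sub>R U x \<partial>lborel) = - (\<integral>x. \<phi> x *\<^sub>R (V x $ i) \<partial>lborel)"
      "(\<integral>x. partial i \<phi> x *\<^sub>R U' x \<partial>lborel) = - (\<integral>x. \<phi> x *\<^sub>R (V' x $ i) \<partial>lborel)"
      using w w' \<phi> unfolding wpair_def by blast+
    ultimately show "(\<integral>x. \<phi> x *\<^sub>R (V x $ i - V' x $ i) \<partial>lborel) = 0"
      using i by (simp add: scaleR_diff_right)
  qed
  from this[of 1] this[of 2] eqV' have eqV: "AE x in lborel. grad u x = V x"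
    by eventually_elim (use z g0 in \<open>auto simp: vec_eq_iff forall_2\<close>)
  have gm: "grad u \<in> borel_measurable borel" by (intro borel_measurable_continuous_onI C1_grad_continuous[OF Cu])
  have "AE x in lborel. x \<in> \<Omega> \<longrightarrow> (norm (wgrad \<Omega> u x))\<^sup>2 = (norm (grad u x))\<^sup>2"
    using eq eqV by eventually_elim auto
  then show "(LINT x:M|lebesgue. (norm (wgrad \<Omega> u x))\<^sup>2) = (\<integral>x. (norm (grad u x))\<^sup>2 \<partial>lborel)"
    by (intro set_lebesgue_integral_extend[OF M]) (use gm g0 in auto)
  define g where "g = trace_on_boundary \<Omega> u"
  obtain \<phi> where \<phi>: "\<And>n. \<phi> n \<in> C1c UNIV" and lim: "(\<lambda>n. H1_dist \<Omega> (\<phi> n) U V) \<longlonglongrightarrow> 0"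
    and g: "L2 (arclength (frontier \<Omega>)) g"
      "(\<lambda>n. \<integral>x. (norm (\<phi> n x - g x))\<^sup>2 \<partial>arclength (frontier \<Omega>)) \<longlonglongrightarrow> 0"
    using is_trace_trace_on_boundary[OF dom H] unfolding is_trace_iff[OF \<Omega> w eq] g_def[symmetric] by blast
  obtain C where C: "0 \<le> C" "emeasure hausdorff1 (frontier \<Omega>) < \<infinity>" and fm: "finite_measure (arclength (frontier \<Omega>))"
    and tr: "\<And>\<phi>. \<phi> \<in> C1c UNIV \<Longrightarrow> (\<integral>x. (norm (\<phi> x))\<^sup>2 \<partial>arclength (frontier \<Omega>)) \<le> C * H1_dist \<Omega> \<phi> (\<lambda>_. 0) (\<lambda>_. 0)"
    by (rule trace_inequality[OF dom]) (rule that)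
  have "AE x in lborel. indicator \<Omega> x * ((norm (u x - U x))\<^sup>2 + (norm (grad u x - V x))\<^sup>2) = 0"
    using eqU eqV by eventually_elim simp
  then have Hu: "H1_dist \<Omega> u U V = 0" unfolding H1_dist_def by (rule integral_eq_zero_AE)
  \<comment> \<open>As \<open>u\<close> vanishes on the frontier, \<open>\<phi> n\<close> has the
    boundary values of \<open>\<phi> n - u\<close>, which the trace inequality controls;
    \<open>u\<close> itself has distance 0 from the pair.\<close>
  have le: "(\<integral>x. (norm (\<phi> n x))\<^sup>2 \<partial>arclength (frontier \<Omega>)) \<le> C * (2 * H1_dist \<Omega> (\<phi> n) U V)" for n
  proof -
    have "x \<notin> \<Omega>" if "x \<in> frontier \<Omega>" for x using that \<Omega> by (simp add: frontier_def interior_open)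
    then have "(\<integral>x. (norm (\<phi> n x))\<^sup>2 \<partial>arclength (frontier \<Omega>)) = (\<integral>x. (norm (\<phi> n x - u x))\<^sup>2 \<partial>arclength (frontier \<Omega>))"
      by (intro Bochner_Integration.integral_cong) (auto simp: arclength_def space_restrict_space u0)
    also have "\<dots> \<le> C * H1_dist \<Omega> (\<lambda>x. \<phi> n x - u x) (\<lambda>_. 0) (\<lambda>_. 0)" by (rule tr[OF C1c_diff[OF \<phi> uU]])
    also have "\<dots> \<le> C * (2 * H1_dist \<Omega> (\<phi> n) U V)"
      using H1_dist_triangle[OF \<Omega>b \<phi> uU L(1,2), of n] Hu C(1) by (intro mult_left_mono) auto
    finally show ?thesis .
  qed
  have lim2: "(\<lambda>n. C * (2 * H1_dist \<Omega> (\<phi> n) U V)) \<longlonglongrightarrow> 0" by (intro tendsto_mult_right_zero lim)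
  have "(\<lambda>n. \<integral>x. (norm (\<phi> n x))\<^sup>2 \<partial>arclength (frontier \<Omega>)) \<longlonglongrightarrow> 0"
    by (rule tendsto_sandwich[OF _ _ tendsto_const lim2]) (simp_all add: le)
  moreover have "(\<lambda>n. \<integral>x. 1 * (norm (\<phi> n x))\<^sup>2 \<partial>arclength (frontier \<Omega>)) \<longlonglongrightarrow> (\<integral>x. 1 * (norm (g x))\<^sup>2 \<partial>arclength (frontier \<Omega>))"
    by (rule tendsto_weighted_L2(1)[OF C1c_L2_arclength[OF fm \<phi>] g, where B=1]) simp_all
  ultimately have "(\<integral>x. (norm (g x))\<^sup>2 \<partial>arclength (frontier \<Omega>)) = 0"
    using LIMSEQ_unique by fastforce
  then have "AE x in arclength (frontier \<Omega>). (norm (g x))\<^sup>2 = 0"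
    using g(1) by (subst (asm) integral_nonneg_eq_0_iff_AE) (auto simp: L2_def)
  then have "AE x in arclength (frontier \<Omega>). \<sigma> x * (norm (g x))\<^sup>2 = 0" by eventually_elim simp
  then show "(LINT x|arclength (frontier \<Omega>). \<sigma> x * (norm (trace_on_boundary \<Omega> u x))\<^sup>2) = 0"
    unfolding g_def by (rule integral_eq_zero_AE)
qed

text \<open>The test function is \<open>sqrt f \<cdot> q\<^sup>2\<close> with \<open>f = ln (\<bar>x\<bar> / \<rho>) + c\<close> and \<open>q = max 0 (L\<^sup>2 - t\<^sup>2)\<close>, where
  \<open>t\<close> is \<open>ln f\<close> up to a translation and \<open>(C - 1/4) L\<^sup>2 = 6\<close>. In the variable \<open>t\<close> the difference of the two sides is
  the integral of \<open>(q\<^sup>2)'\<^sup>2 - (C - 1/4) q\<^sup>4\<close>, and the rule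
  \<open>(t q\<^sup>n)' = (2 n + 1) q\<^sup>n - 2 n L\<^sup>2 q\<^sup>n\<^sup>-\<^sup>1\<close> turns it into that of \<open>- 16/7 L\<^sup>2 q\<^sup>2\<close>.\<close>

lemma Hardy_sharp:
  assumes \<rho>: "0 < \<rho>" and c: "0 < c" and C: "1/4 < C" and R: "\<rho> \<le> R"
  obtains u where "u \<in> C1c {x. R \<le> norm x}"
    "(\<integral>x. (norm (grad u x))\<^sup>2 \<partial>lborel) < C * (\<integral>x. (norm (u x))\<^sup>2 / ((norm x)\<^sup>2 * (ln (norm x / \<rho>) + c)\<^sup>2) \<partial>lborel)"
proof -
  define w where "w = C - 1/4"
  \<comment> \<open>The half-length of the support in the variable \<open>t\<close>. In the
    computation below the last coefficient becomes negative as soon as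
    \<open>L\<^sup>2 w > 3\<close>; the value 6 makes it \<open>- 16/7\<close>.\<close>
  define L where "L = sqrt (6 / w)"
  have w: "0 < w" and C_eq: "C = w + 1/4" using C by (simp_all add: w_def)
  have L: "0 < L" "L\<^sup>2 * w = 6" using w by (simp_all add: L_def)
  define a where "a = R\<^sup>2"
  have a: "0 < a" "\<rho>\<^sup>2 \<le> a" using \<rho> R by (auto simp: a_def intro!: power_mono)
  define f where "f = log_profile \<rho> c"
  have pos: "0 < s" "0 < f s" if "a \<le> s" for s
    using log_profile(2)[OF \<rho>, of s c] that a c by (auto simp: f_def)
  have fD: "(f has_real_derivative 1 / (2 * s)) (at s)" if "a \<le> s" for s
    unfolding f_def by (rule log_profile(1)[OF \<rho> pos(1)[OF that]])
  \<comment> \<open>The translation puts \<open>t = - L\<close> at \<open>\<bar>x\<bar> = R\<close>,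
    so that the support begins there.\<close>
  define \<tau> where "\<tau> = ln (f a) + L"
  define t where "t s = ln (f s) - \<tau>" for s
  have tD: "(t has_real_derivative 1 / (2 * s * f s)) (at s)" if "a \<le> s" for s
    unfolding t_def using fD[OF that] pos[OF that] by (auto intro!: derivative_eq_intros simp: field_simps)
  define Q where "Q s = max 0 (L\<^sup>2 - (t s)\<^sup>2)" for s
  have Q0: "0 \<le> Q s" for s by (simp add: Q_def)
  \<comment> \<open>True on the support because \<open>t\<^sup>2 = L\<^sup>2 - Q\<close> there, and
    trivially where \<open>Q = 0\<close>; it eliminates all squares of \<open>t\<close>.\<close>
  have tQ: "(t s)\<^sup>2 * Q s = (L\<^sup>2 - Q s) * Q s" for s by (simp add: Q_def max_def)
  have ta: "t a = - L" by (simp add: t_def \<tau>_def)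
  have Qa: "Q a = 0" by (simp add: Q_def ta)
  have QD: "((\<lambda>s. Q s ^ Suc (Suc n)) has_real_derivative real (Suc (Suc n)) * Q s ^ Suc n * (- 2 * t s * (1 / (2 * s * f s)))) (at s)"
    if "a \<le> s" for s n
  proof -
    have "((\<lambda>s. L\<^sup>2 - (t s)\<^sup>2) has_real_derivative - 2 * t s * (1 / (2 * s * f s))) (at s)"
      using tD[OF that] by (auto intro!: derivative_eq_intros)
    from DERIV_chain2[OF has_real_derivative_pos_part_power this] show ?thesis unfolding Q_def .
  qed
  have Q2: "((\<lambda>s. (Q s)\<^sup>2) has_real_derivative 2 * Q s * (- 2 * t s * (1 / (2 * s * f s)))) (at s)" if "a \<le> s" for s
    using QD[OF that, of 0] by (simp add: numeral_2_eq_2)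
  have Q3: "((\<lambda>s. (Q s) ^ 3) has_real_derivative 3 * (Q s)\<^sup>2 * (- 2 * t s * (1 / (2 * s * f s)))) (at s)" if "a \<le> s" for s
    using QD[OF that, of 1] by (simp add: eval_nat_numeral)
  have Q4: "((\<lambda>s. (Q s) ^ 4) has_real_derivative 4 * (Q s) ^ 3 * (- 2 * t s * (1 / (2 * s * f s)))) (at s)" if "a \<le> s" for s
    using QD[OF that, of 2] by (simp add: eval_nat_numeral)
  have fc: "continuous_on {a..} f" by (rule DERIV_continuous_on) (use fD in \<open>blast intro: DERIV_subset\<close>)
  have tc: "continuous_on {a..} t" by (rule DERIV_continuous_on) (use tD in \<open>blast intro: DERIV_subset\<close>)
  have Qc: "continuous_on {a..} Q" unfolding Q_def by (intro continuous_intros tc)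
  have nz: "2 * s * sqrt (f s) \<noteq> 0" "2 * s * f s \<noteq> 0" "s * s \<noteq> 0" if "a \<le> s" for s
    using pos[OF that] by auto
  define h where "h s = sqrt (f s) * (Q s)\<^sup>2" for s
  define h' where "h' s = ((Q s)\<^sup>2 / 2 - 4 * t s * Q s) / (2 * s * sqrt (f s))" for s
  have hD: "(h has_real_derivative h' s) (at s)" if "a \<le> s" for s
  proof -
    note p = pos[OF that]
    have "(h has_real_derivative (inverse (sqrt (f s)) / 2 * (1 / (2 * s))) * (Q s)\<^sup>2
        + (2 * Q s * (- 2 * t s * (1 / (2 * s * f s)))) * sqrt (f s)) (at s)"
      unfolding h_def
      by (rule DERIV_mult[OF DERIV_chain2[OF DERIV_real_sqrt[OF p(2)] fD[OF that]] Q2[OF that]])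
    moreover have "(inverse (sqrt (f s)) / 2 * (1 / (2 * s))) * (Q s)\<^sup>2
        + (2 * Q s * (- 2 * t s * (1 / (2 * s * f s)))) * sqrt (f s) = h' s"
    proof -
      define r where "r = sqrt (f s)"
      have r: "0 < r" "f s = r * r" using p by (auto simp: r_def)
      show ?thesis unfolding h'_def r_def[symmetric] r(2) using p(1) r(1) by (simp add: divide_simps)
    qed
    ultimately show ?thesis by simp
  qed
  have h'c: "continuous_on {a..} h'"
    unfolding h'_def by (intro continuous_intros fc tc Qc) (use nz in auto)
  \<comment> \<open>The coefficients come from removing the highest power first. In \<open>- w
    Q\<^sup>4 - 4 t Q\<^sup>3 + 16 L\<^sup>2 Q\<^sup>2 - 16 Q\<^sup>3\<close> the rule for
    \<open>n = 4\<close> with factor \<open>- w / 9\<close> replaces \<open>- w Q\<^sup>4\<close> by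
    \<open>- 16/3 Q\<^sup>3\<close>, using \<open>L\<^sup>2 w = 6\<close>. The total
    \<open>- 64/3 Q\<^sup>3\<close> is removed by the rule for \<open>n = 3\<close> with factor
    \<open>- 64/21\<close>, which leaves \<open>(16 - 128/7) L\<^sup>2 Q\<^sup>2\<close>. The mixed
    term is the \<open>t\<close>-derivative of \<open>Q\<^sup>4 / 2\<close>.\<close>
  define G where "G s = t s * (- 64/21 * (Q s) ^ 3 - w / 9 * (Q s) ^ 4) + (Q s) ^ 4 / 2" for s
  define G' where "G' s = (- 64/21 * (7 * (Q s) ^ 3 - 6 * L\<^sup>2 * (Q s)\<^sup>2) - w / 9 * (9 * (Q s) ^ 4 - 8 * L\<^sup>2 * (Q s) ^ 3)
    - 4 * t s * (Q s) ^ 3) / (2 * s * f s)" for s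
  have GD: "(G has_real_derivative G' s) (at s)" if "a \<le> s" for s
  proof -
    note p = pos[OF that]
    define d where "d = 1 / (2 * s * f s)"
    have "(G has_real_derivative (d * (- 64/21 * (Q s) ^ 3 - w / 9 * (Q s) ^ 4)
        + (- 64/21 * (3 * (Q s)\<^sup>2 * (- 2 * t s * d)) - w / 9 * (4 * (Q s) ^ 3 * (- 2 * t s * d))) * t s)
        + 4 * (Q s) ^ 3 * (- 2 * t s * d) / 2) (at s)"
      unfolding G_def d_def
      by (intro DERIV_add DERIV_mult DERIV_diff DERIV_cmult DERIV_cdivide tD Q3 Q4 that)
    moreover have "(d * (- 64/21 * (Q s) ^ 3 - w / 9 * (Q s) ^ 4)
        + (- 64/21 * (3 * (Q s)\<^sup>2 * (- 2 * t s * d)) - w / 9 * (4 * (Q s) ^ 3 * (- 2 * t s * d))) * t s)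
        + 4 * (Q s) ^ 3 * (- 2 * t s * d) / 2
      = d * (- 64/21 * ((Q s) ^ 3 - 6 * ((t s)\<^sup>2 * Q s) * Q s) - w / 9 * ((Q s) ^ 4 - 8 * ((t s)\<^sup>2 * Q s) * (Q s)\<^sup>2)
        - 4 * t s * (Q s) ^ 3)"
      by (simp add: power2_eq_square power3_eq_cube algebra_simps)
    moreover have "\<dots> = d * (- 64/21 * (7 * (Q s) ^ 3 - 6 * L\<^sup>2 * (Q s)\<^sup>2) - w / 9 * (9 * (Q s) ^ 4 - 8 * L\<^sup>2 * (Q s) ^ 3)
        - 4 * t s * (Q s) ^ 3)"
      unfolding tQ by (simp add: eval_nat_numeral algebra_simps)
    moreover have "\<dots> = G' s" by (simp add: G'_def d_def)
    ultimately show ?thesis by (simp only:)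
  qed
  \<comment> \<open>The field \<open>k (x \<bullet> x) *\<^sub>R x\<close> has divergence
    \<open>2 k + 2 s k' = 2 G'\<close>, so the exact derivative in \<open>t\<close> becomes a
    divergence in the plane and integrates to 0.\<close>
  define k where "k s = G s / s" for s
  define k' where "k' s = (G' s * s - G s) / (s * s)" for s
  have kD: "(k has_real_derivative k' s) (at s)" if "a \<le> s" for s
    unfolding k_def k'_def using DERIV_divide[OF GD[OF that] DERIV_ident] pos(1)[OF that] by simp
  have Gc: "continuous_on {a..} G" unfolding G_def by (intro continuous_intros tc Qc) auto
  have G'c: "continuous_on {a..} G'"
    unfolding G'_def by (intro continuous_intros fc tc Qc) (use nz in auto)
  have k'c: "continuous_on {a..} k'"
    unfolding k'_def by (intro continuous_intros Gc G'c) (use nz in auto)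
  define H where "H s = (if a \<le> s then h s else 0)" for s
  define H' where "H' s = h' (max a s)" for s
  define J where "J s = (if a \<le> s then k s else 0)" for s
  define J' where "J' s = k' (max a s)" for s
  \<comment> \<open>Value and slope vanish at the inner radius, so the continuation by the tangent
    line is the extension by zero.\<close>
  have z: "h a = 0" "h' a = 0" "k a = 0" "k' a = 0"
    by (simp_all add: h_def h'_def k_def k'_def G_def G'_def Qa)
  have HD: "(H has_real_derivative H' s) (at s)" for s
    using C1_linear_extension[of a h h' s, OF hD] unfolding H_def H'_def z mult_zero_left add_0_left .
  have JD: "(J has_real_derivative J' s) (at s)" for s
    using C1_linear_extension[of a k k' s, OF kD] unfolding J_def J'_def z mult_zero_left add_0_left .
  have mx: "continuous_on UNIV (\<lambda>s. max a s)" by (intro continuous_intros)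
  have H'c: "continuous_on UNIV H'" unfolding H'_def by (rule continuous_on_compose2[OF h'c mx]) auto
  have J'c: "continuous_on UNIV J'" unfolding J'_def by (rule continuous_on_compose2[OF k'c mx]) auto
  \<comment> \<open>A radius squared beyond the support: \<open>t \<ge> L\<close> means
    \<open>f s \<ge> f a * exp (2 * L)\<close>, and dropping the positive summand \<open>c\<close>
    of \<open>f\<close> in solving for \<open>s\<close> only enlarges the bound.\<close>
  define b where "b = \<rho>\<^sup>2 * exp (2 * (f a * exp (2 * L)))"
  have Qb: "Q s = 0" if s: "a \<le> s" "b < s" for s
  proof -
    note p = pos[OF s(1)] and pa = pos[OF order_refl]
    have "exp (2 * (f a * exp (2 * L))) \<le> s / \<rho>\<^sup>2"
      using s(2) \<rho> by (simp add: b_def field_simps)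
    then have "2 * (f a * exp (2 * L)) \<le> ln (s / \<rho>\<^sup>2)"
      using p(1) \<rho> by (simp add: ln_ge_iff)
    then have "f a * exp (2 * L) \<le> f s" using c by (simp add: f_def log_profile_def)
    then have "ln (f a * exp (2 * L)) \<le> ln (f s)" using pa p by simp
    then have "L \<le> t s" using pa by (simp add: ln_mult t_def \<tau>_def)
    then have "L\<^sup>2 \<le> (t s)\<^sup>2" using L(1) by (intro power_mono) auto
    then show ?thesis by (simp add: Q_def)
  qed
  define S where "S = {x :: real^2. R \<le> norm x} \<inter> cball 0 (sqrt b)"
  have S: "compact S"
    unfolding S_def by (intro closed_Int_compact closed_Collect_le continuous_intros compact_cball)
  have nS: "a \<le> x \<bullet> x \<longrightarrow> b < x \<bullet> x" if "x \<notin> S" for x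
  proof
    assume "a \<le> x \<bullet> x"
    then have "R \<le> norm x" using \<rho> R by (simp add: a_def power2_norm_eq_inner[symmetric])
    then have "sqrt b < norm x" using that by (simp add: S_def)
    then have "sqrt b < sqrt (x \<bullet> x)" by (simp add: norm_eq_sqrt_inner)
    then show "b < x \<bullet> x" by (simp only: real_sqrt_less_iff)
  qed
  have QS: "Q (x \<bullet> x) = 0" if "x \<notin> S" "a \<le> x \<bullet> x" for x using nS[OF that(1)] that(2) Qb by blast
  define v where "v x = H (x \<bullet> x)" for x :: "real^2"
  define u where "u x = complex_of_real (v x)" for x
  have v: "C1 v" "\<And>i x. partial i v x = H' (x \<bullet> x) * (2 * x $ i)"
    unfolding v_def using C1_radial[OF HD H'c] by auto
  have u: "C1 u" "\<And>i x. partial i u x = of_real (H' (x \<bullet> x) * (2 * x $ i))"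
    unfolding u_def using C1_bounded_linear[OF bounded_linear_of_real v(1)] by (auto simp: v(2))
  have u0: "u x = 0" if "x \<notin> S" for x
    using QS[OF that] by (simp add: u_def v_def H_def h_def)
  have uC: "u \<in> C1c {x. R \<le> norm x}" unfolding C1c_iff using u(1) u0 S S_def by blast
  have gu: "(norm (grad u x))\<^sup>2 = 4 * (x \<bullet> x) * (H' (x \<bullet> x))\<^sup>2" for x
    unfolding norm_grad_square u(2) norm_of_real power2_abs inner_2 by (simp add: power2_eq_square algebra_simps)
  define m where "m x = J (x \<bullet> x)" for x :: "real^2"
  have m: "C1 m" "\<And>i x. partial i m x = J' (x \<bullet> x) * (2 * x $ i)"
    unfolding m_def using C1_radial[OF JD J'c] by auto
  define X where "X x = m x *\<^sub>R x" for x
  have "X x = 0" if "x \<notin> S" for x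
    using QS[OF that] by (simp add: X_def m_def J_def k_def G_def)
  moreover have "C1 X" unfolding X_def by (rule C1_scaleR(1)[OF m(1) C1_ident(1)])
  ultimately have X: "X \<in> C1c UNIV" unfolding C1c_iff using S by blast
  have dX: "divg X x = 2 * J (x \<bullet> x) + 2 * (x \<bullet> x) * J' (x \<bullet> x)" for x
    unfolding X_def divg_scaleR_ident[OF m(1)] m(2) m_def[of x]
    by (subst (3) inner_2) (simp add: power2_eq_square algebra_simps)
  define T where "T x = 16/7 * L\<^sup>2 * (Q (max a (x \<bullet> x)))\<^sup>2 / (max a (x \<bullet> x) * f (max a (x \<bullet> x)))" for x :: "real^2"
  define W where "W x = (norm (u x))\<^sup>2 / ((norm x)\<^sup>2 * (ln (norm x / \<rho>) + c)\<^sup>2)" for x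
  \<comment> \<open>The two sides of the inequality with constant \<open>C\<close> differ pointwise
    by a divergence and by \<open>T\<close>. Thus the gradient integral is smaller by exactly the
    integral of \<open>T\<close>, which is nonnegative and not identically zero.\<close>
  have key: "(norm (grad u x))\<^sup>2 = C * W x + divg X x - T x" for x
  proof (cases "a \<le> x \<bullet> x")
    case True
    define s where "s = x \<bullet> x"
    have s: "a \<le> s" using True by (simp add: s_def)
    note p = pos[OF s]
    have x0: "x \<noteq> 0" using p by (auto simp: s_def)
    define d where "d = 1 / (s * f s)"
    have 1: "(norm (grad u x))\<^sup>2 = d * ((Q s)\<^sup>2 / 2 - 4 * t s * Q s)\<^sup>2"
    proof -
      have "(norm (grad u x))\<^sup>2 = 4 * s * (((Q s)\<^sup>2 / 2 - 4 * t s * Q s) / (2 * s * sqrt (f s)))\<^sup>2"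
        unfolding gu s_def[symmetric] H'_def using s by (simp add: max_absorb2 h'_def)
      also have "\<dots> = d * ((Q s)\<^sup>2 / 2 - 4 * t s * Q s)\<^sup>2"
        using p by (simp add: d_def power_divide power_mult_distrib power2_eq_square[of s])
      finally show ?thesis .
    qed
    have 2: "W x = d * (Q s) ^ 4"
    proof -
      have "(norm (u x))\<^sup>2 = f s * (Q s) ^ 4"
        unfolding u_def norm_of_real power2_abs v_def s_def[symmetric] H_def h_def using s p
        by (simp add: power_mult_distrib power_mult[symmetric])
      then have "W x = f s * (Q s) ^ 4 / (s * (f s)\<^sup>2)"
        unfolding W_def f_def log_profile(3)[OF \<rho> x0, symmetric] s_def by (simp add: power2_norm_eq_inner)
      then show ?thesis using p by (simp add: d_def power2_eq_square)
    qed
    have 3: "divg X x = d * (- 64/21 * (7 * (Q s) ^ 3 - 6 * L\<^sup>2 * (Q s)\<^sup>2) - w / 9 * (9 * (Q s) ^ 4 - 8 * L\<^sup>2 * (Q s) ^ 3)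
      - 4 * t s * (Q s) ^ 3)"
    proof -
      have "divg X x = 2 * k s + 2 * s * k' s"
        unfolding dX s_def[symmetric] J_def J'_def using s by (simp add: max_absorb2)
      also have "\<dots> = 2 * G' s" unfolding k_def k'_def using p(1) by (simp add: field_simps)
      finally have "divg X x = 2 * G' s" .
      moreover have "2 * (y / (2 * s * f s)) = d * y" for y by (simp add: d_def)
      ultimately show ?thesis unfolding G'_def by (simp only:)
    qed
    have 4: "T x = d * (16/7 * L\<^sup>2 * (Q s)\<^sup>2)"
      unfolding T_def s_def[symmetric] using s by (simp add: max_absorb2 d_def)
    have "((Q s)\<^sup>2 / 2 - 4 * t s * Q s)\<^sup>2 = (Q s) ^ 4 / 4 - 4 * t s * (Q s) ^ 3 + 16 * ((t s)\<^sup>2 * Q s) * Q s"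
      by (simp add: eval_nat_numeral algebra_simps)
    also have "\<dots> = (w + 1/4) * (Q s) ^ 4 + (- 64/21 * (7 * (Q s) ^ 3 - 6 * L\<^sup>2 * (Q s)\<^sup>2)
      - (w * (Q s) ^ 4 - 8 / 9 * (L\<^sup>2 * w) * (Q s) ^ 3) - 4 * t s * (Q s) ^ 3) - 16/7 * L\<^sup>2 * (Q s)\<^sup>2"
      unfolding tQ L(2) by (simp add: eval_nat_numeral algebra_simps)
    also have "\<dots> = C * (Q s) ^ 4 + (- 64/21 * (7 * (Q s) ^ 3 - 6 * L\<^sup>2 * (Q s)\<^sup>2)
      - w / 9 * (9 * (Q s) ^ 4 - 8 * L\<^sup>2 * (Q s) ^ 3) - 4 * t s * (Q s) ^ 3) - 16/7 * L\<^sup>2 * (Q s)\<^sup>2"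
      by (simp add: C_eq algebra_simps)
    finally show ?thesis unfolding 1 2 3 4 by (simp only: right_diff_distrib distrib_left mult.left_commute[of C d])
  next
    case False
    then have "max a (x \<bullet> x) = a" by (simp add: max_def)
    then show ?thesis using False
      by (simp add: gu H'_def z W_def u_def v_def H_def dX J_def J'_def T_def Qa)
  qed
  have Tc: "continuous_on UNIV T"
    unfolding T_def
    by (intro continuous_intros continuous_on_compose2[OF Qc] continuous_on_compose2[OF fc]) (use pos[OF max.cobounded1[of a]] a(1) in \<open>auto simp: less_imp_neq[symmetric] max_def\<close>)
  have T0: "0 \<le> T x" for x
    unfolding T_def using pos[OF max.cobounded1[of a "x \<bullet> x"]] by simp
  have TS: "T x = 0" if "x \<notin> S" for x
  proof (cases "a \<le> x \<bullet> x")
    case True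
    then show ?thesis using QS[OF that True] by (simp add: T_def max_absorb2)
  next
    case False
    then show ?thesis by (simp add: T_def max_absorb1 Qa)
  qed
  have iT: "integrable lborel T" by (rule integrable_continuous_compact_support[OF Tc compact_imp_bounded[OF S] TS])
  have "0 < (\<integral>x. T x \<partial>lborel)"
  proof -
    have "(\<integral>x. T x \<partial>lborel) \<noteq> 0"
    proof
      assume "(\<integral>x. T x \<partial>lborel) = 0"
      then have "AE x in lborel. T x = 0" using integral_nonneg_eq_0_iff_AE[OF iT] T0 by simp
      moreover have op: "open {x. T x \<noteq> 0}" by (intro open_Collect_neq Tc continuous_intros)
      ultimately have "{x. T x \<noteq> 0} \<in> null_sets lborel" by (subst (asm) AE_iff_null) auto
      moreover have "{x. T x \<noteq> 0} \<noteq> {}"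
      proof -
        \<comment> \<open>The middle of the support, \<open>t = 0\<close>, where \<open>Q\<close>
          has its largest value \<open>L\<^sup>2\<close>.\<close>
        define s where "s = \<rho>\<^sup>2 * exp (2 * (exp \<tau> - c))"
        have fs: "f s = exp \<tau>" using \<rho> by (simp add: s_def f_def log_profile_def diff_divide_distrib)
        have "f a \<le> exp \<tau>" using pos[OF order_refl] L(1) by (simp add: \<tau>_def exp_add)
        then have "ln (a / \<rho>\<^sup>2) \<le> 2 * (exp \<tau> - c)" by (simp add: f_def log_profile_def)
        then have "exp (ln (a / \<rho>\<^sup>2)) \<le> exp (2 * (exp \<tau> - c))" by simp
        then have "a / \<rho>\<^sup>2 \<le> exp (2 * (exp \<tau> - c))" using a(1) \<rho> by simp
        then have s: "a \<le> s" using \<rho> by (simp add: s_def field_simps)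
        define x :: "real^2" where "x = axis 1 (sqrt s)"
        have xs: "x \<bullet> x = s" using pos(1)[OF s] by (simp add: x_def inner_axis_axis)
        have "Q s = L\<^sup>2" by (simp add: Q_def t_def fs)
        then have "T x \<noteq> 0" using pos[OF s] L(1) s by (simp add: T_def xs max_absorb2)
        then show ?thesis by blast
      qed
      ultimately show False using op open_not_negligible negligible_iff_null_sets null_sets_completionI by blast
    qed
    moreover have "0 \<le> (\<integral>x. T x \<partial>lborel)" by (rule Bochner_Integration.integral_nonneg) (rule T0)
    ultimately show ?thesis by simp
  qed
  moreover have iX: "integrable lborel (divg X)" using divg_integrable[OF X, of UNIV] by simp
  moreover have ig: "integrable lborel (\<lambda>x. (norm (grad u x))\<^sup>2)" using C1c_L2(2)[OF uC] by (simp add: L2_def)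
  moreover have "(\<integral>x. C * W x \<partial>lborel) = (\<integral>x. (norm (grad u x))\<^sup>2 - divg X x + T x \<partial>lborel)" by (simp add: key)
  moreover have "(\<integral>x. divg X x \<partial>lborel) = 0" by (rule integral_divg_zero[OF X])
  ultimately have "(\<integral>x. (norm (grad u x))\<^sup>2 \<partial>lborel) < C * (\<integral>x. W x \<partial>lborel)"
    using iT by simp
  then show ?thesis unfolding W_def by (rule that[OF uC])
qed

text \<open>The supremum is approached by countably many essential lower bounds. If the lower bounds
  are unbounded, \<open>Sup\<close> has no useful value, but then almost every point would satisfy
  \<open>f x \<ge> n\<close> for all \<open>n\<close>; no point does, so the claim holds on a null
  space.\<close>

lemma ess_inf_le:
  assumes "Linfty N f" shows "AE x in N. ess_inf N f \<le> f x"
proof -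
  define A where "A = {a. AE x in N. a \<le> f x}"
  obtain B where "AE x in N. \<bar>f x\<bar> \<le> B" using assms by (auto simp: Linfty_def)
  then have "AE x in N. - B \<le> f x" by eventually_elim auto
  then have ne: "A \<noteq> {}" by (auto simp: A_def)
  show ?thesis
  proof (cases "bdd_above A")
    case True
    have "AE x in N. Sup A - 1 / real (Suc n) \<le> f x" for n
    proof -
      have "Sup A - 1 / real (Suc n) < Sup A" by simp
      then obtain a where a: "a \<in> A" "Sup A - 1 / real (Suc n) < a" using less_cSupE[OF _ ne] by blast
      from a(1) have "AE x in N. a \<le> f x" by (simp add: A_def)
      then show ?thesis by eventually_elim (use a(2) in linarith)
    qed
    then have "AE x in N. \<forall>n. Sup A - 1 / real (Suc n) \<le> f x" by (subst AE_all_countable) simp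
    then show ?thesis
    proof eventually_elim
      case (elim x)
      have "Sup A \<le> f x + e" if "0 < e" for e
        using nat_approx_posE[OF that] elim by (metis add.commute diff_le_eq less_imp_le order_trans add_left_mono)
      then show ?case unfolding ess_inf_def A_def[symmetric] by (rule field_le_epsilon)
    qed
  next
    case False
    have "AE x in N. real n \<le> f x" for n
    proof -
      obtain a where a: "a \<in> A" "real n < a" using False unfolding bdd_above_def by (meson not_le)
      from a(1) have "AE x in N. a \<le> f x" by (simp add: A_def)
      then show ?thesis by eventually_elim (use a(2) in linarith)
    qed
    then have "AE x in N. \<forall>n. real n \<le> f x" by (subst AE_all_countable) simp
    then show ?thesis
    proof eventually_elim
      case (elim x)
      then show ?case using reals_Archimedean2[of "f x"] by (meson not_le)
    qed
  qed
qed

text \<open>Boundedness of \<open>K\<close> makes the distances to the frontier bounded, so that the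
  real supremum dominates each of them; at an interior point the distance is positive.\<close>

lemma inradius_pos:
  fixes K :: "(real^2) set"
  assumes K: "open K" "bounded K" "K \<noteq> {}" shows "0 < inradius K"
proof -
  obtain y where y: "y \<in> K" using K(3) by blast
  have "K \<noteq> UNIV" using K(2) not_bounded_UNIV by blast
  then have F: "frontier K \<noteq> {}" using K(3) frontier_not_empty by blast
  then obtain z where z: "z \<in> frontier K" by blast
  have "y \<notin> frontier K" using y K(1) by (simp add: frontier_def interior_open)
  then have "infdist y (frontier K) \<noteq> 0" using in_closed_iff_infdist_zero[OF frontier_closed F] by blast
  then have "0 < infdist y (frontier K)" using infdist_nonneg[of y "frontier K"] by simp
  also have "\<dots> \<le> inradius K"
    unfolding inradius_def
  proof (rule cSUP_upper[OF y])
    obtain e where e: "\<And>x. x \<in> K \<Longrightarrow> dist z x \<le> e" using bounded_any_center[of K z] K(2) by blast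
    have "infdist x (frontier K) \<le> e" if "x \<in> K" for x
      using infdist_le[OF z, of x] e[OF that] by (simp add: dist_commute)
    then show "bdd_above ((\<lambda>y. infdist y (frontier K)) ` K)" by (intro bdd_aboveI[of _ e]) auto
  qed
  finally show ?thesis .
qed

theorem proposition3p1:
  fixes K M :: "(real^2) set" and \<rho> \<sigma>0 :: real and \<sigma> :: "real^2 \<Rightarrow> real"
  assumes "open K" and "bounded K" and "K \<noteq> {}" and "simply_connected K" and "C2_boundary K"
    and "\<rho> = inradius K" and "ball 0 \<rho> \<subseteq> K"
    and "M = - K"
    and "Linfty (arclength (frontier M)) \<sigma>"
    and "\<sigma>0 = ess_inf (arclength (frontier M)) \<sigma>" and "\<sigma>0 > 0"
  shows "(\<forall>u \<in> H1 (interior M).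
      (LINT x:M|lebesgue. (norm (wgrad (interior M) u x))\<^sup>2)
        + (LINT x|arclength (frontier M). \<sigma> x * (norm (trace_on_boundary (interior M) u x))\<^sup>2)
      \<ge> 1/4 * (LINT x:M|lebesgue. (norm (u x))\<^sup>2
                  / ((norm x)\<^sup>2 * (ln (norm x / \<rho>) + 1 / (2 * \<rho> * \<sigma>0))\<^sup>2)))
    \<and> (\<forall>C > 1/4. \<not> (\<forall>u \<in> H1 (interior M).
      (LINT x:M|lebesgue. (norm (wgrad (interior M) u x))\<^sup>2)
        + (LINT x|arclength (frontier M). \<sigma> x * (norm (trace_on_boundary (interior M) u x))\<^sup>2)
      \<ge> C * (LINT x:M|lebesgue. (norm (u x))\<^sup>2
                  / ((norm x)\<^sup>2 * (ln (norm x / \<rho>) + 1 / (2 * \<rho> * \<sigma>0))\<^sup>2))))"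
proof -
  define \<Omega> where "\<Omega> = interior M"
  define c where "c = 1 / (2 * \<rho> * \<sigma>0)"
  have \<rho>: "0 < \<rho>" using inradius_pos assms(1-3,6) by blast
  have c: "0 < c" using \<rho> assms(11) by (simp add: c_def)
  have dom: "graph_domain \<Omega>" and fr: "frontier \<Omega> = frontier M"
    using C2_boundary_graph_domain[OF assms(1,2,5)] by (auto simp: \<Omega>_def assms(8) frontier_complement)
  have \<Omega>\<rho>: "\<rho> \<le> norm x" if "x \<in> \<Omega>" for x
  proof -
    have "x \<in> - K" using that interior_subset[of M] by (auto simp: \<Omega>_def assms(8))
    then have "x \<notin> ball 0 \<rho>" using assms(7) by auto
    then show ?thesis by simp
  qed
  have Mc: "closed M" using assms(1,8) by (simp add: closed_Compl)
  have M: "M \<in> sets borel" "\<Omega> \<subseteq> M" using Mc interior_subset[of M] by (auto simp: \<Omega>_def)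
  \<comment> \<open>The closed set \<open>M\<close> exceeds its interior by its frontier, a null set
    in view of the charts.\<close>
  have "M - \<Omega> = frontier \<Omega>" unfolding fr unfolding \<Omega>_def frontier_def using Mc by (simp add: closure_closed)
  then have Mn: "M - \<Omega> \<in> null_sets lborel" using graph_domain_frontier_null[OF dom] by simp
  \<comment> \<open>With this \<open>c\<close> the lower bound that the Hardy inequality demands of
    \<open>\<sigma>\<close> is precisely its essential infimum.\<close>
  have "\<sigma>0 = 1 / (2 * \<rho> * c)" using \<rho> by (simp add: c_def)
  then have \<sigma>: "AE x in arclength (frontier \<Omega>). 1 / (2 * \<rho> * c) \<le> \<sigma> x"
    using ess_inf_le[OF assms(9)] assms(10) unfolding fr by simp
  have L: "Linfty (arclength (frontier \<Omega>)) \<sigma>" using assms(9) by (simp add: fr)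
  have sharp: "\<exists>u\<in>H1 \<Omega>. (LINT x:M|lebesgue. (norm (wgrad \<Omega> u x))\<^sup>2)
        + (LINT x|arclength (frontier \<Omega>). \<sigma> x * (norm (trace_on_boundary \<Omega> u x))\<^sup>2)
      < C * (LINT x:M|lebesgue. (norm (u x))\<^sup>2 / ((norm x)\<^sup>2 * (ln (norm x / \<rho>) + c)\<^sup>2))" if C: "1/4 < C" for C
  proof -
    obtain R' where R': "\<And>x. x \<in> K \<Longrightarrow> norm x \<le> R'" using assms(2) by (auto simp: bounded_iff)
    \<comment> \<open>Large enough for the test functions to be supported in the interior of
      \<open>M\<close>, and at least \<open>\<rho>\<close>, as the construction requires.\<close>
    define R where "R = \<rho> + \<bar>R'\<bar> + 1"
    have "{x. R' < norm x} \<subseteq> \<Omega>"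
      unfolding \<Omega>_def
      by (rule interior_maximal) (use R' in \<open>force simp: assms(8)\<close>, intro open_Collect_less continuous_intros)
    moreover have "{x. R \<le> norm x} \<subseteq> {x. R' < norm x}" using \<rho> by (auto simp: R_def)
    ultimately have sub: "{x. R \<le> norm x} \<subseteq> \<Omega>" by blast
    obtain u where u: "u \<in> C1c {x. R \<le> norm x}"
      and lt: "(\<integral>x. (norm (grad u x))\<^sup>2 \<partial>lborel) < C * (\<integral>x. (norm (u x))\<^sup>2 / ((norm x)\<^sup>2 * (ln (norm x / \<rho>) + c)\<^sup>2) \<partial>lborel)"
      using Hardy_sharp[OF \<rho> c C, of R] by (auto simp: R_def)
    have u\<Omega>: "u \<in> C1c \<Omega>" by (rule C1c_mono[OF u sub])
    have "0 \<notin> \<Omega>" using \<Omega>\<rho>[of 0] \<rho> by auto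
    then have ne: "\<Omega> \<noteq> UNIV" by auto
    have u0: "u x = 0" if "x \<notin> \<Omega>" for x using C1cE[OF u\<Omega>] that by (metis subsetD)
    have [measurable]: "u \<in> borel_measurable borel"
      by (intro borel_measurable_continuous_onI C1_continuous[OF C1c_C1[OF u]])
    have "(LINT x:M|lebesgue. (norm (u x))\<^sup>2 / ((norm x)\<^sup>2 * (ln (norm x / \<rho>) + c)\<^sup>2))
        = (\<integral>x. (norm (u x))\<^sup>2 / ((norm x)\<^sup>2 * (ln (norm x / \<rho>) + c)\<^sup>2) \<partial>lborel)"
      by (rule set_lebesgue_integral_extend[OF M Mn]) (use u0 in auto)
    then show ?thesis
      using lt C1c_H1[OF dom ne M Mn u\<Omega>] by (intro bexI[of _ u]) simp_all
  qed
  have "\<not> (\<forall>u\<in>H1 \<Omega>. (LINT x:M|lebesgue. (norm (wgrad \<Omega> u x))\<^sup>2)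
        + (LINT x|arclength (frontier \<Omega>). \<sigma> x * (norm (trace_on_boundary \<Omega> u x))\<^sup>2)
      \<ge> C * (LINT x:M|lebesgue. (norm (u x))\<^sup>2 / ((norm x)\<^sup>2 * (ln (norm x / \<rho>) + c)\<^sup>2)))" if "C > 1/4" for C
    using sharp[OF that] by (meson not_le)
  moreover have "\<forall>u\<in>H1 \<Omega>. (LINT x:M|lebesgue. (norm (wgrad \<Omega> u x))\<^sup>2)
        + (LINT x|arclength (frontier \<Omega>). \<sigma> x * (norm (trace_on_boundary \<Omega> u x))\<^sup>2)
      \<ge> 1/4 * (LINT x:M|lebesgue. (norm (u x))\<^sup>2 / ((norm x)\<^sup>2 * (ln (norm x / \<rho>) + c)\<^sup>2))"
    using Hardy_H1[OF dom \<rho> c \<Omega>\<rho> M Mn L \<sigma>] by blast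
  ultimately show ?thesis unfolding fr[symmetric] unfolding \<Omega>_def[symmetric] c_def[symmetric] by blast
qed

end
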